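(* Let $(u_0,u_1)\in H^1(\mathbb{R}^2)\times L^2(\mathbb{R}^2)$ (of arbitrary size). There exist a time $T>0$ and a unique solution $u\in C([0,T];H^1(\mathbb{R}^2))\cap C^1([0,T];L^2(\mathbb{R}^2))$ of $$\partial_t^2u-\Delta u+u\,e^{4\pi u^2}=0\quad\text{on }[0,T]\times\mathbb{R}^2$$ with $u(0,\cdot)=u_0$ and $\partial_tu(0,\cdot)=u_1$. Moreover, the solution map $(u_0,u_1)\mapsto (u,\partial_t u)$ is continuous on $H^1\times L^2$.
   Context: This is the case $q=2$ of the equation $\partial_t^2u-\Delta u+u(1+u^2)^{(q-2)/2}e^{4\pi((1+u^2)^{q/2}-1)}=0$ on $\mathbb{R}\times\mathbb{R}^2$. *)

theory Defs
  imports "HOL-Analysis.Analysis"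
begin

definition pd :: "'a::euclidean_space \<Rightarrow> ('a \<Rightarrow> real) \<Rightarrow> 'a \<Rightarrow> real" where
  "pd b f x = deriv (\<lambda>h. f (x + h *\<^sub>R b)) 0"

fun iter_pd :: "'a::euclidean_space list \<Rightarrow> ('a \<Rightarrow> real) \<Rightarrow> 'a \<Rightarrow> real" where
  "iter_pd [] f = f"
| "iter_pd (b # bs) f = pd b (iter_pd bs f)"

definition smooth_fun :: "('a::euclidean_space \<Rightarrow> real) \<Rightarrow> bool" where
  "smooth_fun f \<longleftrightarrow> (\<forall>bs. set bs \<subseteq> Basis \<longrightarrow>
      continuous_on UNIV (iter_pd bs f) \<and>
      (\<forall>b\<in>Basis. \<forall>x. (\<lambda>h. iter_pd bs f (x + h *\<^sub>R b)) differentiable (at 0)))"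

definition test_fun :: "'a::euclidean_space set \<Rightarrow> ('a \<Rightarrow> real) \<Rightarrow> bool" where
  "test_fun S f \<longleftrightarrow> smooth_fun f \<and> compact (closure {x. f x \<noteq> 0})
                      \<and> closure {x. f x \<noteq> 0} \<subseteq> S"

definition L2 :: "('a::euclidean_space \<Rightarrow> real) \<Rightarrow> bool" where
  "L2 f \<longleftrightarrow> f \<in> borel_measurable lborel \<and> integrable lborel (\<lambda>x. (f x)\<^sup>2)"

definition L2_norm :: "('a::euclidean_space \<Rightarrow> real) \<Rightarrow> real" where
  "L2_norm f = sqrt (\<integral>x. (f x)\<^sup>2 \<partial>lborel)"

definition weak_partial :: "'a::euclidean_space \<Rightarrow> ('a \<Rightarrow> real) \<Rightarrow> ('a \<Rightarrow> real) \<Rightarrow> bool" where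
  "weak_partial b f g \<longleftrightarrow> (\<forall>\<phi>. test_fun UNIV \<phi> \<longrightarrow>
      integrable lborel (\<lambda>x. f x * pd b \<phi> x) \<and> integrable lborel (\<lambda>x. g x * \<phi> x) \<and>
      (\<integral>x. f x * pd b \<phi> x \<partial>lborel) = - (\<integral>x. g x * \<phi> x \<partial>lborel))"

definition H1 :: "('a::euclidean_space \<Rightarrow> real) \<Rightarrow> bool" where
  "H1 f \<longleftrightarrow> L2 f \<and> (\<forall>b\<in>Basis. \<exists>g. L2 g \<and> weak_partial b f g)"

definition wgrad :: "'a::euclidean_space \<Rightarrow> ('a \<Rightarrow> real) \<Rightarrow> 'a \<Rightarrow> real" where
  "wgrad b f = (SOME g. L2 g \<and> weak_partial b f g)"

definition H1_norm :: "('a::euclidean_space \<Rightarrow> real) \<Rightarrow> real" where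
  "H1_norm f = sqrt ((L2_norm f)\<^sup>2 + (\<Sum>b\<in>Basis. (L2_norm (wgrad b f))\<^sup>2))"

definition lap_x :: "(real \<times> (real^2) \<Rightarrow> real) \<Rightarrow> real \<times> (real^2) \<Rightarrow> real" where
  "lap_x \<phi> z = (\<Sum>b\<in>(Basis :: (real^2) set). pd (0, b) (pd (0, b) \<phi>) z)"

definition dtt :: "(real \<times> (real^2) \<Rightarrow> real) \<Rightarrow> real \<times> (real^2) \<Rightarrow> real" where
  "dtt \<phi> z = pd (1, 0) (pd (1, 0) \<phi>) z"

definition nonlin :: "real \<Rightarrow> real" where
  "nonlin s = s * exp (4 * pi * s\<^sup>2)"

text \<open>u : [0,T] -> H^1 with time derivative v : [0,T] -> L^2 (so u in C([0,T];H^1) and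
  C^1([0,T];L^2)), solving the equation in the sense of distributions on (0,T) x R^2,
  with initial data u(0)=u0, u_t(0)=u1 (almost everywhere).\<close>
definition energy_solution ::
  "real \<Rightarrow> (real \<Rightarrow> real^2 \<Rightarrow> real) \<Rightarrow> (real \<Rightarrow> real^2 \<Rightarrow> real)
     \<Rightarrow> (real^2 \<Rightarrow> real) \<Rightarrow> (real^2 \<Rightarrow> real) \<Rightarrow> bool" where
  "energy_solution T u v u0 u1 \<longleftrightarrow>
     (\<forall>t\<in>{0..T}. H1 (u t) \<and> L2 (v t)) \<and>
     (\<forall>t\<in>{0..T}. ((\<lambda>s. H1_norm (\<lambda>x. u s x - u t x)) \<longlongrightarrow> 0) (at t within {0..T})) \<and>
     (\<forall>t\<in>{0..T}. ((\<lambda>s. L2_norm (\<lambda>x. (u s x - u t x) / (s - t) - v t x)) \<longlongrightarrow> 0)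
                    (at t within {0..T})) \<and>
     (\<forall>t\<in>{0..T}. ((\<lambda>s. L2_norm (\<lambda>x. v s x - v t x)) \<longlongrightarrow> 0) (at t within {0..T})) \<and>
     (\<forall>\<phi>. test_fun ({0<..<T} \<times> UNIV) \<phi> \<longrightarrow>
        (\<forall>t\<in>{0..T}. integrable lborel (\<lambda>x. u t x * (dtt \<phi> (t, x) - lap_x \<phi> (t, x)))
                   \<and> integrable lborel (\<lambda>x. nonlin (u t x) * \<phi> (t, x))) \<and>
        set_integrable lborel {0..T}
          (\<lambda>t. \<integral>x. u t x * (dtt \<phi> (t, x) - lap_x \<phi> (t, x)) \<partial>lborel) \<and>
        set_integrable lborel {0..T} (\<lambda>t. \<integral>x. nonlin (u t x) * \<phi> (t, x) \<partial>lborel) \<and>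
        (LINT t:{0..T}|lborel. (\<integral>x. u t x * (dtt \<phi> (t, x) - lap_x \<phi> (t, x)) \<partial>lborel)
                              + (\<integral>x. nonlin (u t x) * \<phi> (t, x) \<partial>lborel)) = 0) \<and>
     (AE x in lborel. u 0 x = u0 x) \<and>
     (AE x in lborel. v 0 x = u1 x)"

end

(* On a short time interval the equation is solved by contraction in H^1 x L^2, without Strichartz
   estimates: near a fixed u0 in H^1 the map u |-> u exp(4 pi u^2) is Lipschitz from H^1 to L^2.
   Indeed u0 is a smooth compactly supported function plus a function of small H^1 norm, so every u
   near u0 is bounded plus small, and Trudinger's inequality makes exp(c u^2) - 1 integrable for any
   fixed c if the small part is small enough. Trudinger's inequality for small norm comes from
   W^{1,1} <= L^2 in the plane, applied to truncations of u at successive heights: this yields an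
   exponential decay of the level sets.

   The linear part is put into Klein-Gordon form, as a first order system for
   (u_t, u, u_x1, u_x2) with a skew-adjoint generator. Its group is the limit of the exponentials of
   the bounded skew operators in which derivatives are replaced by central differences.

   A solution in the sense of distributions is a mild solution: the difference of the two solves
   the linear equation with zero data, hence vanishes by an energy identity for the equation
   integrated once in time. So uniqueness and continuous dependence follow from the fixed point
   problem. *)

theory Submission imports Defs "HOL-Computational_Algebra.Polynomial"
begin

section \<open>Test functions\<close>

text \<open>Because the data may be large, the lifespan depends on the profile of u0 and not only on
  its norm. The Lipschitz constant of the nonlinearity is governed by the height and the support of
  a test function near u0, and the group is only strongly continuous, so the time during which the
  free evolution stays near the data also depends on them. One T is fixed for a whole neighbourhood
  of the data; this lets the solution map be compared at equal times. The Klein-Gordon form serves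
  two ends. Its energy is the full H^1 x L^2 norm, so the group is isometric in the norm that
  measures the data. And the forcing that remains has zero derivative at 0, so its differences are
  controlled by factors exp(c u^2) - 1, which are integrable over the whole plane. Uniqueness is
  claimed in the whole energy class and not only inside the contraction ball; a continuity argument
  in time shows that every solution stays in the ball. The exponent in the integrability bound is 48
  pi: 12 pi bounds the derivative of the forcing, and it doubles once for the square and once for
  the Cauchy-Schwarz inequality.\<close>

lemma pd_eqI:
  assumes "((\<lambda>h. f (x + h *\<^sub>R b)) has_real_derivative d) (at 0)"
  shows "pd b f x = d"
  using assms by (simp add: pd_def DERIV_imp_deriv)

lemma iter_pd_append: "iter_pd (bs @ bs') f = iter_pd bs (iter_pd bs' f)"
  by (induction bs) auto

text \<open>A family closed under the basis derivatives contains all iterated ones, so a single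
  differentiation step replaces an induction over lists of directions. Each smoothness proof below
  consists of exhibiting such a family.\<close>

lemma smooth_fun_coinduct:
  assumes "f \<in> K"
    and cont: "\<And>f. f \<in> K \<Longrightarrow> continuous_on UNIV f"
    and der: "\<And>f b. f \<in> K \<Longrightarrow> b \<in> Basis \<Longrightarrow>
      \<exists>f'\<in>K. \<forall>x. ((\<lambda>h. f (x + h *\<^sub>R b)) has_real_derivative f' x) (at 0)"
  shows "smooth_fun f"
proof -
  have iter: "iter_pd bs g \<in> K" if "set bs \<subseteq> Basis" "g \<in> K" for bs g
    using that
  proof (induction bs)
    case (Cons b bs)
    then obtain f' where f': "f' \<in> K"
      "\<And>x. ((\<lambda>h. iter_pd bs g (x + h *\<^sub>R b)) has_real_derivative f' x) (at 0)"
      using der[of "iter_pd bs g" b] by auto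
    then have "pd b (iter_pd bs g) = f'" by (auto intro: pd_eqI)
    with f' show ?case by simp
  qed simp
  show ?thesis unfolding smooth_fun_def
  proof (intro allI impI conjI ballI)
    fix bs :: "'a list" assume "set bs \<subseteq> Basis"
    from iter[OF this \<open>f \<in> K\<close>] have *: "iter_pd bs f \<in> K" .
    then show "continuous_on UNIV (iter_pd bs f)" by (rule cont)
    fix b x :: 'a assume "b \<in> Basis"
    then show "(\<lambda>h. iter_pd bs f (x + h *\<^sub>R b)) differentiable at 0"
      using der[OF *] real_differentiable_def by blast
  qed
qed

lemma smooth_fun_continuous: "smooth_fun f \<Longrightarrow> continuous_on UNIV f"
  unfolding smooth_fun_def by (metis empty_subsetI iter_pd.simps(1) list.set(1))

lemma smooth_fun_continuous_compose:
  "smooth_fun f \<Longrightarrow> continuous_on S g \<Longrightarrow> continuous_on S (\<lambda>x. f (g x))"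
  using continuous_on_compose2[OF smooth_fun_continuous] by blast

lemma smooth_fun_DERIV0:
  assumes "smooth_fun f" "b \<in> Basis"
  shows "((\<lambda>h. f (x + h *\<^sub>R b)) has_real_derivative pd b f x) (at 0)"
proof -
  have "(\<lambda>h. f (x + h *\<^sub>R b)) differentiable (at 0)"
    using assms unfolding smooth_fun_def by (metis empty_subsetI iter_pd.simps(1) list.set(1))
  then show ?thesis unfolding pd_def
    using DERIV_deriv_iff_real_differentiable by blast
qed

lemma smooth_fun_DERIV:
  assumes "smooth_fun f" "b \<in> Basis"
  shows "((\<lambda>h. f (x + h *\<^sub>R b)) has_real_derivative pd b f (x + s *\<^sub>R b)) (at s)"
proof -
  have "((\<lambda>h. f ((x + s *\<^sub>R b) + h *\<^sub>R b)) has_real_derivative pd b f (x + s *\<^sub>R b)) (at (s + (-s)))"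
    using smooth_fun_DERIV0[OF assms, of "x + s *\<^sub>R b"] by simp
  then have "((\<lambda>h. f ((x + s *\<^sub>R b) + (h + -s) *\<^sub>R b)) has_real_derivative pd b f (x + s *\<^sub>R b)) (at s)"
    by (subst (asm) DERIV_shift) simp
  then show ?thesis by (simp add: algebra_simps)
qed

lemma smooth_fun_pd:
  assumes "smooth_fun f" "b \<in> Basis" shows "smooth_fun (pd b f)"
  unfolding smooth_fun_def
proof (intro allI impI)
  fix bs :: "'a list" assume "set bs \<subseteq> Basis"
  then have "set (bs @ [b]) \<subseteq> Basis" using assms by auto
  with assms(1)[unfolded smooth_fun_def, rule_format, of "bs @ [b]"]
  show "continuous_on UNIV (iter_pd bs (pd b f)) \<and>
      (\<forall>b'\<in>Basis. \<forall>x. (\<lambda>h. iter_pd bs (pd b f) (x + h *\<^sub>R b')) differentiable at 0)"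
    by (simp add: iter_pd_append)
qed

lemma smooth_fun_const: "smooth_fun (\<lambda>x. c)"
  by (rule smooth_fun_coinduct[where K = "range (\<lambda>c x. c)"]) (auto intro!: exI[of _ 0])

lemma smooth_fun_add:
  fixes f g :: "'a::euclidean_space \<Rightarrow> real"
  assumes "smooth_fun f" "smooth_fun g" shows "smooth_fun (\<lambda>x. f x + g x)"
proof (rule smooth_fun_coinduct[where K = "{\<lambda>x. f x + g x | f g. smooth_fun f \<and> smooth_fun g}"])
  fix h :: "'a \<Rightarrow> real" and b :: 'a assume "h \<in> {\<lambda>x. f x + g x |f g. smooth_fun f \<and> smooth_fun g}" and b: "b \<in> Basis"
  then obtain f g where h: "h = (\<lambda>x. f x + g x)" "smooth_fun f" "smooth_fun g" by auto
  show "\<exists>f'\<in>{\<lambda>x. f x + g x |f g. smooth_fun f \<and> smooth_fun g}.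
          \<forall>x. ((\<lambda>k. h (x + k *\<^sub>R b)) has_real_derivative f' x) (at 0)"
    by (rule bexI[of _ "\<lambda>x. pd b f x + pd b g x"])
      (use h b smooth_fun_pd smooth_fun_DERIV0 in \<open>auto intro!: DERIV_add exI\<close>)
qed (use assms in \<open>auto intro!: continuous_on_add intro: smooth_fun_continuous\<close>)

text \<open>The Leibniz rule turns one product into a sum of two, so the family closed under
  differentiation is that of finite sums of products, kept as lists.\<close>

lemma smooth_fun_mult:
  fixes f g :: "'a::euclidean_space \<Rightarrow> real"
  assumes "smooth_fun f" "smooth_fun g" shows "smooth_fun (\<lambda>x. f x * g x)"
proof -
  define P :: "('a \<Rightarrow> real) set" where "P = {\<lambda>x. f x * g x | f g. smooth_fun f \<and> smooth_fun g}"
  define K where "K = {\<lambda>x. (\<Sum>p\<leftarrow>ps. p x) | ps. set ps \<subseteq> P}"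
  have Pc: "continuous_on UNIV p" if "p \<in> P" for p
    using that unfolding P_def by (auto intro!: continuous_on_mult intro: smooth_fun_continuous)
  have Pd: "\<exists>p1\<in>P. \<exists>p2\<in>P. \<forall>x. ((\<lambda>k. p (x + k *\<^sub>R b)) has_real_derivative p1 x + p2 x) (at 0)"
    if "p \<in> P" and b: "b \<in> Basis" for p b
  proof -
    obtain f g where h: "p = (\<lambda>x. f x * g x)" "smooth_fun f" "smooth_fun g"
      using \<open>p \<in> P\<close> unfolding P_def by auto
    have "((\<lambda>k. p (x + k *\<^sub>R b)) has_real_derivative pd b f x * g x + f x * pd b g x) (at 0)" for x
      using DERIV_mult[OF smooth_fun_DERIV0[OF h(2) b, of x] smooth_fun_DERIV0[OF h(3) b, of x]]
      unfolding h(1) by (simp add: algebra_simps)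
    moreover have "(\<lambda>x. pd b f x * g x) \<in> P" "(\<lambda>x. f x * pd b g x) \<in> P"
      unfolding P_def using h b smooth_fun_pd by blast+
    ultimately show ?thesis
      by (intro bexI[of _ "\<lambda>x. pd b f x * g x"] bexI[of _ "\<lambda>x. f x * pd b g x"]) auto
  qed
  show ?thesis
  proof (rule smooth_fun_coinduct[where K = K])
    show "(\<lambda>x. f x * g x) \<in> K" unfolding K_def P_def using assms
      by (intro CollectI exI[of _ "[\<lambda>x. f x * g x]"] conjI) auto
    fix h assume "h \<in> K"
    then obtain ps where ps: "h = (\<lambda>x. \<Sum>p\<leftarrow>ps. p x)" "set ps \<subseteq> P" unfolding K_def by auto
    have "continuous_on UNIV (\<lambda>x. \<Sum>p\<leftarrow>ps. p x)" using ps(2)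
      by (induction ps) (simp_all add: continuous_on_add Pc)
    with ps show "continuous_on UNIV h" by simp
    fix b :: 'a assume b: "b \<in> Basis"
    have "\<exists>qs. set qs \<subseteq> P \<and> (\<forall>x. ((\<lambda>k. \<Sum>p\<leftarrow>ps. p (x + k *\<^sub>R b)) has_real_derivative (\<Sum>p\<leftarrow>qs. p x)) (at 0))"
      using ps(2)
    proof (induction ps)
      case (Cons p ps)
      then obtain qs where qs: "set qs \<subseteq> P"
        "\<And>x. ((\<lambda>k. \<Sum>p\<leftarrow>ps. p (x + k *\<^sub>R b)) has_real_derivative (\<Sum>p\<leftarrow>qs. p x)) (at 0)" by auto
      obtain p1 p2 where p: "p1 \<in> P" "p2 \<in> P"
        "\<And>x. ((\<lambda>k. p (x + k *\<^sub>R b)) has_real_derivative p1 x + p2 x) (at 0)"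
        using Pd[of p b] Cons.prems b by auto
      have "((\<lambda>k. \<Sum>p\<leftarrow>p # ps. p (x + k *\<^sub>R b)) has_real_derivative (\<Sum>p\<leftarrow>p1 # p2 # qs. p x)) (at 0)" for x
        using DERIV_add[OF p(3)[of x] qs(2)[of x]] by (simp add: add.assoc)
      then show ?case using p qs by (intro exI[of _ "p1 # p2 # qs"]) auto
    qed (auto intro!: exI[of _ "[]"])
    then obtain qs where "set qs \<subseteq> P"
      "\<forall>x. ((\<lambda>k. h (x + k *\<^sub>R b)) has_real_derivative (\<Sum>p\<leftarrow>qs. p x)) (at 0)" unfolding ps(1) by auto
    then show "\<exists>f'\<in>K. \<forall>x. ((\<lambda>k. h (x + k *\<^sub>R b)) has_real_derivative f' x) (at 0)"
      unfolding K_def by (intro bexI[of _ "\<lambda>x. \<Sum>p\<leftarrow>qs. p x"]) auto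
  qed
qed

lemma smooth_fun_cmult: "smooth_fun f \<Longrightarrow> smooth_fun (\<lambda>x. c * f x)"
  by (rule smooth_fun_mult[OF smooth_fun_const])

lemma smooth_fun_prod: "(\<And>i. i \<in> I \<Longrightarrow> smooth_fun (f i)) \<Longrightarrow> smooth_fun (\<lambda>x. \<Prod>i\<in>I. f i x)"
proof (induction I rule: infinite_finite_induct)
  case (insert i I)
  then have "smooth_fun (\<lambda>x. f i x * (\<Prod>i\<in>I. f i x))" by (intro smooth_fun_mult) simp_all
  then show ?case using insert by simp
qed (simp_all add: smooth_fun_const)

lemma smooth_fun_compose_inner:
  fixes \<eta> :: "real \<Rightarrow> real" and v :: "'a::euclidean_space"
  assumes "smooth_fun \<eta>" shows "smooth_fun (\<lambda>x. \<eta> (x \<bullet> v))"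
proof (rule smooth_fun_coinduct[where K = "{\<lambda>x. \<eta> (x \<bullet> v) | \<eta>. smooth_fun \<eta>}"])
  fix h :: "'a \<Rightarrow> real" and b :: 'a
  assume "h \<in> {\<lambda>x. \<eta> (x \<bullet> v) |\<eta>. smooth_fun \<eta>}" and b: "b \<in> Basis"
  then obtain \<eta> :: "real \<Rightarrow> real" where h: "h = (\<lambda>x. \<eta> (x \<bullet> v))" "smooth_fun \<eta>" by auto
  have \<eta>: "(\<eta> has_real_derivative pd 1 \<eta> s) (at s)" for s
    using smooth_fun_DERIV[OF h(2), of 1 0 s] by simp
  have "((\<lambda>k. h (x + k *\<^sub>R b)) has_real_derivative (b \<bullet> v) * pd 1 \<eta> (x \<bullet> v)) (at 0)" for x
  proof -
    have "((\<lambda>k. (x + k *\<^sub>R b) \<bullet> v) has_real_derivative b \<bullet> v) (at 0)"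
      by (auto simp: inner_add_left intro!: derivative_eq_intros)
    from DERIV_chain2[OF \<eta> this]
    show ?thesis unfolding h(1) by (simp add: mult.commute)
  qed
  then show "\<exists>f'\<in>{\<lambda>x. \<eta> (x \<bullet> v) |\<eta>. smooth_fun \<eta>}. \<forall>x. ((\<lambda>k. h (x + k *\<^sub>R b)) has_real_derivative f' x) (at 0)"
    using smooth_fun_cmult[OF smooth_fun_pd[OF h(2), of 1], of "b \<bullet> v"] by auto
qed (use assms smooth_fun_continuous_compose[where S = UNIV and g = "\<lambda>x. x \<bullet> v"] in
    \<open>auto simp: continuous_intros\<close>)

lemma DERIV_scale_at_0:
  assumes "(g has_real_derivative d) (at 0)"
  shows "((\<lambda>k. g (s * k)) has_real_derivative s * d) (at (0::real))"
proof -
  have "((\<lambda>k. s * k) has_real_derivative s) (at 0)" by (auto intro!: derivative_eq_intros)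
  with DERIV_chain2[of g d "\<lambda>k. s * k" 0 s UNIV] assms show ?thesis by (simp add: mult.commute)
qed

lemma smooth_fun_affine:
  fixes f :: "'a::euclidean_space \<Rightarrow> real"
  assumes "smooth_fun f" shows "smooth_fun (\<lambda>x. f (a + s *\<^sub>R x))"
proof (rule smooth_fun_coinduct[where K = "{\<lambda>x. f (a + s *\<^sub>R x) | f. smooth_fun f}"])
  fix h :: "'a \<Rightarrow> real" and b :: 'a
  assume "h \<in> {\<lambda>x. f (a + s *\<^sub>R x) | f. smooth_fun f}" and b: "b \<in> Basis"
  then obtain f where h: "h = (\<lambda>x. f (a + s *\<^sub>R x))" "smooth_fun f" by auto
  have "((\<lambda>k. h (x + k *\<^sub>R b)) has_real_derivative s * pd b f (a + s *\<^sub>R x)) (at 0)" for x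
    using DERIV_scale_at_0[OF smooth_fun_DERIV0[OF h(2) b, of "a + s *\<^sub>R x"], of s]
    unfolding h(1) by (simp add: scaleR_add_right add.assoc)
  then show "\<exists>f'\<in>{\<lambda>x. f (a + s *\<^sub>R x) | f. smooth_fun f}. \<forall>x. ((\<lambda>k. h (x + k *\<^sub>R b)) has_real_derivative f' x) (at 0)"
    using smooth_fun_cmult[OF smooth_fun_pd[OF h(2) b], of s] by auto
qed (use assms smooth_fun_continuous_compose[where S = UNIV and g = "\<lambda>x. a + s *\<^sub>R x"] in
    \<open>auto simp: continuous_intros\<close>)

lemma pd_affine:
  assumes "smooth_fun f" "b \<in> Basis" shows "pd b (\<lambda>x. f (a + s *\<^sub>R x)) x = s * pd b f (a + s *\<^sub>R x)"
  using DERIV_scale_at_0[OF smooth_fun_DERIV0[OF assms, of "a + s *\<^sub>R x"], of s]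
  by (intro pd_eqI) (simp add: scaleR_add_right add.assoc)

lemma pd_mult:
  assumes "smooth_fun f" "smooth_fun g" "b \<in> Basis"
  shows "pd b (\<lambda>x. f x * g x) x = pd b f x * g x + f x * pd b g x"
  using DERIV_mult[OF smooth_fun_DERIV0[OF assms(1,3), of x] smooth_fun_DERIV0[OF assms(2,3), of x]]
  by (intro pd_eqI) (simp add: algebra_simps)

lemma smooth_fun_slice:
  fixes f :: "'a::euclidean_space \<times> 'b::euclidean_space \<Rightarrow> real"
  assumes "smooth_fun f" shows "smooth_fun (\<lambda>x. f (t, x))"
proof (rule smooth_fun_coinduct[where K = "{\<lambda>x. f (t, x) | f. smooth_fun f}"])
  fix h :: "'b \<Rightarrow> real" and b :: 'b
  assume "h \<in> {\<lambda>x. f (t, x) | f. smooth_fun f}" and b: "b \<in> Basis"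
  then obtain f where h: "h = (\<lambda>x. f (t, x))" "smooth_fun f" by auto
  have b': "(0, b) \<in> (Basis :: ('a \<times> 'b) set)" using b by (simp add: Basis_prod_def)
  show "\<exists>f'\<in>{\<lambda>x. f (t, x) | f. smooth_fun f}. \<forall>x. ((\<lambda>k. h (x + k *\<^sub>R b)) has_real_derivative f' x) (at 0)"
    using smooth_fun_pd[OF h(2) b'] smooth_fun_DERIV0[OF h(2) b', of "(t, _)"] unfolding h(1) by auto
qed (use assms smooth_fun_continuous_compose[where S = UNIV and g = "\<lambda>x. (t, x)"] in
    \<open>auto simp: continuous_intros\<close>)

lemma pd_slice: "pd b (\<lambda>x. f (t, x)) x = pd (0, b) f (t, x)"
  by (simp add: pd_def)

lemma smooth_fun_tensor:
  fixes \<theta> :: "'a::euclidean_space \<Rightarrow> real" and \<psi> :: "'b::euclidean_space \<Rightarrow> real"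
  assumes "smooth_fun \<theta>" "smooth_fun \<psi>" shows "smooth_fun (\<lambda>z. \<theta> (fst z) * \<psi> (snd z))"
proof (rule smooth_fun_coinduct[where K = "{\<lambda>z. \<theta> (fst z) * \<psi> (snd z) | \<theta> \<psi>. smooth_fun \<theta> \<and> smooth_fun \<psi>}"])
  fix h :: "'a \<times> 'b \<Rightarrow> real" and b :: "'a \<times> 'b"
  assume "h \<in> {\<lambda>z. \<theta> (fst z) * \<psi> (snd z) | \<theta> \<psi>. smooth_fun \<theta> \<and> smooth_fun \<psi>}" and b: "b \<in> Basis"
  then obtain \<theta> \<psi> where h: "h = (\<lambda>z. \<theta> (fst z) * \<psi> (snd z))" "smooth_fun \<theta>" "smooth_fun \<psi>" by auto
  from b consider c where "b = (c, 0)" "c \<in> Basis" | c where "b = (0, c)" "c \<in> Basis"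
    by (auto simp: Basis_prod_def)
  then show "\<exists>f'\<in>{\<lambda>z. \<theta> (fst z) * \<psi> (snd z) | \<theta> \<psi>. smooth_fun \<theta> \<and> smooth_fun \<psi>}.
      \<forall>x. ((\<lambda>k. h (x + k *\<^sub>R b)) has_real_derivative f' x) (at 0)"
  proof cases
    case 1
    show ?thesis
      by (rule bexI[of _ "\<lambda>z. pd c \<theta> (fst z) * \<psi> (snd z)"])
        (use h 1 smooth_fun_pd[OF h(2)] smooth_fun_DERIV0[OF h(2)] in \<open>auto intro!: DERIV_cmult_right\<close>)
  next
    case 2
    show ?thesis
      by (rule bexI[of _ "\<lambda>z. \<theta> (fst z) * pd c \<psi> (snd z)"])
        (use h 2 smooth_fun_pd[OF h(3)] smooth_fun_DERIV0[OF h(3)] in \<open>auto intro!: DERIV_cmult\<close>)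
  qed
qed (use assms smooth_fun_continuous_compose[where S = UNIV and g = fst]
    smooth_fun_continuous_compose[where S = UNIV and g = snd] in
    \<open>auto simp: continuous_on_fst continuous_on_snd intro!: continuous_on_mult\<close>)

lemma pd_tensor_fst:
  fixes \<theta> :: "'a::euclidean_space \<Rightarrow> real" and \<psi> :: "'b::euclidean_space \<Rightarrow> real"
  assumes "smooth_fun \<theta>" "c \<in> Basis"
  shows "pd (c, 0) (\<lambda>z. \<theta> (fst z) * \<psi> (snd z)) = (\<lambda>z. pd c \<theta> (fst z) * \<psi> (snd z))"
proof
  fix z :: "'a \<times> 'b"
  show "pd (c, 0) (\<lambda>z. \<theta> (fst z) * \<psi> (snd z)) z = pd c \<theta> (fst z) * \<psi> (snd z)"
    using DERIV_cmult_right[OF smooth_fun_DERIV0[OF assms, of "fst z"], of "\<psi> (snd z)"]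
    by (intro pd_eqI) simp
qed

lemma pd_tensor_snd:
  fixes \<theta> :: "'a::euclidean_space \<Rightarrow> real" and \<psi> :: "'b::euclidean_space \<Rightarrow> real"
  assumes "smooth_fun \<psi>" "c \<in> Basis"
  shows "pd (0, c) (\<lambda>z. \<theta> (fst z) * \<psi> (snd z)) = (\<lambda>z. \<theta> (fst z) * pd c \<psi> (snd z))"
proof
  fix z :: "'a \<times> 'b"
  show "pd (0, c) (\<lambda>z. \<theta> (fst z) * \<psi> (snd z)) z = \<theta> (fst z) * pd c \<psi> (snd z)"
    using DERIV_cmult[OF smooth_fun_DERIV0[OF assms, of "snd z"], of "\<theta> (fst z)"]
    by (intro pd_eqI) simp
qed

section \<open>Compact support and uniform estimates for test functions\<close>

lemma test_fun_UNIV_iff: "test_fun UNIV f \<longleftrightarrow> smooth_fun f \<and> (\<exists>R. \<forall>x. f x \<noteq> 0 \<longrightarrow> norm x \<le> R)"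
  unfolding test_fun_def by (auto simp: compact_closure bounded_iff)

lemma test_fun_mono: "test_fun S f \<Longrightarrow> S \<subseteq> S' \<Longrightarrow> test_fun S' f"
  unfolding test_fun_def by auto

lemma pd_eq_0_outside:
  assumes "x \<notin> closure {x. f x \<noteq> 0}" shows "pd b f x = 0"
proof (rule pd_eqI)
  have "open (- closure {x. f x \<noteq> 0})" by auto
  then obtain e where e: "e > 0" "ball x e \<subseteq> - closure {x. f x \<noteq> 0}"
    using assms open_contains_ball by blast
  have z: "f y = 0" if "dist x y < e" for y
  proof -
    have "y \<notin> closure {x. f x \<noteq> 0}" using that e(2) by auto
    then show ?thesis using closure_subset[of "{x. f x \<noteq> 0}"] by blast
  qed
  have "\<forall>\<^sub>F h in nhds 0. dist ((\<lambda>h. x + h *\<^sub>R b) h) x < e"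
  proof (rule tendstoD[OF _ e(1)])
    have "((\<lambda>h. x + h *\<^sub>R b) \<longlongrightarrow> x + 0 *\<^sub>R b) (nhds 0)"
      by (intro tendsto_intros filterlim_ident)
    then show "((\<lambda>h. x + h *\<^sub>R b) \<longlongrightarrow> x) (nhds 0)" by simp
  qed
  then have ev: "\<forall>\<^sub>F h in nhds 0. f (x + h *\<^sub>R b) = 0"
    by eventually_elim (use z in \<open>auto simp: dist_commute\<close>)
  have "((\<lambda>h. 0) has_real_derivative 0) (at 0)" by simp
  then show "((\<lambda>h. f (x + h *\<^sub>R b)) has_real_derivative 0) (at 0)"
    using DERIV_cong_ev[OF refl ev refl] by simp
qed

lemma test_fun_pd:
  assumes "test_fun S f" "b \<in> Basis" shows "test_fun S (pd b f)"
proof -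
  have "closure {x. pd b f x \<noteq> 0} \<subseteq> closure {x. f x \<noteq> 0}"
    using pd_eq_0_outside by (intro closure_minimal) auto
  then have "closure {x. pd b f x \<noteq> 0} \<subseteq> S" "compact (closure {x. pd b f x \<noteq> 0})"
    using assms unfolding test_fun_def compact_eq_bounded_closed
    by (blast, metis bounded_subset closed_closure)
  then show ?thesis using assms smooth_fun_pd unfolding test_fun_def by auto
qed

lemma test_fun_mult_smooth:
  assumes "test_fun UNIV f" "smooth_fun g"
  shows "test_fun UNIV (\<lambda>x. g x * f x)" "test_fun UNIV (\<lambda>x. f x * g x)"
  using assms smooth_fun_mult[of f g] smooth_fun_mult[of g f] by (auto simp: test_fun_UNIV_iff)

lemma test_fun_cmult: "test_fun UNIV f \<Longrightarrow> test_fun UNIV (\<lambda>x. c * f x)"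
  by (rule test_fun_mult_smooth(1)[OF _ smooth_fun_const])

lemma test_fun_zero: "test_fun UNIV (\<lambda>x. 0)"
  by (auto simp: test_fun_UNIV_iff smooth_fun_const)

lemma test_fun_affine:
  assumes "test_fun UNIV f" "s \<noteq> 0" shows "test_fun UNIV (\<lambda>x. f (a + s *\<^sub>R x))"
proof -
  obtain R where R: "\<And>x. f x \<noteq> 0 \<Longrightarrow> norm x \<le> R" using assms by (auto simp: test_fun_UNIV_iff)
  have "norm x \<le> (R + norm a) / \<bar>s\<bar>" if "f (a + s *\<^sub>R x) \<noteq> 0" for x
  proof -
    have "norm (s *\<^sub>R x) \<le> norm (a + s *\<^sub>R x) + norm a" by (metis add.commute add_diff_cancel_left' norm_triangle_ineq4)
    with R[OF that] show ?thesis using assms(2) by (simp add: field_simps)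
  qed
  then show ?thesis using assms by (auto simp: test_fun_UNIV_iff smooth_fun_affine)
qed

lemma bounded_support_uniformly_continuous:
  fixes f :: "'a::euclidean_space \<Rightarrow> real"
  assumes "continuous_on UNIV f" and R: "\<And>x. f x \<noteq> 0 \<Longrightarrow> norm x \<le> R"
  shows "uniformly_continuous_on UNIV f"
proof -
  \<comment> \<open>The extra unit of radius ensures that two points at distance below 1 either both
    lie in this ball or are both off the support.\<close>
  have "uniformly_continuous_on (cball 0 (R + 1)) f"
    using assms(1) by (intro compact_uniformly_continuous) (auto intro: continuous_on_subset)
  show ?thesis unfolding uniformly_continuous_on_def
  proof (intro allI impI)
    fix e :: real assume e: "e > 0"
    with \<open>uniformly_continuous_on (cball 0 (R + 1)) f\<close> obtain d where d: "d > 0"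
      "\<And>x y. x \<in> cball 0 (R + 1) \<Longrightarrow> y \<in> cball 0 (R + 1) \<Longrightarrow> dist y x < d \<Longrightarrow> dist (f y) (f x) < e"
      unfolding uniformly_continuous_on_def by metis
    have "dist (f y) (f x) < e" if "dist y x < min d 1" for x y
    proof (cases "norm x \<le> R \<or> norm y \<le> R")
      case True
      have "norm (y - x) < 1" using that by (simp add: dist_norm)
      then have "norm x \<le> R + 1" "norm y \<le> R + 1"
        using True norm_triangle_ineq2[of x y] norm_triangle_ineq2[of y x] by (auto simp: norm_minus_commute)
      then show ?thesis using d that by auto
    next
      case False
      then have "f x = 0" "f y = 0" using R by blast+
      then show ?thesis using e by simp
    qed
    then show "\<exists>d>0. \<forall>x\<in>UNIV. \<forall>x'\<in>UNIV. dist x' x < d \<longrightarrow> dist (f x') (f x) < e"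
      using d by (intro exI[of _ "min d 1"]) auto
  qed
qed

lemma test_fun_uniformly_continuous: "test_fun UNIV f \<Longrightarrow> uniformly_continuous_on UNIV f"
  using bounded_support_uniformly_continuous smooth_fun_continuous unfolding test_fun_UNIV_iff by metis

lemma test_fun_bounded:
  fixes f :: "'a::euclidean_space \<Rightarrow> real"
  assumes "test_fun UNIV f" obtains M where "M \<ge> 0" "\<And>x. \<bar>f x\<bar> \<le> M"
proof -
  have "compact (closure {x. f x \<noteq> 0})" "continuous_on (closure {x. f x \<noteq> 0}) f"
    using assms by (auto simp: test_fun_def intro: continuous_on_subset[OF smooth_fun_continuous])
  then have "bounded (f ` closure {x. f x \<noteq> 0})"
    using compact_continuous_image compact_imp_bounded by blast
  then obtain M where M: "\<And>x. x \<in> closure {x. f x \<noteq> 0} \<Longrightarrow> \<bar>f x\<bar> \<le> M" "M > 0"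
    unfolding bounded_pos by auto
  have "\<bar>f x\<bar> \<le> M" for x
    using M(1)[of x] M(2) closure_subset[of "{x. f x \<noteq> 0}"] by (cases "f x = 0") auto
  then show thesis using that M(2) less_imp_le by blast
qed

text \<open>The function \<open>f (x + s b) - s * pd b f x\<close> of s has a derivative that is
  small by the uniform continuity of \<open>pd b f\<close>, so the mean value inequality gives an
  estimate uniform in x. Uniformity is the point: together with bounded support it gives convergence
  of difference quotients in L2, and it permits differentiation under the integral sign.\<close>

lemma test_fun_difference_quotient:
  fixes f :: "'a::euclidean_space \<Rightarrow> real"
  assumes f: "test_fun UNIV f" and b: "b \<in> Basis" and e: "e > 0"
  obtains d where "d > 0"
    "\<And>x h. 0 < \<bar>h\<bar> \<Longrightarrow> \<bar>h\<bar> < d \<Longrightarrow> \<bar>(f (x + h *\<^sub>R b) - f x) / h - pd b f x\<bar> \<le> e"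
proof -
  have sm: "smooth_fun f" using f by (simp add: test_fun_def)
  obtain d where d: "d > 0" "\<And>x y. dist y x < d \<Longrightarrow> dist (pd b f y) (pd b f x) < e"
    using test_fun_uniformly_continuous[OF test_fun_pd[OF f b]] e unfolding uniformly_continuous_on_def by auto
  have "\<bar>(f (x + h *\<^sub>R b) - f x) / h - pd b f x\<bar> \<le> e" if h: "0 < \<bar>h\<bar>" "\<bar>h\<bar> < d" for x h
  proof -
    have "norm ((f (x + h *\<^sub>R b) - h * pd b f x) - (f (x + 0 *\<^sub>R b) - 0 * pd b f x)) \<le> e * norm (h - 0)"
    proof (rule field_differentiable_bound[where S = "closed_segment 0 h" and f' = "\<lambda>s. pd b f (x + s *\<^sub>R b) - pd b f x"])
      fix s assume s: "s \<in> closed_segment 0 h"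
      show "((\<lambda>s. f (x + s *\<^sub>R b) - s * pd b f x) has_field_derivative pd b f (x + s *\<^sub>R b) - pd b f x) (at s within closed_segment 0 h)"
        using DERIV_diff[OF smooth_fun_DERIV[OF sm b, of x s] DERIV_cmult_right[OF DERIV_ident, of "pd b f x"]]
        by (simp add: has_field_derivative_at_within)
      have "\<bar>s\<bar> \<le> \<bar>h\<bar>" using s by (auto simp: closed_segment_eq_real_ivl split: if_splits)
      then have "dist (x + s *\<^sub>R b) x < d" using h b by (simp add: dist_norm)
      from d(2)[OF this] show "norm (pd b f (x + s *\<^sub>R b) - pd b f x) \<le> e" by (simp add: dist_real_def)
    qed auto
    then have "\<bar>f (x + h *\<^sub>R b) - f x - h * pd b f x\<bar> \<le> e * \<bar>h\<bar>" by (simp add: algebra_simps)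
    moreover have "(f (x + h *\<^sub>R b) - f x) / h - pd b f x = (f (x + h *\<^sub>R b) - f x - h * pd b f x) / h"
      using h by (simp add: field_simps)
    ultimately show ?thesis using h by (simp add: field_simps)
  qed
  with d that show thesis by blast
qed

text \<open>The functions \<open>p (1/x) exp (-1/x)\<close> with a polynomial \<open>p\<close>, extended by \<open>0\<close>, are closed
  under differentiation, so the usual flat function is smooth.\<close>

definition flat :: "real poly \<Rightarrow> real \<Rightarrow> real" where
  "flat p x = (if x > 0 then poly p (1 / x) * exp (- (1 / x)) else 0)"

lemma flat_tendsto_0: "(flat p \<longlongrightarrow> 0) (at_right 0)"
proof -
  have *: "((\<lambda>y. poly p y * exp (- y)) \<longlongrightarrow> 0) at_top"
  proof -
    have "((\<lambda>y. \<Sum>i\<le>degree p. coeff p i * (y ^ i / exp y)) \<longlongrightarrow> (\<Sum>i\<le>degree p. coeff p i * 0)) at_top"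
      by (intro tendsto_sum tendsto_mult tendsto_const tendsto_power_div_exp_0)
    then show ?thesis
      by (simp add: poly_altdef sum_distrib_right exp_minus divide_inverse mult.assoc)
  qed
  have "filterlim (\<lambda>x. 1 / x :: real) at_top (at_right 0)"
    using filterlim_inverse_at_top_right by (simp add: inverse_eq_divide)
  from filterlim_compose[OF * this] show ?thesis
    by (rule Lim_transform_eventually) (auto simp: eventually_at_filter flat_def)
qed

text \<open>With y = 1/x one has dy/dx = -y^2, so p(y) exp(-y) has the derivative y^2 (p - p')(y)
  exp(-y), and \<open>[:0, 0, 1:]\<close> is the factor y^2. At 0 the right difference quotient is
  again a flat function, with the polynomial y p(y), and tends to 0.\<close>

lemma flat_DERIV: "(flat p has_real_derivative flat ([:0, 0, 1:] * (p - pderiv p)) x) (at x)"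
proof -
  consider "x > 0" | "x < 0" | "x = 0" by linarith
  then show ?thesis
  proof cases
    case 1
    have D: "((\<lambda>x. poly p (1 / x) * exp (- (1 / x))) has_real_derivative flat ([:0, 0, 1:] * (p - pderiv p)) x) (at x)"
      unfolding flat_def using 1
      by (auto intro!: derivative_eq_intros DERIV_chain2[OF poly_DERIV] simp: field_simps power2_eq_square)
    have ev: "\<forall>\<^sub>F y in nhds x. flat p y = poly p (1 / y) * exp (- (1 / y))"
      using eventually_nhds_in_open[of "{0<..}" x] 1 by (auto elim!: eventually_mono simp: flat_def)
    show ?thesis by (rule DERIV_cong_ev[OF refl ev refl, THEN iffD2, OF D])
  next
    case 2
    have ev: "\<forall>\<^sub>F y in nhds x. flat p y = 0"
      using eventually_nhds_in_open[of "{..<0}" x] 2 by (auto elim!: eventually_mono simp: flat_def)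
    have D: "((\<lambda>x. 0) has_real_derivative flat ([:0, 0, 1:] * (p - pderiv p)) x) (at x)"
      using 2 by (simp add: flat_def)
    show ?thesis by (rule DERIV_cong_ev[OF refl ev refl, THEN iffD2, OF D])
  next
    case 3
    have "\<forall>\<^sub>F x in at_right 0. flat ([:0, 1:] * p) x = (flat p x - flat p 0) / x"
      using eventually_at_right_less[of "0::real"] by eventually_elim (simp add: flat_def)
    then have "((\<lambda>h. (flat p h - flat p 0) / h) \<longlongrightarrow> 0) (at_right 0)"
      by (rule Lim_transform_eventually[OF flat_tendsto_0])
    moreover have "((\<lambda>h. (flat p h - flat p 0) / h) \<longlongrightarrow> 0) (at_left 0)"
    proof (rule tendsto_eventually)
      have "\<forall>\<^sub>F x in at_left 0. x < (0::real)" by (simp add: eventually_at_filter)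
      then show "\<forall>\<^sub>F x in at_left 0. (flat p x - flat p 0) / x = 0"
        by eventually_elim (simp add: flat_def)
    qed
    ultimately have "((\<lambda>h. (flat p (0 + h) - flat p 0) / h) \<longlongrightarrow> 0) (at 0)"
      by (simp add: filterlim_split_at)
    then show ?thesis using 3 by (simp add: DERIV_def flat_def)
  qed
qed

lemma smooth_fun_flat: "smooth_fun (flat p)"
proof (rule smooth_fun_coinduct[where K = "range flat"])
  show "continuous_on UNIV f" if "f \<in> range flat" for f
    using that flat_DERIV DERIV_isCont continuous_at_imp_continuous_on by blast
  fix f :: "real \<Rightarrow> real" and b :: real assume "f \<in> range flat" "b \<in> Basis"
  then obtain p where f: "f = flat p" and b: "b = 1" by auto
  have "((\<lambda>h. f (x + h *\<^sub>R b)) has_real_derivative flat ([:0, 0, 1:] * (p - pderiv p)) x) (at 0)" for x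
    using DERIV_shift[of "flat p" "flat ([:0, 0, 1:] * (p - pderiv p)) x" 0 x] flat_DERIV[of p x]
    unfolding f b by (simp add: add.commute)
  then show "\<exists>f'\<in>range flat. \<forall>x. ((\<lambda>h. f (x + h *\<^sub>R b)) has_real_derivative f' x) (at 0)" by blast
qed auto

lemma ex_bump:
  fixes r :: real assumes "r > 0"
  obtains \<rho> :: "'a::euclidean_space \<Rightarrow> real"
  where "test_fun UNIV \<rho>" "\<And>x. \<rho> x \<ge> 0" "\<rho> 0 > 0" "\<And>x. \<rho> x \<noteq> 0 \<Longrightarrow> norm x \<le> r"
proof -
  define n where "n = real DIM('a)"
  have n: "n > 0" by (simp add: n_def)
  \<comment> \<open>Half-width r / n in each of the n coordinates keeps the sum of the coordinate
    moduli, hence the norm, at most r. The scalars 1 and -1 are written out to match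
    \<open>smooth_fun_affine\<close>.\<close>
  define \<eta> where "\<eta> = (\<lambda>x. flat 1 (r / n + 1 *\<^sub>R x) * flat 1 (r / n + (-1) *\<^sub>R x))"
  have \<eta>: "smooth_fun \<eta>" "\<And>x. \<eta> x \<ge> 0" "\<eta> 0 > 0" "\<And>x. \<eta> x \<noteq> 0 \<Longrightarrow> \<bar>x\<bar> \<le> r / n"
  proof -
    show "smooth_fun \<eta>" unfolding \<eta>_def
      by (intro smooth_fun_mult smooth_fun_affine[where f = "flat 1"] smooth_fun_flat)
  qed (use n assms in \<open>auto simp: \<eta>_def flat_def split: if_splits\<close>)
  define \<rho> where "\<rho> = (\<lambda>x::'a. \<Prod>b\<in>Basis. \<eta> (x \<bullet> b))"
  have supp: "norm x \<le> r" if "\<rho> x \<noteq> 0" for x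
  proof -
    have "norm x \<le> (\<Sum>b\<in>Basis. \<bar>x \<bullet> b\<bar>)" by (rule norm_le_l1)
    also have "\<dots> \<le> (\<Sum>b\<in>(Basis::'a set). r / n)"
      using that by (intro sum_mono \<eta>(4)) (auto simp: \<rho>_def)
    finally show ?thesis using n by (simp add: n_def)
  qed
  show thesis
  proof (rule that[of \<rho>])
    show "test_fun UNIV \<rho>" using supp unfolding test_fun_UNIV_iff
      unfolding \<rho>_def by (intro conjI smooth_fun_prod smooth_fun_compose_inner[where \<eta> = \<eta>] \<eta>) auto
  qed (use supp \<eta> in \<open>auto simp: \<rho>_def intro!: prod_nonneg prod_pos\<close>)
qed

section \<open>The Hilbert space \<open>L\<^sup>2\<close>\<close>

lemma L2_measurable: "L2 f \<Longrightarrow> f \<in> borel_measurable borel"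
  by (simp add: L2_def)

lemma L2_integrable_square: "L2 f \<Longrightarrow> integrable lborel (\<lambda>x. (f x)\<^sup>2)"
  by (simp add: L2_def)

lemma L2_integrable_mult:
  assumes "L2 f" "L2 g" shows "integrable lborel (\<lambda>x. f x * g x)"
proof (rule Bochner_Integration.integrable_bound)
  show "integrable lborel (\<lambda>x. (f x)\<^sup>2 + (g x)\<^sup>2)" using assms by (simp add: L2_def)
  show "(\<lambda>x. f x * g x) \<in> borel_measurable lborel" using assms by (auto simp: L2_def)
  have "\<bar>f x * g x\<bar> \<le> (f x)\<^sup>2 + (g x)\<^sup>2" for x
  proof -
    have "2 * (\<bar>f x\<bar> * \<bar>g x\<bar>) \<le> (f x)\<^sup>2 + (g x)\<^sup>2"
      using sum_squares_bound[of "\<bar>f x\<bar>" "\<bar>g x\<bar>"] by (simp add: mult.assoc)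
    moreover have "0 \<le> \<bar>f x\<bar> * \<bar>g x\<bar>" by simp
    ultimately show ?thesis unfolding abs_mult by linarith
  qed
  then show "AE x in lborel. norm (f x * g x) \<le> norm ((f x)\<^sup>2 + (g x)\<^sup>2)"
    by (intro AE_I2) (simp add: order_trans[OF _ abs_ge_self])
qed

lemma L2_zero: "L2 (\<lambda>x. 0)" by (simp add: L2_def)

lemma L2_cmult: "L2 f \<Longrightarrow> L2 (\<lambda>x. c * f x)"
  unfolding L2_def power_mult_distrib by auto

lemma L2_add:
  assumes "L2 f" "L2 g" shows "L2 (\<lambda>x. f x + g x)"
proof -
  have "integrable lborel (\<lambda>x. (f x)\<^sup>2 + (g x)\<^sup>2 + 2 * (f x * g x))"
    using assms L2_integrable_mult[OF assms] by (auto simp: L2_def)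
  then show ?thesis using assms unfolding L2_def power2_sum mult.assoc by auto
qed

lemma L2_uminus: "L2 f \<Longrightarrow> L2 (\<lambda>x. - f x)"
  using L2_cmult[of f "-1"] by simp

lemma L2_diff: "L2 f \<Longrightarrow> L2 g \<Longrightarrow> L2 (\<lambda>x. f x - g x)"
  using L2_add[of f "\<lambda>x. - g x"] L2_uminus[of g] by simp

lemma L2_bound:
  assumes "L2 g" "f \<in> borel_measurable borel" "\<And>x. \<bar>f x\<bar> \<le> \<bar>g x\<bar>" shows "L2 f"
proof -
  have "integrable lborel (\<lambda>x. (f x)\<^sup>2)"
    by (rule Bochner_Integration.integrable_bound[OF L2_integrable_square[OF assms(1)]])
      (use assms in \<open>auto simp: abs_le_square_iff\<close>)
  then show ?thesis using assms(2) by (simp add: L2_def)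
qed

lemma L2_AE_cong:
  assumes "L2 g" "f \<in> borel_measurable borel" "AE x in lborel. f x = g x" shows "L2 f"
proof -
  have ae: "AE x in lborel. (f x)\<^sup>2 = (g x)\<^sup>2" using assms(3) by eventually_elim simp
  have "integrable lborel (\<lambda>x. (f x)\<^sup>2) = integrable lborel (\<lambda>x. (g x)\<^sup>2)"
    by (rule integrable_cong_AE[OF _ _ ae]) (use assms(2) L2_measurable[OF assms(1)] in simp_all)
  then show ?thesis using assms(1,2) unfolding L2_def by simp
qed

\<comment> \<open>The relation is partial, so that the type contains classes of square-integrable
  functions only. As elements of a Hilbert space type they can be values of limits, derivatives and
  integrals in time.\<close>
quotient_type (overloaded) 'a l2 = "'a::euclidean_space \<Rightarrow> real" /
  partial: "\<lambda>f g. L2 f \<and> L2 g \<and> (AE x in lborel. f x = g x)"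
proof (rule part_equivpI)
  show "\<exists>f::'a \<Rightarrow> real. L2 f \<and> L2 f \<and> (AE x in lborel. f x = f x)" using L2_zero by auto
  show "symp (\<lambda>f g::'a \<Rightarrow> real. L2 f \<and> L2 g \<and> (AE x in lborel. f x = g x))"
    by (rule sympI) (simp add: eq_commute)
  show "transp (\<lambda>f g::'a \<Rightarrow> real. L2 f \<and> L2 g \<and> (AE x in lborel. f x = g x))"
  proof (rule transpI, elim conjE, intro conjI)
    fix f g h :: "'a \<Rightarrow> real"
    assume "AE x in lborel. f x = g x" "AE x in lborel. g x = h x"
    then show "AE x in lborel. f x = h x" by eventually_elim simp
  qed
qed

instantiation l2 :: (euclidean_space) real_vector
begin
lift_definition zero_l2 :: "'a l2" is "\<lambda>x. 0" by (simp add: L2_zero)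
lift_definition plus_l2 :: "'a l2 \<Rightarrow> 'a l2 \<Rightarrow> 'a l2" is "\<lambda>f g x. f x + g x"
proof (elim conjE, intro conjI)
  fix f f' g g' :: "'a \<Rightarrow> real"
  assume "AE x in lborel. f x = f' x" "AE x in lborel. g x = g' x"
  then show "AE x in lborel. f x + g x = f' x + g' x" by eventually_elim simp
qed (rule L2_add; assumption)+
lift_definition minus_l2 :: "'a l2 \<Rightarrow> 'a l2 \<Rightarrow> 'a l2" is "\<lambda>f g x. f x - g x"
proof (elim conjE, intro conjI)
  fix f f' g g' :: "'a \<Rightarrow> real"
  assume "AE x in lborel. f x = f' x" "AE x in lborel. g x = g' x"
  then show "AE x in lborel. f x - g x = f' x - g' x" by eventually_elim simp
qed (rule L2_diff; assumption)+
lift_definition uminus_l2 :: "'a l2 \<Rightarrow> 'a l2" is "\<lambda>f x. - f x"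
proof (elim conjE, intro conjI)
  fix f f' :: "'a \<Rightarrow> real"
  assume "AE x in lborel. f x = f' x"
  then show "AE x in lborel. - f x = - f' x" by eventually_elim simp
qed (rule L2_uminus; assumption)+
lift_definition scaleR_l2 :: "real \<Rightarrow> 'a l2 \<Rightarrow> 'a l2" is "\<lambda>c f x. c * f x"
proof (elim conjE, intro conjI)
  fix f f' :: "'a \<Rightarrow> real" and c :: real
  assume "AE x in lborel. f x = f' x"
  then show "AE x in lborel. c * f x = c * f' x" by eventually_elim simp
qed (rule L2_cmult; assumption)+
instance
proof
  fix x y z :: "'a l2" and c d :: real
  show "x + y + z = x + (y + z)" by transfer (simp add: L2_add add.assoc)
  show "x + y = y + x" by transfer (simp add: L2_add add.commute)
  show "0 + x = x" by transfer simp
  show "- x + x = 0" by transfer (simp add: L2_zero)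
  show "x - y = x + - y" by transfer (simp add: L2_add L2_diff L2_uminus)
  show "c *\<^sub>R (x + y) = c *\<^sub>R x + c *\<^sub>R y" by transfer (simp add: L2_add L2_cmult distrib_left)
  show "(c + d) *\<^sub>R x = c *\<^sub>R x + d *\<^sub>R x" by transfer (simp add: L2_add L2_cmult distrib_right)
  show "c *\<^sub>R d *\<^sub>R x = (c * d) *\<^sub>R x" by transfer (simp add: L2_cmult mult.assoc)
  show "1 *\<^sub>R x = x" by transfer simp
qed
end

instantiation l2 :: (euclidean_space) real_inner
begin
lift_definition inner_l2 :: "'a l2 \<Rightarrow> 'a l2 \<Rightarrow> real" is "\<lambda>f g. \<integral>x. f x * g x \<partial>lborel"
proof -
  fix f f' g g' :: "'a \<Rightarrow> real"
  assume *: "L2 f \<and> L2 f' \<and> (AE x in lborel. f x = f' x)" "L2 g \<and> L2 g' \<and> (AE x in lborel. g x = g' x)"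
  have "AE x in lborel. f x = f' x" "AE x in lborel. g x = g' x" using * by blast+
  then have ae: "AE x in lborel. f x * g x = f' x * g' x" by eventually_elim simp
  have "f \<in> borel_measurable borel" "g \<in> borel_measurable borel"
    "f' \<in> borel_measurable borel" "g' \<in> borel_measurable borel"
    using * L2_measurable by blast+
  then show "(\<integral>x. f x * g x \<partial>lborel) = (\<integral>x. f' x * g' x \<partial>lborel)"
    by (intro integral_cong_AE ae) simp_all
qed
definition norm_l2 :: "'a l2 \<Rightarrow> real" where "norm_l2 x = sqrt (inner x x)"
definition sgn_l2 :: "'a l2 \<Rightarrow> 'a l2" where "sgn_l2 x = x /\<^sub>R norm x"
definition dist_l2 :: "'a l2 \<Rightarrow> 'a l2 \<Rightarrow> real" where "dist_l2 x y = norm (x - y)"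
definition uniformity_l2 :: "('a l2 \<times> 'a l2) filter"
  where "uniformity_l2 = (INF e\<in>{0<..}. principal {(x, y). dist x y < e})"
definition open_l2 :: "'a l2 set \<Rightarrow> bool"
  where "open_l2 U = (\<forall>x\<in>U. \<forall>\<^sub>F (x', y) in uniformity. x' = x \<longrightarrow> y \<in> U)"
instance
proof
  fix x y z :: "'a l2" and r :: real and U :: "'a l2 set"
  show "inner x y = inner y x" by transfer (simp add: mult.commute)
  show "inner (x + y) z = inner x z + inner y z"
    by transfer (simp add: distrib_right L2_integrable_mult)
  show "inner (r *\<^sub>R x) y = r * inner x y" by transfer (simp add: mult.assoc)
  show "0 \<le> inner x x" by transfer simp
  show "inner x x = 0 \<longleftrightarrow> x = 0"
  proof transfer
    fix f :: "'a \<Rightarrow> real" assume "L2 f \<and> L2 f \<and> (AE x in lborel. f x = f x)"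
    then have f: "L2 f" ..
    have "integrable lborel (\<lambda>x. f x * f x)" using L2_integrable_mult[OF f f] .
    then have "(\<integral>x. f x * f x \<partial>lborel) = 0 \<longleftrightarrow> (AE x in lborel. f x * f x = 0)"
      by (intro integral_nonneg_eq_0_iff_AE AE_I2) auto
    then show "(\<integral>x. f x * f x \<partial>lborel) = 0 \<longleftrightarrow> L2 f \<and> L2 (\<lambda>x. 0::real) \<and> (AE x in lborel. f x = 0)"
      using f L2_zero unfolding mult_eq_0_iff disj_absorb by blast
  qed
qed (rule norm_l2_def sgn_l2_def dist_l2_def uniformity_l2_def open_l2_def)+
end

text \<open>\<open>fn\<close> picks one square-integrable representative; algebraic identities such
  as \<open>fn (u - v) x = fn u x - fn v x\<close> are available only almost everywhere.\<close>

definition toL2 :: "('a::euclidean_space \<Rightarrow> real) \<Rightarrow> 'a l2" where "toL2 = abs_l2"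
definition fn :: "'a::euclidean_space l2 \<Rightarrow> 'a \<Rightarrow> real" where "fn = rep_l2"

lemma L2_fn: "L2 (fn u)"
  unfolding fn_def using Quotient_rep_reflp[OF Quotient_l2, of u] by blast

lemma toL2_fn [simp]: "toL2 (fn u) = u"
  unfolding fn_def toL2_def by (rule Quotient_abs_rep[OF Quotient_l2])

lemma toL2_eq_iff: "L2 f \<Longrightarrow> L2 g \<Longrightarrow> toL2 f = toL2 g \<longleftrightarrow> (AE x in lborel. f x = g x)"
  unfolding toL2_def using Quotient_rel[OF Quotient_l2, of f g] by blast

lemma fn_toL2: "L2 f \<Longrightarrow> AE x in lborel. fn (toL2 f) x = f x"
  using toL2_eq_iff[OF L2_fn, of f "toL2 f"] by simp

lemma fn_measurable [measurable]: "fn u \<in> borel_measurable borel"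
  using L2_measurable[OF L2_fn] .

lemma inner_toL2: "L2 f \<Longrightarrow> L2 g \<Longrightarrow> inner (toL2 f) (toL2 g) = (\<integral>x. f x * g x \<partial>lborel)"
  unfolding toL2_def by (simp add: inner_l2.abs_eq)

lemma toL2_add: "L2 f \<Longrightarrow> L2 g \<Longrightarrow> toL2 (\<lambda>x. f x + g x) = toL2 f + toL2 g"
  unfolding toL2_def by (simp add: plus_l2.abs_eq)

lemma toL2_diff: "L2 f \<Longrightarrow> L2 g \<Longrightarrow> toL2 (\<lambda>x. f x - g x) = toL2 f - toL2 g"
  unfolding toL2_def by (simp add: minus_l2.abs_eq)

lemma toL2_uminus: "L2 f \<Longrightarrow> toL2 (\<lambda>x. - f x) = - toL2 f"
  unfolding toL2_def by (simp add: uminus_l2.abs_eq)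

lemma toL2_cmult: "L2 f \<Longrightarrow> toL2 (\<lambda>x. c * f x) = c *\<^sub>R toL2 f"
  unfolding toL2_def by (simp add: scaleR_l2.abs_eq)

lemma toL2_zero: "toL2 (\<lambda>x. 0) = 0"
  unfolding toL2_def by (simp add: zero_l2_def)

lemma norm_toL2: "L2 f \<Longrightarrow> norm (toL2 f) = L2_norm f"
  by (simp add: norm_l2_def inner_toL2 L2_norm_def power2_eq_square)

lemma norm_toL2_sq: "L2 f \<Longrightarrow> (norm (toL2 f))\<^sup>2 = (\<integral>x. (f x)\<^sup>2 \<partial>lborel)"
  by (simp add: norm_toL2 L2_norm_def)

lemma nn_integral_square: "L2 f \<Longrightarrow> (\<integral>\<^sup>+x. ennreal ((f x)\<^sup>2) \<partial>lborel) = ennreal ((norm (toL2 f))\<^sup>2)"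
  by (simp add: norm_toL2_sq nn_integral_eq_integral L2_integrable_square)

lemma L2I_nn_integral:
  assumes "f \<in> borel_measurable borel" "(\<integral>\<^sup>+x. ennreal ((f x)\<^sup>2) \<partial>lborel) < \<infinity>" shows "L2 f"
  unfolding L2_def
proof
  show "integrable lborel (\<lambda>x. (f x)\<^sup>2)" using assms by (intro integrableI_nonneg) simp_all
qed (use assms(1) in simp)

lemma fn_diff: "AE x in lborel. fn (u - v) x = fn u x - fn v x"
  using fn_toL2[OF L2_diff[OF L2_fn L2_fn]] by (simp add: toL2_diff L2_fn)

lemma fn_scaleR: "AE x in lborel. fn (c *\<^sub>R u) x = c * fn u x"
  using fn_toL2[OF L2_cmult[OF L2_fn]] by (simp add: toL2_cmult L2_fn)

lemma inner_fn: "inner u v = (\<integral>x. fn u x * fn v x \<partial>lborel)"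
  using inner_toL2[OF L2_fn L2_fn, of u v] by simp

lemma L2_nonneg_le_imp_norm_le:
  assumes "L2 f" "L2 g" "\<And>x. \<bar>f x\<bar> \<le> \<bar>g x\<bar>" shows "norm (toL2 f) \<le> norm (toL2 g)"
  unfolding norm_toL2[OF assms(1)] norm_toL2[OF assms(2)] L2_norm_def
proof (rule real_sqrt_le_mono, rule integral_mono)
  show "(f x)\<^sup>2 \<le> (g x)\<^sup>2" for x using assms(3)[of x] by (simp add: abs_le_square_iff)
qed (rule L2_integrable_square assms)+

section \<open>Completeness of L2\<close>

text \<open>The squared increments have integral at most 16^(-k), so even after the weight 4^k their
  sum is integrable and hence almost everywhere bounded by some C. Pointwise the increments are then
  at most sqrt C / 2^k and sum up.\<close>

lemma fast_Cauchy_AE_convergent: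
  fixes f :: "nat \<Rightarrow> 'a::euclidean_space \<Rightarrow> real"
  assumes f: "\<And>k. L2 (f k)" and d: "\<And>k. norm (toL2 (f (Suc k)) - toL2 (f k)) \<le> (1/4) ^ k"
  shows "AE x in lborel. convergent (\<lambda>k. f k x)"
proof -
  have [measurable]: "f k \<in> borel_measurable borel" for k using f by (simp add: L2_def)
  define g where "g k x = 4 ^ k * (f (Suc k) x - f k x)\<^sup>2" for k x
  have "(\<integral>\<^sup>+x. ennreal (g k x) \<partial>lborel) \<le> ennreal ((1/4) ^ k)" for k
  proof -
    have "(\<integral>\<^sup>+x. ennreal (g k x) \<partial>lborel) = 4 ^ k * ennreal ((norm (toL2 (f (Suc k)) - toL2 (f k)))\<^sup>2)"
      using nn_integral_square[OF L2_diff[OF f f], of "Suc k" k] unfolding g_def toL2_diff[OF f f, symmetric]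
      by (simp add: ennreal_mult' nn_integral_cmult ennreal_power[symmetric])
    also have "\<dots> \<le> 4 ^ k * ennreal (((1/4) ^ k)\<^sup>2)"
      using d[of k] by (intro mult_left_mono ennreal_leI power_mono) auto
    also have "4 ^ k * ennreal (((1/4) ^ k)\<^sup>2) = ennreal (4 ^ k * ((1/4) ^ k)\<^sup>2)"
      by (simp add: ennreal_mult' ennreal_power[symmetric])
    also have "4 ^ k * ((1/4) ^ k)\<^sup>2 = (1/4 :: real) ^ k"
      by (simp add: power2_eq_square power_divide)
    finally show ?thesis .
  qed
  then have "(\<Sum>k. \<integral>\<^sup>+x. ennreal (g k x) \<partial>lborel) \<le> (\<Sum>k. ennreal ((1/4) ^ k))"
    by (intro suminf_le) auto
  also have "\<dots> = ennreal (\<Sum>k. (1/4) ^ k)" by (intro suminf_ennreal2) auto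
  also have "\<dots> < \<infinity>" by simp
  finally have "(\<integral>\<^sup>+x. (\<Sum>k. ennreal (g k x)) \<partial>lborel) < \<infinity>"
    by (subst nn_integral_suminf) (auto simp: g_def)
  then have "AE x in lborel. (\<Sum>k. ennreal (g k x)) \<noteq> \<infinity>"
    by (intro nn_integral_PInf_AE) (auto simp: g_def)
  then show ?thesis
  proof eventually_elim
    case (elim x)
    then obtain C where C: "C \<ge> 0" "(\<Sum>k. ennreal (g k x)) = ennreal C" by (cases "\<Sum>k. ennreal (g k x)") auto
    have le: "\<bar>f (Suc k) x - f k x\<bar> \<le> sqrt C * (1/2) ^ k" for k
    proof -
      have "ennreal (g k x) \<le> ennreal C"
        unfolding C(2)[symmetric] using sum_le_suminf[of "\<lambda>k. ennreal (g k x)" "{k}"] by simp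
      then have "4 ^ k * (f (Suc k) x - f k x)\<^sup>2 \<le> C" using C(1) by (simp add: g_def)
      then have "(f (Suc k) x - f k x)\<^sup>2 \<le> C * (1/4) ^ k" by (simp add: power_divide field_simps)
      also have "(1/4 :: real) ^ k = ((1/2) ^ k)\<^sup>2"
        unfolding power2_eq_square power_mult_distrib[symmetric] by simp
      also have "C * ((1/2) ^ k)\<^sup>2 = (sqrt C * (1/2) ^ k)\<^sup>2"
        using C(1) unfolding power_mult_distrib by simp
      finally show ?thesis using C(1) by (simp add: abs_le_square_iff[symmetric])
    qed
    have "summable (\<lambda>k. sqrt C * (1/2) ^ k)" by (intro summable_mult summable_geometric) auto
    then have "summable (\<lambda>k. f (Suc k) x - f k x)"
      by (rule summable_comparison_test'[where N = 0]) (use le in simp)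
    then have "convergent (\<lambda>n. (\<Sum>k<n. f (Suc k) x - f k x) + f 0 x)"
      unfolding summable_iff_convergent by (intro convergent_add convergent_const)
    then show ?case by (simp add: sum_lessThan_telescope[of "\<lambda>k. f k x"])
  qed
qed

text \<open>Riesz-Fischer: a fast subsequence converges almost everywhere, and Fatou's lemma applied
  to its differences turns the pointwise limit into a limit in norm.\<close>

instance l2 :: (euclidean_space) banach
proof
  fix X :: "nat \<Rightarrow> 'a l2" assume X: "Cauchy X"
  have "\<exists>r. strict_mono r \<and> (\<forall>k. \<forall>m\<ge>r k. norm (X m - X (r k)) \<le> (1/4) ^ k)"
  proof -
    have "\<exists>N. \<forall>m\<ge>N. \<forall>n\<ge>N. norm (X m - X n) < (1/4) ^ k" for k
      using CauchyD[OF X, of "(1/4) ^ k"] by simp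
    then obtain N where N: "\<And>k m n. m \<ge> N k \<Longrightarrow> n \<ge> N k \<Longrightarrow> norm (X m - X n) < (1/4) ^ k" by metis
    define r where "r = rec_nat (N 0) (\<lambda>k s. max (Suc s) (N (Suc k)))"
    have r: "r 0 = N 0" "r (Suc k) = max (Suc (r k)) (N (Suc k))" for k by (simp_all add: r_def)
    have rN: "r k \<ge> N k" for k by (cases k) (auto simp: r)
    have "norm (X m - X (r k)) \<le> (1/4) ^ k" if "m \<ge> r k" for m k
      using N[of k m "r k"] rN[of k] that by simp
    then show ?thesis
      by (intro exI[of _ r] conjI strict_mono_Suc_iff[THEN iffD2]) (auto simp: r)
  qed
  then obtain r where r: "strict_mono r" "\<And>k m. m \<ge> r k \<Longrightarrow> norm (X m - X (r k)) \<le> (1/4) ^ k" by blast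
  define f where "f k = fn (X (r k))" for k
  have f: "L2 (f k)" "toL2 (f k) = X (r k)" for k by (simp_all add: f_def L2_fn)
  have [measurable]: "f k \<in> borel_measurable borel" for k using f by (simp add: L2_def)
  have conv: "AE x in lborel. convergent (\<lambda>k. f k x)"
  proof (rule fast_Cauchy_AE_convergent[OF f(1)])
    show "norm (toL2 (f (Suc k)) - toL2 (f k)) \<le> (1/4) ^ k" for k
      unfolding f(2) by (rule r(2)) (rule strict_mono_leD[OF r(1)], simp)
  qed
  define F where "F x = lim (\<lambda>k. f k x)" for x
  have [measurable]: "F \<in> borel_measurable borel" unfolding F_def by measurable
  have est: "(\<integral>\<^sup>+x. ennreal ((F x - f k x)\<^sup>2) \<partial>lborel) \<le> ennreal (((1/4) ^ k)\<^sup>2)" for k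
  proof -
    have "(\<integral>\<^sup>+x. ennreal ((F x - f k x)\<^sup>2) \<partial>lborel) = (\<integral>\<^sup>+x. liminf (\<lambda>m. ennreal ((f m x - f k x)\<^sup>2)) \<partial>lborel)"
    proof (rule nn_integral_cong_AE)
      show "AE x in lborel. ennreal ((F x - f k x)\<^sup>2) = liminf (\<lambda>m. ennreal ((f m x - f k x)\<^sup>2))"
        using conv
      proof eventually_elim
        case (elim x)
        then have "(\<lambda>m. f m x) \<longlonglongrightarrow> F x" by (simp add: F_def convergent_LIMSEQ_iff)
        then have "(\<lambda>m. ennreal ((f m x - f k x)\<^sup>2)) \<longlonglongrightarrow> ennreal ((F x - f k x)\<^sup>2)"
          by (intro tendsto_ennrealI tendsto_intros)
        from lim_imp_Liminf[OF _ this] show ?case by simp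
      qed
    qed
    also have "\<dots> \<le> liminf (\<lambda>m. \<integral>\<^sup>+x. ennreal ((f m x - f k x)\<^sup>2) \<partial>lborel)"
      by (rule nn_integral_liminf) auto
    also have "\<dots> \<le> limsup (\<lambda>m. \<integral>\<^sup>+x. ennreal ((f m x - f k x)\<^sup>2) \<partial>lborel)"
      by (rule Liminf_le_Limsup) simp
    also have "\<dots> \<le> ennreal (((1/4) ^ k)\<^sup>2)"
    proof (rule Limsup_bounded)
      show "\<forall>\<^sub>F m in sequentially. (\<integral>\<^sup>+x. ennreal ((f m x - f k x)\<^sup>2) \<partial>lborel) \<le> ennreal (((1/4) ^ k)\<^sup>2)"
        using eventually_ge_at_top[of k]
      proof eventually_elim
        case (elim m)
        then have "norm (X (r m) - X (r k)) \<le> (1/4) ^ k"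
            by (intro r(2) strict_mono_leD[OF r(1)])
        then show ?case
          by (subst nn_integral_square[OF L2_diff[OF f(1) f(1)]])
            (simp add: toL2_diff f power_mono del: power_divide power_one)
      qed
    qed
    finally show ?thesis .
  qed
  have Fd: "L2 (\<lambda>x. F x - f k x)" for k
    by (rule L2I_nn_integral) (use le_less_trans[OF est ennreal_less_top] in simp_all)
  have F: "L2 F" using L2_add[OF Fd f(1), of 0 0] by simp
  have "norm (toL2 F - X (r k)) \<le> (1/4) ^ k" for k
  proof -
    have "ennreal ((norm (toL2 (\<lambda>x. F x - f k x)))\<^sup>2) \<le> ennreal (((1/4) ^ k)\<^sup>2)"
      using est[of k] by (simp add: nn_integral_square Fd del: power_divide power_one)
    then have "(norm (toL2 (\<lambda>x. F x - f k x)))\<^sup>2 \<le> ((1/4) ^ k)\<^sup>2"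
      by (subst (asm) ennreal_le_iff) auto
    then have "norm (toL2 (\<lambda>x. F x - f k x)) \<le> (1/4) ^ k" by (rule power2_le_imp_le) simp
    then show ?thesis by (simp add: toL2_diff F f)
  qed
  then have "(\<lambda>k. toL2 F - X (r k)) \<longlonglongrightarrow> 0"
    by (intro Lim_null_comparison[OF always_eventually LIMSEQ_power_zero[of "1/4"]]) simp_all
  from tendsto_diff[OF tendsto_const this, of "toL2 F"]
  have "(\<lambda>k. X (r k)) \<longlonglongrightarrow> toL2 F" by simp
  then have "X \<longlonglongrightarrow> toL2 F" by (intro Cauchy_converges_subseq[OF X r(1)]) (simp add: o_def)
  then show "convergent X" by (rule convergentI)
qed

lemma L2_indicator:
  assumes "A \<in> sets borel" "emeasure lborel A < \<infinity>" shows "L2 (indicator A)"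
proof -
  have "(\<lambda>x. (indicator A x :: real)\<^sup>2) = indicator A" by (auto simp: indicator_def)
  then show ?thesis using assms by (simp add: L2_def)
qed

text \<open>The identity operator has norm 1 only on a nontrivial space; this class expresses that
  for the algebra of bounded operators used for the exponentials.\<close>

instance l2 :: (euclidean_space) perfect_space
proof
  fix u :: "'a l2"
  define v :: "'a l2" where "v = toL2 (indicator (cbox 0 One))"
  have "emeasure lborel (cbox 0 One :: 'a set) = 1"
    by (subst emeasure_lborel_cbox) simp_all
  then have "L2 (indicator (cbox 0 One) :: 'a \<Rightarrow> real)" "measure lborel (cbox 0 One :: 'a set) = 1"
    by (simp_all add: L2_indicator measure_def)
  moreover have "(\<lambda>x::'a. (indicator (cbox 0 One) x :: real)\<^sup>2) = indicator (cbox 0 One)"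
    by (auto simp: indicator_def)
  ultimately have "(norm v)\<^sup>2 = 1" unfolding v_def by (simp add: norm_toL2_sq)
  then have v: "norm v \<noteq> 0" by (metis zero_neq_one zero_power2)
  show "\<not> open {u}"
  proof
    assume "open {u}"
    then obtain e where e: "e > 0" "ball u e \<subseteq> {u}" by (meson openE singletonI)
    have "dist u (u + (e / 2 / norm v) *\<^sub>R v) = e / 2" using e(1) v by (simp add: dist_norm)
    then have "u + (e / 2 / norm v) *\<^sub>R v \<in> ball u e" using e(1) unfolding mem_ball by linarith
    then have "u + (e / 2 / norm v) *\<^sub>R v = u" using e(2) by blast
    then show False using e(1) v by simp
  qed
qed

lemma toL2_eqI: "AE x in lborel. f x = g x \<Longrightarrow> L2 f \<Longrightarrow> L2 g \<Longrightarrow> toL2 f = toL2 g"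
  by (simp add: toL2_eq_iff)

lemma test_fun_continuous: "test_fun UNIV \<phi> \<Longrightarrow> continuous_on UNIV \<phi>"
  by (simp add: test_fun_def smooth_fun_continuous)

lemma test_fun_measurable: "test_fun UNIV \<phi> \<Longrightarrow> \<phi> \<in> borel_measurable borel"
  by (rule borel_measurable_continuous_onI[OF test_fun_continuous])

lemma bounded_support_L2:
  fixes f :: "'a::euclidean_space \<Rightarrow> real"
  assumes [measurable]: "f \<in> borel_measurable borel"
    and b: "\<And>x. \<bar>f x\<bar> \<le> M" and s: "\<And>x. f x \<noteq> 0 \<Longrightarrow> norm x \<le> R"
  shows "L2 f" and "integrable lborel f"
    and "(norm (toL2 f))\<^sup>2 \<le> M\<^sup>2 * measure lborel (cball 0 R :: 'a set)"
proof -
  have M: "M \<ge> 0" using b[of 0] by linarith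
  have fin: "emeasure lborel (cball 0 R :: 'a set) < \<infinity>"
    by (rule emeasure_lborel_cball_finite)
  have int: "integrable lborel (indicator (cball 0 R) :: 'a \<Rightarrow> real)" using fin by simp
  have le: "\<bar>f x\<bar> \<le> M * indicator (cball 0 R) x" for x
    using b[of x] s[of x] by (cases "f x = 0") (auto simp: indicator_def M)
  have L2i: "L2 (\<lambda>x::'a. M * indicator (cball 0 R) x)" by (intro L2_cmult L2_indicator fin) simp
  show L2f: "L2 f"
    by (rule L2_bound[OF L2i]) (use order_trans[OF le abs_ge_self] in simp_all)
  show "integrable lborel f"
    by (rule Bochner_Integration.integrable_bound[of lborel "\<lambda>x. M * indicator (cball 0 R) x"])
      (use int le M in \<open>auto simp: abs_mult intro!: AE_I2\<close>)
  have sq: "(f x)\<^sup>2 \<le> M\<^sup>2 * indicator (cball 0 R) x" for x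
    using power_mono[OF le[of x], of 2] by (cases "norm x \<le> R") (simp_all add: power_mult_distrib)
  have "(norm (toL2 f))\<^sup>2 = (\<integral>x. (f x)\<^sup>2 \<partial>lborel)" by (rule norm_toL2_sq[OF L2f])
  also have "\<dots> \<le> (\<integral>x. M\<^sup>2 * indicator (cball 0 R) x \<partial>(lborel :: 'a measure))"
    by (rule integral_mono) (use sq int L2_integrable_square[OF L2f] in simp_all)
  finally show "(norm (toL2 f))\<^sup>2 \<le> M\<^sup>2 * measure lborel (cball 0 R :: 'a set)" by simp
qed

lemma test_fun_L2_integrable:
  assumes "test_fun UNIV \<phi>" shows test_fun_L2: "L2 \<phi>" and test_fun_integrable: "integrable lborel \<phi>"
proof -
  obtain M where "\<And>x. \<bar>\<phi> x\<bar> \<le> M" using test_fun_bounded[OF assms] by metis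
  moreover obtain R where "\<And>x. \<phi> x \<noteq> 0 \<Longrightarrow> norm x \<le> R" using assms unfolding test_fun_UNIV_iff by metis
  ultimately show "L2 \<phi>" "integrable lborel \<phi>"
    using bounded_support_L2[OF test_fun_measurable[OF assms], of M R] by blast+
qed

lemma toL2_dominated_convergence:
  assumes s: "\<And>n. s n \<in> borel_measurable borel" and f: "f \<in> borel_measurable borel" and w: "L2 w"
    and bd: "\<And>n. AE x in lborel. \<bar>s n x\<bar> \<le> \<bar>w x\<bar>" and lim: "AE x in lborel. (\<lambda>n. s n x) \<longlonglongrightarrow> f x"
  shows "L2 f" and "\<And>n. L2 (s n)" and "(\<lambda>n. toL2 (s n)) \<longlonglongrightarrow> toL2 f"
proof -
  have AEall: "AE x in lborel. \<forall>n. \<bar>s n x\<bar> \<le> \<bar>w x\<bar>" using bd by (simp add: AE_all_countable)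
  have fw: "AE x in lborel. \<bar>f x\<bar> \<le> \<bar>w x\<bar>"
    using lim AEall
  proof eventually_elim
    case (elim x)
    have "(\<lambda>n. \<bar>s n x\<bar>) \<longlonglongrightarrow> \<bar>f x\<bar>" by (rule tendsto_rabs[OF elim(1)])
    then show ?case by (rule LIMSEQ_le_const2) (use elim(2) in blast)
  qed
  have w2: "integrable lborel (\<lambda>x. (w x)\<^sup>2)" by (rule L2_integrable_square[OF w])
  have L2_AE_bound: "L2 h" if h: "h \<in> borel_measurable borel" "AE x in lborel. \<bar>h x\<bar> \<le> \<bar>w x\<bar>" for h
  proof -
    have "AE x in lborel. norm ((h x)\<^sup>2) \<le> norm ((w x)\<^sup>2)"
      using h(2) by eventually_elim (simp add: abs_le_square_iff)
    then have "integrable lborel (\<lambda>x. (h x)\<^sup>2)"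
      by (rule Bochner_Integration.integrable_bound[OF w2, rotated]) (use h(1) in simp)
    then show ?thesis using h(1) by (simp add: L2_def)
  qed
  show L2f: "L2 f" by (rule L2_AE_bound[OF f fw])
  show L2s: "L2 (s n)" for n by (rule L2_AE_bound[OF s bd])
  have "(\<lambda>n. \<integral>x. (s n x - f x)\<^sup>2 \<partial>lborel) \<longlonglongrightarrow> (\<integral>x. 0 \<partial>(lborel :: 'a measure))"
  proof (rule integral_dominated_convergence[where w = "\<lambda>x. 4 * (w x)\<^sup>2"])
    show "AE x in lborel. (\<lambda>n. (s n x - f x)\<^sup>2) \<longlonglongrightarrow> 0"
      using lim
    proof eventually_elim
      case (elim x)
      have "(\<lambda>n. (s n x - f x)\<^sup>2) \<longlonglongrightarrow> (f x - f x)\<^sup>2" by (intro tendsto_intros elim)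
      then show ?case by simp
    qed
    show "AE x in lborel. norm ((s n x - f x)\<^sup>2) \<le> 4 * (w x)\<^sup>2" for n
      using bd[of n] fw
    proof eventually_elim
      case (elim x)
      then have "\<bar>s n x - f x\<bar> \<le> \<bar>2 * w x\<bar>" by linarith
      then have "(s n x - f x)\<^sup>2 \<le> (2 * w x)\<^sup>2" by (simp only: abs_le_square_iff)
      then show ?case by (simp add: power_mult_distrib)
    qed
  qed (use s f w2 in simp_all)
  then have "(\<lambda>n. (norm (toL2 (s n) - toL2 f))\<^sup>2) \<longlonglongrightarrow> 0"
    by (simp add: norm_toL2_sq L2_diff L2s L2f toL2_diff[symmetric])
  from tendsto_real_sqrt[OF this] have "(\<lambda>n. norm (toL2 (s n) - toL2 f)) \<longlonglongrightarrow> 0" by simp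
  then show "(\<lambda>n. toL2 (s n)) \<longlonglongrightarrow> toL2 f" by (simp add: LIM_zero_iff tendsto_norm_zero_iff)
qed

section \<open>Mollification and weak derivatives\<close>

lemma distr_lborel_reflect: "distr lborel borel (\<lambda>x. a - x) = (lborel :: 'a::euclidean_space measure)"
  using lborel_affine[of "-1" a] by (simp add: density_1)

lemma distr_lborel_translate: "distr lborel borel (\<lambda>x. x + a) = (lborel :: 'a::euclidean_space measure)"
  using lborel_distr_plus[of a] unfolding add.commute[of a] .

lemma integral_lborel_reflect:
  fixes f :: "'a::euclidean_space \<Rightarrow> real"
  assumes "f \<in> borel_measurable borel"
  shows "(\<integral>x. f (a - x) \<partial>lborel) = (\<integral>x. f x \<partial>lborel)" "integrable lborel (\<lambda>x. f (a - x)) = integrable lborel f"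
  using integral_distr[of "\<lambda>x. a - x" lborel borel f] integrable_distr_eq[of "\<lambda>x. a - x" lborel borel f] assms
  by (simp_all add: distr_lborel_reflect)

lemma integral_lborel_translate:
  fixes f :: "'a::euclidean_space \<Rightarrow> real"
  assumes "f \<in> borel_measurable borel"
  shows "(\<integral>x. f (x + a) \<partial>lborel) = (\<integral>x. f x \<partial>lborel)" "integrable lborel (\<lambda>x. f (x + a)) = integrable lborel f"
  using integral_distr[of "\<lambda>x. x + a" lborel borel f] integrable_distr_eq[of "\<lambda>x. x + a" lborel borel f] assms
  by (simp_all add: distr_lborel_translate)

lemma AE_lborel_translate:
  assumes "AE x in lborel. P x" shows "AE x in (lborel :: 'a::euclidean_space measure). P (x + a)"
proof -
  have m: "(\<lambda>x. x + a) \<in> measurable lborel borel" by simp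
  have "AE x in distr lborel borel (\<lambda>x. x + a). P x" unfolding distr_lborel_translate by (rule assms)
  then show ?thesis by (rule AE_distrD[OF m])
qed

section \<open>Convolution with mollifiers\<close>

definition mollifier :: "real \<Rightarrow> ('a::euclidean_space \<Rightarrow> real) \<Rightarrow> bool" where
  "mollifier r \<rho> \<longleftrightarrow> test_fun UNIV \<rho> \<and> (\<forall>x. \<rho> x \<ge> 0) \<and> (\<forall>x. \<rho> x \<noteq> 0 \<longrightarrow> norm x \<le> r) \<and> (\<integral>x. \<rho> x \<partial>lborel) = 1"

lemma ex_mollifier: assumes "r > 0" obtains \<rho> :: "'a::euclidean_space \<Rightarrow> real" where "mollifier r \<rho>"
proof -
  obtain \<eta> :: "'a \<Rightarrow> real" where \<eta>: "test_fun UNIV \<eta>" "\<And>x. \<eta> x \<ge> 0" "\<eta> 0 > 0" "\<And>x. \<eta> x \<noteq> 0 \<Longrightarrow> norm x \<le> r"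
    using ex_bump[OF assms] by blast
  define c where "c = (\<integral>x. \<eta> x \<partial>lborel)"
  have "c \<noteq> 0"
  proof
    assume "c = 0"
    then have "AE x in lborel. \<eta> x = 0"
      unfolding c_def using integral_nonneg_eq_0_iff_AE[OF test_fun_integrable[OF \<eta>(1)]] \<eta>(2) by simp
    then have "AE x in lborel. x \<notin> {x. \<eta> x > 0}" by eventually_elim simp
    moreover have op: "open {x. \<eta> x > 0}"
      by (intro open_Collect_less test_fun_continuous[OF \<eta>(1)] continuous_on_const)
    ultimately have "{x. \<eta> x > 0} \<in> null_sets lborel" by (subst AE_iff_null_sets) simp_all
    then have "negligible {x. \<eta> x > 0}" by (simp add: negligible_iff_null_sets null_sets_completionI)
    then show False using open_not_negligible[OF op] \<eta>(3) by blast
  qed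
  moreover have "c \<ge> 0" unfolding c_def by (rule Bochner_Integration.integral_nonneg) (rule \<eta>(2))
  ultimately have c: "c > 0" by simp
  have "mollifier r (\<lambda>x. (1 / c) * \<eta> x)" unfolding mollifier_def
  proof (intro conjI allI impI)
    show "(\<integral>x. (1 / c) * \<eta> x \<partial>lborel) = 1" using c by (simp add: c_def)
  qed (use \<eta> c test_fun_cmult[OF \<eta>(1), of "1 / c"] in auto)
  then show thesis by (rule that)
qed

definition conv :: "('a::euclidean_space \<Rightarrow> real) \<Rightarrow> ('a \<Rightarrow> real) \<Rightarrow> 'a \<Rightarrow> real" where
  "conv \<rho> f x = (\<integral>y. \<rho> (x - y) * f y \<partial>lborel)"

lemma conv_integrable:
  assumes "test_fun UNIV \<rho>" "integrable lborel f" shows "integrable lborel (\<lambda>y. \<rho> (x - y) * f y)"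
proof -
  have [measurable]: "\<rho> \<in> borel_measurable borel" "f \<in> borel_measurable borel"
    using test_fun_measurable[OF assms(1)] assms(2) by auto
  obtain M where M: "M \<ge> 0" "\<And>x. \<bar>\<rho> x\<bar> \<le> M" using test_fun_bounded[OF assms(1)] by metis
  show ?thesis
  proof (rule Bochner_Integration.integrable_bound[of lborel "\<lambda>y. M * f y"])
    show "AE y in lborel. norm (\<rho> (x - y) * f y) \<le> norm (M * f y)"
      by (intro AE_I2) (use M in \<open>simp add: abs_mult mult_right_mono\<close>)
  qed (use assms in simp_all)
qed

lemma abs_integral_le:
  fixes f :: "'a \<Rightarrow> real" shows "\<bar>integral\<^sup>L M f\<bar> \<le> (\<integral>x. \<bar>f x\<bar> \<partial>M)"
  using integral_norm_bound[of M f] by simp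

lemma conv_diff_le:
  fixes k f :: "'a::euclidean_space \<Rightarrow> real"
  assumes "\<And>y. \<bar>k y\<bar> \<le> e" "integrable lborel f" "integrable lborel (\<lambda>y. k y * f y)"
  shows "\<bar>\<integral>y. k y * f y \<partial>lborel\<bar> \<le> e * (\<integral>y. \<bar>f y\<bar> \<partial>lborel)"
proof -
  have "\<bar>\<integral>y. k y * f y \<partial>lborel\<bar> \<le> (\<integral>y. \<bar>k y * f y\<bar> \<partial>lborel)" by (rule abs_integral_le)
  also have "\<dots> \<le> (\<integral>y. e * \<bar>f y\<bar> \<partial>lborel)"
  proof (rule integral_mono)
    show "\<bar>k y * f y\<bar> \<le> e * \<bar>f y\<bar>" for y using assms(1)[of y] by (simp add: abs_mult mult_right_mono)
  qed (use assms in simp_all)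
  finally show ?thesis by simp
qed

lemma conv_DERIV:
  assumes \<rho>: "test_fun UNIV \<rho>" and f: "integrable lborel f" and b: "b \<in> Basis"
  shows "((\<lambda>h. conv \<rho> f (x + h *\<^sub>R b)) has_real_derivative conv (pd b \<rho>) f x) (at 0)"
proof -
  \<comment> \<open>The summand 1 keeps the divisor positive when f vanishes almost everywhere and
    makes the last estimate strict.\<close>
  define I where "I = (\<integral>y. \<bar>f y\<bar> \<partial>lborel) + 1"
  have I: "I > 0" unfolding I_def by (rule add_nonneg_pos, rule Bochner_Integration.integral_nonneg) simp_all
  have "(\<lambda>h. (conv \<rho> f (x + h *\<^sub>R b) - conv \<rho> f x) / h) \<midarrow>0\<rightarrow> conv (pd b \<rho>) f x"
  proof (rule LIM_I)
    fix r :: real assume r: "r > 0"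
    then have e: "r / I > 0" using I by simp
    obtain d where d: "d > 0"
      "\<And>x h. 0 < \<bar>h\<bar> \<Longrightarrow> \<bar>h\<bar> < d \<Longrightarrow> \<bar>(\<rho> (x + h *\<^sub>R b) - \<rho> x) / h - pd b \<rho> x\<bar> \<le> r / I"
      using test_fun_difference_quotient[OF \<rho> b e] by metis
    show "\<exists>s>0. \<forall>h. h \<noteq> 0 \<and> norm (h - 0) < s \<longrightarrow>
      norm ((conv \<rho> f (x + h *\<^sub>R b) - conv \<rho> f x) / h - conv (pd b \<rho>) f x) < r"
    proof (intro exI[of _ d] conjI d(1) allI impI)
      fix h :: real assume "h \<noteq> 0 \<and> norm (h - 0) < d"
      then have h: "0 < \<bar>h\<bar>" "\<bar>h\<bar> < d" by auto
      define k where "k y = (\<rho> ((x - y) + h *\<^sub>R b) - \<rho> (x - y)) / h - pd b \<rho> (x - y)" for y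
      have int: "integrable lborel (\<lambda>y. \<rho> ((x + h *\<^sub>R b) - y) * f y)" "integrable lborel (\<lambda>y. \<rho> (x - y) * f y)"
        "integrable lborel (\<lambda>y. pd b \<rho> (x - y) * f y)"
        by (intro conv_integrable \<rho> f test_fun_pd b)+
      have k: "(\<lambda>y. k y * f y) = (\<lambda>y. (\<rho> ((x + h *\<^sub>R b) - y) * f y - \<rho> (x - y) * f y) / h - pd b \<rho> (x - y) * f y)"
        by (auto simp: k_def field_simps)
      have "(conv \<rho> f (x + h *\<^sub>R b) - conv \<rho> f x) / h - conv (pd b \<rho>) f x = (\<integral>y. k y * f y \<partial>lborel)"
        unfolding conv_def k using int by simp
      moreover have "\<bar>\<integral>y. k y * f y \<partial>lborel\<bar> \<le> r / I * (\<integral>y. \<bar>f y\<bar> \<partial>lborel)"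
      proof (rule conv_diff_le[OF _ f])
        show "\<bar>k y\<bar> \<le> r / I" for y unfolding k_def by (rule d(2)[OF h])
        show "integrable lborel (\<lambda>y. k y * f y)" unfolding k using int by simp
      qed
      moreover have "r / I * (\<integral>y. \<bar>f y\<bar> \<partial>lborel) < r / I * I"
        by (rule mult_strict_left_mono) (use e in \<open>simp_all add: I_def\<close>)
      ultimately show "norm ((conv \<rho> f (x + h *\<^sub>R b) - conv \<rho> f x) / h - conv (pd b \<rho>) f x) < r"
        using I by simp
    qed
  qed
  then show ?thesis by (simp add: DERIV_def)
qed

lemma conv_continuous:
  assumes \<rho>: "test_fun UNIV \<rho>" and f: "integrable lborel f"
  shows "continuous_on UNIV (conv \<rho> f)"
proof (rule continuous_onI)
  fix x e :: "'a" and r :: real assume r: "r > 0"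
  define I where "I = (\<integral>y. \<bar>f y\<bar> \<partial>lborel) + 1"
  have I: "I > 0" unfolding I_def by (rule add_nonneg_pos, rule Bochner_Integration.integral_nonneg) simp_all
  have e: "r / I > 0" using r I by simp
  obtain d where d: "d > 0" "\<And>x y. dist y x < d \<Longrightarrow> dist (\<rho> y) (\<rho> x) < r / I"
    using test_fun_uniformly_continuous[OF \<rho>] e unfolding uniformly_continuous_on_def by auto
  show "\<exists>d>0. \<forall>x'\<in>UNIV. dist x' x < d \<longrightarrow> dist (conv \<rho> f x') (conv \<rho> f x) \<le> r"
  proof (intro exI[of _ d] conjI d(1) ballI impI)
    fix x' assume x': "dist x' x < d"
    have int: "integrable lborel (\<lambda>y. \<rho> (x' - y) * f y)" "integrable lborel (\<lambda>y. \<rho> (x - y) * f y)"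
      by (intro conv_integrable \<rho> f)+
    have eq: "(\<lambda>y. (\<rho> (x' - y) - \<rho> (x - y)) * f y) = (\<lambda>y. \<rho> (x' - y) * f y - \<rho> (x - y) * f y)"
      by (simp add: algebra_simps)
    have "\<bar>\<integral>y. (\<rho> (x' - y) - \<rho> (x - y)) * f y \<partial>lborel\<bar> \<le> r / I * (\<integral>y. \<bar>f y\<bar> \<partial>lborel)"
    proof (rule conv_diff_le[OF _ f])
      show "\<bar>\<rho> (x' - y) - \<rho> (x - y)\<bar> \<le> r / I" for y
        using d(2)[of "x' - y" "x - y"] x' by (simp add: dist_norm)
    qed (use int in \<open>simp add: eq\<close>)
    also have "\<dots> \<le> r / I * I" by (rule mult_left_mono) (use e in \<open>simp_all add: I_def\<close>)
    also have "(\<integral>y. (\<rho> (x' - y) - \<rho> (x - y)) * f y \<partial>lborel) = conv \<rho> f x' - conv \<rho> f x"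
      unfolding eq conv_def using int by simp
    finally show "dist (conv \<rho> f x') (conv \<rho> f x) \<le> r" using I by (simp add: dist_real_def)
  qed
qed

lemma pd_conv:
  assumes "test_fun UNIV \<rho>" "integrable lborel f" "b \<in> Basis"
  shows "pd b (conv \<rho> f) = conv (pd b \<rho>) f"
  using conv_DERIV[OF assms] by (intro ext pd_eqI)

lemma smooth_fun_conv:
  assumes "test_fun UNIV \<rho>" "integrable lborel f" shows "smooth_fun (conv \<rho> f)"
proof (rule smooth_fun_coinduct[where K = "{conv \<rho> f | \<rho>. test_fun UNIV \<rho>}"])
  fix g assume "g \<in> {conv \<rho> f | \<rho>. test_fun UNIV \<rho>}"
  then obtain \<rho> where g: "g = conv \<rho> f" "test_fun UNIV \<rho>" by blast
  show "continuous_on UNIV g" unfolding g(1) by (rule conv_continuous[OF g(2) assms(2)])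
  fix b :: 'a assume b: "b \<in> Basis"
  show "\<exists>f'\<in>{conv \<rho> f | \<rho>. test_fun UNIV \<rho>}. \<forall>x. ((\<lambda>h. g (x + h *\<^sub>R b)) has_real_derivative f' x) (at 0)"
    using conv_DERIV[OF g(2) assms(2) b] test_fun_pd[OF g(2) b] unfolding g(1) by blast
qed (use assms in blast)

lemma conv_support:
  assumes "\<And>x. \<rho> x \<noteq> 0 \<Longrightarrow> norm x \<le> r" "\<And>x. f x \<noteq> 0 \<Longrightarrow> norm x \<le> R" "conv \<rho> f x \<noteq> 0"
  shows "norm x \<le> R + r"
proof (rule ccontr)
  assume *: "\<not> norm x \<le> R + r"
  have "\<rho> (x - y) * f y = 0" for y
  proof (rule ccontr)
    assume "\<rho> (x - y) * f y \<noteq> 0"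
    then have "norm (x - y) \<le> r" "norm y \<le> R" using assms(1)[of "x - y"] assms(2)[of y] by auto
    then show False using * norm_triangle_ineq[of "x - y" y] by simp
  qed
  then have "(\<lambda>y. \<rho> (x - y) * f y) = (\<lambda>y. 0)" by (rule ext)
  then show False using assms(3) unfolding conv_def by simp
qed

lemma test_fun_conv:
  assumes \<rho>: "test_fun UNIV \<rho>" and f: "integrable lborel f" and s: "\<And>x. f x \<noteq> 0 \<Longrightarrow> norm x \<le> R"
  shows "test_fun UNIV (conv \<rho> f)"
proof -
  obtain r where "\<And>x. \<rho> x \<noteq> 0 \<Longrightarrow> norm x \<le> r" using \<rho> unfolding test_fun_UNIV_iff by blast
  from conv_support[OF this s] show ?thesis
    using smooth_fun_conv[OF \<rho> f] unfolding test_fun_UNIV_iff by blast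
qed

text \<open>Young's inequality for \<open>L\<^sup>2\<close>: Jensen for the probability density \<open>\<rho> (x - y) dy\<close>, then Tonelli.\<close>

lemma norm_conv_le:
  assumes \<rho>: "mollifier r \<rho>" and f: "integrable lborel f" "L2 f"
  shows "L2 (conv \<rho> f)" "norm (toL2 (conv \<rho> f)) \<le> norm (toL2 f)"
proof -
  have t: "test_fun UNIV \<rho>" and nn: "\<And>x. \<rho> x \<ge> 0" and one: "(\<integral>x. \<rho> x \<partial>lborel) = 1"
    using \<rho> by (auto simp: mollifier_def)
  have [measurable]: "\<rho> \<in> borel_measurable borel" "f \<in> borel_measurable borel"
    using test_fun_measurable[OF t] L2_measurable[OF f(2)] by auto
  have [measurable]: "conv \<rho> f \<in> borel_measurable borel"
    by (rule borel_measurable_continuous_onI[OF conv_continuous[OF t f(1)]])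
  have jensen: "ennreal ((conv \<rho> f x)\<^sup>2) \<le> (\<integral>\<^sup>+y. ennreal (\<rho> (x - y) * (f y)\<^sup>2) \<partial>lborel)" for x
  proof -
    define c where "c = conv \<rho> f x"
    have i0: "integrable lborel (\<lambda>y. \<rho> (x - y))" "(\<integral>y. \<rho> (x - y) \<partial>lborel) = 1"
      using integral_lborel_reflect[of \<rho> x] test_fun_integrable[OF t] one by simp_all
    have i1: "integrable lborel (\<lambda>y. \<rho> (x - y) * f y)" by (rule conv_integrable[OF t f(1)])
    have i2: "integrable lborel (\<lambda>y. \<rho> (x - y) * (f y)\<^sup>2)"
      by (rule conv_integrable[OF t L2_integrable_square[OF f(2)]])
    \<comment> \<open>The variance of f under the density \<rho>(x - y), expanded around its mean c,
      is nonnegative.\<close>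
    have "0 \<le> (\<integral>y. \<rho> (x - y) * (f y - c)\<^sup>2 \<partial>lborel)" by (rule Bochner_Integration.integral_nonneg) (simp add: nn)
    also have "(\<lambda>y. \<rho> (x - y) * (f y - c)\<^sup>2) = (\<lambda>y. \<rho> (x - y) * (f y)\<^sup>2 - 2 * c * (\<rho> (x - y) * f y) + c\<^sup>2 * \<rho> (x - y))"
      by (simp add: power2_eq_square algebra_simps)
    also have "(\<integral>y. \<rho> (x - y) * (f y)\<^sup>2 - 2 * c * (\<rho> (x - y) * f y) + c\<^sup>2 * \<rho> (x - y) \<partial>lborel)
      = (\<integral>y. \<rho> (x - y) * (f y)\<^sup>2 \<partial>lborel) - 2 * c * c + c\<^sup>2"
      using i0 i1 i2 by (simp add: c_def conv_def)
    finally have "c\<^sup>2 \<le> (\<integral>y. \<rho> (x - y) * (f y)\<^sup>2 \<partial>lborel)" by (simp add: power2_eq_square)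
    then have "ennreal (c\<^sup>2) \<le> ennreal (\<integral>y. \<rho> (x - y) * (f y)\<^sup>2 \<partial>lborel)" by (rule ennreal_leI)
    also have "\<dots> = (\<integral>\<^sup>+y. ennreal (\<rho> (x - y) * (f y)\<^sup>2) \<partial>lborel)"
      by (rule nn_integral_eq_integral[symmetric]) (use i2 nn in \<open>simp_all add: AE_I2\<close>)
    finally show ?thesis by (simp add: c_def)
  qed
  have "(\<integral>\<^sup>+x. ennreal ((conv \<rho> f x)\<^sup>2) \<partial>lborel) \<le> (\<integral>\<^sup>+x. (\<integral>\<^sup>+y. ennreal (\<rho> (x - y) * (f y)\<^sup>2) \<partial>lborel) \<partial>lborel)"
    by (rule nn_integral_mono) (rule jensen)
  also have "\<dots> = (\<integral>\<^sup>+y. (\<integral>\<^sup>+x. ennreal (\<rho> (x - y) * (f y)\<^sup>2) \<partial>lborel) \<partial>lborel)"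
    by (rule lborel_pair.Fubini'[symmetric]) measurable
  also have "\<dots> = (\<integral>\<^sup>+y. ennreal ((f y)\<^sup>2) \<partial>lborel)"
  proof (rule nn_integral_cong)
    fix y
    have i: "integrable lborel (\<lambda>x. \<rho> (x - y))" "(\<integral>x. \<rho> (x - y) \<partial>lborel) = 1"
      using integral_lborel_translate[of \<rho> "-y"] test_fun_integrable[OF t] one by simp_all
    have "(\<integral>\<^sup>+x. ennreal (\<rho> (x - y) * (f y)\<^sup>2) \<partial>lborel) = ennreal (\<integral>x. \<rho> (x - y) * (f y)\<^sup>2 \<partial>lborel)"
      by (rule nn_integral_eq_integral) (use i nn in \<open>simp_all add: AE_I2\<close>)
    also have "(\<integral>x. \<rho> (x - y) * (f y)\<^sup>2 \<partial>lborel) = (f y)\<^sup>2" using i by simp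
    finally show "(\<integral>\<^sup>+x. ennreal (\<rho> (x - y) * (f y)\<^sup>2) \<partial>lborel) = ennreal ((f y)\<^sup>2)" .
  qed
  finally have le: "(\<integral>\<^sup>+x. ennreal ((conv \<rho> f x)\<^sup>2) \<partial>lborel) \<le> ennreal ((norm (toL2 f))\<^sup>2)"
    by (simp add: nn_integral_square f(2))
  show L2c: "L2 (conv \<rho> f)"
    by (rule L2I_nn_integral) (use le_less_trans[OF le ennreal_less_top] in simp_all)
  have "(norm (toL2 (conv \<rho> f)))\<^sup>2 \<le> (norm (toL2 f))\<^sup>2"
    using le unfolding nn_integral_square[OF L2c] by (subst (asm) ennreal_le_iff) simp_all
  then show "norm (toL2 (conv \<rho> f)) \<le> norm (toL2 f)" by (rule power2_le_imp_le) simp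
qed

section \<open>Density of test functions in L2\<close>

definition Cc :: "('a::euclidean_space \<Rightarrow> real) \<Rightarrow> bool" where
  "Cc g \<longleftrightarrow> continuous_on UNIV g \<and> (\<exists>M. \<forall>x. \<bar>g x\<bar> \<le> M) \<and> (\<exists>R. \<forall>x. g x \<noteq> 0 \<longrightarrow> norm x \<le> R)"

lemma Cc_L2: assumes "Cc g" shows "L2 g" "integrable lborel g"
proof -
  obtain M R where "\<And>x. \<bar>g x\<bar> \<le> M" "\<And>x. g x \<noteq> 0 \<Longrightarrow> norm x \<le> R" "continuous_on UNIV g"
    using assms unfolding Cc_def by metis
  then show "L2 g" "integrable lborel g"
    using bounded_support_L2[OF borel_measurable_continuous_onI, of g M R] by blast+
qed

lemma Cc_uniformly_continuous: "Cc g \<Longrightarrow> uniformly_continuous_on UNIV g"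
  using bounded_support_uniformly_continuous unfolding Cc_def by metis

text \<open>Truncate to bounded functions of bounded support, then use that a measurable function is an
  almost everywhere limit of continuous ones.\<close>

lemma Cc_dense:
  fixes u :: "'a::euclidean_space l2" assumes "\<epsilon> > 0"
  obtains g where "Cc g" "norm (toL2 g - u) < \<epsilon>"
proof -
  define cl where "cl k t = max (- real k) (min (real k) t)" for k t
  define \<psi> where "\<psi> k x = max 0 (min 1 (real k + 1 - norm x))" for k and x :: 'a
  define f where "f k x = \<psi> k x * cl k (fn u x)" for k x
  have \<psi>: "0 \<le> \<psi> k x" "\<psi> k x \<le> 1" "norm x > real k + 1 \<Longrightarrow> \<psi> k x = 0" "norm x \<le> real k \<Longrightarrow> \<psi> k x = 1" for k x
    by (auto simp: \<psi>_def)
  have \<psi>c: "continuous_on UNIV (\<psi> k)" for k unfolding \<psi>_def by (intro continuous_intros)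
  have clc: "continuous_on UNIV (cl k)" for k unfolding cl_def by (intro continuous_intros)
  have cl: "\<bar>cl k t\<bar> \<le> \<bar>t\<bar>" "\<bar>cl k t\<bar> \<le> real k" for k t by (auto simp: cl_def)
  have cle: "cl k t = t" if "\<bar>t\<bar> \<le> real k" for k t using that by (auto simp: cl_def)
  have [measurable]: "f k \<in> borel_measurable borel" for k
    unfolding f_def using borel_measurable_continuous_onI[OF \<psi>c] borel_measurable_continuous_onI[OF clc]
    by measurable
  have "(\<lambda>k. toL2 (f k)) \<longlonglongrightarrow> toL2 (fn u)"
  proof (rule toL2_dominated_convergence(3)[OF _ _ L2_fn[of u]])
    show "AE x in lborel. \<bar>f k x\<bar> \<le> \<bar>fn u x\<bar>" for k
    proof (rule AE_I2)
      fix x show "\<bar>f k x\<bar> \<le> \<bar>fn u x\<bar>"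
        using mult_mono[of "\<bar>\<psi> k x\<bar>" 1 "\<bar>cl k (fn u x)\<bar>" "\<bar>fn u x\<bar>"] \<psi>(1,2)[where k = k and x = x] cl
        by (simp add: f_def abs_mult)
    qed
    show "AE x in lborel. (\<lambda>k. f k x) \<longlonglongrightarrow> fn u x"
    proof (rule AE_I2, rule tendsto_eventually)
      fix x
      obtain N :: nat where N: "real N \<ge> max (norm x) \<bar>fn u x\<bar>" using real_arch_simple by blast
      show "\<forall>\<^sub>F k in sequentially. f k x = fn u x"
        using eventually_ge_at_top[of N]
      proof eventually_elim
        case (elim k)
        then have "real N \<le> real k" by simp
        then have "norm x \<le> real k" "\<bar>fn u x\<bar> \<le> real k" using N by linarith+
        then show ?case by (simp add: f_def \<psi>(4) cle)
      qed
    qed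
  qed simp_all
  then have "(\<lambda>k. toL2 (f k)) \<longlonglongrightarrow> u" by simp
  from LIMSEQ_D[OF this half_gt_zero[OF assms]] obtain k where k: "norm (toL2 (f k) - u) < \<epsilon> / 2" by blast
  have "fn u \<in> borel_measurable (lebesgue_on UNIV)"
    using fn_measurable[of u] by (intro measurable_restrict_space1 measurable_completion) simp
  then have "fn u measurable_on UNIV" by (subst measurable_on_iff_borel_measurable) simp_all
  then obtain N h where N: "negligible N" "\<And>n. continuous_on UNIV (h n)" "\<And>x. x \<notin> N \<Longrightarrow> (\<lambda>n. h n x) \<longlonglongrightarrow> fn u x"
    unfolding measurable_on_def by auto
  have "AE x in lebesgue. x \<notin> N" using N(1) by (intro AE_not_in) (simp add: negligible_iff_null_sets)
  then have hlim: "AE x in lborel. x \<notin> N" by (simp add: AE_completion_iff)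
  \<comment> \<open>The continuous functions h n may be unbounded. Passing them through the same
    clamp and cutoff keeps them continuous, dominates them by \<open>\<psi> k x * real k\<close>,
    and leaves \<open>f k\<close> as the limit.\<close>
  define g where "g n x = \<psi> k x * cl k (h n x)" for n x
  have gc: "continuous_on UNIV (g n)" for n
    unfolding g_def by (intro continuous_on_mult \<psi>c continuous_on_compose2[OF clc N(2)]) simp
  have gb: "\<bar>g n x\<bar> \<le> \<psi> k x * real k" for n x
    unfolding g_def using cl(2)[of k "h n x"] \<psi>(1,2)[where k = k and x = x] by (simp add: abs_mult mult_left_mono)
  have gM: "\<bar>g n x\<bar> \<le> real k" for n x
    using order_trans[OF gb mult_right_mono[of "\<psi> k x" 1 "real k"]] \<psi> by simp
  have gs: "norm x \<le> real k + 1" if "g n x \<noteq> 0" for n x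
    using that \<psi>(3)[where k = k and x = x] by (force simp: g_def)
  have gCc: "Cc (g n)" for n unfolding Cc_def using gc gM gs by blast
  have "Cc (\<lambda>x. \<psi> k x * real k)" unfolding Cc_def
  proof (intro conjI exI allI impI)
    show "continuous_on UNIV (\<lambda>x. \<psi> k x * real k)" by (intro continuous_intros \<psi>c)
    show "\<bar>\<psi> k x * real k\<bar> \<le> real k" for x using \<psi>(1,2)[where k = k and x = x] by (simp add: abs_mult mult_left_le_one_le)
    show "norm x \<le> real k + 1" if "\<psi> k x * real k \<noteq> 0" for x using that \<psi>(3)[where k = k and x = x] by force
  qed
  then have wL2: "L2 (\<lambda>x. \<psi> k x * real k)" by (rule Cc_L2)
  have "(\<lambda>n. toL2 (g n)) \<longlonglongrightarrow> toL2 (f k)"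
  proof (rule toL2_dominated_convergence(3)[OF _ _ wL2])
    show "g n \<in> borel_measurable borel" for n by (rule borel_measurable_continuous_onI[OF gc])
    show "AE x in lborel. \<bar>g n x\<bar> \<le> \<bar>\<psi> k x * real k\<bar>" for n
      by (rule AE_I2) (rule order_trans[OF gb abs_ge_self])
    show "AE x in lborel. (\<lambda>n. g n x) \<longlonglongrightarrow> f k x" using hlim
    proof eventually_elim
      case (elim x)
      have "isCont (cl k) (fn u x)" using clc by (simp add: continuous_on_eq_continuous_at)
      from isCont_tendsto_compose[OF this N(3)[OF elim]] show ?case
        unfolding g_def f_def by (intro tendsto_mult tendsto_const)
    qed
  qed simp
  from LIMSEQ_D[OF this half_gt_zero[OF assms]] obtain n where n: "norm (toL2 (g n) - toL2 (f k)) < \<epsilon> / 2" by blast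
  have "norm (toL2 (g n) - u) < \<epsilon>" using norm_triangle_lt[of "toL2 (g n) - toL2 (f k)" "toL2 (f k) - u" \<epsilon>] n k by simp
  with gCc show thesis by (rule that)
qed

text \<open>A mollified value is a weighted mean of f over the ball of radius r, with nonnegative
  weights of total mass 1.\<close>

lemma conv_near:
  fixes f :: "'a::euclidean_space \<Rightarrow> real"
  assumes \<rho>: "mollifier r \<rho>" and f: "integrable lborel f" and near: "\<And>y. norm (x - y) \<le> r \<Longrightarrow> \<bar>f y - c\<bar> \<le> e"
  shows "\<bar>conv \<rho> f x - c\<bar> \<le> e"
proof -
  have t: "test_fun UNIV \<rho>" and nn: "\<And>x. \<rho> x \<ge> 0" and one: "(\<integral>x. \<rho> x \<partial>lborel) = 1"
    and s: "\<And>x. \<rho> x \<noteq> 0 \<Longrightarrow> norm x \<le> r" using \<rho> by (auto simp: mollifier_def)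
  have i0: "integrable lborel (\<lambda>y. \<rho> (x - y))" "(\<integral>y. \<rho> (x - y) \<partial>lborel) = 1"
    using integral_lborel_reflect[OF test_fun_measurable[OF t], of x] test_fun_integrable[OF t] one by simp_all
  have i1: "integrable lborel (\<lambda>y. \<rho> (x - y) * f y)" by (rule conv_integrable[OF t f])
  have i2: "integrable lborel (\<lambda>y. \<rho> (x - y) * (f y - c))" unfolding right_diff_distrib using i0 i1 by simp
  have "conv \<rho> f x - c = (\<integral>y. \<rho> (x - y) * (f y - c) \<partial>lborel)"
    unfolding right_diff_distrib using i0 i1 by (simp add: conv_def)
  also have "\<bar>\<dots>\<bar> \<le> (\<integral>y. \<bar>\<rho> (x - y) * (f y - c)\<bar> \<partial>lborel)" by (rule abs_integral_le)
  also have "\<dots> \<le> (\<integral>y. \<rho> (x - y) * e \<partial>lborel)"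
  proof (rule integral_mono)
    fix y show "\<bar>\<rho> (x - y) * (f y - c)\<bar> \<le> \<rho> (x - y) * e"
    proof (cases "\<rho> (x - y) = 0")
      case False
      then have "\<bar>f y - c\<bar> \<le> e" using s[of "x - y"] near by simp
      then show ?thesis using nn[of "x - y"] by (simp add: abs_mult mult_left_mono)
    qed simp
  qed (use i0 i2 in simp_all)
  also have "\<dots> = e" using i0 by simp
  finally show ?thesis .
qed

lemma mollifier_Cc_tendsto:
  assumes g: "Cc g" and "\<epsilon> > 0"
  obtains r0 where "r0 > 0" "\<And>r \<rho>. mollifier r \<rho> \<Longrightarrow> r \<le> r0 \<Longrightarrow> norm (toL2 (conv \<rho> g) - toL2 g) < \<epsilon>"
proof -
  obtain R where R: "\<And>x. g x \<noteq> 0 \<Longrightarrow> norm x \<le> R" using g unfolding Cc_def by metis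
  \<comment> \<open>Mollification with radius at most 1 stays supported in the ball of radius R + 1.
    A uniform error e = \<epsilon> / sqrt m on that ball has L2 norm below \<epsilon>; the added 1
    avoids division by zero and makes the estimate strict. The same device returns for difference
    quotients.\<close>
  define m where "m = measure lborel (cball 0 (R + 1) :: 'a set) + 1"
  have m: "m > 0" "measure lborel (cball 0 (R + 1) :: 'a set) < m"
    unfolding m_def by (intro add_nonneg_pos measure_nonneg) simp_all
  define e where "e = \<epsilon> / sqrt m"
  have e: "e > 0" "e\<^sup>2 * m = \<epsilon>\<^sup>2" using assms m by (simp_all add: e_def power_divide)
  obtain d where d: "d > 0" "\<And>x y. dist y x < d \<Longrightarrow> dist (g y) (g x) < e"
    using Cc_uniformly_continuous[OF g] e(1) unfolding uniformly_continuous_on_def by auto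
  have int: "integrable lborel g" and L2g: "L2 g" using Cc_L2[OF g] by blast+
  show thesis
  proof (rule that[of "min 1 (d / 2)"])
    show "min 1 (d / 2) > 0" using d by simp
    fix r and \<rho> :: "'a \<Rightarrow> real" assume \<rho>: "mollifier r \<rho>" and r: "r \<le> min 1 (d / 2)"
    have t: "test_fun UNIV \<rho>" and nn: "\<And>x. \<rho> x \<ge> 0" and one: "(\<integral>x. \<rho> x \<partial>lborel) = 1"
      and s: "\<And>x. \<rho> x \<noteq> 0 \<Longrightarrow> norm x \<le> r" using \<rho> by (auto simp: mollifier_def)
    have [measurable]: "\<rho> \<in> borel_measurable borel" by (rule test_fun_measurable[OF t])
    have bd: "\<bar>conv \<rho> g x - g x\<bar> \<le> e" for x
    proof (rule conv_near[OF \<rho> int])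
      fix y assume "norm (x - y) \<le> r"
      then have "norm (x - y) < d" using r d(1) by simp
      then show "\<bar>g y - g x\<bar> \<le> e" using d(2)[of y x] by (simp add: dist_norm norm_minus_commute)
    qed
    have supp: "norm x \<le> R + 1" if "conv \<rho> g x - g x \<noteq> 0" for x
      using that conv_support[of \<rho> r g R x] s R[of x] R r by (cases "g x = 0") force+
    have L2c: "L2 (conv \<rho> g)" by (rule norm_conv_le(1)[OF \<rho> int L2g])
    have "(norm (toL2 (\<lambda>x. conv \<rho> g x - g x)))\<^sup>2 \<le> e\<^sup>2 * measure lborel (cball 0 (R + 1) :: 'a set)"
      by (rule bounded_support_L2(3)[OF L2_measurable[OF L2_diff[OF L2c L2g]] bd supp])
    also have "\<dots> < e\<^sup>2 * m" by (rule mult_strict_left_mono) (use m e in simp_all)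
    also have "\<dots> = \<epsilon>\<^sup>2" by (rule e(2))
    finally show "norm (toL2 (conv \<rho> g) - toL2 g) < \<epsilon>"
      using assms(2) by (intro power2_less_imp_less[of _ \<epsilon>]) (simp_all add: toL2_diff L2c L2g)
  qed
qed

lemma conv_diff:
  assumes "test_fun UNIV \<rho>" "integrable lborel f" "integrable lborel g"
  shows "conv \<rho> (\<lambda>x. f x - g x) = (\<lambda>x. conv \<rho> f x - conv \<rho> g x)"
  unfolding conv_def right_diff_distrib using conv_integrable[OF assms(1)] assms by (intro ext) simp

lemma mollifier_tendsto:
  assumes f: "L2 f" "integrable lborel f" and \<epsilon>: "\<epsilon> > 0"
  obtains r0 where "r0 > 0" "\<And>r \<rho>. mollifier r \<rho> \<Longrightarrow> r \<le> r0 \<Longrightarrow> norm (toL2 (conv \<rho> f) - toL2 f) < \<epsilon>"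
proof -
  have e3: "\<epsilon> / 3 > 0" using \<epsilon> by simp
  obtain g where g: "Cc g" "norm (toL2 g - toL2 f) < \<epsilon> / 3" using Cc_dense[OF e3] by metis
  obtain r0 where r0: "r0 > 0" "\<And>r \<rho>. mollifier r \<rho> \<Longrightarrow> r \<le> r0 \<Longrightarrow> norm (toL2 (conv \<rho> g) - toL2 g) < \<epsilon> / 3"
    using mollifier_Cc_tendsto[OF g(1) e3] by metis
  have gL: "L2 g" "integrable lborel g" using Cc_L2[OF g(1)] by blast+
  have dL: "L2 (\<lambda>x. f x - g x)" "integrable lborel (\<lambda>x. f x - g x)"
    using L2_diff[OF f(1) gL(1)] f gL by simp_all
  show thesis
  proof (rule that[OF r0(1)])
    fix r and \<rho> :: "'a \<Rightarrow> real" assume \<rho>: "mollifier r \<rho>" and r: "r \<le> r0"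
    have t: "test_fun UNIV \<rho>" using \<rho> by (simp add: mollifier_def)
    have "norm (toL2 (conv \<rho> f) - toL2 (conv \<rho> g)) = norm (toL2 (conv \<rho> (\<lambda>x. f x - g x)))"
      by (simp add: conv_diff[OF t f(2) gL(2)] toL2_diff norm_conv_le(1)[OF \<rho>] f gL)
    also have "\<dots> \<le> norm (toL2 f - toL2 g)"
      using norm_conv_le(2)[OF \<rho> dL(2,1)] by (simp add: toL2_diff f gL)
    finally have 1: "norm (toL2 (conv \<rho> f) - toL2 (conv \<rho> g)) < \<epsilon> / 3" using g(2) by (simp add: norm_minus_commute)
    have eq: "toL2 (conv \<rho> f) - toL2 f = (toL2 (conv \<rho> f) - toL2 (conv \<rho> g)) + (toL2 (conv \<rho> g) - toL2 g) + (toL2 g - toL2 f)"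
      by simp
    show "norm (toL2 (conv \<rho> f) - toL2 f) < \<epsilon>"
      unfolding eq using 1 norm_triangle_ineq[of "(toL2 (conv \<rho> f) - toL2 (conv \<rho> g)) + (toL2 (conv \<rho> g) - toL2 g)" "toL2 g - toL2 f"]
        norm_triangle_ineq[of "toL2 (conv \<rho> f) - toL2 (conv \<rho> g)" "toL2 (conv \<rho> g) - toL2 g"]
        r0(2)[OF \<rho> r] g(2) by linarith
  qed
qed

lemma test_fun_dense_L2:
  fixes u :: "'a::euclidean_space l2" assumes "\<epsilon> > 0"
  obtains \<phi> where "test_fun UNIV \<phi>" "norm (toL2 \<phi> - u) < \<epsilon>"
proof -
  obtain g where g: "Cc g" "norm (toL2 g - u) < \<epsilon> / 2" using Cc_dense[of "\<epsilon> / 2" u] assms by auto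
  obtain r0 where r0: "r0 > 0" "\<And>r \<rho>. mollifier r \<rho> \<Longrightarrow> r \<le> r0 \<Longrightarrow> norm (toL2 (conv \<rho> g) - toL2 g) < \<epsilon> / 2"
    using mollifier_Cc_tendsto[OF g(1), of "\<epsilon> / 2"] assms by (metis half_gt_zero)
  obtain \<rho> :: "'a \<Rightarrow> real" where \<rho>: "mollifier r0 \<rho>" using ex_mollifier[OF r0(1)] by blast
  obtain R where "\<And>x. g x \<noteq> 0 \<Longrightarrow> norm x \<le> R" using g(1) unfolding Cc_def by metis
  then have "test_fun UNIV (conv \<rho> g)"
    using test_fun_conv[of \<rho> g R] \<rho> Cc_L2[OF g(1)] by (simp add: mollifier_def)
  moreover have "norm (toL2 (conv \<rho> g) - u) < \<epsilon>"
    using norm_triangle_ineq[of "toL2 (conv \<rho> g) - toL2 g" "toL2 g - u"] g(2) r0(2)[OF \<rho>] by simp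
  ultimately show thesis by (rule that)
qed

lemma l2_eqI:
  assumes "\<And>\<phi>. test_fun UNIV \<phi> \<Longrightarrow> inner u (toL2 \<phi>) = inner v (toL2 \<phi>)" shows "u = v"
proof (rule ccontr)
  assume "u \<noteq> v"
  then have n: "norm (u - v) > 0" by simp
  obtain \<phi> where \<phi>: "test_fun UNIV \<phi>" "norm (toL2 \<phi> - (u - v)) < norm (u - v)" using test_fun_dense_L2[OF n] by blast
  have "inner (u - v) (toL2 \<phi>) = 0" using assms[OF \<phi>(1)] by (simp add: inner_diff_left)
  then have "(norm (u - v))\<^sup>2 = inner (u - v) ((u - v) - toL2 \<phi>)"
    by (simp add: inner_diff_right power2_norm_eq_inner)
  also have "\<dots> \<le> norm (u - v) * norm ((u - v) - toL2 \<phi>)" by (rule norm_cauchy_schwarz)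
  also have "\<dots> < norm (u - v) * norm (u - v)"
    using \<phi>(2) n by (intro mult_strict_left_mono) (simp_all add: norm_minus_commute)
  finally show False by (simp add: power2_eq_square)
qed

section \<open>Weak derivatives in L2 and density of test functions in H1\<close>

text \<open>For L2 functions the integrability clauses of \<open>weak_partial\<close> hold
  automatically, so only the pairing remains. Kept as a relation, the weak derivative has a closed
  graph, which lets the gradient constraint pass to limits of the iteration.\<close>

definition wp :: "'a::euclidean_space \<Rightarrow> 'a l2 \<Rightarrow> 'a l2 \<Rightarrow> bool" where
  "wp b u g \<longleftrightarrow> (\<forall>\<phi>. test_fun UNIV \<phi> \<longrightarrow> inner u (toL2 (pd b \<phi>)) = - inner g (toL2 \<phi>))"

lemma wp_unique: "wp b u g \<Longrightarrow> wp b u g' \<Longrightarrow> g = g'"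
  by (rule l2_eqI) (simp add: wp_def)

lemma weak_partial_iff_wp:
  assumes "L2 f" "L2 g" "b \<in> Basis" shows "weak_partial b f g \<longleftrightarrow> wp b (toL2 f) (toL2 g)"
proof -
  have "integrable lborel (\<lambda>x. f x * pd b \<phi> x) \<and> integrable lborel (\<lambda>x. g x * \<phi> x)
    \<and> inner (toL2 f) (toL2 (pd b \<phi>)) = (\<integral>x. f x * pd b \<phi> x \<partial>lborel)
    \<and> inner (toL2 g) (toL2 \<phi>) = (\<integral>x. g x * \<phi> x \<partial>lborel)" if "test_fun UNIV \<phi>" for \<phi>
    using that assms test_fun_pd[OF that assms(3)]
    by (simp add: inner_toL2 L2_integrable_mult test_fun_L2)
  then show ?thesis unfolding weak_partial_def wp_def by auto
qed

lemma wp_scaleR: "wp b u g \<Longrightarrow> wp b (c *\<^sub>R u) (c *\<^sub>R g)"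
  by (simp add: wp_def)

lemma wp_diff: "wp b u g \<Longrightarrow> wp b v h \<Longrightarrow> wp b (u - v) (g - h)"
  by (simp add: wp_def inner_diff_left)

lemma wp_zero: "wp b 0 0" by (simp add: wp_def)

lemma closed_wp: "closed {z. wp b (fst z) (snd z)}"
proof -
  have "{z. wp b (fst z) (snd z)} = (\<Inter>\<phi>\<in>Collect (test_fun UNIV).
      {z. inner (fst z) (toL2 (pd b \<phi>)) = - inner (snd z) (toL2 \<phi>)})"
    by (auto simp: wp_def)
  then show ?thesis
    by (simp only:) (intro closed_INT ballI closed_Collect_eq continuous_intros)
qed

lemma inner_fn_test:
  assumes "test_fun UNIV \<phi>"
  shows "inner u (toL2 \<phi>) = (\<integral>x. fn u x * \<phi> x \<partial>lborel)" "integrable lborel (\<lambda>x. fn u x * \<phi> x)"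
  using inner_toL2[OF L2_fn test_fun_L2[OF assms], of u] L2_integrable_mult[OF L2_fn test_fun_L2[OF assms]] by simp_all

lemma L2_mult_bounded:
  assumes "L2 f" "k \<in> borel_measurable borel" "\<And>x. \<bar>k x\<bar> \<le> M"
  shows "L2 (\<lambda>x. k x * f x)" "norm (toL2 (\<lambda>x. k x * f x)) \<le> M * norm (toL2 f)"
proof -
  have M: "M \<ge> 0" using assms(3)[of 0] by linarith
  have le: "\<bar>k x * f x\<bar> \<le> \<bar>M * f x\<bar>" for x
    using assms(3)[of x] M by (simp add: abs_mult mult_right_mono)
  show L: "L2 (\<lambda>x. k x * f x)"
    by (rule L2_bound[OF L2_cmult[OF assms(1), of M] _ le]) (use assms L2_measurable[OF assms(1)] in simp)
  show "norm (toL2 (\<lambda>x. k x * f x)) \<le> M * norm (toL2 f)"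
    using L2_nonneg_le_imp_norm_le[OF L L2_cmult[OF assms(1), of M] le] M by (simp add: toL2_cmult assms)
qed

text \<open>Testing the weak derivative of u with \<kappa>\<phi> in place of \<phi> moves the
  product rule onto smooth functions.\<close>

lemma wp_mult_test:
  assumes wp: "wp b u g" and \<kappa>: "test_fun UNIV \<kappa>" and b: "b \<in> Basis"
  shows "wp b (toL2 (\<lambda>x. \<kappa> x * fn u x)) (toL2 (\<lambda>x. \<kappa> x * fn g x + pd b \<kappa> x * fn u x))"
  unfolding wp_def
proof (intro allI impI)
  fix \<phi> :: "'a \<Rightarrow> real" assume \<phi>: "test_fun UNIV \<phi>"
  have sm: "smooth_fun \<kappa>" "smooth_fun \<phi>" using \<kappa> \<phi> by (simp_all add: test_fun_def)
  note t = test_fun_pd[OF \<kappa> b] test_fun_pd[OF \<phi> b]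
  obtain M M' where "\<And>x. \<bar>\<kappa> x\<bar> \<le> M" "\<And>x. \<bar>pd b \<kappa> x\<bar> \<le> M'"
    using test_fun_bounded[OF \<kappa>] test_fun_bounded[OF t(1)] by metis
  then have L: "L2 (\<lambda>x. \<kappa> x * fn u x)" "L2 (\<lambda>x. \<kappa> x * fn g x)" "L2 (\<lambda>x. pd b \<kappa> x * fn u x)"
    using L2_mult_bounded(1)[OF L2_fn] test_fun_measurable[OF \<kappa>] test_fun_measurable[OF t(1)] by blast+
  have tp: "test_fun UNIV (\<lambda>x. \<kappa> x * \<phi> x)" "test_fun UNIV (\<lambda>x. pd b \<kappa> x * \<phi> x)"
    using test_fun_mult_smooth(1)[OF \<phi> sm(1)] test_fun_mult_smooth(1)[OF \<phi> smooth_fun_pd[OF sm(1) b]] by blast+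
  have i: "integrable lborel (\<lambda>x. fn u x * (\<kappa> x * pd b \<phi> x))" "integrable lborel (\<lambda>x. fn u x * (pd b \<kappa> x * \<phi> x))"
    "integrable lborel (\<lambda>x. fn g x * (\<kappa> x * \<phi> x))"
    by (intro inner_fn_test(2) test_fun_mult_smooth(1)[OF t(2) sm(1)] tp)+
  have "inner u (toL2 (pd b (\<lambda>x. \<kappa> x * \<phi> x))) = - inner g (toL2 (\<lambda>x. \<kappa> x * \<phi> x))"
    using wp tp(1) unfolding wp_def by blast
  then have "(\<integral>x. fn u x * (pd b \<kappa> x * \<phi> x) + fn u x * (\<kappa> x * pd b \<phi> x) \<partial>lborel) = - (\<integral>x. fn g x * (\<kappa> x * \<phi> x) \<partial>lborel)"
    by (simp add: inner_fn_test test_fun_pd[OF tp(1) b] tp pd_mult[OF sm b] distrib_left)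
  then have "(\<integral>x. fn u x * (\<kappa> x * pd b \<phi> x) \<partial>lborel) = - ((\<integral>x. fn g x * (\<kappa> x * \<phi> x) \<partial>lborel) + (\<integral>x. fn u x * (pd b \<kappa> x * \<phi> x) \<partial>lborel))"
    using i by simp
  also have "\<dots> = - (\<integral>x. (\<kappa> x * fn g x + pd b \<kappa> x * fn u x) * \<phi> x \<partial>lborel)"
    using i by (simp add: distrib_right distrib_left ac_simps)
  finally show "inner (toL2 (\<lambda>x. \<kappa> x * fn u x)) (toL2 (pd b \<phi>)) =
      - inner (toL2 (\<lambda>x. \<kappa> x * fn g x + pd b \<kappa> x * fn u x)) (toL2 \<phi>)"
    unfolding inner_toL2[OF L(1) test_fun_L2[OF t(2)]] inner_toL2[OF L2_add[OF L(2,3)] test_fun_L2[OF \<phi>]]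
    by (simp add: ac_simps)
qed

text \<open>For fixed x the kernel \<rho>(x - y) is a test function of y, and its derivative has the
  opposite sign; this sign cancels the one in the weak derivative.\<close>

lemma pd_conv_wp:
  assumes f: "integrable lborel f" "L2 f" and g: "L2 g" and wp: "wp b (toL2 f) (toL2 g)"
    and \<rho>: "test_fun UNIV \<rho>" and b: "b \<in> Basis"
  shows "pd b (conv \<rho> f) = conv \<rho> g"
proof
  fix x
  have sm: "smooth_fun \<rho>" using \<rho> by (simp add: test_fun_def)
  define \<phi> where "\<phi> = (\<lambda>y. \<rho> (x + (-1) *\<^sub>R y))"
  have \<phi>: "test_fun UNIV \<phi>" unfolding \<phi>_def by (rule test_fun_affine[OF \<rho>]) simp
  have pd: "pd b \<phi> y = - pd b \<rho> (x - y)" for y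
    unfolding \<phi>_def using pd_affine[OF sm b, of x "-1" y] by simp
  have "inner (toL2 f) (toL2 (pd b \<phi>)) = - inner (toL2 g) (toL2 \<phi>)" using wp \<phi> unfolding wp_def by blast
  then have "(\<integral>y. f y * - pd b \<rho> (x - y) \<partial>lborel) = - (\<integral>y. g y * \<rho> (x - y) \<partial>lborel)"
    unfolding inner_toL2[OF f(2) test_fun_L2[OF test_fun_pd[OF \<phi> b]]] inner_toL2[OF g test_fun_L2[OF \<phi>]] pd
    by (simp add: \<phi>_def)
  then show "pd b (conv \<rho> f) x = conv \<rho> g x"
    unfolding pd_conv[OF \<rho> f(1) b] conv_def by (simp add: mult.commute)
qed

lemma ex_cutoff:
  obtains \<kappa> :: "'a::euclidean_space \<Rightarrow> real" where
    "test_fun UNIV \<kappa>" "\<And>x. 0 \<le> \<kappa> x" "\<And>x. \<kappa> x \<le> 1" "\<And>x. norm x \<le> 1 \<Longrightarrow> \<kappa> x = 1"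
proof -
  obtain \<rho> :: "'a \<Rightarrow> real" where \<rho>: "mollifier 1 \<rho>" using ex_mollifier[of 1] by auto
  have t: "test_fun UNIV \<rho>" and nn: "\<And>x. \<rho> x \<ge> 0" and one: "(\<integral>x. \<rho> x \<partial>lborel) = 1"
    and s: "\<And>x. \<rho> x \<noteq> 0 \<Longrightarrow> norm x \<le> 1" using \<rho> by (auto simp: mollifier_def)
  \<comment> \<open>Radius 2 leaves a margin of 1, the radius of the mollifier, around the unit
    ball.\<close>
  define A where "A = (indicator (cball 0 2) :: 'a \<Rightarrow> real)"
  have A: "integrable lborel A" using emeasure_lborel_cball_finite[of "0::'a" 2] by (simp add: A_def)
  have i0: "integrable lborel (\<lambda>y. \<rho> (x - y))" "(\<integral>y. \<rho> (x - y) \<partial>lborel) = 1" for x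
    using integral_lborel_reflect[of \<rho> x] test_fun_integrable[OF t] test_fun_measurable[OF t] one by simp_all
  show thesis
  proof (rule that[of "conv \<rho> A"])
    show "test_fun UNIV (conv \<rho> A)" by (rule test_fun_conv[OF t A, of 2]) (auto simp: A_def indicator_def)
    show "0 \<le> conv \<rho> A x" for x unfolding conv_def by (rule Bochner_Integration.integral_nonneg) (simp add: nn A_def)
    have "conv \<rho> A x \<le> (\<integral>y. \<rho> (x - y) \<partial>lborel)" for x
      unfolding conv_def by (rule integral_mono[OF conv_integrable[OF t A] i0(1)]) (simp add: nn A_def indicator_def)
    then show "conv \<rho> A x \<le> 1" for x by (simp add: i0)
    show "conv \<rho> A x = 1" if x: "norm x \<le> 1" for x
    proof -
      have "\<rho> (x - y) * A y = \<rho> (x - y)" for y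
      proof (cases "\<rho> (x - y) = 0")
        case False
        then have "norm y \<le> 2" using s[of "x - y"] x norm_triangle_ineq4[of x "x - y"] by simp
        then show ?thesis by (simp add: A_def)
      qed simp
      then have "(\<lambda>y. \<rho> (x - y) * A y) = (\<lambda>y. \<rho> (x - y))" by (rule ext)
      then show ?thesis unfolding conv_def by (simp only: i0)
    qed
  qed
qed

text \<open>The cutoffs \<kappa>(x / (n + 1)) have gradients of size O(1/n), so the product rule
  term with u disappears in the limit. Mollification of the cut off function commutes with its weak
  derivatives, so one small radius s, the minimum over u and all directions, approximates the
  function and its gradient at the same time.\<close>

lemma test_fun_dense_H1:
  fixes u :: "'a::euclidean_space l2" and g :: "'a \<Rightarrow> 'a l2"
  assumes wp: "\<And>b. b \<in> Basis \<Longrightarrow> wp b u (g b)" and \<epsilon>: "\<epsilon> > 0"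
  obtains \<phi> where "test_fun UNIV \<phi>" "norm (toL2 \<phi> - u) < \<epsilon>"
    "\<And>b. b \<in> Basis \<Longrightarrow> norm (toL2 (pd b \<phi>) - g b) < \<epsilon>"
proof -
  obtain \<kappa> :: "'a \<Rightarrow> real" where \<kappa>: "test_fun UNIV \<kappa>" "\<And>x. 0 \<le> \<kappa> x" "\<And>x. \<kappa> x \<le> 1" "\<And>x. norm x \<le> 1 \<Longrightarrow> \<kappa> x = 1"
    using ex_cutoff by blast
  have sm: "smooth_fun \<kappa>" using \<kappa> by (simp add: test_fun_def)
  define X where "X n x = \<kappa> (0 + (1 / real (Suc n)) *\<^sub>R x)" for n x
  have X: "test_fun UNIV (X n)" for n unfolding X_def by (rule test_fun_affine[OF \<kappa>(1)]) simp
  have Xm: "X n \<in> borel_measurable borel" for n by (rule test_fun_measurable[OF X])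
  have X1: "\<bar>X n x\<bar> \<le> 1" for n x using \<kappa>(2,3) by (simp add: X_def)
  have Xlim: "(\<lambda>n. toL2 (\<lambda>x. X n x * fn v x)) \<longlonglongrightarrow> v" for v :: "'a l2"
  proof -
    have "(\<lambda>n. toL2 (\<lambda>x. X n x * fn v x)) \<longlonglongrightarrow> toL2 (fn v)"
    proof (rule toL2_dominated_convergence(3)[OF _ _ L2_fn[of v]])
      show "AE x in lborel. \<bar>X n x * fn v x\<bar> \<le> \<bar>fn v x\<bar>" for n
        by (rule AE_I2) (simp add: abs_mult mult_left_le_one_le X1)
      show "AE x in lborel. (\<lambda>n. X n x * fn v x) \<longlonglongrightarrow> fn v x"
      proof (rule AE_I2, rule tendsto_eventually)
        fix x :: 'a
        obtain N :: nat where N: "real N \<ge> norm x" using real_arch_simple by blast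
        show "\<forall>\<^sub>F n in sequentially. X n x * fn v x = fn v x"
          using eventually_ge_at_top[of N]
        proof eventually_elim
          case (elim n)
          then have "real N \<le> real n" by simp
          then have "norm x \<le> real (Suc n)" using N by simp
          then have "norm (0 + (1 / real (Suc n)) *\<^sub>R x) \<le> 1" by (simp add: field_simps)
          then show ?case unfolding X_def by (simp only: \<kappa>(4) mult_1)
        qed
      qed
    qed (use Xm in simp_all)
    then show ?thesis by simp
  qed
  define G where "G b n = toL2 (\<lambda>x. X n x * fn (g b) x + pd b (X n) x * fn u x)" for b n
  have LX: "L2 (\<lambda>x. X n x * fn v x)" for n and v :: "'a l2"
    by (rule L2_mult_bounded(1)[OF L2_fn Xm X1])
  have Glim: "G b \<longlonglongrightarrow> g b" and GL: "L2 (\<lambda>x. pd b (X n) x * fn u x)" if b: "b \<in> Basis" for b n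
  proof -
    obtain M where M: "M \<ge> 0" "\<And>x. \<bar>pd b \<kappa> x\<bar> \<le> M" using test_fun_bounded[OF test_fun_pd[OF \<kappa>(1) b]] by metis
    have pdX: "pd b (X n) x = (1 / real (Suc n)) * pd b \<kappa> (0 + (1 / real (Suc n)) *\<^sub>R x)" for n x
      unfolding X_def by (rule pd_affine[OF sm b])
    have pdb: "\<bar>pd b (X n) x\<bar> \<le> M / real (Suc n)" for n x
      unfolding pdX using M(2)[of "0 + (1 / real (Suc n)) *\<^sub>R x"] by (simp add: abs_mult divide_right_mono)
    note * = L2_mult_bounded[OF L2_fn test_fun_measurable[OF test_fun_pd[OF X b]] pdb]
    show "L2 (\<lambda>x. pd b (X n) x * fn u x)" by (rule *(1))
    have "(\<lambda>n. M * norm u * (1 / real (Suc n))) \<longlonglongrightarrow> M * norm u * 0"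
      by (intro tendsto_mult tendsto_const LIMSEQ_Suc lim_1_over_n)
    then have "(\<lambda>n. M / real (Suc n) * norm (toL2 (fn u))) \<longlonglongrightarrow> 0" by (simp add: field_simps)
    then have "(\<lambda>n. toL2 (\<lambda>x. pd b (X n) x * fn u x)) \<longlonglongrightarrow> 0"
      by (rule Lim_null_comparison[rotated]) (intro always_eventually allI *(2))
    from tendsto_add[OF Xlim[of "g b"] this] show "G b \<longlonglongrightarrow> g b"
      unfolding G_def by (simp add: toL2_add LX *(1))
  qed
  have "\<forall>\<^sub>F n in sequentially. norm (toL2 (\<lambda>x. X n x * fn u x) - u) < \<epsilon> / 2 \<and> (\<forall>b\<in>Basis. norm (G b n - g b) < \<epsilon> / 2)"
    using tendstoD[OF Xlim half_gt_zero[OF \<epsilon>]] tendstoD[OF Glim half_gt_zero[OF \<epsilon>]]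
    by (simp add: eventually_conj_iff eventually_ball_finite_distrib dist_norm)
  then obtain n where n: "norm (toL2 (\<lambda>x. X n x * fn u x) - u) < \<epsilon> / 2" "\<And>b. b \<in> Basis \<Longrightarrow> norm (G b n - g b) < \<epsilon> / 2"
    unfolding eventually_sequentially by blast
  define f where "f x = X n x * fn u x" for x
  define h where "h b x = X n x * fn (g b) x + pd b (X n) x * fn u x" for b x
  obtain R where R: "\<And>x. X n x \<noteq> 0 \<Longrightarrow> norm x \<le> R" using X[of n] unfolding test_fun_UNIV_iff by metis
  have fs: "norm x \<le> R" if "f x \<noteq> 0" for x using that R[of x] by (auto simp: f_def)
  have fL: "L2 f" unfolding f_def by (rule LX)
  have hL: "L2 (h b)" if "b \<in> Basis" for b unfolding h_def by (intro L2_add LX GL that)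
  have int: "integrable lborel v" if v: "L2 v" "\<And>x. norm x > R \<Longrightarrow> v x = 0" for v :: "'a \<Rightarrow> real"
  proof -
    have "L2 (indicator (cball 0 R) :: 'a \<Rightarrow> real)" by (intro L2_indicator emeasure_lborel_cball_finite) simp
    from L2_integrable_mult[OF this v(1)] show ?thesis
      by (rule Bochner_Integration.integrable_cong[THEN iffD1, rotated 2])
        (use v(2) in \<open>auto simp: indicator_def not_le\<close>)
  qed
  have fint: "integrable lborel f" by (rule int[OF fL]) (use fs in force)
  have hint: "integrable lborel (h b)" if b: "b \<in> Basis" for b
  proof (rule int[OF hL[OF b]])
    fix x :: 'a assume x: "norm x > R"
    have "closure {x. X n x \<noteq> 0} \<subseteq> cball 0 R" by (rule closure_minimal) (use R in auto)
    then have "pd b (X n) x = 0" using x by (intro pd_eq_0_outside) auto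
    then show "h b x = 0" using R[of x] x by (cases "X n x = 0") (auto simp: h_def)
  qed
  have wpf: "wp b (toL2 f) (toL2 (h b))" if b: "b \<in> Basis" for b
    unfolding f_def h_def by (rule wp_mult_test[OF wp[OF b] X b])
  have "\<exists>r>0. \<forall>\<rho>. \<forall>s\<le>r. mollifier s \<rho> \<longrightarrow> norm (toL2 (conv \<rho> v) - toL2 v) < \<epsilon> / 2" if "L2 v" "integrable lborel v" for v :: "'a \<Rightarrow> real"
    using mollifier_tendsto[OF that half_gt_zero[OF \<epsilon>]] by metis
  then obtain r where r: "\<And>v::'a \<Rightarrow> real. L2 v \<Longrightarrow> integrable lborel v \<Longrightarrow> r v > 0"
    "\<And>v \<rho> s. L2 v \<Longrightarrow> integrable lborel v \<Longrightarrow> s \<le> r v \<Longrightarrow> mollifier s \<rho> \<Longrightarrow> norm (toL2 (conv \<rho> v) - toL2 v) < \<epsilon> / 2"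
    by metis
  define s where "s = Min (insert (r f) ((\<lambda>b. r (h b)) ` Basis))"
  have s: "s > 0" "s \<le> r f" "\<And>b. b \<in> Basis \<Longrightarrow> s \<le> r (h b)"
  proof -
    have fin: "finite (insert (r f) ((\<lambda>b. r (h b)) ` Basis))" by simp
    show "s > 0" unfolding s_def using r(1) fL fint hL hint by (subst Min_gr_iff[OF fin]) auto
    show "s \<le> r f" unfolding s_def by (rule Min_le[OF fin]) simp
    show "s \<le> r (h b)" if "b \<in> Basis" for b unfolding s_def by (rule Min_le[OF fin]) (use that in simp)
  qed
  obtain \<rho> :: "'a \<Rightarrow> real" where \<rho>: "mollifier s \<rho>" using ex_mollifier[OF s(1)] by blast
  have t: "test_fun UNIV \<rho>" using \<rho> by (simp add: mollifier_def)
  show thesis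
  proof (rule that[of "conv \<rho> f"])
    show "test_fun UNIV (conv \<rho> f)" by (rule test_fun_conv[OF t fint fs])
    have "norm (toL2 (conv \<rho> f) - toL2 f) < \<epsilon> / 2" by (rule r(2)[OF fL fint s(2) \<rho>])
    moreover have "norm (toL2 f - u) < \<epsilon> / 2" unfolding f_def[abs_def] by (rule n(1))
    ultimately show "norm (toL2 (conv \<rho> f) - u) < \<epsilon>"
      using norm_triangle_ineq[of "toL2 (conv \<rho> f) - toL2 f" "toL2 f - u"] by simp
    fix b :: 'a assume b: "b \<in> Basis"
    have "norm (toL2 (conv \<rho> (h b)) - toL2 (h b)) < \<epsilon> / 2" by (rule r(2)[OF hL[OF b] hint[OF b] s(3)[OF b] \<rho>])
    moreover have "norm (toL2 (h b) - g b) < \<epsilon> / 2" using n(2)[OF b] unfolding h_def[abs_def] G_def .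
    ultimately show "norm (toL2 (pd b (conv \<rho> f)) - g b) < \<epsilon>"
      unfolding pd_conv_wp[OF fint fL hL[OF b] wpf[OF b] t b]
      using norm_triangle_ineq[of "toL2 (conv \<rho> (h b)) - toL2 (h b)" "toL2 (h b) - g b"] by simp
  qed
qed

section \<open>Unitary groups as limits of exponentials\<close>

text \<open>Bounded operators as a Banach algebra, so that the exponential of \<open>real_normed_algebra_1\<close> applies.\<close>

typedef (overloaded) 'a bop = "UNIV :: ('a::real_normed_vector \<Rightarrow>\<^sub>L 'a) set"
  morphisms blf Bop ..

setup_lifting type_definition_bop

instantiation bop :: (real_normed_vector) real_vector
begin
lift_definition zero_bop :: "'a bop" is 0 .
lift_definition plus_bop :: "'a bop \<Rightarrow> 'a bop \<Rightarrow> 'a bop" is "(+)" .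
lift_definition minus_bop :: "'a bop \<Rightarrow> 'a bop \<Rightarrow> 'a bop" is "(-)" .
lift_definition uminus_bop :: "'a bop \<Rightarrow> 'a bop" is uminus .
lift_definition scaleR_bop :: "real \<Rightarrow> 'a bop \<Rightarrow> 'a bop" is scaleR .
instance by standard (transfer; simp add: algebra_simps)+
end

instantiation bop :: (real_normed_vector) real_normed_vector
begin
lift_definition norm_bop :: "'a bop \<Rightarrow> real" is norm .
definition sgn_bop :: "'a bop \<Rightarrow> 'a bop" where "sgn_bop x = x /\<^sub>R norm x"
definition dist_bop :: "'a bop \<Rightarrow> 'a bop \<Rightarrow> real" where "dist_bop x y = norm (x - y)"
definition uniformity_bop :: "('a bop \<times> 'a bop) filter"
  where "uniformity_bop = (INF e\<in>{0<..}. principal {(x, y). dist x y < e})"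
definition open_bop :: "'a bop set \<Rightarrow> bool"
  where "open_bop U = (\<forall>x\<in>U. \<forall>\<^sub>F (x', y) in uniformity. x' = x \<longrightarrow> y \<in> U)"
instance
proof
  fix x y :: "'a bop" and a :: real
  show "norm x = 0 \<longleftrightarrow> x = 0" by transfer simp
  show "norm (x + y) \<le> norm x + norm y" by transfer (rule norm_triangle_ineq)
  show "norm (a *\<^sub>R x) = \<bar>a\<bar> * norm x" by transfer simp
qed (rule sgn_bop_def dist_bop_def uniformity_bop_def open_bop_def)+
end

instantiation bop :: ("{real_normed_vector, perfect_space}") real_normed_algebra_1
begin
lift_definition one_bop :: "'a bop" is id_blinfun .
lift_definition times_bop :: "'a bop \<Rightarrow> 'a bop \<Rightarrow> 'a bop" is "(o\<^sub>L)" .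
instance
proof
  fix x y z :: "'a bop" and a :: real
  show "x * y * z = x * (y * z)" by transfer (simp add: blinfun_eqI)
  show "(x + y) * z = x * z + y * z" by transfer (simp add: blinfun_eqI blinfun.add_left)
  show "x * (y + z) = x * y + x * z" by transfer (simp add: blinfun_eqI blinfun.add_right blinfun.add_left)
  show "(a *\<^sub>R x) * y = a *\<^sub>R (x * y)" by transfer (simp add: blinfun_eqI blinfun.scaleR_left)
  show "x * (a *\<^sub>R y) = a *\<^sub>R (x * y)" by transfer (simp add: blinfun_eqI blinfun.scaleR_right blinfun.scaleR_left)
  show "1 * x = x" by transfer (simp add: blinfun_eqI)
  show "x * 1 = x" by transfer (simp add: blinfun_eqI)
  show "norm (x * y) \<le> norm x * norm y" by transfer (rule norm_blinfun_compose)
  show "norm (1 :: 'a bop) = 1" by transfer (rule norm_blinfun_id)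
  show "(0 :: 'a bop) \<noteq> 1"
    by transfer (metis norm_blinfun_id norm_zero zero_neq_one)
qed
end

instance bop :: (banach) banach
proof
  fix X :: "nat \<Rightarrow> 'a bop" assume "Cauchy X"
  have d: "dist (blf A) (blf B) = dist A B" for A B :: "'a bop"
    unfolding dist_norm by transfer (rule refl)
  have "Cauchy (\<lambda>n. blf (X n))" using \<open>Cauchy X\<close> unfolding Cauchy_def d .
  then obtain L where "(\<lambda>n. blf (X n)) \<longlonglongrightarrow> L" using Cauchy_convergent convergent_def by blast
  then have "(\<lambda>n. blf (X n)) \<longlonglongrightarrow> blf (Bop L)" by (simp add: Bop_inverse)
  then have "X \<longlonglongrightarrow> Bop L" unfolding lim_sequentially d .
  then show "convergent X" by (rule convergentI)
qed

lift_definition ap :: "'a::real_normed_vector bop \<Rightarrow> 'a \<Rightarrow> 'a" is blinfun_apply .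

lemma bounded_bilinear_ap: "bounded_bilinear ap"
proof
  fix A B :: "'a bop" and x y :: 'a and r :: real
  show "ap (A + B) x = ap A x + ap B x" by transfer (rule blinfun.add_left)
  show "ap A (x + y) = ap A x + ap A y" by transfer (rule blinfun.add_right)
  show "ap (r *\<^sub>R A) x = r *\<^sub>R ap A x" by transfer (rule blinfun.scaleR_left)
  show "ap A (r *\<^sub>R x) = r *\<^sub>R ap A x" by transfer (rule blinfun.scaleR_right)
  show "\<exists>K. \<forall>A (x::'a). norm (ap A x) \<le> norm A * norm x * K"
    by (rule exI[of _ 1], transfer) (simp add: norm_blinfun)
qed

interpretation ap: bounded_bilinear ap by (rule bounded_bilinear_ap)

lemma ap_mult: "ap (A * B) x = ap A (ap B x)" by transfer simp
lemma ap_one: "ap 1 x = x" by transfer simp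

lift_definition mkop :: "('a::real_normed_vector \<Rightarrow> 'a) \<Rightarrow> 'a bop" is Blinfun .

lemma ap_mkop: "bounded_linear f \<Longrightarrow> ap (mkop f) = f"
  by transfer (rule bounded_linear_Blinfun_apply)

lemma bop_eqI: "(\<And>x. ap A x = ap B x) \<Longrightarrow> A = B"
  by transfer (rule blinfun_eqI)

lemma exp_commute:
  fixes A C :: "'a::{real_normed_algebra_1, banach}"
  assumes "C * A = A * C" shows "C * exp A = exp A * C"
proof -
  have "C * A ^ n = A ^ n * C" for n using power_commuting_commutes[OF assms[symmetric], of n] by simp
  then have eq: "(\<lambda>n. C * (A ^ n /\<^sub>R fact n)) = (\<lambda>n. (A ^ n /\<^sub>R fact n) * C)" by simp
  have "C * exp A = (\<Sum>n. C * (A ^ n /\<^sub>R fact n))"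
    unfolding exp_def by (rule bounded_linear.suminf[OF bounded_linear_mult_right summable_exp_generic])
  also have "\<dots> = exp A * C"
    unfolding eq exp_def by (rule bounded_linear.suminf[OF bounded_linear_mult_left summable_exp_generic, symmetric])
  finally show ?thesis .
qed

lemma exp_scaleR_minus_inverse: "exp (t *\<^sub>R A) * exp ((- t) *\<^sub>R A) = (1 :: 'a::{real_normed_algebra_1, banach})"
  using exp_minus_inverse[of "t *\<^sub>R A"] by simp

lemma has_vector_derivative_within_iff_quotient:
  fixes f :: "real \<Rightarrow> 'a::real_normed_vector"
  shows "(f has_vector_derivative f') (at t within X) \<longleftrightarrow> ((\<lambda>s. (f s - f t) /\<^sub>R (s - t)) \<longlongrightarrow> f') (at t within X)"
proof -
  have eq: "norm ((1 / norm (s - t)) *\<^sub>R (f s - (f t + (s - t) *\<^sub>R f'))) = norm ((f s - f t) /\<^sub>R (s - t) - f')" if "s \<noteq> t" for s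
  proof -
    have "(f s - f t) /\<^sub>R (s - t) - f' = (f s - (f t + (s - t) *\<^sub>R f')) /\<^sub>R (s - t)"
      using that by (simp add: scaleR_diff_right scaleR_add_right)
    then show ?thesis by (simp add: inverse_eq_divide)
  qed
  let ?q = "\<lambda>s. (1 / norm (s - t)) *\<^sub>R (f s - (f t + (s - t) *\<^sub>R f'))" and ?r = "\<lambda>s. (f s - f t) /\<^sub>R (s - t) - f'"
  have "(?q \<longlongrightarrow> 0) (at t within X) \<longleftrightarrow> ((\<lambda>s. norm (?q s)) \<longlongrightarrow> 0) (at t within X)"
    by (rule tendsto_norm_zero_iff[symmetric])
  also have "\<dots> \<longleftrightarrow> ((\<lambda>s. norm (?r s)) \<longlongrightarrow> 0) (at t within X)"
  proof (rule filterlim_cong[OF refl refl])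
    show "\<forall>\<^sub>F s in at t within X. norm (?q s) = norm (?r s)"
      unfolding eventually_at_filter by (intro always_eventually allI impI eq)
  qed
  also have "\<dots> \<longleftrightarrow> (?r \<longlongrightarrow> 0) (at t within X)" by (rule tendsto_norm_zero_iff)
  also have "\<dots> \<longleftrightarrow> ((\<lambda>s. (f s - f t) /\<^sub>R (s - t)) \<longlongrightarrow> f') (at t within X)" by (rule LIM_zero_iff)
  finally show ?thesis
    unfolding has_vector_derivative_def has_derivative_within by (simp only: bounded_linear_scaleR_left simp_thms)
qed

text \<open>Trotter--Kato: skew-adjoint bounded operators \<open>B n\<close> whose differences are controlled by
  operators \<open>C1\<close>, \<open>C2\<close> that commute with all \<open>B m\<close>. Their exponentials converge.\<close>

locale skew_approx =
  fixes B :: "nat \<Rightarrow> 'y::{banach, real_inner, perfect_space} bop" and C1 C2 :: "nat \<Rightarrow> 'y bop"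
    and K :: real and D :: "'y set" and A :: "'y \<Rightarrow> 'y"
  assumes skew: "inner (ap (B n) x) y = - inner x (ap (B n) y)"
    and comm: "C1 n * B m = B m * C1 n" "C2 n * B m = B m * C2 n"
    and K: "K \<ge> 0"
    and control: "norm (ap (B n) x - ap (B m) x) \<le>
      K * (norm (ap (C1 n) x - ap (C1 m) x) + norm (ap (C2 n) x - ap (C2 m) x))"
    and conv_B: "x \<in> D \<Longrightarrow> (\<lambda>n. ap (B n) x) \<longlonglongrightarrow> A x"
    and conv_C: "x \<in> D \<Longrightarrow> convergent (\<lambda>n. ap (C1 n) x)" "x \<in> D \<Longrightarrow> convergent (\<lambda>n. ap (C2 n) x)"
    and dense: "closure D = UNIV"
begin

definition E :: "nat \<Rightarrow> real \<Rightarrow> 'y bop" where "E n t = exp (t *\<^sub>R B n)"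

lemma E_deriv: "((\<lambda>t. ap (E n t) x) has_vector_derivative ap (B n) (ap (E n t) x)) (at t within T)"
  using bounded_linear.has_vector_derivative[OF ap.bounded_linear_left[of x]
      has_vector_derivative_at_within[OF exp_scaleR_has_vector_derivative_left[of "B n" t], of T]]
  by (simp add: E_def ap_mult)

lemma E_deriv': "((\<lambda>t. ap (E n t) x) has_vector_derivative ap (E n t) (ap (B n) x)) (at t within T)"
  using bounded_linear.has_vector_derivative[OF ap.bounded_linear_left[of x]
      exp_scaleR_has_vector_derivative_right[of "B n" t T]]
  by (simp add: E_def ap_mult)

lemma E_inner: "inner (ap (E n t) x) (ap (E n t) y) = inner x y"
proof -
  let ?f = "\<lambda>t. inner (ap (E n t) x) (ap (E n t) y)"
  have "(?f has_real_derivative 0) (at s)" for s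
  proof -
    have "(?f has_vector_derivative inner (ap (E n s) x) (ap (B n) (ap (E n s) y))
        + inner (ap (B n) (ap (E n s) x)) (ap (E n s) y)) (at s)"
      by (rule bounded_bilinear.has_vector_derivative[OF bounded_bilinear_inner E_deriv E_deriv])
    then show ?thesis unfolding has_real_derivative_iff_has_vector_derivative by (simp add: skew)
  qed
  then have "?f t = ?f 0" by (intro DERIV_isconst_all) blast
  then show ?thesis by (simp add: E_def ap_one)
qed

lemma E_norm: "norm (ap (E n t) x) = norm x"
  using E_inner[of n t x x] by (simp add: norm_eq_sqrt_inner)

lemma E_inverse: "ap (E n t) (ap (E n (- t)) x) = x"
  unfolding E_def ap_mult[symmetric] exp_scaleR_minus_inverse ap_one ..

lemma E_adjoint: "inner (ap (E n t) x) y = inner x (ap (E n (- t)) y)"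
  using E_inner[of n t x "ap (E n (- t)) y"] by (simp add: E_inverse)

text \<open>The path E n (t - s) E m s x leads from E n t x to E m t x. Its derivative is an
  isometry applied to (B m - B n) E m s x, and since the controlling operators commute with E m s,
  the bound no longer contains s: it is a bound by differences of C1 and C2 at x itself.\<close>

lemma E_difference:
  "norm (ap (E n t) x - ap (E m t) x) \<le>
    \<bar>t\<bar> * (K * (norm (ap (C1 n) x - ap (C1 m) x) + norm (ap (C2 n) x - ap (C2 m) x)))"
proof -
  let ?c = "K * (norm (ap (C1 n) x - ap (C1 m) x) + norm (ap (C2 n) x - ap (C2 m) x))"
  define \<psi> where "\<psi> s = ap (E n (t - s)) (ap (E m s) x)" for s
  define \<psi>' where "\<psi>' s = ap (E n (t - s)) (ap (B m) (ap (E m s) x) - ap (B n) (ap (E m s) x))" for s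
  have "(\<psi> has_vector_derivative \<psi>' s) (at s)" for s
  proof -
    have inner_fun: "((\<lambda>s. t - s) has_vector_derivative -1) (at s)"
      by (auto intro!: derivative_eq_intros simp: has_real_derivative_iff_has_vector_derivative[symmetric])
    have "(((\<lambda>s. exp (s *\<^sub>R B n)) \<circ> (\<lambda>s. t - s)) has_vector_derivative (-1) *\<^sub>R (E n (t - s) * B n)) (at s)"
      unfolding E_def by (rule vector_diff_chain_at[OF inner_fun exp_scaleR_has_vector_derivative_right])
    then have "((\<lambda>s. E n (t - s)) has_vector_derivative - (E n (t - s) * B n)) (at s)"
      by (simp add: E_def o_def)
    from bounded_bilinear.has_vector_derivative[OF bounded_bilinear_ap this E_deriv[of m x s UNIV]]
    show ?thesis unfolding \<psi>_def \<psi>'_def by (simp add: ap_mult ap.diff_right ap.minus_left)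
  qed
  then have der: "(\<psi> has_derivative (\<lambda>h. h *\<^sub>R \<psi>' s)) (at s within UNIV)" for s
    unfolding has_vector_derivative_def by simp
  have comm': "ap (C1 i) (ap (E m s) x) = ap (E m s) (ap (C1 i) x)" "ap (C2 i) (ap (E m s) x) = ap (E m s) (ap (C2 i) x)" for i s
    unfolding ap_mult[symmetric] E_def by (subst exp_commute; simp add: comm)+
  have bd: "norm (\<psi>' s) \<le> ?c" for s
  proof -
    have "norm (\<psi>' s) = norm (ap (B n) (ap (E m s) x) - ap (B m) (ap (E m s) x))"
      unfolding \<psi>'_def E_norm by (rule norm_minus_commute)
    also have "\<dots> \<le> K * (norm (ap (C1 n) (ap (E m s) x) - ap (C1 m) (ap (E m s) x))
        + norm (ap (C2 n) (ap (E m s) x) - ap (C2 m) (ap (E m s) x)))" by (rule control)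
    also have "\<dots> = ?c" unfolding comm' ap.diff_right[symmetric] E_norm ..
    finally show ?thesis .
  qed
  have "norm (\<psi> 0 - \<psi> t) \<le> ?c * norm (0 - t)"
  proof (rule differentiable_bound[where S = UNIV and f' = "\<lambda>s h. h *\<^sub>R \<psi>' s"])
    fix s :: real
    show "(\<psi> has_derivative (\<lambda>h. h *\<^sub>R \<psi>' s)) (at s within UNIV)" by (rule der)
    show "onorm (\<lambda>h. h *\<^sub>R \<psi>' s) \<le> ?c"
    proof (rule onorm_le)
      fix h :: real
      have "\<bar>h\<bar> * norm (\<psi>' s) \<le> \<bar>h\<bar> * ?c" using bd[of s] by (rule mult_left_mono) simp
      then show "norm (h *\<^sub>R \<psi>' s) \<le> ?c * norm h" by (simp add: mult.commute)
    qed
  qed simp_all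
  then show ?thesis by (simp add: \<psi>_def E_def ap_one mult.commute)
qed

text \<open>On D the difference estimate is controlled by Cauchy sequences that do not depend on t.
  The isometry of the exponentials carries this to every x, at the cost of twice the distance to a
  point of D.\<close>

lemma E_uniformly_Cauchy: "uniformly_Cauchy_on {-T..T} (\<lambda>n t. ap (E n t) x)"
  unfolding uniformly_Cauchy_on_def
proof (intro allI impI)
  fix e :: real assume e: "e > 0"
  have "x \<in> closure D" using dense by simp
  then obtain z where z: "z \<in> D" "dist z x < e / 4" using e closure_approachable[of x D] by (metis divide_pos_pos zero_less_numeral)
  define c where "c = e / (4 * (\<bar>T\<bar> * K + 1))"
  have TK: "\<bar>T\<bar> * K + 1 > 0" using K by (intro add_nonneg_pos mult_nonneg_nonneg) simp_all
  have c: "c > 0" "\<bar>T\<bar> * K * (c + c) \<le> e / 2"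
  proof -
    show "c > 0" unfolding c_def using e TK by simp
    have "\<bar>T\<bar> * K * (c + c) \<le> (\<bar>T\<bar> * K + 1) * (c + c)" using \<open>c > 0\<close> by (intro mult_right_mono) simp_all
    also have "\<dots> = 2 * ((\<bar>T\<bar> * K + 1) * c)" by (simp only: distrib_left mult_2)
    also have "(\<bar>T\<bar> * K + 1) * c = e / 4"
    proof -
      have "q * (e / (4 * q)) = e / 4" if "q > 0" for q :: real using that by simp
      from this[OF TK] show ?thesis unfolding c_def .
    qed
    also have "2 * (e / 4) = e / 2" by simp
    finally show "\<bar>T\<bar> * K * (c + c) \<le> e / 2" .
  qed
  have "Cauchy (\<lambda>n. ap (C1 n) z)" "Cauchy (\<lambda>n. ap (C2 n) z)"
    using conv_C[OF z(1)] convergent_Cauchy by blast+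
  then obtain M1 M2 where M: "\<And>m n. m \<ge> M1 \<Longrightarrow> n \<ge> M1 \<Longrightarrow> norm (ap (C1 m) z - ap (C1 n) z) < c"
    "\<And>m n. m \<ge> M2 \<Longrightarrow> n \<ge> M2 \<Longrightarrow> norm (ap (C2 m) z - ap (C2 n) z) < c"
    unfolding Cauchy_iff using c(1) by metis
  show "\<exists>M. \<forall>t\<in>{-T..T}. \<forall>m\<ge>M. \<forall>n\<ge>M. dist (ap (E m t) x) (ap (E n t) x) < e"
  proof (intro exI[of _ "max M1 M2"] ballI allI impI)
    fix t m n assume t: "t \<in> {-T..T}" and m: "max M1 M2 \<le> m" and n: "max M1 M2 \<le> n"
    let ?d = "norm (ap (C1 m) z - ap (C1 n) z) + norm (ap (C2 m) z - ap (C2 n) z)"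
    have "?d \<le> c + c" using M(1)[of m n] M(2)[of m n] m n by simp
    then have "\<bar>t\<bar> * (K * ?d) \<le> \<bar>T\<bar> * (K * (c + c))"
      using t K c(1) by (intro mult_mono mult_left_mono mult_nonneg_nonneg add_nonneg_nonneg) auto
    then have 1: "norm (ap (E m t) z - ap (E n t) z) \<le> e / 2"
      using E_difference[of m t z n] c(2) by (simp add: mult.assoc)
    have eq: "ap (E m t) x - ap (E n t) x = ap (E m t) (x - z) + (ap (E m t) z - ap (E n t) z) + ap (E n t) (z - x)"
      by (simp add: ap.diff_right)
    have 2: "norm (ap (E m t) (x - z)) < e / 4" "norm (ap (E n t) (z - x)) < e / 4"
      using z(2) by (simp_all add: E_norm dist_norm norm_minus_commute)
    show "dist (ap (E m t) x) (ap (E n t) x) < e"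
      unfolding dist_norm eq using 1 2 norm_triangle_ineq[of "ap (E m t) (x - z) + (ap (E m t) z - ap (E n t) z)" "ap (E n t) (z - x)"]
        norm_triangle_ineq[of "ap (E m t) (x - z)" "ap (E m t) z - ap (E n t) z"]
      by linarith
  qed
qed

definition S :: "real \<Rightarrow> 'y \<Rightarrow> 'y" where "S t x = lim (\<lambda>n. ap (E n t) x)"

lemma E_uniform_limit: "uniform_limit {-T..T} (\<lambda>n t. ap (E n t) x) (\<lambda>t. S t x) sequentially"
  using Cauchy_uniformly_convergent[OF E_uniformly_Cauchy[of T x]]
  unfolding uniformly_convergent_uniform_limit_iff S_def .

lemma E_tendsto_S: "(\<lambda>n. ap (E n t) x) \<longlonglongrightarrow> S t x"
  by (rule tendsto_uniform_limitI[OF E_uniform_limit[where T = "\<bar>t\<bar>"]]) auto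

lemma S_norm: "norm (S t x) = norm x"
proof -
  have "(\<lambda>n. norm (ap (E n t) x)) \<longlonglongrightarrow> norm (S t x)" by (intro tendsto_norm E_tendsto_S)
  then show ?thesis by (simp add: E_norm LIMSEQ_const_iff)
qed

lemma S_diff: "S t (x - y) = S t x - S t y"
  by (rule LIMSEQ_unique[OF E_tendsto_S])
    (use tendsto_diff[OF E_tendsto_S[of t x] E_tendsto_S[of t y]] in \<open>simp add: ap.diff_right\<close>)

lemma S_scaleR: "S t (c *\<^sub>R x) = c *\<^sub>R S t x"
  by (rule LIMSEQ_unique[OF E_tendsto_S])
    (use tendsto_scaleR[OF tendsto_const[of c] E_tendsto_S[of t x]] in \<open>simp add: ap.scaleR_right\<close>)

lemma S_zero_time: "S 0 x = x"
  using E_tendsto_S[of 0 x] by (simp add: E_def ap_one LIMSEQ_const_iff)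

lemma S_adjoint: "inner (S t x) y = inner x (S (- t) y)"
proof (rule LIMSEQ_unique)
  show "(\<lambda>n. inner (ap (E n t) x) y) \<longlonglongrightarrow> inner (S t x) y" by (intro tendsto_intros E_tendsto_S)
  show "(\<lambda>n. inner (ap (E n t) x) y) \<longlonglongrightarrow> inner x (S (- t) y)"
    unfolding E_adjoint by (intro tendsto_intros E_tendsto_S)
qed

lemma S_continuous_time: "continuous_on UNIV (\<lambda>t. S t x)"
proof -
  have "continuous_on {-T..T} (\<lambda>t. S t x)" for T
  proof (rule uniform_limit_theorem[OF _ E_uniform_limit])
    show "\<forall>\<^sub>F n in sequentially. continuous_on {-T..T} (\<lambda>t. ap (E n t) x)"
    proof (intro always_eventually allI)
      show "continuous_on {-T..T} (\<lambda>t. ap (E n t) x)" for n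
        by (intro continuous_at_imp_continuous_on ballI has_vector_derivative_continuous[OF E_deriv])
    qed
  qed simp
  then have "isCont (\<lambda>t. S t x) t" for t
    by (rule continuous_on_interior[of "{- (\<bar>t\<bar> + 1)..\<bar>t\<bar> + 1}"]) auto
  then show ?thesis by (simp add: continuous_at_imp_continuous_on)
qed

lemma S_tendsto:
  assumes "(f \<longlongrightarrow> t) F" "(h \<longlongrightarrow> x) F" shows "((\<lambda>i. S (f i) (h i)) \<longlongrightarrow> S t x) F"
proof -
  have "isCont (\<lambda>t. S t x) t" using S_continuous_time by (simp add: continuous_on_eq_continuous_at)
  from isCont_tendsto_compose[OF this assms(1)] have 1: "((\<lambda>i. S (f i) x) \<longlongrightarrow> S t x) F" .
  have "((\<lambda>i. h i - x) \<longlongrightarrow> 0) F" using tendsto_diff[OF assms(2) tendsto_const[of x]] by simp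
  then have "((\<lambda>i. S (f i) (h i - x)) \<longlongrightarrow> 0) F"
    unfolding tendsto_norm_zero_iff[of "\<lambda>i. S (f i) (h i - x)", symmetric] S_norm by (rule tendsto_norm_zero)
  from tendsto_add[OF this 1] show ?thesis by (simp add: S_diff)
qed

lemma S_continuous_on:
  assumes "continuous_on X f" "continuous_on X h" shows "continuous_on X (\<lambda>i. S (f i) (h i))"
  using assms unfolding continuous_on_def by (auto intro: S_tendsto)

text \<open>The derivatives E n s (B n x) converge to S s (A x) uniformly on bounded intervals of s,
  so limit and derivative may be exchanged. The derivative is written as S t applied to A x because
  S t x may leave D. The interval reaches beyond |t| so that t is interior.\<close>

lemma S_deriv:
  assumes x: "x \<in> D" shows "((\<lambda>t. S t x) has_vector_derivative S t (A x)) (at t)"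
proof -
  define T where "T = \<bar>t\<bar> + 1"
  have ev: "\<forall>\<^sub>F n in sequentially. \<forall>s\<in>{-T..T}. \<forall>h. norm (h *\<^sub>R ap (E n s) (ap (B n) x) - h *\<^sub>R S s (A x)) \<le> e * norm h"
    if e: "e > 0" for e
  proof -
    have "\<forall>\<^sub>F n in sequentially. dist (ap (B n) x) (A x) < e / 2" by (rule tendstoD[OF conv_B[OF x]]) (use e in simp)
    moreover have "\<forall>\<^sub>F n in sequentially. \<forall>s\<in>{-T..T}. dist (ap (E n s) (A x)) (S s (A x)) < e / 2"
      by (rule uniform_limitD[OF E_uniform_limit]) (use e in simp)
    ultimately show ?thesis
    proof eventually_elim
      case (elim n)
      show ?case
      proof (intro ballI allI)
        fix s h assume s: "s \<in> {-T..T}"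
        have "norm (ap (E n s) (ap (B n) x) - S s (A x)) \<le>
            norm (ap (E n s) (ap (B n) x - A x)) + norm (ap (E n s) (A x) - S s (A x))"
          using norm_triangle_ineq[of "ap (E n s) (ap (B n) x - A x)" "ap (E n s) (A x) - S s (A x)"]
          by (simp add: ap.diff_right)
        also have "\<dots> \<le> e" using elim s by (force simp: E_norm dist_norm)
        finally have "\<bar>h\<bar> * norm (ap (E n s) (ap (B n) x) - S s (A x)) \<le> \<bar>h\<bar> * e"
          by (rule mult_left_mono) simp
        then show "norm (h *\<^sub>R ap (E n s) (ap (B n) x) - h *\<^sub>R S s (A x)) \<le> e * norm h"
          by (simp add: scaleR_diff_right[symmetric] mult.commute)
      qed
    qed
  qed
  obtain g where g: "\<And>s. s \<in> {-T..T} \<Longrightarrow> (\<lambda>n. ap (E n s) x) \<longlonglongrightarrow> g s"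
    "\<And>s. s \<in> {-T..T} \<Longrightarrow> (g has_derivative (\<lambda>h. h *\<^sub>R S s (A x))) (at s within {-T..T})"
  proof -
    have "\<exists>g. \<forall>s\<in>{-T..T}. (\<lambda>n. ap (E n s) x) \<longlonglongrightarrow> g s \<and> (g has_derivative (\<lambda>h. h *\<^sub>R S s (A x))) (at s within {-T..T})"
    proof (rule has_derivative_sequence[where f' = "\<lambda>n s h. h *\<^sub>R ap (E n s) (ap (B n) x)" and ?x0.0 = 0])
      show "((\<lambda>s. ap (E n s) x) has_derivative (\<lambda>h. h *\<^sub>R ap (E n s) (ap (B n) x))) (at s within {-T..T})" for n s
        using E_deriv'[of n x s "{-T..T}"] unfolding has_vector_derivative_def .
      show "(\<lambda>n. ap (E n 0) x) \<longlonglongrightarrow> S 0 x" by (rule E_tendsto_S)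
    qed (use ev in \<open>simp_all add: T_def\<close>)
    then show thesis using that by blast
  qed
  have t: "t \<in> {-T<..<T}" "{-T<..<T} \<subseteq> {-T..T}" by (auto simp: T_def)
  have gS: "g s = S s x" if "s \<in> {-T<..<T}" for s
    using LIMSEQ_unique[OF g(1)[of s] E_tendsto_S[of s x]] that by simp
  have "(g has_vector_derivative S t (A x)) (at t within {-T<..<T})"
    using has_derivative_subset[OF g(2) t(2)] t unfolding has_vector_derivative_def by auto
  then have "(g has_vector_derivative S t (A x)) (at t)"
    using has_vector_derivative_within_open[OF t(1) open_greaterThanLessThan] by blast
  then show ?thesis
    by (rule has_vector_derivative_transform_within_open[of _ _ _ "{-T<..<T}"]) (use t gS in simp_all)
qed

text \<open>Duhamel's formula with S t pulled out of the integral: what remains inside is an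
  indefinite integral, whose derivative is given by the fundamental theorem.\<close>

definition mild :: "'y \<Rightarrow> (real \<Rightarrow> 'y) \<Rightarrow> real \<Rightarrow> 'y" where
  "mild y0 g t = S t (y0 + integral {0..t} (\<lambda>s. S (- s) (g s)))"

lemma mild_zero_time: "mild y0 g 0 = y0"
  by (simp add: mild_def S_zero_time)

lemma mild_integrand_continuous:
  "continuous_on {0..T} g \<Longrightarrow> continuous_on {0..T} (\<lambda>s. S (- s) (g s))"
  by (intro S_continuous_on continuous_intros)

lemma mild_continuous:
  assumes "continuous_on {0..T} g" shows "continuous_on {0..T} (mild y0 g)"
  unfolding mild_def[abs_def]
  by (intro S_continuous_on continuous_intros indefinite_integral_continuous_1
      integrable_continuous_real mild_integrand_continuous assms)

lemma mild_diff_le: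
  assumes g: "continuous_on {0..T} g" "continuous_on {0..T} g'" and t: "t \<in> {0..T}"
    and M: "\<And>s. s \<in> {0..t} \<Longrightarrow> norm (g s - g' s) \<le> M"
  shows "norm (mild y0 g t - mild y0' g' t) \<le> norm (y0 - y0') + t * M"
proof -
  have sub: "{0..t} \<subseteq> {0..T}" using t by auto
  have i: "(\<lambda>s. S (- s) (g s)) integrable_on {0..t}" "(\<lambda>s. S (- s) (g' s)) integrable_on {0..t}"
    by (intro integrable_continuous_real mild_integrand_continuous continuous_on_subset[OF g(1) sub]
        continuous_on_subset[OF g(2) sub])+
  have "mild y0 g t - mild y0' g' t = S t ((y0 + integral {0..t} (\<lambda>s. S (- s) (g s)))
      - (y0' + integral {0..t} (\<lambda>s. S (- s) (g' s))))"
    by (simp only: mild_def S_diff)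
  also have "(y0 + integral {0..t} (\<lambda>s. S (- s) (g s))) - (y0' + integral {0..t} (\<lambda>s. S (- s) (g' s)))
      = (y0 - y0') + integral {0..t} (\<lambda>s. S (- s) (g s) - S (- s) (g' s))"
    by (simp add: Henstock_Kurzweil_Integration.integral_diff[OF i])
  finally have "norm (mild y0 g t - mild y0' g' t) \<le> norm (y0 - y0') + norm (integral {0..t} (\<lambda>s. S (- s) (g s) - S (- s) (g' s)))"
    by (simp add: S_norm norm_triangle_ineq)
  also have "norm (integral {0..t} (\<lambda>s. S (- s) (g s) - S (- s) (g' s))) \<le> M * (t - 0)"
  proof (rule integral_bound)
    show "continuous_on {0..t} (\<lambda>s. S (- s) (g s) - S (- s) (g' s))"
      by (intro continuous_on_diff mild_integrand_continuous continuous_on_subset[OF g(1) sub]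
        continuous_on_subset[OF g(2) sub])
  qed (use t M in \<open>simp_all add: S_diff[symmetric] S_norm\<close>)
  finally show ?thesis by (simp add: mult.commute)
qed

text \<open>Split S (-s) (\<Psi> s) into S (-s) (\<Psi> s - \<Psi> t) and S (-s) (\<Psi> t). The
  first part is differentiated by joint continuity of S, the second by \<open>S_deriv\<close>;
  membership in D enters only at the one time t.\<close>

lemma S_minus_deriv:
  assumes \<Psi>: "(\<Psi> has_vector_derivative \<Psi>') (at t within X)" and D: "\<Psi> t \<in> D"
  shows "((\<lambda>s. S (- s) (\<Psi> s)) has_vector_derivative S (- t) (\<Psi>' - A (\<Psi> t))) (at t within X)"
proof -
  have lin: "((\<lambda>s. - s) has_vector_derivative -1) (at t)"
    by (auto intro!: derivative_eq_intros simp: has_real_derivative_iff_has_vector_derivative[symmetric])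
  have "(((\<lambda>s. S s (\<Psi> t)) \<circ> (\<lambda>s. - s)) has_vector_derivative (-1) *\<^sub>R S (- t) (A (\<Psi> t))) (at t)"
    by (rule vector_diff_chain_at[OF lin S_deriv[OF D]])
  then have 1: "((\<lambda>s. S (- s) (\<Psi> t)) has_vector_derivative - S (- t) (A (\<Psi> t))) (at t within X)"
    by (simp add: o_def has_vector_derivative_at_within)
  have q: "((\<lambda>s. (\<Psi> s - \<Psi> t) /\<^sub>R (s - t)) \<longlongrightarrow> \<Psi>') (at t within X)"
    using \<Psi> by (simp add: has_vector_derivative_within_iff_quotient)
  have "((\<lambda>s. - s) \<longlongrightarrow> - t) (at t within X)" by (intro tendsto_intros)
  from S_tendsto[OF this q] have "((\<lambda>s. S (- s) ((\<Psi> s - \<Psi> t) /\<^sub>R (s - t))) \<longlongrightarrow> S (- t) \<Psi>') (at t within X)" .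
  then have 2: "((\<lambda>s. S (- s) (\<Psi> s - \<Psi> t)) has_vector_derivative S (- t) \<Psi>') (at t within X)"
    by (simp add: has_vector_derivative_within_iff_quotient S_scaleR S_norm[of _ 0] S_diff[of _ x x for x, simplified])
  from has_vector_derivative_add[OF 2 1] show ?thesis by (simp add: S_diff)
qed

text \<open>Since S is unitary, pairing S t z with \<Psi> equals pairing z with S (-t) \<Psi>, so
  the generator acts on the smooth test state alone. With constant \<Psi> this yields the gradient
  constraint and the velocity, with moving \<Psi> the equation in the sense of
  distributions.\<close>

lemma mild_weak_deriv:
  assumes g: "continuous_on {0..T} g" and t: "t \<in> {0..T}"
    and \<Psi>: "(\<Psi> has_vector_derivative \<Psi>') (at t within {0..T})" and D: "\<Psi> t \<in> D"
  shows "((\<lambda>s. inner (mild y0 g s) (\<Psi> s)) has_real_derivative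
    inner (g t) (\<Psi> t) + inner (mild y0 g t) (\<Psi>' - A (\<Psi> t))) (at t within {0..T})"
proof -
  define z where "z t = y0 + integral {0..t} (\<lambda>s. S (- s) (g s))" for t
  have "(z has_vector_derivative S (- t) (g t)) (at t within {0..T})"
    unfolding z_def using has_vector_derivative_add[OF has_vector_derivative_const[of y0]
      integral_has_vector_derivative[OF mild_integrand_continuous[OF g] t]] by simp
  from bounded_bilinear.has_vector_derivative[OF bounded_bilinear_inner this S_minus_deriv[OF \<Psi> D]]
  have "((\<lambda>s. inner (z s) (S (- s) (\<Psi> s))) has_real_derivative
      inner (z t) (S (- t) (\<Psi>' - A (\<Psi> t))) + inner (S (- t) (g t)) (S (- t) (\<Psi> t))) (at t within {0..T})"
    unfolding has_real_derivative_iff_has_vector_derivative .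
  moreover have "inner (S (- t) (g t)) (S (- t) (\<Psi> t)) = inner (g t) (\<Psi> t)"
    by (rule LIMSEQ_unique[OF tendsto_inner[OF E_tendsto_S E_tendsto_S]]) (simp add: E_inner)
  ultimately show ?thesis by (simp add: mild_def z_def S_adjoint add.commute)
qed

end

lemma L2_translate: assumes "L2 f" shows "L2 (\<lambda>x. f (x + z))"
proof -
  have m: "f \<in> borel_measurable borel" "(\<lambda>x. (f x)\<^sup>2) \<in> borel_measurable borel"
    using L2_measurable[OF assms] by simp_all
  have "integrable lborel (\<lambda>x. (f (x + z))\<^sup>2)"
    using integral_lborel_translate(2)[OF m(2), of z] L2_integrable_square[OF assms] by simp
  then show ?thesis using m(1) by (simp add: L2_def)
qed

section \<open>The Klein--Gordon group\<close>

definition tr :: "'a::euclidean_space \<Rightarrow> 'a l2 \<Rightarrow> 'a l2" where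
  "tr z u = toL2 (\<lambda>x. fn u (x + z))"

lemma tr_toL2: assumes "L2 f" shows "tr z (toL2 f) = toL2 (\<lambda>x. f (x + z))"
  unfolding tr_def
  by (rule toL2_eqI[OF AE_lborel_translate[OF fn_toL2[OF assms]] L2_translate[OF L2_fn] L2_translate[OF assms]])

lemma tr_add: "tr z (u + v) = tr z u + tr z v"
proof -
  have "tr z (toL2 (fn u) + toL2 (fn v)) = tr z (toL2 (fn u)) + tr z (toL2 (fn v))"
    unfolding toL2_add[OF L2_fn L2_fn, symmetric] tr_toL2[OF L2_add[OF L2_fn L2_fn]] tr_toL2[OF L2_fn]
    by (rule toL2_add) (intro L2_translate L2_fn)+
  then show ?thesis by simp
qed

lemma tr_scaleR: "tr z (c *\<^sub>R u) = c *\<^sub>R tr z u"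
proof -
  have "tr z (c *\<^sub>R toL2 (fn u)) = c *\<^sub>R tr z (toL2 (fn u))"
    unfolding toL2_cmult[OF L2_fn, symmetric] tr_toL2[OF L2_cmult[OF L2_fn]] tr_toL2[OF L2_fn]
    by (rule toL2_cmult) (intro L2_translate L2_fn)
  then show ?thesis by simp
qed

lemma tr_tr: "tr z (tr w u) = tr (z + w) u"
  unfolding tr_def[of w] tr_def[of "z + w"] tr_toL2[OF L2_translate[OF L2_fn]] by (simp add: add.assoc)

lemma tr_zero: "tr 0 u = u"
  by (simp add: tr_def)

lemma inner_tr: "inner (tr z u) (tr z v) = inner u v"
proof -
  have "inner (tr z u) (tr z v) = (\<integral>x. fn u (x + z) * fn v (x + z) \<partial>lborel)"
    unfolding tr_def by (rule inner_toL2) (intro L2_translate L2_fn)+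
  also have "\<dots> = (\<integral>x. fn u x * fn v x \<partial>lborel)"
    by (rule integral_lborel_translate(1)[of "\<lambda>x. fn u x * fn v x"]) simp
  finally show ?thesis by (simp add: inner_fn)
qed

lemma inner_tr_adjoint: "inner (tr z u) v = inner u (tr (- z) v)"
  using inner_tr[of z u "tr (- z) v"] by (simp add: tr_tr tr_zero)

lemma bounded_linear_tr: "bounded_linear (tr z)"
proof (rule bounded_linear_intro[where K = 1])
  show "norm (tr z u) \<le> norm u * 1" for u using inner_tr[of z u u] by (simp add: norm_eq_sqrt_inner)
qed (rule tr_add tr_scaleR)+

text \<open>Central rather than one-sided differences, with step 1 / (n + 1): translations by h and
  by -h are adjoint to each other, which makes the central difference skew.\<close>

definition cd :: "'a::euclidean_space \<Rightarrow> nat \<Rightarrow> 'a l2 \<Rightarrow> 'a l2" where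
  "cd b n u = (real (Suc n) / 2) *\<^sub>R (tr (b /\<^sub>R real (Suc n)) u - tr (- (b /\<^sub>R real (Suc n))) u)"

lemma bounded_linear_cd: "bounded_linear (cd b n)"
  unfolding cd_def[abs_def]
  by (intro bounded_linear_const_scaleR bounded_linear_sub bounded_linear_tr)

lemma cd_skew: "inner (cd b n u) v = - inner u (cd b n v)"
  by (simp add: cd_def inner_diff_left inner_diff_right inner_tr_adjoint algebra_simps)

lemma tr_cd: "tr z (cd b n u) = cd b n (tr z u)"
proof -
  interpret bounded_linear "tr z" by (rule bounded_linear_tr)
  show ?thesis by (simp only: cd_def scaleR diff tr_tr add.commute)
qed

lemma cd_commute: "cd b n (cd c m u) = cd c m (cd b n u)"
proof -
  interpret bounded_linear "cd c m" by (rule bounded_linear_cd)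
  show ?thesis by (simp only: cd_def[of b n] scaleR diff tr_cd)
qed

lemma cd_test_tendsto:
  fixes \<phi> :: "'a::euclidean_space \<Rightarrow> real"
  assumes \<phi>: "test_fun UNIV \<phi>" and b: "b \<in> Basis"
  shows "(\<lambda>n. cd b n (toL2 \<phi>)) \<longlonglongrightarrow> toL2 (pd b \<phi>)"
proof (rule LIMSEQ_I)
  fix \<epsilon> :: real assume \<epsilon>: "\<epsilon> > 0"
  obtain R where R: "\<And>x. \<phi> x \<noteq> 0 \<Longrightarrow> norm x \<le> R" using \<phi> unfolding test_fun_UNIV_iff by metis
  obtain R' where R': "\<And>x. pd b \<phi> x \<noteq> 0 \<Longrightarrow> norm x \<le> R'" using test_fun_pd[OF \<phi> b] unfolding test_fun_UNIV_iff by metis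
  \<comment> \<open>The steps have length at most 1, so the translates of \<phi> vanish outside the
    radius R + 1, and the derivative vanishes outside R'.\<close>
  define Q where "Q = max (R + 1) R'"
  define m where "m = measure lborel (cball 0 Q :: 'a set) + 1"
  have m: "m > 0" "measure lborel (cball 0 Q :: 'a set) < m"
    unfolding m_def by (intro add_nonneg_pos measure_nonneg) simp_all
  define e where "e = \<epsilon> / sqrt m"
  have e: "e > 0" "e\<^sup>2 * m = \<epsilon>\<^sup>2" using \<epsilon> m by (simp_all add: e_def power_divide)
  obtain d where d: "d > 0" "\<And>x h. 0 < \<bar>h\<bar> \<Longrightarrow> \<bar>h\<bar> < d \<Longrightarrow> \<bar>(\<phi> (x + h *\<^sub>R b) - \<phi> x) / h - pd b \<phi> x\<bar> \<le> e"
    using test_fun_difference_quotient[OF \<phi> b e(1)] by metis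
  obtain N where N: "inverse (real (Suc N)) < d" using reals_Archimedean[OF d(1)] by blast
  show "\<exists>N. \<forall>n\<ge>N. norm (cd b n (toL2 \<phi>) - toL2 (pd b \<phi>)) < \<epsilon>"
  proof (intro exI[of _ N] allI impI)
    fix n assume n: "n \<ge> N"
    define h where "h = inverse (real (Suc n))"
    have h: "0 < h" "h < d" "h \<le> 1"
    proof -
      show "0 < h" by (simp add: h_def)
      have "h \<le> inverse (real (Suc N))" unfolding h_def using n by (intro le_imp_inverse_le) simp_all
      then show "h < d" using N by simp
      show "h \<le> 1" by (simp add: h_def inverse_le_1_iff)
    qed
    define k where "k x = (1 / (2 * h)) * (\<phi> (x + h *\<^sub>R b) - \<phi> (x + - (h *\<^sub>R b)))" for x
    have L\<phi>: "L2 \<phi>" by (rule test_fun_L2[OF \<phi>])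
    note Lp = test_fun_L2[OF test_fun_pd[OF \<phi> b]]
    have Lk: "L2 k" unfolding k_def by (intro L2_cmult L2_diff L2_translate L\<phi>)
    have "cd b n (toL2 \<phi>) = toL2 k"
    proof -
      have "1 / (2 * h) = real (Suc n) / 2" by (simp add: h_def inverse_eq_divide)
      then show ?thesis unfolding k_def cd_def tr_toL2[OF L\<phi>] h_def[symmetric]
        by (simp only: toL2_cmult[OF L2_diff[OF L2_translate[OF L\<phi>] L2_translate[OF L\<phi>]]] toL2_diff[OF L2_translate[OF L\<phi>] L2_translate[OF L\<phi>]])
    qed
    then have "norm (cd b n (toL2 \<phi>) - toL2 (pd b \<phi>)) = norm (toL2 (\<lambda>x. k x - pd b \<phi> x))"
      by (simp add: toL2_diff[OF Lk Lp])
    moreover have "(norm (toL2 (\<lambda>x. k x - pd b \<phi> x)))\<^sup>2 < \<epsilon>\<^sup>2"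
    proof -
      have bd: "\<bar>k x - pd b \<phi> x\<bar> \<le> e" for x
      proof -
        have half: "\<bar>(r + s) / 2\<bar> \<le> e" if "\<bar>r\<bar> \<le> e" "\<bar>s\<bar> \<le> e" for r s :: real
        proof -
          have "\<bar>r + s\<bar> \<le> 2 * e" using abs_triangle_ineq[of r s] that by linarith
          then show ?thesis by simp
        qed
        \<comment> \<open>The central quotient is the mean of the forward and the backward one, each
          within e of the derivative.\<close>
        have eq: "k x - pd b \<phi> x = (((\<phi> (x + h *\<^sub>R b) - \<phi> x) / h - pd b \<phi> x) + ((\<phi> (x + (- h) *\<^sub>R b) - \<phi> x) / (- h) - pd b \<phi> x)) / 2"
          using h by (simp add: k_def field_simps)
        have "\<bar>(\<phi> (x + h *\<^sub>R b) - \<phi> x) / h - pd b \<phi> x\<bar> \<le> e" "\<bar>(\<phi> (x + (- h) *\<^sub>R b) - \<phi> x) / (- h) - pd b \<phi> x\<bar> \<le> e"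
          using d(2)[of h x] d(2)[of "- h" x] h by auto
        then show ?thesis unfolding eq by (rule half)
      qed
      have supp: "norm x \<le> Q" if ne: "k x - pd b \<phi> x \<noteq> 0" for x
      proof (rule ccontr)
        assume x: "\<not> norm x \<le> Q"
        have nb: "norm (h *\<^sub>R b) \<le> 1" using h b by simp
        have "norm (x + h *\<^sub>R b) > R" "norm (x + - (h *\<^sub>R b)) > R"
          using x nb norm_triangle_ineq4[of "x + h *\<^sub>R b" "h *\<^sub>R b"] norm_triangle_ineq[of "x + - (h *\<^sub>R b)" "h *\<^sub>R b"]
          unfolding Q_def by simp_all
        then have "\<phi> (x + h *\<^sub>R b) = 0" "\<phi> (x + - (h *\<^sub>R b)) = 0" using R not_le by blast+
        moreover have "\<not> norm x \<le> R'" using x by (simp add: Q_def)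
        then have "pd b \<phi> x = 0" using R' by blast
        ultimately show False using ne by (simp add: k_def)
      qed
      have "(norm (toL2 (\<lambda>x. k x - pd b \<phi> x)))\<^sup>2 \<le> e\<^sup>2 * measure lborel (cball 0 Q :: 'a set)"
        by (rule bounded_support_L2(3)[OF L2_measurable[OF L2_diff[OF Lk Lp]] bd supp])
      also have "\<dots> < e\<^sup>2 * m" by (rule mult_strict_left_mono) (use m e in simp_all)
      finally show ?thesis by (simp only: e(2))
    qed
    ultimately show "norm (cd b n (toL2 \<phi>) - toL2 (pd b \<phi>)) < \<epsilon>"
      using \<epsilon> by (simp add: power2_less_imp_less)
  qed
qed

text \<open>Makes the product of L2 spaces, the space of states, admissible for the operator
  algebra.\<close>

instance prod :: (perfect_space, topological_space) perfect_space
proof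
  fix x :: "'a \<times> 'b"
  show "\<not> open {x}" using open_image_fst[of "{x}"] not_open_singleton[of "fst x"] by auto
qed

text \<open>The Klein--Gordon system for the states \<open>(\<partial>\<^sub>t u, u, \<partial>\<^sub>1 u, \<partial>\<^sub>2 u)\<close>: the product norm is the
  \<open>H\<^sup>1 \<times> L\<^sup>2\<close> norm, and the generator is skew-adjoint. The operators \<open>KB n\<close> approximate the generator
  \<open>KA\<close>, known on the dense set \<open>KD\<close>; \<open>KC b n\<close> is the difference quotient in all components. The closed
  subspace \<open>G\<close> below consists of the states whose last two components are the gradient of \<open>u\<close>.\<close>

type_synonym ll = "(real^2) l2"
type_synonym st = "ll \<times> ll \<times> ll \<times> ll"

definition e1 :: "real^2" where "e1 = axis 1 1"
definition e2 :: "real^2" where "e2 = axis 2 1"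

lemma Basis_real2: "(Basis :: (real^2) set) = {e1, e2}"
  by (auto simp: Basis_vec_def e1_def e2_def UNIV_2)

lemma e1_Basis: "e1 \<in> Basis" and e2_Basis: "e2 \<in> Basis" and e1_neq_e2: "e1 \<noteq> e2"
  by (auto simp: Basis_real2 e1_def e2_def axis_eq_axis)

definition KB :: "nat \<Rightarrow> st \<Rightarrow> st" where
  "KB n y = (case y of (v, u, p, q) \<Rightarrow> (cd e1 n p + cd e2 n q - u, v, cd e1 n v, cd e2 n v))"

definition KC :: "real^2 \<Rightarrow> nat \<Rightarrow> st \<Rightarrow> st" where
  "KC b n y = (case y of (v, u, p, q) \<Rightarrow> (cd b n v, cd b n u, cd b n p, cd b n q))"

definition KD :: "st set" where
  "KD = {(toL2 a, toL2 b, toL2 c, toL2 d) | a b c d.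
    test_fun UNIV a \<and> test_fun UNIV b \<and> test_fun UNIV c \<and> test_fun UNIV d}"

definition KA :: "st \<Rightarrow> st" where "KA y = lim (\<lambda>n. KB n y)"

lemma bounded_linear_KB: "bounded_linear (KB n)"
proof -
  note bl = bounded_linear_compose[OF bounded_linear_cd]
  have "bounded_linear (\<lambda>y::st. (cd e1 n (fst (snd (snd y))) + cd e2 n (snd (snd (snd y))) - fst (snd y),
      fst y, cd e1 n (fst y), cd e2 n (fst y)))"
    by (intro bounded_linear_Pair bounded_linear_sub bounded_linear_add bl bounded_linear_fst
        bounded_linear_fst_comp bounded_linear_snd_comp bounded_linear_ident)
  then show ?thesis by (simp add: KB_def[abs_def] case_prod_beta')
qed

lemma bounded_linear_KC: "bounded_linear (KC b n)"
proof -
  note bl = bounded_linear_compose[OF bounded_linear_cd]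
  have "bounded_linear (\<lambda>y::st. (cd b n (fst y), cd b n (fst (snd y)), cd b n (fst (snd (snd y))), cd b n (snd (snd (snd y)))))"
    by (intro bounded_linear_Pair bl bounded_linear_fst
        bounded_linear_fst_comp bounded_linear_snd_comp bounded_linear_ident)
  then show ?thesis by (simp add: KC_def[abs_def] case_prod_beta')
qed

lemma KB_tendsto:
  assumes t: "test_fun UNIV a" "test_fun UNIV b" "test_fun UNIV c" "test_fun UNIV d"
  shows "(\<lambda>n. KB n (toL2 a, toL2 b, toL2 c, toL2 d)) \<longlonglongrightarrow>
    (toL2 (pd e1 c) + toL2 (pd e2 d) - toL2 b, toL2 a, toL2 (pd e1 a), toL2 (pd e2 a))"
  unfolding KB_def by (simp, intro tendsto_intros cd_test_tendsto t e1_Basis e2_Basis)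

lemma KA_test:
  assumes t: "test_fun UNIV a" "test_fun UNIV b" "test_fun UNIV c" "test_fun UNIV d"
  shows "KA (toL2 a, toL2 b, toL2 c, toL2 d) =
    (toL2 (pd e1 c) + toL2 (pd e2 d) - toL2 b, toL2 a, toL2 (pd e1 a), toL2 (pd e2 a))"
  unfolding KA_def by (rule limI[OF KB_tendsto[OF t]])

lemma KC_convergent:
  assumes "y \<in> KD" "b \<in> Basis" shows "convergent (\<lambda>n. KC b n y)"
proof -
  obtain p q r s where y: "y = (toL2 p, toL2 q, toL2 r, toL2 s)"
    and t: "test_fun UNIV p" "test_fun UNIV q" "test_fun UNIV r" "test_fun UNIV s"
    using assms(1) unfolding KD_def by blast
  have "(\<lambda>n. KC b n y) \<longlonglongrightarrow> (toL2 (pd b p), toL2 (pd b q), toL2 (pd b r), toL2 (pd b s))"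
    unfolding y KC_def by (simp, intro tendsto_intros cd_test_tendsto t assms(2))
  then show ?thesis by (rule convergentI)
qed

lemma norm_components:
  fixes v :: "'a::real_normed_vector" and u :: "'b::real_normed_vector"
    and p :: "'c::real_normed_vector" and q :: "'d::real_normed_vector"
  shows "norm v \<le> norm (v, u, p, q)" "norm u \<le> norm (v, u, p, q)" "norm p \<le> norm (v, u, p, q)" "norm q \<le> norm (v, u, p, q)"
    "norm (v, u, p, q) \<le> norm v + norm u + norm p + norm q"
proof -
  note 1 = norm_snd_le[of "(u, p, q)" v] norm_snd_le[of "(p, q)" u]
  show "norm v \<le> norm (v, u, p, q)" by (rule norm_fst_le)
  show "norm u \<le> norm (v, u, p, q)" using norm_fst_le[of u "(p, q)"] 1 by linarith
  show "norm p \<le> norm (v, u, p, q)" using norm_fst_le[of p q] 1 by linarith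
  show "norm q \<le> norm (v, u, p, q)" using norm_snd_le[of q p] 1 by linarith
  show "norm (v, u, p, q) \<le> norm v + norm u + norm p + norm q"
    using norm_Pair_le[of v "(u, p, q)"] norm_Pair_le[of u "(p, q)"] norm_Pair_le[of p q] by linarith
qed

lemma KD_dense: "closure KD = UNIV"
proof -
  have "y \<in> closure KD" for y
  proof -
    obtain v u p q where y: "y = (v, u, p, q)" by (cases y) auto
    show ?thesis unfolding closure_approachable
    proof (intro allI impI)
      fix e :: real assume "e > 0"
      then have e: "e / 4 > 0" by simp
      obtain a where a: "test_fun UNIV a" "norm (toL2 a - v) < e / 4" by (rule test_fun_dense_L2[OF e])
      obtain b where b: "test_fun UNIV b" "norm (toL2 b - u) < e / 4" by (rule test_fun_dense_L2[OF e])
      obtain c where c: "test_fun UNIV c" "norm (toL2 c - p) < e / 4" by (rule test_fun_dense_L2[OF e])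
      obtain d where d: "test_fun UNIV d" "norm (toL2 d - q) < e / 4" by (rule test_fun_dense_L2[OF e])
      have "dist (toL2 a, toL2 b, toL2 c, toL2 d) y < e"
        using norm_components(5)[of "toL2 a - v" "toL2 b - u" "toL2 c - p" "toL2 d - q"] a(2) b(2) c(2) d(2)
        unfolding dist_norm y by simp
      moreover have "(toL2 a, toL2 b, toL2 c, toL2 d) \<in> KD" unfolding KD_def using a(1) b(1) c(1) d(1) by blast
      ultimately show "\<exists>z\<in>KD. dist z y < e" by blast
    qed
  qed
  then show ?thesis by blast
qed

interpretation kg: skew_approx "\<lambda>n. mkop (KB n)" "\<lambda>n. mkop (KC e1 n)" "\<lambda>n. mkop (KC e2 n)" 2 KD KA
proof
  have add: "cd b n (x + y) = cd b n x + cd b n y" "cd b n (x - y) = cd b n x - cd b n y" for b n and x y :: ll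
    using bounded_linear_cd[of b n] by (simp_all add: linear_add linear_diff bounded_linear.linear)
  note apB = ap_mkop[OF bounded_linear_KB] and apC = ap_mkop[OF bounded_linear_KC]
  show "inner (ap (mkop (KB n)) x) y = - inner x (ap (mkop (KB n)) y)" for n x y
  proof -
    obtain v u p q v' u' p' q' where xy: "x = (v, u, p, q)" "y = (v', u', p', q')" by (cases x; cases y) auto
    show ?thesis unfolding apB KB_def xy
      by (simp add: inner_add_left inner_add_right inner_diff_left inner_diff_right cd_skew)
  qed
  show "mkop (KC e1 n) * mkop (KB m) = mkop (KB m) * mkop (KC e1 n)" for n m
    by (rule bop_eqI) (simp add: ap_mult apB apC KB_def KC_def case_prod_beta add cd_commute[of e1 n])
  show "mkop (KC e2 n) * mkop (KB m) = mkop (KB m) * mkop (KC e2 n)" for n m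
    by (rule bop_eqI) (simp add: ap_mult apB apC KB_def KC_def case_prod_beta add cd_commute[of e2 n])
  show "norm (ap (mkop (KB n)) x - ap (mkop (KB m)) x) \<le>
      2 * (norm (ap (mkop (KC e1 n)) x - ap (mkop (KC e1 m)) x) + norm (ap (mkop (KC e2 n)) x - ap (mkop (KC e2 m)) x))" for n m x
  proof -
    obtain v u p q where x: "x = (v, u, p, q)" by (cases x) auto
    define d :: "real^2 \<Rightarrow> ll \<Rightarrow> ll" where "d b w = cd b n w - cd b m w" for b w
    \<comment> \<open>The mass terms \<open>- u\<close> and \<open>v\<close> do not depend on n and
      cancel. For each direction one component of p or q and one of v remain, both bounded by the
      same norm of a \<open>KC\<close> difference, which gives the factor 2.\<close>
    have B: "KB n x - KB m x = (d e1 p + d e2 q, 0, d e1 v, d e2 v)" unfolding x KB_def d_def by simp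
    have C: "KC b n x - KC b m x = (d b v, d b u, d b p, d b q)" for b unfolding x KC_def d_def by simp
    show ?thesis unfolding apB apC B C
      using norm_components(5)[of "d e1 p + d e2 q" "0::ll" "d e1 v" "d e2 v"] norm_triangle_ineq[of "d e1 p" "d e2 q"]
        norm_components(1,3)[where v = "d e1 v" and u = "d e1 u" and p = "d e1 p" and q = "d e1 q"]
        norm_components(1,4)[where v = "d e2 v" and u = "d e2 u" and p = "d e2 p" and q = "d e2 q"]
      by simp
  qed
  show "(\<lambda>n. ap (mkop (KB n)) x) \<longlonglongrightarrow> KA x" if D: "x \<in> KD" for x
  proof -
    obtain a b c d where x: "x = (toL2 a, toL2 b, toL2 c, toL2 d)"
      and t: "test_fun UNIV a" "test_fun UNIV b" "test_fun UNIV c" "test_fun UNIV d"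
      using D unfolding KD_def by blast
    show ?thesis unfolding apB x KA_test[OF t] by (rule KB_tendsto[OF t])
  qed
  show "convergent (\<lambda>n. ap (mkop (KC e1 n)) x)" "convergent (\<lambda>n. ap (mkop (KC e2 n)) x)" if "x \<in> KD" for x
    unfolding apC by (rule KC_convergent[OF that e1_Basis], rule KC_convergent[OF that e2_Basis])
  show "closure KD = UNIV" by (rule KD_dense)
qed simp

definition G :: "st set" where
  "G = {y. wp e1 (fst (snd y)) (fst (snd (snd y))) \<and> wp e2 (fst (snd y)) (snd (snd (snd y)))}"

lemma G_iff: "(v, u, p, q) \<in> G \<longleftrightarrow> wp e1 u p \<and> wp e2 u q"
  by (simp add: G_def)

lemma G_diff: "x \<in> G \<Longrightarrow> y \<in> G \<Longrightarrow> x - y \<in> G"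
  by (auto simp: G_def wp_diff)

lemma closed_G: "closed G"
proof -
  have eq: "G = (\<lambda>y. (fst (snd y), fst (snd (snd y)))) -` {z. wp e1 (fst z) (snd z)}
      \<inter> (\<lambda>y. (fst (snd y), snd (snd (snd y)))) -` {z. wp e2 (fst z) (snd z)}"
    by (auto simp: G_def)
  show ?thesis unfolding eq by (intro closed_Int closed_vimage closed_wp continuous_intros)
qed

lemma zero_derivative_const:
  assumes "\<And>t. t \<in> {0..T} \<Longrightarrow> (f has_real_derivative 0) (at t within {0..T})" "t \<in> {0..T}"
  shows "f t = f (0::real)"
proof -
  obtain c where c: "\<And>s. s \<in> {0..T} \<Longrightarrow> f s = c"
    using has_field_derivative_zero_constant[of "{0..T}" f] assms(1) by auto
  have "0 \<in> {0..T}" using assms(2) by auto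
  then show ?thesis using c assms(2) by simp
qed

lemmas test_fun_0 = test_fun_zero[where 'a = "real^2"]

lemma pd_const: "pd b (\<lambda>x. c) = (\<lambda>x. 0)"
  by (intro ext pd_eqI) simp

lemma KA_simps:
  assumes "test_fun UNIV a" "test_fun UNIV b"
  shows "KA (toL2 a, toL2 b, 0, 0) = (- toL2 b, toL2 a, toL2 (pd e1 a), toL2 (pd e2 a))"
    "KA (0, toL2 b, toL2 a, 0) = (toL2 (pd e1 a) - toL2 b, 0, 0, 0)"
    "KA (0, toL2 b, 0, toL2 a) = (toL2 (pd e2 a) - toL2 b, 0, 0, 0)"
  using KA_test[OF assms(1) assms(2) test_fun_0 test_fun_0]
    KA_test[OF test_fun_0 assms(2) assms(1) test_fun_0] KA_test[OF test_fun_0 assms(2) test_fun_0 assms(1)]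
  by (simp_all add: toL2_zero pd_const)

lemma KD_I:
  assumes "test_fun UNIV a" "test_fun UNIV b"
  shows "(toL2 a, toL2 b, 0, 0) \<in> KD" "(0, toL2 b, toL2 a, 0) \<in> KD" "(0, toL2 b, 0, toL2 a) \<in> KD"
  unfolding KD_def using assms test_fun_0 toL2_zero[where 'a = "real^2"] by (force intro: exI[of _ "\<lambda>x. 0"])+

text \<open>Pairing the solution with a state \<Psi> such that \<open>KA \<Psi> = 0\<close> and
  \<open>fst \<Psi> = 0\<close> gives a quantity that is constant in time. The states built from
  (\<partial>_i \<phi>, \<phi>) are of this kind, and the vanishing of these pairings is exactly the
  weak derivative relation, so it is inherited from the initial state.\<close>

lemma mild_G:
  assumes y0: "y0 \<in> G" and f: "continuous_on {0..T} f" and t: "t \<in> {0..T}"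
  shows "kg.mild y0 (\<lambda>s. (f s, 0, 0, 0)) t \<in> G"
proof -
  let ?g = "\<lambda>s. (f s, 0, 0, 0) :: st" and ?y = "kg.mild y0 (\<lambda>s. (f s, 0, 0, 0))"
  have g: "continuous_on {0..T} ?g" by (intro continuous_intros f)
  have c: "inner (?y t) \<Psi> = inner y0 \<Psi>" if "\<Psi> \<in> KD" "KA \<Psi> = 0" "fst \<Psi> = 0" for \<Psi>
  proof -
    have "((\<lambda>s. inner (?y s) \<Psi>) has_real_derivative 0) (at s within {0..T})" if s: "s \<in> {0..T}" for s
      using kg.mild_weak_deriv[OF g s has_vector_derivative_const[of \<Psi>] \<open>\<Psi> \<in> KD\<close>, of y0] \<open>KA \<Psi> = 0\<close> \<open>fst \<Psi> = 0\<close>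
      by (cases \<Psi>) simp
    from zero_derivative_const[OF this t] show ?thesis by (simp add: kg.mild_zero_time)
  qed
  obtain v u p q where y: "?y t = (v, u, p, q)" by (cases "?y t") auto
  obtain v0 u0 p0 q0 where y0': "y0 = (v0, u0, p0, q0)" by (cases y0) auto
  have "wp e1 u p" unfolding wp_def
  proof (intro allI impI)
    fix \<phi> :: "real^2 \<Rightarrow> real" assume \<phi>: "test_fun UNIV \<phi>"
    have t1: "test_fun UNIV (pd e1 \<phi>)" by (rule test_fun_pd[OF \<phi> e1_Basis])
    have "inner u (toL2 (pd e1 \<phi>)) + inner p (toL2 \<phi>) = inner u0 (toL2 (pd e1 \<phi>)) + inner p0 (toL2 \<phi>)"
    proof -
      have "KA (0, toL2 (pd e1 \<phi>), toL2 \<phi>, 0) = 0" unfolding KA_simps(2)[OF \<phi> t1] by (simp add: zero_prod_def)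
      from c[OF KD_I(2)[OF \<phi> t1] this, unfolded y] show ?thesis by (simp add: y0')
    qed
    then show "inner u (toL2 (pd e1 \<phi>)) = - inner p (toL2 \<phi>)"
      using y0 \<phi> unfolding y0' G_iff wp_def by simp
  qed
  moreover have "wp e2 u q" unfolding wp_def
  proof (intro allI impI)
    fix \<phi> :: "real^2 \<Rightarrow> real" assume \<phi>: "test_fun UNIV \<phi>"
    have t1: "test_fun UNIV (pd e2 \<phi>)" by (rule test_fun_pd[OF \<phi> e2_Basis])
    have "inner u (toL2 (pd e2 \<phi>)) + inner q (toL2 \<phi>) = inner u0 (toL2 (pd e2 \<phi>)) + inner q0 (toL2 \<phi>)"
    proof -
      have "KA (0, toL2 (pd e2 \<phi>), 0, toL2 \<phi>) = 0" unfolding KA_simps(3)[OF \<phi> t1] by (simp add: zero_prod_def)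
      from c[OF KD_I(3)[OF \<phi> t1] this, unfolded y] show ?thesis by (simp add: y0')
    qed
    then show "inner u (toL2 (pd e2 \<phi>)) = - inner q (toL2 \<phi>)"
      using y0 \<phi> unfolding y0' G_iff wp_def by simp
  qed
  ultimately show ?thesis unfolding y G_iff by blast
qed

text \<open>The test state (0, \<phi>, 0, 0) is sent by \<open>KA\<close> to (-\<phi>, 0, 0, 0), so
  the pairing of u with \<phi> has the derivative given by pairing v with \<phi>. This identifies u
  with U, the integral of the continuous function v, and U is differentiable in norm.\<close>

lemma mild_velocity:
  fixes y0 :: st
  assumes f: "continuous_on {0..T} f" and t: "t \<in> {0..T}"
  defines "y \<equiv> kg.mild y0 (\<lambda>s. (f s, 0, 0, 0))"
  shows "((\<lambda>s. fst (snd (y s))) has_vector_derivative fst (y t)) (at t within {0..T})"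
proof -
  let ?g = "\<lambda>s. (f s, 0, 0, 0) :: st"
  have g: "continuous_on {0..T} ?g" by (intro continuous_intros f)
  have yc: "continuous_on {0..T} y" unfolding y_def by (rule kg.mild_continuous[OF g])
  define U where "U s = fst (snd y0) + integral {0..s} (\<lambda>r. fst (y r))" for s
  have U: "(U has_vector_derivative fst (y s)) (at s within {0..T})" if "s \<in> {0..T}" for s
    unfolding U_def using has_vector_derivative_add[OF has_vector_derivative_const[of "fst (snd y0)"]
        integral_has_vector_derivative[OF continuous_on_fst[OF yc] that]] by simp
  have "fst (snd (y s)) = U s" if s: "s \<in> {0..T}" for s
  proof (rule l2_eqI)
    fix \<phi> :: "real^2 \<Rightarrow> real" assume \<phi>: "test_fun UNIV \<phi>"
    let ?\<Psi> = "(0, toL2 \<phi>, 0, 0) :: st"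
    have "((\<lambda>s. inner (y s) ?\<Psi> - inner (U s) (toL2 \<phi>)) has_real_derivative 0) (at r within {0..T})" if r: "r \<in> {0..T}" for r
    proof -
      have D: "?\<Psi> \<in> KD" "KA ?\<Psi> = (- toL2 \<phi>, 0, 0, 0)"
        using KD_I(1)[OF test_fun_0 \<phi>] KA_simps(1)[OF test_fun_0 \<phi>] by (simp_all add: toL2_zero pd_const)
      have "((\<lambda>s. inner (y s) ?\<Psi>) has_real_derivative inner (fst (y r)) (toL2 \<phi>)) (at r within {0..T})"
        using kg.mild_weak_deriv[OF g r has_vector_derivative_const[of ?\<Psi>] D(1), of y0] unfolding D(2) y_def
        by (cases "kg.mild y0 ?g r") simp
      moreover have "((\<lambda>s. inner (U s) (toL2 \<phi>)) has_real_derivative inner (fst (y r)) (toL2 \<phi>)) (at r within {0..T})"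
        unfolding has_real_derivative_iff_has_vector_derivative
        by (rule bounded_linear.has_vector_derivative[OF bounded_linear_inner_left U[OF r]])
      ultimately show ?thesis using DERIV_diff by fastforce
    qed
    from zero_derivative_const[OF this s] show "inner (fst (snd (y s))) (toL2 \<phi>) = inner (U s) (toL2 \<phi>)"
      by (cases "y s"; cases y0) (simp add: y_def kg.mild_zero_time U_def)
  qed
  then show ?thesis
    using has_vector_derivative_transform[OF t _ U[OF t]] by metis
qed

section \<open>Space-time test functions and the equation in the sense of distributions\<close>

lemma test_fun_slice:
  fixes \<phi> :: "real \<times> 'b::euclidean_space \<Rightarrow> real"
  assumes "test_fun UNIV \<phi>" shows "test_fun UNIV (\<lambda>x. \<phi> (t, x))"
proof -
  obtain R where R: "\<And>z. \<phi> z \<noteq> 0 \<Longrightarrow> norm z \<le> R" using assms unfolding test_fun_UNIV_iff by metis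
  have "norm x \<le> R" if "\<phi> (t, x) \<noteq> 0" for x
    by (rule order_trans[OF norm_snd_le[of x t] R[OF that]])
  then show ?thesis using assms smooth_fun_slice unfolding test_fun_UNIV_iff by blast
qed

text \<open>The time difference quotients converge uniformly in x and live in one fixed ball, so
  they converge in L2.\<close>

lemma slice_time_derivative:
  fixes \<phi> :: "real \<times> 'b::euclidean_space \<Rightarrow> real"
  assumes \<phi>: "test_fun UNIV \<phi>"
  shows "((\<lambda>t. toL2 (\<lambda>x. \<phi> (t, x))) has_vector_derivative toL2 (\<lambda>x. pd (1, 0) \<phi> (t, x))) (at t within X)"
  unfolding has_vector_derivative_within_iff_quotient
proof (rule tendsto_within_subset[OF _ subset_UNIV])
  have b: "(1, 0) \<in> (Basis :: (real \<times> 'b) set)" by (simp add: Basis_prod_def)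
  let ?L = "\<lambda>t. toL2 (\<lambda>x. \<phi> (t, x))" and ?L' = "toL2 (\<lambda>x. pd (1, 0) \<phi> (t, x))"
  show "((\<lambda>s. (?L s - ?L t) /\<^sub>R (s - t)) \<longlongrightarrow> ?L') (at t)"
  proof (rule LIM_I)
    fix \<epsilon> :: real assume \<epsilon>: "\<epsilon> > 0"
    obtain R where R: "\<And>z. \<phi> z \<noteq> 0 \<Longrightarrow> norm z \<le> R" using \<phi> unfolding test_fun_UNIV_iff by metis
    obtain R' where R': "\<And>z. pd (1, 0) \<phi> z \<noteq> 0 \<Longrightarrow> norm z \<le> R'" using test_fun_pd[OF \<phi> b] unfolding test_fun_UNIV_iff by metis
    define Q where "Q = max R R'"
    have R2: "norm x \<le> Q" if "\<phi> (s, x) \<noteq> 0 \<or> pd (1, 0) \<phi> (s, x) \<noteq> 0" for s x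
      using norm_snd_le[of x s] R[of "(s, x)"] R'[of "(s, x)"] that unfolding Q_def by auto
    define m where "m = measure lborel (cball 0 Q :: 'b set) + 1"
    have m: "m > 0" "measure lborel (cball 0 Q :: 'b set) < m"
      unfolding m_def by (intro add_nonneg_pos measure_nonneg) simp_all
    define e where "e = \<epsilon> / sqrt m"
    have e: "e > 0" "e\<^sup>2 * m = \<epsilon>\<^sup>2" using \<epsilon> m by (simp_all add: e_def power_divide)
    obtain d where d: "d > 0"
      "\<And>z h. 0 < \<bar>h\<bar> \<Longrightarrow> \<bar>h\<bar> < d \<Longrightarrow> \<bar>(\<phi> (z + h *\<^sub>R (1, 0)) - \<phi> z) / h - pd (1, 0) \<phi> z\<bar> \<le> e"
      using test_fun_difference_quotient[OF \<phi> b e(1)] by metis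
    show "\<exists>r>0. \<forall>s. s \<noteq> t \<and> norm (s - t) < r \<longrightarrow> norm ((?L s - ?L t) /\<^sub>R (s - t) - ?L') < \<epsilon>"
    proof (intro exI[of _ d] conjI d(1) allI impI)
      fix s assume "s \<noteq> t \<and> norm (s - t) < d"
      then have h: "0 < \<bar>s - t\<bar>" "\<bar>s - t\<bar> < d" by auto
      define k where "k x = inverse (s - t) * (\<phi> (s, x) - \<phi> (t, x)) - pd (1, 0) \<phi> (t, x)" for x
      have L: "L2 (\<lambda>x. \<phi> (s, x))" "L2 (\<lambda>x. \<phi> (t, x))" "L2 (\<lambda>x. pd (1, 0) \<phi> (t, x))"
        by (intro test_fun_L2 test_fun_slice \<phi> test_fun_pd b)+
      have Lk: "L2 k" unfolding k_def by (intro L2_diff L2_cmult L)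
      have eq: "(?L s - ?L t) /\<^sub>R (s - t) - ?L' = toL2 k"
        unfolding k_def by (simp only: toL2_diff[OF L2_cmult[OF L2_diff[OF L(1,2)]] L(3)] toL2_cmult[OF L2_diff[OF L(1,2)]] toL2_diff[OF L(1,2)])
      have "(norm (toL2 k))\<^sup>2 \<le> e\<^sup>2 * measure lborel (cball 0 Q :: 'b set)"
      proof (rule bounded_support_L2(3)[OF L2_measurable[OF Lk]])
        show "\<bar>k x\<bar> \<le> e" for x using d(2)[OF h, of "(t, x)"] by (simp add: k_def inverse_eq_divide)
        show "norm x \<le> Q" if "k x \<noteq> 0" for x
          using that R2[of s x] R2[of t x] unfolding k_def by force
      qed
      also have "\<dots> < e\<^sup>2 * m" by (rule mult_strict_left_mono) (use m e in simp_all)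
      also have "\<dots> = \<epsilon>\<^sup>2" by (rule e(2))
      finally show "norm ((?L s - ?L t) /\<^sub>R (s - t) - ?L') < \<epsilon>"
        unfolding eq using \<epsilon> by (simp add: power2_less_imp_less)
    qed
  qed
qed

lemma continuous_on_slice:
  fixes \<phi> :: "real \<times> 'b::euclidean_space \<Rightarrow> real"
  assumes "test_fun UNIV \<phi>" shows "continuous_on X (\<lambda>t. toL2 (\<lambda>x. \<phi> (t, x)))"
  by (intro continuous_at_imp_continuous_on ballI has_vector_derivative_continuous[OF slice_time_derivative[OF assms]])

text \<open>The moving test state is (\<phi>, -\<partial>_t \<phi>, 0, 0). Its time derivative and
  its image under \<open>KA\<close> have the same first component, so the velocity drops out of the
  derivative of M. The pairings of p and q with the gradient of \<phi> turn into the Laplacian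
  through \<open>mild_G\<close>, and M vanishes at both ends since \<phi> has support in the open
  interval.\<close>

lemma mild_space_time:
  fixes \<phi> :: "real \<times> (real^2) \<Rightarrow> real"
  assumes y0: "y0 \<in> G" and f: "continuous_on {0..T} f" and \<phi>: "test_fun ({0<..<T} \<times> UNIV) \<phi>" and T: "T \<ge> 0"
  defines "u \<equiv> \<lambda>s. fst (snd (kg.mild y0 (\<lambda>s. (f s, 0, 0, 0)) s))"
  shows "((\<lambda>t. inner (f t - u t) (toL2 (\<lambda>x. \<phi> (t, x))) - inner (u t) (toL2 (\<lambda>x. dtt \<phi> (t, x) - lap_x \<phi> (t, x))))
    has_integral 0) {0..T}"
proof -
  let ?g = "\<lambda>s. (f s, 0, 0, 0) :: st" and ?y = "kg.mild y0 (\<lambda>s. (f s, 0, 0, 0))"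
  have g: "continuous_on {0..T} ?g" by (intro continuous_intros f)
  have \<phi>U: "test_fun UNIV \<phi>" by (rule test_fun_mono[OF \<phi>]) simp
  have b: "(1, 0) \<in> (Basis :: (real \<times> (real^2)) set)" "(0, e1) \<in> (Basis :: (real \<times> (real^2)) set)" "(0, e2) \<in> (Basis :: (real \<times> (real^2)) set)"
    using e1_Basis e2_Basis by (simp_all add: Basis_prod_def)
  note t1 = test_fun_pd[OF \<phi>U b(1)]
  note t2 = test_fun_pd[OF t1 b(1)]
  define P where "P t = toL2 (\<lambda>x. \<phi> (t, x))" for t
  define P1 where "P1 t = toL2 (\<lambda>x. pd (1, 0) \<phi> (t, x))" for t
  define P2 where "P2 t = toL2 (\<lambda>x. pd (1, 0) (pd (1, 0) \<phi>) (t, x))" for t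
  define M where "M t = inner (?y t) (P t, - P1 t, 0, 0)" for t
  have neg: "- P1 t = toL2 (\<lambda>x. (-1) * pd (1, 0) \<phi> (t, x))" "test_fun UNIV (\<lambda>x. (-1) * pd (1, 0) \<phi> (t, x))" for t
    unfolding P1_def using toL2_uminus[OF test_fun_L2[OF test_fun_slice[OF t1]]] test_fun_cmult[OF test_fun_slice[OF t1], of "-1"] by simp_all
  have slice: "pd b (\<lambda>x. \<phi> (t, x)) = (\<lambda>x. pd (0, b) \<phi> (t, x))" for b t and \<phi> :: "real \<times> (real^2) \<Rightarrow> real"
    by (rule ext) (rule pd_slice)
  have der: "(M has_real_derivative inner (f t - u t) (P t) - inner (u t) (toL2 (\<lambda>x. dtt \<phi> (t, x) - lap_x \<phi> (t, x)))) (at t within {0..T})"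
    if t: "t \<in> {0..T}" for t
  proof -
    obtain v u' p q where y: "?y t = (v, u', p, q)" by (cases "?y t") auto
    have u': "u t = u'" by (simp add: u_def y)
    have wp: "wp e1 u' p" "wp e2 u' q" using mild_G[OF y0 f t] unfolding y G_iff by blast+
    have D: "(P t, - P1 t, 0, 0) \<in> KD" unfolding neg(1) P_def by (rule KD_I(1)[OF test_fun_slice[OF \<phi>U] neg(2)])
    have A: "KA (P t, - P1 t, 0, 0) = (P1 t, P t, toL2 (\<lambda>x. pd (0, e1) \<phi> (t, x)), toL2 (\<lambda>x. pd (0, e2) \<phi> (t, x)))"
    proof -
      have "KA (P t, - P1 t, 0, 0) = (- (- P1 t), P t, toL2 (pd e1 (\<lambda>x. \<phi> (t, x))), toL2 (pd e2 (\<lambda>x. \<phi> (t, x))))"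
        unfolding neg(1) P_def by (rule KA_simps(1)[OF test_fun_slice[OF \<phi>U] neg(2)])
      then show ?thesis by (simp only: slice minus_minus)
    qed
    have "((\<lambda>t. (P t, - P1 t, 0, 0) :: st) has_vector_derivative (P1 t, - P2 t, 0, 0)) (at t within {0..T})"
      unfolding P_def P1_def P2_def
      by (intro has_vector_derivative_Pair has_vector_derivative_minus has_vector_derivative_const slice_time_derivative \<phi>U t1)
    from kg.mild_weak_deriv[OF g t this D, of y0]
    have 1: "(M has_real_derivative inner (f t) (P t) - inner u' (P2 t) - inner u' (P t)
        - inner p (toL2 (\<lambda>x. pd (0, e1) \<phi> (t, x))) - inner q (toL2 (\<lambda>x. pd (0, e2) \<phi> (t, x)))) (at t within {0..T})"
      unfolding A M_def y by (simp add: inner_diff_right algebra_simps)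
    have s1: "test_fun UNIV (\<lambda>x. pd (0, e1) \<phi> (t, x))" "test_fun UNIV (\<lambda>x. pd (0, e2) \<phi> (t, x))"
      by (intro test_fun_slice test_fun_pd \<phi>U b)+
    have s2: "test_fun UNIV (\<lambda>x. pd (0, e1) (pd (0, e1) \<phi>) (t, x))" "test_fun UNIV (\<lambda>x. pd (0, e2) (pd (0, e2) \<phi>) (t, x))"
      by (intro test_fun_slice test_fun_pd \<phi>U b)+
    have 2: "inner u' (toL2 (\<lambda>x. pd (0, e1) (pd (0, e1) \<phi>) (t, x))) = - inner p (toL2 (\<lambda>x. pd (0, e1) \<phi> (t, x)))"
      "inner u' (toL2 (\<lambda>x. pd (0, e2) (pd (0, e2) \<phi>) (t, x))) = - inner q (toL2 (\<lambda>x. pd (0, e2) \<phi> (t, x)))"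
      using wp[unfolded wp_def, rule_format, OF s1(1)] wp(2)[unfolded wp_def, rule_format, OF s1(2)]
      by (simp_all add: slice)
    have "(\<lambda>x. dtt \<phi> (t, x) - lap_x \<phi> (t, x)) = (\<lambda>x. pd (1, 0) (pd (1, 0) \<phi>) (t, x)
        - (pd (0, e1) (pd (0, e1) \<phi>) (t, x) + pd (0, e2) (pd (0, e2) \<phi>) (t, x)))"
      using e1_neq_e2 by (simp add: dtt_def lap_x_def Basis_real2)
    then have "toL2 (\<lambda>x. dtt \<phi> (t, x) - lap_x \<phi> (t, x)) = P2 t
        - (toL2 (\<lambda>x. pd (0, e1) (pd (0, e1) \<phi>) (t, x)) + toL2 (\<lambda>x. pd (0, e2) (pd (0, e2) \<phi>) (t, x)))"
      unfolding P2_def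
      by (simp only: toL2_diff[OF test_fun_L2[OF test_fun_slice[OF t2]] L2_add[OF test_fun_L2[OF s2(1)] test_fun_L2[OF s2(2)]]]
          toL2_add[OF test_fun_L2[OF s2(1)] test_fun_L2[OF s2(2)]])
    then have "inner (f t) (P t) - inner u' (P2 t) - inner u' (P t)
        - inner p (toL2 (\<lambda>x. pd (0, e1) \<phi> (t, x))) - inner q (toL2 (\<lambda>x. pd (0, e2) \<phi> (t, x)))
      = inner (f t - u t) (P t) - inner (u t) (toL2 (\<lambda>x. dtt \<phi> (t, x) - lap_x \<phi> (t, x)))"
      using 2 by (simp add: u' inner_diff_left inner_diff_right inner_add_right)
    then show ?thesis using 1 by simp
  qed
  have z: "\<phi> (s, x) = 0 \<and> pd (1, 0) \<phi> (s, x) = 0" if "s = 0 \<or> s = T" for s x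
  proof -
    have "(s, x) \<notin> closure {z. \<phi> z \<noteq> 0}" using \<phi> that unfolding test_fun_def by auto
    then show ?thesis using closure_subset[of "{z. \<phi> z \<noteq> 0}"] pd_eq_0_outside[of "(s, x)" \<phi>] by blast
  qed
  have "M T = 0" "M 0 = 0" unfolding M_def P_def P1_def by (simp_all add: z toL2_zero zero_prod_def[symmetric])
  with fundamental_theorem_of_calculus[OF T der[unfolded has_real_derivative_iff_has_vector_derivative]]
  show ?thesis by (simp add: P_def)
qed

section \<open>Iterated integrals on the plane\<close>

lemma e_simps: "inner e1 e1 = 1" "inner e1 e2 = 0" "inner e2 e1 = 0" "inner e2 e2 = 1"
  by (simp_all add: e1_def e2_def inner_axis_axis)

text \<open>Lebesgue measure is determined by its values on boxes. The identification with
  \<open>real \<times> real\<close> gives access to Tonelli's theorem.\<close>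

lemma distr_lborel_real2:
  "distr (lborel :: (real \<times> real) measure) borel (\<lambda>z. fst z *\<^sub>R e1 + snd z *\<^sub>R e2) = (lborel :: (real^2) measure)"
proof (rule lborel_eqI[symmetric])
  let ?J = "\<lambda>z :: real \<times> real. fst z *\<^sub>R e1 + snd z *\<^sub>R e2"
  have m: "?J \<in> measurable lborel borel"
  proof -
    have "?J \<in> measurable borel borel" by (intro borel_measurable_continuous_onI continuous_intros)
    then show ?thesis by simp
  qed
  fix l u :: "real^2" assume le: "\<And>b. b \<in> Basis \<Longrightarrow> l \<bullet> b \<le> u \<bullet> b"
  have pre: "?J -` box l u = {l \<bullet> e1<..<u \<bullet> e1} \<times> {l \<bullet> e2<..<u \<bullet> e2}"
    by (auto simp: mem_box Basis_real2 inner_add_left e_simps)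
  have "emeasure (distr lborel borel ?J) (box l u) = emeasure lborel ({l \<bullet> e1<..<u \<bullet> e1} \<times> {l \<bullet> e2<..<u \<bullet> e2})"
    by (subst emeasure_distr[OF m]) (simp_all add: pre)
  also have "\<dots> = emeasure lborel {l \<bullet> e1<..<u \<bullet> e1} * emeasure lborel {l \<bullet> e2<..<u \<bullet> e2}"
    unfolding lborel_prod[symmetric] by (rule lborel.emeasure_pair_measure_Times) simp_all
  also have "\<dots> = (\<Prod>b\<in>Basis. (u - l) \<bullet> b)"
    using le[OF e1_Basis] le[OF e2_Basis] e1_neq_e2
    by (simp add: Basis_real2 inner_diff_left ennreal_mult)
  finally show "emeasure (distr lborel borel ?J) (box l u) = ennreal (\<Prod>b\<in>Basis. (u - l) \<bullet> b)" .
qed simp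

lemma nn_integral_real2:
  assumes [measurable]: "g \<in> borel_measurable (borel :: (real^2) measure)"
  shows "(\<integral>\<^sup>+x. g x \<partial>lborel) = (\<integral>\<^sup>+a. \<integral>\<^sup>+b. g (a *\<^sub>R e1 + b *\<^sub>R e2) \<partial>lborel \<partial>lborel)"
proof -
  let ?J = "\<lambda>z :: real \<times> real. fst z *\<^sub>R e1 + snd z *\<^sub>R e2"
  have m: "?J \<in> measurable borel borel" by (intro borel_measurable_continuous_onI continuous_intros)
  have "(\<integral>\<^sup>+x. g x \<partial>lborel) = (\<integral>\<^sup>+x. g x \<partial>distr lborel borel ?J)" by (simp only: distr_lborel_real2)
  also have "\<dots> = (\<integral>\<^sup>+z. g (?J z) \<partial>lborel)" by (rule nn_integral_distr) (use m in simp_all)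
  also have "\<dots> = (\<integral>\<^sup>+z. g (?J z) \<partial>(lborel \<Otimes>\<^sub>M lborel))" by (simp only: lborel_prod)
  also have "\<dots> = (\<integral>\<^sup>+a. \<integral>\<^sup>+b. g (?J (a, b)) \<partial>lborel \<partial>lborel)"
  proof (rule lborel.nn_integral_fst[symmetric])
    show "(\<lambda>z. g (?J z)) \<in> borel_measurable (lborel \<Otimes>\<^sub>M lborel)"
      unfolding lborel_prod using measurable_compose[OF m assms] by simp
  qed
  finally show ?thesis by simp
qed

lemma abs_le_line_integral:
  fixes f d :: "'a::euclidean_space \<Rightarrow> real"
  assumes D: "\<And>x. ((\<lambda>h. f (x + h *\<^sub>R e)) has_real_derivative d x) (at 0)" and cd: "continuous_on UNIV d"
    and e: "norm e = 1" and supp: "\<And>x. f x \<noteq> 0 \<Longrightarrow> norm x \<le> R"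
  shows "ennreal \<bar>f (y + t *\<^sub>R e)\<bar> \<le> (\<integral>\<^sup>+s. ennreal \<bar>d (y + s *\<^sub>R e)\<bar> \<partial>lborel)"
proof -
  \<comment> \<open>Far enough out that y + s0 e has norm greater than R, where f vanishes; the term
    |t| puts s0 below t.\<close>
  define s0 where "s0 = - (\<bar>R\<bar> + norm y + \<bar>t\<bar> + 1)"
  have s0: "s0 \<le> t" unfolding s0_def using norm_ge_zero[of y] by linarith
  have "norm (s0 *\<^sub>R e) \<le> norm (y + s0 *\<^sub>R e) + norm y"
    using norm_triangle_ineq4[of "y + s0 *\<^sub>R e" y] by simp
  then have "norm (y + s0 *\<^sub>R e) > R" using e by (simp add: s0_def)
  then have f0: "f (y + s0 *\<^sub>R e) = 0" using supp not_le by blast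
  have der: "((\<lambda>h. f (y + h *\<^sub>R e)) has_real_derivative d (y + s *\<^sub>R e)) (at s)" for s
  proof -
    have "((\<lambda>h. f ((y + s *\<^sub>R e) + h *\<^sub>R e)) has_real_derivative d (y + s *\<^sub>R e)) (at (s + (-s)))"
      using D[of "y + s *\<^sub>R e"] by simp
    then have "((\<lambda>h. f ((y + s *\<^sub>R e) + (h + -s) *\<^sub>R e)) has_real_derivative d (y + s *\<^sub>R e)) (at s)"
      by (subst (asm) DERIV_shift) simp
    then show ?thesis by (simp add: algebra_simps)
  qed
  have cl: "continuous_on X (\<lambda>s. d (y + s *\<^sub>R e))" for X
    by (rule continuous_on_compose2[OF cd]) (auto intro!: continuous_intros)
  have "(\<integral>s. indicator {s0..t} s *\<^sub>R d (y + s *\<^sub>R e) \<partial>lborel) = f (y + t *\<^sub>R e) - f (y + s0 *\<^sub>R e)"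
  proof (rule integral_FTC_atLeastAtMost[OF s0])
    show "((\<lambda>h. f (y + h *\<^sub>R e)) has_vector_derivative d (y + s *\<^sub>R e)) (at s within {s0..t})" for s
      using der[of s] unfolding has_real_derivative_iff_has_vector_derivative by (rule has_vector_derivative_at_within)
  qed (rule cl)
  then have "\<bar>f (y + t *\<^sub>R e)\<bar> = norm (\<integral>s. indicator {s0..t} s *\<^sub>R d (y + s *\<^sub>R e) \<partial>lborel)" by (simp add: f0)
  also have "ennreal \<dots> \<le> (\<integral>\<^sup>+s. ennreal (norm (indicator {s0..t} s *\<^sub>R d (y + s *\<^sub>R e))) \<partial>lborel)"
    by (rule integral_norm_bound_ennreal)
      (use borel_integrable_atLeastAtMost'[OF cl] in \<open>simp add: set_integrable_def\<close>)
  also have "\<dots> \<le> (\<integral>\<^sup>+s. ennreal \<bar>d (y + s *\<^sub>R e)\<bar> \<partial>lborel)"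
    by (intro nn_integral_mono ennreal_leI) (simp add: indicator_def)
  finally show ?thesis .
qed

section \<open>Trudinger's inequality\<close>

text \<open>The Gagliardo--Nirenberg inequality \<open>W\<^sup>1\<^sup>,\<^sup>1 \<subseteq> L\<^sup>2\<close>: bound \<open>|f x|\<close> by the integral of \<open>|\<partial>\<^sub>i f|\<close> along the
  line through \<open>x\<close> in each of the two directions, and multiply.\<close>

lemma square_integral_le_gradient:
  fixes f d1 d2 :: "real^2 \<Rightarrow> real"
  assumes D1: "\<And>x. ((\<lambda>h. f (x + h *\<^sub>R e1)) has_real_derivative d1 x) (at 0)" and c1: "continuous_on UNIV d1"
    and D2: "\<And>x. ((\<lambda>h. f (x + h *\<^sub>R e2)) has_real_derivative d2 x) (at 0)" and c2: "continuous_on UNIV d2"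
    and supp: "\<And>x. f x \<noteq> 0 \<Longrightarrow> norm x \<le> R" and cf: "continuous_on UNIV f"
  shows "(\<integral>\<^sup>+x. ennreal ((f x)\<^sup>2) \<partial>lborel) \<le> (\<integral>\<^sup>+x. ennreal \<bar>d1 x\<bar> \<partial>lborel) * (\<integral>\<^sup>+x. ennreal \<bar>d2 x\<bar> \<partial>lborel)"
proof -
  have [measurable]: "f \<in> borel_measurable borel" "d1 \<in> borel_measurable borel" "d2 \<in> borel_measurable borel"
    using borel_measurable_continuous_onI cf c1 c2 by blast+
  define A where "A b = (\<integral>\<^sup>+a. ennreal \<bar>d1 (a *\<^sub>R e1 + b *\<^sub>R e2)\<bar> \<partial>lborel)" for b
  define B where "B a = (\<integral>\<^sup>+b. ennreal \<bar>d2 (a *\<^sub>R e1 + b *\<^sub>R e2)\<bar> \<partial>lborel)" for a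
  have [measurable]: "(\<lambda>(a, b). a *\<^sub>R e1 + b *\<^sub>R e2) \<in> borel_measurable (borel \<Otimes>\<^sub>M borel)"
    unfolding borel_prod case_prod_beta by (intro borel_measurable_continuous_onI continuous_intros)
  have mJ: "(\<lambda>(a, b). ennreal \<bar>g (a *\<^sub>R e1 + b *\<^sub>R e2)\<bar>) \<in> borel_measurable (lborel \<Otimes>\<^sub>M lborel)"
    if [measurable]: "g \<in> borel_measurable borel" for g :: "real^2 \<Rightarrow> real" by measurable
  have [measurable]: "A \<in> borel_measurable borel" "B \<in> borel_measurable borel"
    unfolding A_def[abs_def] B_def[abs_def] by measurable
  have n: "norm e1 = 1" "norm e2 = 1" by (simp_all add: norm_eq_sqrt_inner e_simps)
  have le: "ennreal ((f (a *\<^sub>R e1 + b *\<^sub>R e2))\<^sup>2) \<le> A b * B a" for a b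
  proof -
    have "ennreal \<bar>f (a *\<^sub>R e1 + b *\<^sub>R e2)\<bar> \<le> A b"
      using abs_le_line_integral[OF D1 c1 n(1) supp, of "b *\<^sub>R e2" a] by (simp add: A_def add.commute)
    moreover have "ennreal \<bar>f (a *\<^sub>R e1 + b *\<^sub>R e2)\<bar> \<le> B a"
      using abs_le_line_integral[OF D2 c2 n(2) supp, of "a *\<^sub>R e1" b] by (simp add: B_def)
    ultimately have "ennreal \<bar>f (a *\<^sub>R e1 + b *\<^sub>R e2)\<bar> * ennreal \<bar>f (a *\<^sub>R e1 + b *\<^sub>R e2)\<bar> \<le> A b * B a"
      by (intro mult_mono) simp_all
    moreover have "ennreal ((f (a *\<^sub>R e1 + b *\<^sub>R e2))\<^sup>2) = ennreal \<bar>f (a *\<^sub>R e1 + b *\<^sub>R e2)\<bar> * ennreal \<bar>f (a *\<^sub>R e1 + b *\<^sub>R e2)\<bar>"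
      by (subst ennreal_mult[symmetric]) (simp_all add: power2_eq_square)
    ultimately show ?thesis by simp
  qed
  have "(\<integral>\<^sup>+x. ennreal ((f x)\<^sup>2) \<partial>lborel) = (\<integral>\<^sup>+a. \<integral>\<^sup>+b. ennreal ((f (a *\<^sub>R e1 + b *\<^sub>R e2))\<^sup>2) \<partial>lborel \<partial>lborel)"
    by (rule nn_integral_real2) simp
  also have "\<dots> \<le> (\<integral>\<^sup>+a. \<integral>\<^sup>+b. A b * B a \<partial>lborel \<partial>lborel)"
    by (intro nn_integral_mono le)
  also have "\<dots> = (\<integral>\<^sup>+b. A b \<partial>lborel) * (\<integral>\<^sup>+a. B a \<partial>lborel)"
    by (simp add: nn_integral_multc nn_integral_cmult)
  also have "(\<integral>\<^sup>+b. A b \<partial>lborel) = (\<integral>\<^sup>+a. \<integral>\<^sup>+b. ennreal \<bar>d1 (a *\<^sub>R e1 + b *\<^sub>R e2)\<bar> \<partial>lborel \<partial>lborel)"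
    unfolding A_def by (rule lborel_pair.Fubini'[OF mJ]) simp
  also have "\<dots> = (\<integral>\<^sup>+x. ennreal \<bar>d1 x\<bar> \<partial>lborel)" by (rule nn_integral_real2[symmetric]) simp
  also have "(\<integral>\<^sup>+a. B a \<partial>lborel) = (\<integral>\<^sup>+x. ennreal \<bar>d2 x\<bar> \<partial>lborel)"
    unfolding B_def by (rule nn_integral_real2[symmetric]) simp
  finally show ?thesis .
qed

section \<open>Truncation at successive heights\<close>

definition rsq :: "real \<Rightarrow> real" where "rsq r = (max 0 r)\<^sup>2"

lemma rsq_DERIV: "(rsq has_real_derivative 2 * max 0 r) (at r)"
proof -
  consider "r > 0" | "r < 0" | "r = 0" by linarith
  then show ?thesis
  proof cases
    case 1
    have ev: "\<forall>\<^sub>F s in nhds r. rsq s = s\<^sup>2"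
      using eventually_nhds_in_open[of "{0<..}" r] 1 by (auto elim!: eventually_mono simp: rsq_def)
    have "((\<lambda>s. s\<^sup>2) has_real_derivative 2 * max 0 r) (at r)" using 1 by (auto intro!: derivative_eq_intros)
    then show ?thesis by (rule DERIV_cong_ev[OF refl ev refl, THEN iffD2])
  next
    case 2
    have ev: "\<forall>\<^sub>F s in nhds r. rsq s = 0"
      using eventually_nhds_in_open[of "{..<0}" r] 2 by (auto elim!: eventually_mono simp: rsq_def)
    have "((\<lambda>s. 0) has_real_derivative 2 * max 0 r) (at r)" using 2 by simp
    then show ?thesis by (rule DERIV_cong_ev[OF refl ev refl, THEN iffD2])
  next
    case 3
    have "((\<lambda>h. (rsq (0 + h) - rsq 0) / h) \<longlongrightarrow> 0) (at 0)"
    proof (rule Lim_null_comparison)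
      show "\<forall>\<^sub>F h in at 0. norm ((rsq (0 + h) - rsq 0) / h) \<le> \<bar>h\<bar>"
        unfolding eventually_at_filter
        by (intro always_eventually allI impI) (simp add: rsq_def power2_eq_square max_def)
      show "((\<lambda>h::real. \<bar>h\<bar>) \<longlongrightarrow> 0) (at 0)" by (rule tendsto_rabs_zero[OF tendsto_ident_at])
    qed
    then show ?thesis using 3 by (simp add: DERIV_def)
  qed
qed

text \<open>A ramp from 0 to 1 on the unit interval, twice the second difference of the squared
  positive part; its derivative \<open>step'\<close> is the tent of height 2 over [0, 1]. This is
  C^1, the regularity that \<open>square_integral_le_gradient\<close> asks for.\<close>

definition step :: "real \<Rightarrow> real" where "step r = 2 * (rsq r - 2 * rsq (r - 1/2) + rsq (r - 1))"
definition step' :: "real \<Rightarrow> real" where "step' r = 4 * (max 0 r - 2 * max 0 (r - 1/2) + max 0 (r - 1))"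

lemma step_DERIV: "(step has_real_derivative step' r) (at r)"
proof -
  have shift: "((\<lambda>r. rsq (r - c)) has_real_derivative 2 * max 0 (r - c)) (at r)" for c
    using DERIV_shift[of rsq "2 * max 0 (r - c)" r "- c"] rsq_DERIV[of "r - c"] by simp
  have "((\<lambda>r. 2 * (rsq r - 2 * rsq (r - 1/2) + rsq (r - 1))) has_real_derivative
      2 * (2 * max 0 r - 2 * (2 * max 0 (r - 1/2)) + 2 * max 0 (r - 1))) (at r)"
    by (intro DERIV_cmult DERIV_add DERIV_diff shift rsq_DERIV)
  then show ?thesis unfolding step_def[abs_def] step'_def by (simp add: algebra_simps)
qed

lemma step_values:
  "r \<le> 0 \<Longrightarrow> step r = 0" "r \<ge> 1 \<Longrightarrow> step r = 1" "0 \<le> step' r" "step' r \<le> 2"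
  "r \<le> 0 \<Longrightarrow> step' r = 0" "r \<ge> 1 \<Longrightarrow> step' r = 0"
  by (auto simp: step_def step'_def rsq_def power2_eq_square max_def field_simps)

lemma continuous_step': "continuous_on UNIV step'"
  unfolding step'_def[abs_def] by (intro continuous_intros)

lemma inner_indicator_le:
  fixes g :: "'a::euclidean_space \<Rightarrow> real"
  assumes A: "A \<in> sets borel" "emeasure lborel A < \<infinity>" and g: "L2 g"
  shows "integrable lborel (\<lambda>x. indicator A x * \<bar>g x\<bar>)"
    "(\<integral>x. indicator A x * \<bar>g x\<bar> \<partial>lborel)\<^sup>2 \<le> measure lborel A * (\<integral>x. indicator A x * (g x)\<^sup>2 \<partial>lborel)"
proof -
  have m: "g \<in> borel_measurable borel" by (rule L2_measurable[OF g])
  have i: "L2 (indicator A :: 'a \<Rightarrow> real)" by (rule L2_indicator[OF A])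
  have h: "L2 (\<lambda>x. indicator A x * \<bar>g x\<bar>)"
    by (rule L2_bound[OF g]) (use m A in \<open>auto simp: abs_mult indicator_def\<close>)
  have eq: "(\<lambda>x. indicator A x * (indicator A x * \<bar>g x\<bar>)) = (\<lambda>x. indicator A x * \<bar>g x\<bar>)"
    "(\<lambda>x. (indicator A x * \<bar>g x\<bar>)\<^sup>2) = (\<lambda>x. indicator A x * (g x)\<^sup>2)" "(\<lambda>x. (indicator A x :: real)\<^sup>2) = indicator A"
    by (auto simp: indicator_def)
  show "integrable lborel (\<lambda>x. indicator A x * \<bar>g x\<bar>)"
    using L2_integrable_mult[OF i h] unfolding eq .
  have "(\<integral>x. indicator A x * \<bar>g x\<bar> \<partial>lborel)\<^sup>2 = (inner (toL2 (indicator A)) (toL2 (\<lambda>x. indicator A x * \<bar>g x\<bar>)))\<^sup>2"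
    unfolding inner_toL2[OF i h] eq ..
  also have "\<dots> \<le> (norm (toL2 (indicator A :: 'a \<Rightarrow> real)))\<^sup>2 * (norm (toL2 (\<lambda>x. indicator A x * \<bar>g x\<bar>)))\<^sup>2"
    by (metis Cauchy_Schwarz_ineq power2_norm_eq_inner)
  also have "\<dots> = measure lborel A * (\<integral>x. indicator A x * (g x)\<^sup>2 \<partial>lborel)"
    unfolding norm_toL2_sq[OF i] norm_toL2_sq[OF h] eq using A by simp
  finally show "(\<integral>x. indicator A x * \<bar>g x\<bar> \<partial>lborel)\<^sup>2 \<le> measure lborel A * (\<integral>x. indicator A x * (g x)\<^sup>2 \<partial>lborel)" .
qed

context
  fixes \<phi> :: "real^2 \<Rightarrow> real"
  assumes \<phi>: "test_fun UNIV \<phi>"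
begin

lemma \<phi>_smooth: "smooth_fun \<phi>" using \<phi> by (simp add: test_fun_def)

lemma \<phi>_meas [measurable]: "\<phi> \<in> borel_measurable borel" by (rule test_fun_measurable[OF \<phi>])
lemma pd_meas [measurable]: "b \<in> Basis \<Longrightarrow> pd b \<phi> \<in> borel_measurable borel"
  by (rule test_fun_measurable[OF test_fun_pd[OF \<phi>]])

definition lev :: "real \<Rightarrow> (real^2) set" where "lev t = {x. t \<le> \<bar>\<phi> x\<bar>}"
text \<open>The open annulus is enough, because \<open>step'\<close> vanishes at both ends of the
  unit interval.\<close>

definition ann :: "real \<Rightarrow> nat \<Rightarrow> (real^2) set" where
  "ann h j = {x. real j * h < \<bar>\<phi> x\<bar> \<and> \<bar>\<phi> x\<bar> < real (Suc j) * h}"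
definition grad2 :: "real^2 \<Rightarrow> real" where "grad2 x = (pd e1 \<phi> x)\<^sup>2 + (pd e2 \<phi> x)\<^sup>2"

lemma lev_sets: "lev t \<in> sets borel"
  unfolding lev_def by measurable

lemma ann_sets: "ann h j \<in> sets borel"
  unfolding ann_def by measurable

lemma lev_finite: assumes "t > 0" shows "emeasure lborel (lev t) < \<infinity>"
proof -
  obtain R where R: "\<And>x. \<phi> x \<noteq> 0 \<Longrightarrow> norm x \<le> R" using \<phi> unfolding test_fun_UNIV_iff by metis
  have "lev t \<subseteq> cball 0 R" using R assms unfolding lev_def by force
  then have "emeasure lborel (lev t) \<le> emeasure lborel (cball 0 R :: (real^2) set)" by (intro emeasure_mono) simp_all
  then show ?thesis using emeasure_lborel_cball_finite[of "0 :: real^2" R] by (rule le_less_trans)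
qed

lemma ann_finite: assumes "h > 0" "j \<ge> 1" shows "emeasure lborel (ann h j) < \<infinity>" "measure lborel (ann h j) \<le> measure lborel (lev (real j * h))"
proof -
  have sub: "ann h j \<subseteq> lev (real j * h)" unfolding ann_def lev_def by auto
  have fin: "emeasure lborel (lev (real j * h)) < \<infinity>" using assms by (intro lev_finite) simp
  show "emeasure lborel (ann h j) < \<infinity>"
    by (rule le_less_trans[OF emeasure_mono[OF sub] fin]) (simp add: lev_sets)
  show "measure lborel (ann h j) \<le> measure lborel (lev (real j * h))"
    by (rule measure_mono_fmeasurable[OF sub]) (use fin lev_sets ann_sets in \<open>simp_all add: fmeasurable_def\<close>)
qed

text \<open>The truncation H(\<phi>) equals 1 on the upper level set, and its partial derivatives
  are at most 2/h times those of \<phi> and live on the annulus. The Gagliardo-Nirenberg inequality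
  bounds the upper measure by the product of the two L^1 norms, and Cauchy-Schwarz on the annulus
  turns them into measure times energy. The factor is (2/h)^2 / 2, the half coming from 2 c1 c2
  \<le> c1^2 + c2^2. For j \<ge> 1 the annulus has finite measure.\<close>

lemma level_step:
  assumes h: "h > 0" and j: "j \<ge> 1"
  shows "measure lborel (lev (real (Suc j) * h)) \<le>
    2 / h\<^sup>2 * measure lborel (lev (real j * h)) * (\<integral>x. indicator (ann h j) x * grad2 x \<partial>lborel)"
proof -
  \<comment> \<open>One ramp for each sign of s, so that H depends on |s| only and stays
    C^1.\<close>
  define H where "H s = step (s / h - real j) + step (- s / h - real j)" for s
  define H' where "H' s = (step' (s / h - real j) - step' (- s / h - real j)) / h" for s
  have HD: "(H has_real_derivative H' s) (at s)" for s
  proof -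
    have "((\<lambda>s. step (s / h - real j)) has_real_derivative step' (s / h - real j) * (1 / h)) (at s)"
      by (rule DERIV_chain2[OF step_DERIV]) (use h in \<open>auto intro!: derivative_eq_intros\<close>)
    moreover have "((\<lambda>s. step (- s / h - real j)) has_real_derivative step' (- s / h - real j) * (- 1 / h)) (at s)"
      by (rule DERIV_chain2[OF step_DERIV]) (use h in \<open>auto intro!: derivative_eq_intros\<close>)
    ultimately have "((\<lambda>s. step (s / h - real j) + step (- s / h - real j)) has_real_derivative
        step' (s / h - real j) * (1 / h) + step' (- s / h - real j) * (- 1 / h)) (at s)" by (rule DERIV_add)
    then show ?thesis unfolding H_def[abs_def] H'_def using h by (simp add: diff_divide_distrib)
  qed
  have Hc: "continuous_on UNIV H" using HD DERIV_isCont by (intro continuous_at_imp_continuous_on) blast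
  have H'c: "continuous_on UNIV H'" unfolding H'_def[abs_def]
    by (intro continuous_on_divide continuous_on_diff continuous_on_compose2[OF continuous_step'] continuous_intros) (use h in simp_all)
  have H0: "H 0 = 0" by (simp add: H_def step_values)
  have H1: "H s = 1" if "real (Suc j) * h \<le> \<bar>s\<bar>" for s
  proof (cases "s \<ge> 0")
    case True
    then have "s / h \<ge> 0" using h by simp
    moreover have "s / h - real j \<ge> 1" using True that h by (simp add: field_simps)
    ultimately have "s / h - real j \<ge> 1" "- s / h - real j \<le> 0" by simp_all
    then show ?thesis by (simp add: H_def step_values)
  next
    case False
    then have "s / h \<le> 0" using h by (simp add: divide_nonpos_pos)
    moreover have "- s / h - real j \<ge> 1" using False that h by (simp add: field_simps)
    ultimately have "- s / h - real j \<ge> 1" "s / h - real j \<le> 0" by simp_all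
    then show ?thesis by (simp add: H_def step_values)
  qed
  have H'b: "\<bar>H' s\<bar> \<le> 2 / h" for s
  proof -
    have "\<bar>step' (s / h - real j) - step' (- s / h - real j)\<bar> \<le> 2"
      using step_values(3,4)[of "s / h - real j"] step_values(3,4)[of "- s / h - real j"] by linarith
    then show ?thesis using h by (simp add: H'_def divide_right_mono)
  qed
  have H'0: "H' s = 0" if "\<not> (real j * h < \<bar>s\<bar> \<and> \<bar>s\<bar> < real (Suc j) * h)" for s
  proof -
    have z: "step' (r / h - real j) = 0" if "\<not> (real j * h < r \<and> r < real (Suc j) * h)" for r
    proof (cases "r \<le> real j * h")
      case True
      then have "r / h - real j \<le> 0" using h by (simp add: field_simps)
      then show ?thesis by (rule step_values)
    next
      case False
      then have "r / h - real j \<ge> 1" using that h by (simp add: field_simps)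
      then show ?thesis by (rule step_values)
    qed
    have "\<not> (real j * h < s \<and> s < real (Suc j) * h)" "\<not> (real j * h < - s \<and> - s < real (Suc j) * h)"
      using that h j by (auto simp: abs_if not_less split: if_splits intro: order_trans[OF _ mult_nonneg_nonneg])
    from z[OF this(1)] z[OF this(2)] show ?thesis by (simp add: H'_def)
  qed
  define f where "f x = H (\<phi> x)" for x
  define d where "d b x = H' (\<phi> x) * pd b \<phi> x" for b x
  have \<phi>c: "continuous_on UNIV \<phi>" by (rule smooth_fun_continuous[OF \<phi>_smooth])
  have D: "((\<lambda>k. f (x + k *\<^sub>R b)) has_real_derivative d b x) (at 0)" if b: "b \<in> Basis" for b x
    unfolding f_def d_def using DERIV_chain2[of H "H' (\<phi> (x + 0 *\<^sub>R b))" "\<lambda>k. \<phi> (x + k *\<^sub>R b)" 0 _ UNIV, OF HD smooth_fun_DERIV0[OF \<phi>_smooth b, of x]]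
    by simp
  have dc: "continuous_on UNIV (d b)" if "b \<in> Basis" for b
    unfolding d_def[abs_def] by (intro continuous_on_mult continuous_on_compose2[OF H'c \<phi>c] test_fun_continuous test_fun_pd[OF \<phi> that]) simp
  have fc: "continuous_on UNIV f" unfolding f_def[abs_def] by (rule continuous_on_compose2[OF Hc \<phi>c]) simp
  obtain R where R: "\<And>x. \<phi> x \<noteq> 0 \<Longrightarrow> norm x \<le> R" using \<phi> unfolding test_fun_UNIV_iff by metis
  have fs: "norm x \<le> R" if "f x \<noteq> 0" for x using that R[of x] by (cases "\<phi> x = 0") (simp_all add: f_def H0)
  note af = ann_finite[OF h j]
  define a where "a b = (\<integral>x. indicator (ann h j) x * (pd b \<phi> x)\<^sup>2 \<partial>lborel)" for b
  define c where "c b = (\<integral>x. indicator (ann h j) x * \<bar>pd b \<phi> x\<bar> \<partial>lborel)" for b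
  have dI: "(\<integral>\<^sup>+x. ennreal \<bar>d b x\<bar> \<partial>lborel) \<le> ennreal (2 / h * c b)" if b: "b \<in> Basis" for b
  proof -
    note L = test_fun_L2[OF test_fun_pd[OF \<phi> b]]
    have "(\<integral>\<^sup>+x. ennreal \<bar>d b x\<bar> \<partial>lborel) \<le> (\<integral>\<^sup>+x. ennreal (2 / h * (indicator (ann h j) x * \<bar>pd b \<phi> x\<bar>)) \<partial>lborel)"
    proof (intro nn_integral_mono ennreal_leI)
      fix x show "\<bar>d b x\<bar> \<le> 2 / h * (indicator (ann h j) x * \<bar>pd b \<phi> x\<bar>)"
      proof (cases "x \<in> ann h j")
        case True then show ?thesis using mult_right_mono[OF H'b[of "\<phi> x"], of "\<bar>pd b \<phi> x\<bar>"] by (simp add: d_def abs_mult)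
      next
        case False then show ?thesis using H'0[of "\<phi> x"] by (simp add: d_def ann_def)
      qed
    qed
    also have "\<dots> = ennreal (\<integral>x. 2 / h * (indicator (ann h j) x * \<bar>pd b \<phi> x\<bar>) \<partial>lborel)"
      by (rule nn_integral_eq_integral)
        (use inner_indicator_le(1)[OF ann_sets af(1) L] h in \<open>simp_all add: AE_I2\<close>)
    also have "\<dots> = ennreal (2 / h * c b)" by (simp add: c_def)
    finally show ?thesis .
  qed
  have c0: "c b \<ge> 0" "a b \<ge> 0" for b
    unfolding c_def a_def by (rule Bochner_Integration.integral_nonneg; simp)+
  have cs: "(c b)\<^sup>2 \<le> measure lborel (lev (real j * h)) * a b" if b: "b \<in> Basis" for b
  proof -
    have "(c b)\<^sup>2 \<le> measure lborel (ann h j) * a b"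
      unfolding c_def a_def by (rule inner_indicator_le(2)[OF ann_sets af(1) test_fun_L2[OF test_fun_pd[OF \<phi> b]]])
    also have "\<dots> \<le> measure lborel (lev (real j * h)) * a b" by (rule mult_right_mono[OF af(2) c0(2)])
    finally show ?thesis .
  qed
  have fin: "emeasure lborel (lev (real (Suc j) * h)) < \<infinity>" using h by (intro lev_finite) simp
  have "ennreal (measure lborel (lev (real (Suc j) * h))) = emeasure lborel (lev (real (Suc j) * h))"
    using fin by (intro emeasure_eq_ennreal_measure[symmetric]) auto
  also have "\<dots> = (\<integral>\<^sup>+x. indicator (lev (real (Suc j) * h)) x \<partial>lborel)" by (simp add: lev_sets)
  also have "\<dots> \<le> (\<integral>\<^sup>+x. ennreal ((f x)\<^sup>2) \<partial>lborel)"
    by (rule nn_integral_mono) (use H1 in \<open>auto simp: indicator_def lev_def f_def\<close>)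
  also have "\<dots> \<le> (\<integral>\<^sup>+x. ennreal \<bar>d e1 x\<bar> \<partial>lborel) * (\<integral>\<^sup>+x. ennreal \<bar>d e2 x\<bar> \<partial>lborel)"
    by (rule square_integral_le_gradient[OF D[OF e1_Basis] dc[OF e1_Basis] D[OF e2_Basis] dc[OF e2_Basis] fs fc])
  also have "\<dots> \<le> ennreal (2 / h * c e1) * ennreal (2 / h * c e2)"
    by (intro mult_mono dI e1_Basis e2_Basis) simp_all
  also have "\<dots> = ennreal ((2 / h * c e1) * (2 / h * c e2))"
    by (rule ennreal_mult[symmetric]) (use h c0 in simp_all)
  finally have "measure lborel (lev (real (Suc j) * h)) \<le> (2 / h * c e1) * (2 / h * c e2)"
    using h c0 by (subst (asm) ennreal_le_iff) simp_all
  also have "\<dots> = 2 / h\<^sup>2 * (2 * c e1 * c e2)" by (simp add: power2_eq_square)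
  also have "\<dots> \<le> 2 / h\<^sup>2 * (measure lborel (lev (real j * h)) * (a e1 + a e2))"
  proof (rule mult_left_mono)
    show "2 * c e1 * c e2 \<le> measure lborel (lev (real j * h)) * (a e1 + a e2)"
      using sum_squares_bound[of "c e1" "c e2"] cs[OF e1_Basis] cs[OF e2_Basis] by (simp add: distrib_left)
  qed simp
  also have "a e1 + a e2 = (\<integral>x. indicator (ann h j) x * grad2 x \<partial>lborel)"
  proof -
    have "integrable lborel (\<lambda>x. indicator (ann h j) x * (pd b \<phi> x)\<^sup>2)" if b: "b \<in> Basis" for b
    proof (rule Bochner_Integration.integrable_bound[OF L2_integrable_square[OF test_fun_L2[OF test_fun_pd[OF \<phi> b]]]])
      show "(\<lambda>x. indicator (ann h j) x * (pd b \<phi> x)\<^sup>2) \<in> borel_measurable lborel"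
        using pd_meas[OF b] ann_sets by simp
    qed (simp add: indicator_def)
    from this[OF e1_Basis] this[OF e2_Basis] show ?thesis by (simp add: a_def grad2_def distrib_left)
  qed
  finally show ?thesis by (simp add: mult.assoc)
qed

lemma grad2_integrable: "integrable lborel grad2"
  unfolding grad2_def[abs_def]
  by (intro Bochner_Integration.integrable_add L2_integrable_square test_fun_L2 test_fun_pd \<phi> e1_Basis e2_Basis)

text \<open>Iterating \<open>level_step\<close>; the product of the local energies is at most \<open>n\<^sup>-\<^sup>n\<close> because
  \<open>x \<le> exp (x - 1)\<close> and the annuli are disjoint.\<close>

lemma level_decay:
  assumes en: "(\<integral>x. (\<phi> x)\<^sup>2 \<partial>lborel) + (\<integral>x. grad2 x \<partial>lborel) \<le> 1" and n: "n \<ge> 1"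
  shows "measure lborel (lev (8 * sqrt (real n))) \<le> (1/4) ^ n"
proof -
  \<comment> \<open>n steps of height h lead from height h to (n + 1) h, which is the height 8 sqrt
    n of the claim. This makes 2 / (h^2 n) = (n + 1)^2 / (32 n^2), at most 1/8.\<close>
  define h where "h = 8 * sqrt (real n) / real (Suc n)"
  have h: "h > 0" using n by (simp add: h_def)
  define \<mu> where "\<mu> j = measure lborel (lev (real j * h))" for j
  define e where "e j = (\<integral>x. indicator (ann h j) x * grad2 x \<partial>lborel)" for j
  have \<mu>0: "\<mu> j \<ge> 0" for j by (simp add: \<mu>_def)
  have g0: "grad2 x \<ge> 0" for x by (simp add: grad2_def)
  have e0: "e j \<ge> 0" for j unfolding e_def by (rule Bochner_Integration.integral_nonneg) (simp add: g0)
  have it: "\<mu> (Suc m) \<le> \<mu> 1 * (\<Prod>j\<in>{1..m}. 2 / h\<^sup>2 * e j)" for m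
  proof (induction m)
    case (Suc m)
    have "\<mu> (Suc (Suc m)) \<le> 2 / h\<^sup>2 * \<mu> (Suc m) * e (Suc m)"
      unfolding \<mu>_def e_def by (rule level_step[OF h]) simp
    also have "\<dots> = \<mu> (Suc m) * (2 / h\<^sup>2 * e (Suc m))" by simp
    also have "\<dots> \<le> (\<mu> 1 * (\<Prod>j\<in>{1..m}. 2 / h\<^sup>2 * e j)) * (2 / h\<^sup>2 * e (Suc m))"
      by (rule mult_right_mono[OF Suc.IH]) (simp add: e0)
    finally show ?case by (simp add: mult.assoc)
  qed simp
  have grad_le: "(\<integral>x. grad2 x \<partial>lborel) \<le> 1" "(\<integral>x. (\<phi> x)\<^sup>2 \<partial>lborel) \<le> 1"
  proof -
    have "(\<integral>x. grad2 x \<partial>lborel) \<ge> 0" "(\<integral>x. (\<phi> x)\<^sup>2 \<partial>lborel) \<ge> 0"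
      by (rule Bochner_Integration.integral_nonneg; simp add: g0)+
    then show "(\<integral>x. grad2 x \<partial>lborel) \<le> 1" "(\<integral>x. (\<phi> x)\<^sup>2 \<partial>lborel) \<le> 1" using en by linarith+
  qed
  have ei: "integrable lborel (\<lambda>x. indicator (ann h j) x * grad2 x)" for j
  proof (rule Bochner_Integration.integrable_bound[OF grad2_integrable])
    show "(\<lambda>x. indicator (ann h j) x * grad2 x) \<in> borel_measurable lborel"
      using borel_measurable_integrable[OF grad2_integrable] ann_sets by simp
  qed (simp add: indicator_def)
  have "(\<Sum>j\<in>{1..n}. e j) = (\<integral>x. (\<Sum>j\<in>{1..n}. indicator (ann h j) x * grad2 x) \<partial>lborel)"
    unfolding e_def by (rule Bochner_Integration.integral_sum[symmetric]) (rule ei)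
  also have "\<dots> \<le> (\<integral>x. grad2 x \<partial>lborel)"
  proof (rule integral_mono)
    fix x
    have disj: "j = k" if "x \<in> ann h j" "x \<in> ann h k" for j k
    proof (rule ccontr)
      assume "j \<noteq> k"
      then consider "Suc j \<le> k" | "Suc k \<le> j" by linarith
      then show False
      proof cases
        case 1
        then have "real (Suc j) * h \<le> real k * h" using h by (intro mult_right_mono) simp_all
        then show False using that unfolding ann_def by auto
      next
        case 2
        then have "real (Suc k) * h \<le> real j * h" using h by (intro mult_right_mono) simp_all
        then show False using that unfolding ann_def by auto
      qed
    qed
    have "(\<Sum>j\<in>{1..n}. indicator (ann h j) x) \<le> (1 :: real)"
    proof (cases "\<exists>k\<in>{1..n}. x \<in> ann h k")
      case True
      then obtain k where k: "k \<in> {1..n}" "x \<in> ann h k" by blast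
      have "(\<Sum>j\<in>{1..n}. indicator (ann h j) x) = (\<Sum>j\<in>{1..n}. if j = k then 1 else (0::real))"
        by (rule sum.cong) (use disj k in \<open>auto simp: indicator_def\<close>)
      then show ?thesis using k by simp
    next
      case False
      then have "(\<Sum>j\<in>{1..n}. indicator (ann h j) x) = (\<Sum>j\<in>{1..n}. (0::real))"
        by (intro sum.cong) (auto simp: indicator_def)
      then show ?thesis by simp
    qed
    then have "(\<Sum>j\<in>{1..n}. indicator (ann h j) x) * grad2 x \<le> 1 * grad2 x" by (rule mult_right_mono[OF _ g0])
    then show "(\<Sum>j\<in>{1..n}. indicator (ann h j) x * grad2 x) \<le> grad2 x" by (simp add: sum_distrib_right)
  qed (rule grad2_integrable Bochner_Integration.integrable_sum[OF ei])+
  finally have esum: "(\<Sum>j\<in>{1..n}. e j) \<le> 1" using grad_le by linarith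
  have prod1: "(\<Prod>j\<in>{1..n}. real n * e j) \<le> 1"
  proof -
    have "(\<Prod>j\<in>{1..n}. real n * e j) \<le> (\<Prod>j\<in>{1..n}. exp (real n * e j - 1))"
    proof (rule prod_mono)
      fix j show "0 \<le> real n * e j \<and> real n * e j \<le> exp (real n * e j - 1)"
        using exp_ge_add_one_self[of "real n * e j - 1"] e0[of j] by simp
    qed
    also have "\<dots> = exp (\<Sum>j\<in>{1..n}. real n * e j - 1)" by (rule exp_sum[symmetric]) simp
    also have "(\<Sum>j\<in>{1..n}. real n * e j - 1) = real n * (\<Sum>j\<in>{1..n}. e j) - real n"
      by (simp add: sum_subtractf sum_distrib_left)
    also have "exp \<dots> \<le> 1" using mult_left_mono[OF esum, of "real n"] by simp
    finally show ?thesis .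
  qed
  have "2 / h\<^sup>2 / real n = (real (Suc n))\<^sup>2 / (32 * (real n)\<^sup>2)"
    using n by (simp add: h_def power_divide power_mult_distrib power2_eq_square)
  also have "\<dots> \<le> (2 * real n)\<^sup>2 / (32 * (real n)\<^sup>2)"
    using n by (intro divide_right_mono power_mono) simp_all
  also have "\<dots> = 1 / 8" using n by (simp add: power_mult_distrib)
  finally have q: "2 / h\<^sup>2 / real n \<le> 1 / 8" .
  have "(\<Prod>j\<in>{1..n}. 2 / h\<^sup>2 * e j) = (\<Prod>j\<in>{1..n}. (2 / h\<^sup>2 / real n) * (real n * e j))"
    using n by (intro prod.cong) simp_all
  also have "\<dots> = (2 / h\<^sup>2 / real n) ^ n * (\<Prod>j\<in>{1..n}. real n * e j)"
    by (simp only: prod.distrib prod_constant card_atLeastAtMost) simp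
  also have "\<dots> \<le> (1 / 8) ^ n * 1"
    by (intro mult_mono power_mono prod1 q prod_nonneg) (use n e0 in auto)
  finally have p: "(\<Prod>j\<in>{1..n}. 2 / h\<^sup>2 * e j) \<le> (1 / 8) ^ n" by simp
  \<comment> \<open>Chebyshev at the lowest height gives 1 / h^2, at most n / 16. This factor is
    absorbed by 2^n below, which weakens the rate from 8^(-n) to 4^(-n).\<close>
  have m1: "\<mu> 1 \<le> real n / 16"
  proof -
    have i: "integrable lborel (\<lambda>x. (\<phi> x)\<^sup>2)" by (rule L2_integrable_square[OF test_fun_L2[OF \<phi>]])
    have fin: "emeasure lborel (lev h) < \<infinity>" by (rule lev_finite[OF h])
    have "h\<^sup>2 * \<mu> 1 = (\<integral>x. h\<^sup>2 * indicator (lev h) x \<partial>lborel)" by (simp add: \<mu>_def)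
    also have "\<dots> \<le> (\<integral>x. (\<phi> x)\<^sup>2 \<partial>lborel)"
    proof (rule integral_mono)
      fix x show "h\<^sup>2 * indicator (lev h) x \<le> (\<phi> x)\<^sup>2"
        using h power_mono[of h "\<bar>\<phi> x\<bar>" 2] by (auto simp: indicator_def lev_def)
    qed (use fin lev_sets i in simp_all)
    finally have "h\<^sup>2 * \<mu> 1 \<le> 1" using grad_le by linarith
    then have "\<mu> 1 \<le> 1 / h\<^sup>2" using h by (simp add: field_simps)
    also have "\<dots> = real n / 2 * (2 / h\<^sup>2 / real n)" using n by simp
    also have "\<dots> \<le> real n / 2 * (1 / 8)" by (rule mult_left_mono[OF q]) simp
    finally show ?thesis by simp
  qed
  have "\<mu> (Suc n) \<le> \<mu> 1 * (\<Prod>j\<in>{1..n}. 2 / h\<^sup>2 * e j)" by (rule it)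
  also have "\<dots> \<le> real n / 16 * (1 / 8) ^ n"
    by (rule mult_mono[OF m1 p]) (simp_all add: prod_nonneg e0)
  also have "\<dots> \<le> 2 ^ n * (1 / 8) ^ n"
  proof (rule mult_right_mono)
    have "real n < 2 ^ n" by (rule of_nat_less_two_power)
    then show "real n / 16 \<le> 2 ^ n" by linarith
  qed simp
  also have "\<dots> = (1 / 4) ^ n" unfolding power_mult_distrib[symmetric] by simp
  finally have "\<mu> (Suc n) \<le> (1 / 4) ^ n" .
  moreover have "real (Suc n) * h = 8 * sqrt (real n)" by (simp add: h_def)
  ultimately show ?thesis by (simp add: \<mu>_def)
qed

text \<open>With s = \<phi>^2 / 64, the set where s is at least m is the level set of height 8 sqrt
  m and has measure at most 4^(-m), while exp s is at most 3^(m + 1) where s lies between m and m +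
  1. The ratio 3/4 makes the series converge, with sum (9/4) / (1 - 3/4) = 9. Where s \<le> 1 the
  integrand is at most \<phi>^2, which contributes the remaining 1 of the bound 10.\<close>

lemma trudinger_test:
  assumes en: "(\<integral>x. (\<phi> x)\<^sup>2 \<partial>lborel) + (\<integral>x. grad2 x \<partial>lborel) \<le> 1"
  shows "(\<integral>\<^sup>+x. ennreal (exp ((\<phi> x)\<^sup>2 / 64) - 1) \<partial>lborel) \<le> 10"
proof -
  define I where "I k x = ennreal (3 ^ (k + 2)) * indicator (lev (8 * sqrt (real (Suc k)))) x" for k :: nat and x
  have [measurable]: "I k \<in> borel_measurable borel" for k
    unfolding I_def using lev_sets by measurable
  have pw: "ennreal (exp ((\<phi> x)\<^sup>2 / 64) - 1) \<le> ennreal ((\<phi> x)\<^sup>2) + (\<Sum>k. I k x)" for x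
  proof -
    define s where "s = (\<phi> x)\<^sup>2 / 64"
    have s0: "s \<ge> 0" by (simp add: s_def)
    show ?thesis
    proof (cases "s \<le> 1")
      case True
      have "exp s \<le> 1 + s + s\<^sup>2" by (rule exp_bound[OF s0 True])
      also have "s\<^sup>2 \<le> s" using s0 True by (simp add: power2_eq_square mult_left_le)
      finally have "exp s - 1 \<le> 64 * s" using s0 by simp
      then have "exp s - 1 \<le> (\<phi> x)\<^sup>2" by (simp add: s_def)
      then have "ennreal (exp s - 1) \<le> ennreal ((\<phi> x)\<^sup>2)" by (rule ennreal_leI)
      also have "\<dots> \<le> ennreal ((\<phi> x)\<^sup>2) + (\<Sum>k. I k x)" by simp
      finally show ?thesis unfolding s_def .
    next
      case False
      define m where "m = nat \<lfloor>s\<rfloor>"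
      have m: "real m \<le> s" "s \<le> real m + 1" "m \<ge> 1"
        using False unfolding m_def by linarith+
      then obtain k where k: "m = Suc k" by (cases m) auto
      have "exp s \<le> exp (real m + 1)" using m by simp
      also have "\<dots> = exp 1 ^ (m + 1)"
        using exp_of_nat_mult[of "m + 1" "1 :: real"] by (simp add: add.commute)
      also have "\<dots> \<le> 3 ^ (m + 1)" by (rule power_mono[OF exp_le]) simp
      finally have 1: "exp s - 1 \<le> 3 ^ (k + 2)" by (simp add: k)
      have "(8 * sqrt (real (Suc k)))\<^sup>2 \<le> (\<phi> x)\<^sup>2" using m by (simp add: k s_def power_mult_distrib)
      then have "8 * sqrt (real (Suc k)) \<le> \<bar>\<phi> x\<bar>" by (metis abs_le_square_iff abs_ge_self order_trans)
      then have "I k x = ennreal (3 ^ (k + 2))" by (simp add: I_def lev_def)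
      then have "ennreal (exp s - 1) \<le> I k x" using 1 by (simp add: ennreal_leI)
      also have "\<dots> \<le> (\<Sum>k. I k x)" using sum_le_suminf[of "\<lambda>k. I k x" "{k}"] by simp
      also have "\<dots> \<le> ennreal ((\<phi> x)\<^sup>2) + (\<Sum>k. I k x)" by simp
      finally show ?thesis unfolding s_def .
    qed
  qed
  have int_I: "(\<integral>\<^sup>+x. I k x \<partial>lborel) \<le> ennreal (9 / 4 * (3 / 4) ^ k)" for k
  proof -
    have fin: "emeasure lborel (lev (8 * sqrt (real (Suc k)))) < \<infinity>" by (rule lev_finite) simp
    have "(\<integral>\<^sup>+x. I k x \<partial>lborel) = ennreal (3 ^ (k + 2)) * emeasure lborel (lev (8 * sqrt (real (Suc k))))"
      unfolding I_def using lev_sets by (simp add: nn_integral_cmult_indicator)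
    also have "\<dots> = ennreal (3 ^ (k + 2)) * ennreal (measure lborel (lev (8 * sqrt (real (Suc k)))))"
      using fin by (subst emeasure_eq_ennreal_measure) auto
    also have "\<dots> \<le> ennreal (3 ^ (k + 2)) * ennreal ((1/4) ^ Suc k)"
      by (intro mult_left_mono ennreal_leI level_decay[OF en]) simp_all
    also have "\<dots> = ennreal (3 ^ (k + 2) * (1/4) ^ Suc k)" by (rule ennreal_mult[symmetric]) simp_all
    also have "3 ^ (k + 2) * (1/4) ^ Suc k = 9 / 4 * (3 / 4 :: real) ^ k"
      by (simp add: power_divide power_add)
    finally show ?thesis .
  qed
  have "(\<integral>\<^sup>+x. (\<Sum>k. I k x) \<partial>lborel) = (\<Sum>k. \<integral>\<^sup>+x. I k x \<partial>lborel)" by (rule nn_integral_suminf) simp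
  also have "\<dots> \<le> (\<Sum>k. ennreal (9 / 4 * (3 / 4) ^ k))" by (rule suminf_le[OF int_I]) simp_all
  also have "\<dots> = ennreal (\<Sum>k. 9 / 4 * (3 / 4) ^ k)"
    by (rule suminf_ennreal2) (simp_all add: summable_mult summable_geometric)
  also have "(\<Sum>k. 9 / 4 * (3 / 4 :: real) ^ k) = 9"
    by (subst suminf_mult) (simp_all add: summable_geometric suminf_geometric)
  finally have sumI: "(\<integral>\<^sup>+x. (\<Sum>k. I k x) \<partial>lborel) \<le> ennreal 9" .
  have "(\<integral>x. grad2 x \<partial>lborel) \<ge> 0" by (rule Bochner_Integration.integral_nonneg) (simp add: grad2_def)
  then have "(\<integral>x. (\<phi> x)\<^sup>2 \<partial>lborel) \<le> 1" using en by linarith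
  then have \<phi>1: "(\<integral>\<^sup>+x. ennreal ((\<phi> x)\<^sup>2) \<partial>lborel) \<le> ennreal 1"
    using nn_integral_square[OF test_fun_L2[OF \<phi>]] by (simp add: norm_toL2_sq test_fun_L2[OF \<phi>] ennreal_leI)
  have "(\<integral>\<^sup>+x. ennreal (exp ((\<phi> x)\<^sup>2 / 64) - 1) \<partial>lborel) \<le> (\<integral>\<^sup>+x. ennreal ((\<phi> x)\<^sup>2) + (\<Sum>k. I k x) \<partial>lborel)"
    by (rule nn_integral_mono) (rule pw)
  also have "\<dots> = (\<integral>\<^sup>+x. ennreal ((\<phi> x)\<^sup>2) \<partial>lborel) + (\<integral>\<^sup>+x. (\<Sum>k. I k x) \<partial>lborel)"
    by (rule nn_integral_add) simp_all
  also have "\<dots> \<le> ennreal 1 + ennreal 9" by (rule add_mono[OF \<phi>1 sumI])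
  also have "\<dots> = 10" by (simp add: ennreal_plus[symmetric] del: ennreal_plus)
  finally show ?thesis .
qed

end

section \<open>Exponential integrability on H1\<close>

lemma test_fun_dense_plane:
  assumes wp: "wp e1 u p" "wp e2 u q" and \<epsilon>: "\<epsilon> > 0"
  obtains \<phi> where "test_fun UNIV \<phi>" "norm (toL2 \<phi> - u) < \<epsilon>" "norm (toL2 (pd e1 \<phi>) - p) < \<epsilon>" "norm (toL2 (pd e2 \<phi>) - q) < \<epsilon>"
proof -
  define g where "g b = (if b = e1 then p else q)" for b
  have g: "g e1 = p" "g e2 = q" using e1_neq_e2 by (simp_all add: g_def)
  have wpg: "wp b u (g b)" if "b \<in> Basis" for b using that wp by (auto simp: Basis_real2 g)
  show thesis
  proof (rule test_fun_dense_H1[OF wpg \<epsilon>])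
    fix \<phi> assume \<phi>: "test_fun UNIV \<phi>" "norm (toL2 \<phi> - u) < \<epsilon>" "\<And>b. b \<in> Basis \<Longrightarrow> norm (toL2 (pd b \<phi>) - g b) < \<epsilon>"
    show thesis using that[OF \<phi>(1,2)] \<phi>(3)[OF e1_Basis] \<phi>(3)[OF e2_Basis] by (simp only: g)
  qed
qed

lemma square_sum_le: "(a + b)\<^sup>2 \<le> 2 * a\<^sup>2 + 2 * b\<^sup>2" for a b :: real
  using sum_squares_bound[of a b] by (simp add: power2_sum)

text \<open>The strict inequality leaves room for approximating test functions of norm at most 1;
  the 3 in \<epsilon> k counts the components u, p, q. Along a subsequence converging almost
  everywhere Fatou's lemma carries the bound over.\<close>

lemma trudinger_H1:
  assumes wp: "wp e1 u p" "wp e2 u q" and N: "norm (u, p, q) < 1"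
  shows "(\<integral>\<^sup>+x. ennreal (exp ((fn u x)\<^sup>2 / 64) - 1) \<partial>lborel) \<le> 10"
proof -
  define \<epsilon> where "\<epsilon> k = (1 - norm (u, p, q)) / (3 * real (Suc k))" for k
  have \<epsilon>: "\<epsilon> k > 0" for k using N by (simp add: \<epsilon>_def)
  have "\<exists>\<phi>. test_fun UNIV \<phi> \<and> norm (toL2 \<phi> - u) < \<epsilon> k \<and> norm (toL2 (pd e1 \<phi>) - p) < \<epsilon> k \<and> norm (toL2 (pd e2 \<phi>) - q) < \<epsilon> k" for k
    by (rule test_fun_dense_plane[OF wp \<epsilon>[of k]]) blast
  then obtain \<phi> where \<phi>: "\<And>k. test_fun UNIV (\<phi> k)" "\<And>k. norm (toL2 (\<phi> k) - u) < \<epsilon> k"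
    "\<And>k. norm (toL2 (pd e1 (\<phi> k)) - p) < \<epsilon> k" "\<And>k. norm (toL2 (pd e2 (\<phi> k)) - q) < \<epsilon> k" by metis
  have L: "L2 (\<phi> k)" "L2 (pd e1 (\<phi> k))" "L2 (pd e2 (\<phi> k))" for k
    by (intro test_fun_L2 test_fun_pd \<phi>(1) e1_Basis e2_Basis)+
  have bound: "(\<integral>\<^sup>+x. ennreal (exp ((\<phi> k x)\<^sup>2 / 64) - 1) \<partial>lborel) \<le> 10" for k
  proof (rule trudinger_test[OF \<phi>(1)])
    let ?v = "(toL2 (\<phi> k), toL2 (pd e1 (\<phi> k)), toL2 (pd e2 (\<phi> k)))"
    have "\<epsilon> k \<le> (1 - norm (u, p, q)) / 3"
      unfolding \<epsilon>_def using N by (intro divide_left_mono) simp_all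
    then have 3: "norm (?v - (u, p, q)) \<le> 1 - norm (u, p, q)"
      using norm_Pair_le[of "toL2 (\<phi> k) - u" "(toL2 (pd e1 (\<phi> k)) - p, toL2 (pd e2 (\<phi> k)) - q)"]
        norm_Pair_le[of "toL2 (pd e1 (\<phi> k)) - p" "toL2 (pd e2 (\<phi> k)) - q"] \<phi>(2,3,4)[of k] by simp
    have "norm ?v \<le> norm (?v - (u, p, q)) + norm (u, p, q)" using norm_triangle_ineq[of "?v - (u, p, q)" "(u, p, q)"] by simp
    then have "norm ?v \<le> 1" using 3 by linarith
    then have "(norm ?v)\<^sup>2 \<le> 1" by (simp add: power_le_one)
    then have "(norm (toL2 (\<phi> k)))\<^sup>2 + ((norm (toL2 (pd e1 (\<phi> k))))\<^sup>2 + (norm (toL2 (pd e2 (\<phi> k))))\<^sup>2) \<le> 1"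
      by (simp add: norm_Pair)
    then show "(\<integral>x. (\<phi> k x)\<^sup>2 \<partial>lborel) + (\<integral>x. grad2 (\<phi> k) x \<partial>lborel) \<le> 1"
      unfolding grad2_def[OF \<phi>(1)] norm_toL2_sq[OF L(1)] norm_toL2_sq[OF L(2)] norm_toL2_sq[OF L(3)]
      by (simp add: L2_integrable_square L)
  qed
  have "(\<lambda>k. \<epsilon> k * \<epsilon> k) \<longlonglongrightarrow> 0"
  proof -
    have "(\<lambda>k. (1 - norm (u, p, q)) / 3 * (1 / real (Suc k))) \<longlonglongrightarrow> (1 - norm (u, p, q)) / 3 * 0"
      by (intro tendsto_mult tendsto_const LIMSEQ_Suc lim_1_over_n)
    then have "\<epsilon> \<longlonglongrightarrow> 0" by (simp add: \<epsilon>_def[abs_def])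
    from tendsto_mult[OF this this] show ?thesis by simp
  qed
  have Ld: "L2 (\<lambda>x. \<phi> k x - fn u x)" for k by (intro L2_diff L L2_fn)
  have "(\<lambda>k. \<integral>x. norm ((\<phi> k x - fn u x)\<^sup>2) \<partial>lborel) \<longlonglongrightarrow> 0"
  proof (rule Lim_null_comparison[OF _ \<open>(\<lambda>k. \<epsilon> k * \<epsilon> k) \<longlonglongrightarrow> 0\<close>])
    show "\<forall>\<^sub>F k in sequentially. norm (\<integral>x. norm ((\<phi> k x - fn u x)\<^sup>2) \<partial>lborel) \<le> \<epsilon> k * \<epsilon> k"
    proof (intro always_eventually allI)
      fix k
      have "(\<integral>x. norm ((\<phi> k x - fn u x)\<^sup>2) \<partial>lborel) = (norm (toL2 (\<phi> k) - u))\<^sup>2"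
        using norm_toL2_sq[OF Ld, of k] by (simp add: toL2_diff L L2_fn)
      also have "\<dots> \<le> (\<epsilon> k)\<^sup>2" using \<phi>(2)[of k] by (intro power_mono) simp_all
      finally show "norm (\<integral>x. norm ((\<phi> k x - fn u x)\<^sup>2) \<partial>lborel) \<le> \<epsilon> k * \<epsilon> k"
        by (simp add: power2_eq_square)
    qed
  qed
  from tendsto_L1_AE_subseq[OF L2_integrable_square[OF Ld] this]
  obtain r :: "nat \<Rightarrow> nat" where r: "AE x in lborel. (\<lambda>n. (\<phi> (r n) x - fn u x)\<^sup>2) \<longlonglongrightarrow> 0" by blast
  have [measurable]: "\<phi> k \<in> borel_measurable borel" for k by (rule test_fun_measurable[OF \<phi>(1)])
  have "(\<integral>\<^sup>+x. ennreal (exp ((fn u x)\<^sup>2 / 64) - 1) \<partial>lborel)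
      = (\<integral>\<^sup>+x. liminf (\<lambda>n. ennreal (exp ((\<phi> (r n) x)\<^sup>2 / 64) - 1)) \<partial>lborel)"
  proof (rule nn_integral_cong_AE)
    show "AE x in lborel. ennreal (exp ((fn u x)\<^sup>2 / 64) - 1) = liminf (\<lambda>n. ennreal (exp ((\<phi> (r n) x)\<^sup>2 / 64) - 1))"
      using r
    proof eventually_elim
      case (elim x)
      from tendsto_real_sqrt[OF elim] have "(\<lambda>n. \<bar>\<phi> (r n) x - fn u x\<bar>) \<longlonglongrightarrow> 0" by simp
      then have "(\<lambda>n. \<phi> (r n) x) \<longlonglongrightarrow> fn u x" by (simp add: tendsto_rabs_zero_iff LIM_zero_iff)
      then have "(\<lambda>n. ennreal (exp ((\<phi> (r n) x)\<^sup>2 / 64) - 1)) \<longlonglongrightarrow> ennreal (exp ((fn u x)\<^sup>2 / 64) - 1)"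
        by (intro tendsto_ennrealI tendsto_intros) simp_all
      from lim_imp_Liminf[OF _ this] show ?case by simp
    qed
  qed
  also have "\<dots> \<le> liminf (\<lambda>n. \<integral>\<^sup>+x. ennreal (exp ((\<phi> (r n) x)\<^sup>2 / 64) - 1) \<partial>lborel)"
    by (rule nn_integral_liminf) simp
  also have "\<dots> \<le> limsup (\<lambda>n. \<integral>\<^sup>+x. ennreal (exp ((\<phi> (r n) x)\<^sup>2 / 64) - 1) \<partial>lborel)"
    by (rule Liminf_le_Limsup) simp
  also have "\<dots> \<le> 10" by (rule Limsup_bounded) (intro always_eventually allI bound)
  finally show ?thesis .
qed

definition expm :: "real \<Rightarrow> ll \<Rightarrow> ennreal" where
  "expm \<kappa> u = (\<integral>\<^sup>+x. ennreal (exp (\<kappa> * (fn u x)\<^sup>2) - 1) \<partial>lborel)"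

text \<open>Scaling by c = 1 / (2 r) brings the norm down to at most 1/2, below the threshold 1, and
  256 \<kappa> r^2 \<le> 1 says that \<kappa> \<le> c^2 / 64.\<close>

lemma trudinger_scaled:
  assumes wp: "wp e1 u p" "wp e2 u q" and N: "norm (u, p, q) \<le> r" and r: "r > 0" "256 * \<kappa> * r\<^sup>2 \<le> 1"
  shows "expm \<kappa> u \<le> 10"
proof -
  define c where "c = 1 / (2 * r)"
  have c: "c > 0" using r by (simp add: c_def)
  have "norm (c *\<^sub>R u, c *\<^sub>R p, c *\<^sub>R q) = c * norm (u, p, q)"
    using norm_scaleR[of c "(u, p, q)"] c by simp
  also have "\<dots> \<le> c * r" by (rule mult_left_mono[OF N]) (use c in simp)
  also have "\<dots> < 1" using r by (simp add: c_def)
  finally have T: "(\<integral>\<^sup>+x. ennreal (exp ((fn (c *\<^sub>R u) x)\<^sup>2 / 64) - 1) \<partial>lborel) \<le> 10"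
    by (rule trudinger_H1[OF wp_scaleR[OF wp(1)] wp_scaleR[OF wp(2)]])
  have "expm \<kappa> u \<le> (\<integral>\<^sup>+x. ennreal (exp ((fn (c *\<^sub>R u) x)\<^sup>2 / 64) - 1) \<partial>lborel)"
    unfolding expm_def
  proof (rule nn_integral_mono_AE)
    show "AE x in lborel. ennreal (exp (\<kappa> * (fn u x)\<^sup>2) - 1) \<le> ennreal (exp ((fn (c *\<^sub>R u) x)\<^sup>2 / 64) - 1)"
      using fn_scaleR[of c u]
    proof eventually_elim
      case (elim x)
      have "\<kappa> \<le> c\<^sup>2 / 64" using r by (simp add: c_def power_mult_distrib power_divide field_simps)
      from mult_right_mono[OF this zero_le_power2[of "fn u x"]]
      show ?case unfolding elim by (intro ennreal_leI) (simp add: power_mult_distrib)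
    qed
  qed
  from this T show ?thesis by (rule order_trans)
qed

text \<open>The second order term of the exponential, s^2 / 2 \<le> exp s - 1 for s = \<kappa> u^2,
  extracts the fourth power from Trudinger's inequality. With \<kappa> = 1 / (256 r^2) the integral
  of u^4 is at most 20 * 256^2 * r^4, and 2000 is a round bound for the square root. Norm 0 is
  treated apart, since the scaling needs r > 0.\<close>

lemma sobolev_L4:
  assumes wp: "wp e1 u p" "wp e2 u q"
  shows "L2 (\<lambda>x. (fn u x)\<^sup>2)" "norm (toL2 (\<lambda>x. (fn u x)\<^sup>2)) \<le> 2000 * (norm (u, p, q))\<^sup>2"
proof -
  have main: "L2 (\<lambda>x. (fn u x)\<^sup>2) \<and> norm (toL2 (\<lambda>x. (fn u x)\<^sup>2)) \<le> 2000 * r\<^sup>2"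
    if r: "r > 0" "norm (u, p, q) \<le> r" for r
  proof -
    define \<kappa> where "\<kappa> = 1 / (256 * r\<^sup>2)"
    have \<kappa>: "\<kappa> > 0" "256 * \<kappa> * r\<^sup>2 \<le> 1" using r by (simp_all add: \<kappa>_def)
    have "expm \<kappa> u \<le> 10" by (rule trudinger_scaled[OF wp r(2,1) \<kappa>(2)])
    have "(\<integral>\<^sup>+x. ennreal (((fn u x)\<^sup>2)\<^sup>2) \<partial>lborel) \<le> (\<integral>\<^sup>+x. ennreal (2 / \<kappa>\<^sup>2) * ennreal (exp (\<kappa> * (fn u x)\<^sup>2) - 1) \<partial>lborel)"
    proof (rule nn_integral_mono)
      fix x
      define s where "s = \<kappa> * (fn u x)\<^sup>2"
      have s: "s \<ge> 0" using \<kappa> by (simp add: s_def)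
      have "1 + s + s\<^sup>2 / 2 \<le> exp s" by (rule exp_lower_Taylor_quadratic[OF s])
      then have "s\<^sup>2 / 2 \<le> exp s - 1" using s by simp
      then have "2 / \<kappa>\<^sup>2 * (s\<^sup>2 / 2) \<le> 2 / \<kappa>\<^sup>2 * (exp s - 1)" by (rule mult_left_mono) simp
      moreover have "2 / \<kappa>\<^sup>2 * (s\<^sup>2 / 2) = ((fn u x)\<^sup>2)\<^sup>2" using \<kappa> by (simp add: s_def power_mult_distrib)
      ultimately have "((fn u x)\<^sup>2)\<^sup>2 \<le> 2 / \<kappa>\<^sup>2 * (exp s - 1)" by simp
      then show "ennreal (((fn u x)\<^sup>2)\<^sup>2) \<le> ennreal (2 / \<kappa>\<^sup>2) * ennreal (exp (\<kappa> * (fn u x)\<^sup>2) - 1)"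
        unfolding s_def by (subst ennreal_mult'[symmetric]) (simp_all add: ennreal_leI)
    qed
    also have "\<dots> = ennreal (2 / \<kappa>\<^sup>2) * expm \<kappa> u" unfolding expm_def by (rule nn_integral_cmult) simp
    also have "\<dots> \<le> ennreal (2 / \<kappa>\<^sup>2) * ennreal 10" using \<open>expm \<kappa> u \<le> 10\<close> by (intro mult_left_mono) simp_all
    also have "\<dots> = ennreal (2 / \<kappa>\<^sup>2 * 10)" by (rule ennreal_mult[symmetric]) simp_all
    finally have le: "(\<integral>\<^sup>+x. ennreal (((fn u x)\<^sup>2)\<^sup>2) \<partial>lborel) \<le> ennreal (2 / \<kappa>\<^sup>2 * 10)" .
    have L: "L2 (\<lambda>x. (fn u x)\<^sup>2)" by (rule L2I_nn_integral) (use le_less_trans[OF le ennreal_less_top] in simp_all)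
    have "(norm (toL2 (\<lambda>x. (fn u x)\<^sup>2)))\<^sup>2 \<le> 2 / \<kappa>\<^sup>2 * 10"
      using le unfolding nn_integral_square[OF L] by (subst (asm) ennreal_le_iff) simp_all
    also have "\<dots> = 20 * 65536 * (r\<^sup>2)\<^sup>2" using r by (simp add: \<kappa>_def power_mult_distrib power_divide)
    also have "\<dots> \<le> (2000 * r\<^sup>2)\<^sup>2" by (simp add: power_mult_distrib)
    finally show ?thesis using L power2_le_imp_le[of _ "2000 * r\<^sup>2"] by simp
  qed
  show "L2 (\<lambda>x. (fn u x)\<^sup>2)" using main[of "norm (u, p, q) + 1"] by (simp add: add_nonneg_pos)
  show "norm (toL2 (\<lambda>x. (fn u x)\<^sup>2)) \<le> 2000 * (norm (u, p, q))\<^sup>2"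
  proof (cases "norm (u, p, q) = 0")
    case False
    then show ?thesis using main[of "norm (u, p, q)"] by simp
  next
    case True
    then have "u = 0" by (simp add: zero_prod_def)
    have "AE x in lborel. fn u x = 0" using fn_toL2[OF L2_zero] unfolding toL2_zero \<open>u = 0\<close> .
    then have "AE x in lborel. (fn u x)\<^sup>2 = 0" by eventually_elim simp
    then have "toL2 (\<lambda>x. (fn u x)\<^sup>2) = toL2 (\<lambda>x. 0)"
      using main[of 1] True by (intro toL2_eqI L2_zero) simp_all
    then show ?thesis by (simp add: toL2_zero)
  qed
qed

lemma trudinger_local:
  assumes wp0: "wp e1 u0 p0" "wp e2 u0 q0" and \<kappa>: "\<kappa> > 0"
  obtains r C where "r > 0" "C \<ge> 0"
    "\<And>u p q. wp e1 u p \<Longrightarrow> wp e2 u q \<Longrightarrow> norm ((u, p, q) - (u0, p0, q0)) \<le> r \<Longrightarrow> expm \<kappa> u \<le> ennreal C"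
proof -
  \<comment> \<open>\<open>trudinger_scaled\<close> will be applied to w = u - \<phi> with exponent
    2 \<kappa>, as (a + b)^2 \<le> 2 a^2 + 2 b^2, and with radius 2 r, from u to u0 and from u0 to
    \<phi>; this requires 2048 \<kappa> r^2 \<le> 1. The dependence on u0 sits in C alone.\<close>
  define r where "r = 1 / (1 + 2048 * \<kappa>)"
  have r: "r > 0" using \<kappa> by (simp add: r_def)
  have r2: "256 * (2 * \<kappa>) * (2 * r)\<^sup>2 \<le> 1"
  proof -
    have "r \<le> 1" using \<kappa> by (simp add: r_def)
    then have "r\<^sup>2 \<le> r" using r by (simp add: power2_eq_square mult_left_le)
    then have "2048 * \<kappa> * r\<^sup>2 \<le> 2048 * \<kappa> * r" using \<kappa> by (intro mult_left_mono) simp_all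
    also have "\<dots> \<le> 1" using \<kappa> by (simp add: r_def)
    finally show ?thesis by (simp add: power_mult_distrib)
  qed
  have r3: "r / 3 > 0" using r by simp
  obtain \<phi> where \<phi>: "test_fun UNIV \<phi>" "norm (toL2 \<phi> - u0) < r / 3"
    "norm (toL2 (pd e1 \<phi>) - p0) < r / 3" "norm (toL2 (pd e2 \<phi>) - q0) < r / 3"
    by (rule test_fun_dense_plane[OF wp0 r3])
  note L = test_fun_L2[OF \<phi>(1)] test_fun_L2[OF test_fun_pd[OF \<phi>(1) e1_Basis]] test_fun_L2[OF test_fun_pd[OF \<phi>(1) e2_Basis]]
  let ?P = "(toL2 \<phi>, toL2 (pd e1 \<phi>), toL2 (pd e2 \<phi>))"
  have near: "norm ((u0, p0, q0) - ?P) \<le> r"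
    using norm_Pair_le[of "toL2 \<phi> - u0" "(toL2 (pd e1 \<phi>) - p0, toL2 (pd e2 \<phi>) - q0)"]
      norm_Pair_le[of "toL2 (pd e1 \<phi>) - p0" "toL2 (pd e2 \<phi>) - q0"] \<phi>(2,3,4)
      norm_minus_commute[of ?P "(u0, p0, q0)"] by simp
  \<comment> \<open>Integration by parts for test functions, as the limit of the skewness of the
    central differences.\<close>
  have wpP: "wp b (toL2 \<phi>) (toL2 (pd b \<phi>))" if b: "b \<in> Basis" for b unfolding wp_def
  proof (intro allI impI)
    fix \<psi> :: "real^2 \<Rightarrow> real" assume \<psi>: "test_fun UNIV \<psi>"
    show "inner (toL2 \<phi>) (toL2 (pd b \<psi>)) = - inner (toL2 (pd b \<phi>)) (toL2 \<psi>)"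
    proof (rule LIMSEQ_unique)
      show "(\<lambda>n. inner (toL2 \<phi>) (cd b n (toL2 \<psi>))) \<longlonglongrightarrow> inner (toL2 \<phi>) (toL2 (pd b \<psi>))"
        by (intro tendsto_intros cd_test_tendsto \<psi> b)
      have "(\<lambda>n. - inner (cd b n (toL2 \<phi>)) (toL2 \<psi>)) \<longlonglongrightarrow> - inner (toL2 (pd b \<phi>)) (toL2 \<psi>)"
        by (intro tendsto_intros cd_test_tendsto \<phi>(1) b)
      then show "(\<lambda>n. inner (toL2 \<phi>) (cd b n (toL2 \<psi>))) \<longlonglongrightarrow> - inner (toL2 (pd b \<phi>)) (toL2 \<psi>)"
        by (simp add: cd_skew)
    qed
  qed
  obtain M where M: "M \<ge> 0" "\<And>x. \<bar>\<phi> x\<bar> \<le> M" by (rule test_fun_bounded[OF \<phi>(1)]) blast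
  obtain R where R: "\<And>x. \<phi> x \<noteq> 0 \<Longrightarrow> norm x \<le> R" using \<phi>(1) unfolding test_fun_UNIV_iff by metis
  \<comment> \<open>For u = \<phi> + w, exp(\<kappa> u^2) is at most (k + 1) exp(2 \<kappa> w^2).
    After subtracting 1 there remain K times a Trudinger integrand and k itself, which is bounded
    with bounded support.\<close>
  define k where "k x = exp (2 * \<kappa> * (\<phi> x)\<^sup>2) - 1" for x
  have [measurable]: "\<phi> \<in> borel_measurable borel" by (rule test_fun_measurable[OF \<phi>(1)])
  have k0: "k x \<ge> 0" for x using \<kappa> by (simp add: k_def)
  define K where "K = exp (2 * \<kappa> * M\<^sup>2)"
  have kK: "k x + 1 \<le> K" for x
    using M \<kappa> by (simp add: k_def K_def abs_le_square_iff[symmetric])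
  have K0: "K \<ge> 0" by (simp add: K_def)
  have ki: "integrable lborel k"
  proof (rule bounded_support_L2(2))
    show "\<bar>k x\<bar> \<le> K" for x using k0[of x] kK[of x] by simp
    show "norm x \<le> R" if "k x \<noteq> 0" for x using that R[of x] by (cases "\<phi> x = 0") (simp_all add: k_def)
    show "k \<in> borel_measurable borel" unfolding k_def[abs_def] by simp
  qed
  define C where "C = K * 10 + (\<integral>x. k x \<partial>lborel)"
  have Ik: "(\<integral>x. k x \<partial>lborel) \<ge> 0" by (rule Bochner_Integration.integral_nonneg) (rule k0)
  have C: "C \<ge> 0" using Ik K0 by (simp add: C_def)
  show thesis
  proof (rule that[OF r C])
    fix u p q assume wp: "wp e1 u p" "wp e2 u q" and n: "norm ((u, p, q) - (u0, p0, q0)) \<le> r"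
    define w where "w = u - toL2 \<phi>"
    have "norm (w, p - toL2 (pd e1 \<phi>), q - toL2 (pd e2 \<phi>)) \<le> 2 * r"
      using norm_triangle_ineq[of "(u, p, q) - (u0, p0, q0)" "(u0, p0, q0) - ?P"] n near by (simp add: w_def)
    then have w: "expm (2 * \<kappa>) w \<le> 10" unfolding w_def
      by (rule trudinger_scaled[OF wp_diff[OF wp(1) wpP[OF e1_Basis]] wp_diff[OF wp(2) wpP[OF e2_Basis]] _ _ r2]) (use r in simp)
    have "expm \<kappa> u \<le> (\<integral>\<^sup>+x. ennreal K * ennreal (exp (2 * \<kappa> * (fn w x)\<^sup>2) - 1) + ennreal (k x) \<partial>lborel)"
      unfolding expm_def
    proof (rule nn_integral_mono_AE)
      show "AE x in lborel. ennreal (exp (\<kappa> * (fn u x)\<^sup>2) - 1) \<le> ennreal K * ennreal (exp (2 * \<kappa> * (fn w x)\<^sup>2) - 1) + ennreal (k x)"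
        using fn_diff[of u "toL2 \<phi>"] fn_toL2[OF L(1)]
      proof eventually_elim
        case (elim x)
        define a b where "a = \<phi> x" and "b = fn w x"
        have u: "fn u x = a + b" using elim by (simp add: a_def b_def w_def)
        have "(a + b)\<^sup>2 \<le> 2 * a\<^sup>2 + 2 * b\<^sup>2" by (rule square_sum_le)
        then have "\<kappa> * (a + b)\<^sup>2 \<le> 2 * \<kappa> * a\<^sup>2 + 2 * \<kappa> * b\<^sup>2" using mult_left_mono[of "(a + b)\<^sup>2" "2 * a\<^sup>2 + 2 * b\<^sup>2" \<kappa>] \<kappa> by (simp add: algebra_simps)
        then have "exp (\<kappa> * (a + b)\<^sup>2) \<le> exp (2 * \<kappa> * a\<^sup>2) * exp (2 * \<kappa> * b\<^sup>2)" by (simp add: exp_add[symmetric])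
        also have "\<dots> = (k x + 1) * (exp (2 * \<kappa> * b\<^sup>2) - 1) + (k x + 1)" by (simp add: k_def a_def algebra_simps)
        also have "\<dots> \<le> K * (exp (2 * \<kappa> * b\<^sup>2) - 1) + (k x + 1)"
          using kK[of x] \<kappa> by (intro add_right_mono mult_right_mono) simp_all
        finally have "exp (\<kappa> * (fn u x)\<^sup>2) - 1 \<le> K * (exp (2 * \<kappa> * (fn w x)\<^sup>2) - 1) + k x" unfolding u b_def by simp
        then have "ennreal (exp (\<kappa> * (fn u x)\<^sup>2) - 1) \<le> ennreal (K * (exp (2 * \<kappa> * (fn w x)\<^sup>2) - 1) + k x)" by (rule ennreal_leI)
        also have "\<dots> = ennreal K * ennreal (exp (2 * \<kappa> * (fn w x)\<^sup>2) - 1) + ennreal (k x)"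
          using K0 k0 \<kappa> by (subst ennreal_plus) (simp_all add: ennreal_mult)
        finally show ?case .
      qed
    qed
    also have "\<dots> = (\<integral>\<^sup>+x. ennreal K * ennreal (exp (2 * \<kappa> * (fn w x)\<^sup>2) - 1) \<partial>lborel) + (\<integral>\<^sup>+x. ennreal (k x) \<partial>lborel)"
      by (rule nn_integral_add) (simp_all add: k_def)
    also have "(\<integral>\<^sup>+x. ennreal K * ennreal (exp (2 * \<kappa> * (fn w x)\<^sup>2) - 1) \<partial>lborel) = ennreal K * expm (2 * \<kappa>) w"
      unfolding expm_def by (rule nn_integral_cmult) simp
    also have "(\<integral>\<^sup>+x. ennreal (k x) \<partial>lborel) = ennreal (\<integral>x. k x \<partial>lborel)"
      by (rule nn_integral_eq_integral[OF ki]) (simp add: k0)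
    also have "ennreal K * expm (2 * \<kappa>) w + ennreal (\<integral>x. k x \<partial>lborel) \<le> ennreal K * ennreal 10 + ennreal (\<integral>x. k x \<partial>lborel)"
      using w by (intro add_right_mono mult_left_mono) simp_all
    also have "\<dots> = ennreal C" unfolding C_def using K0 Ik by (subst ennreal_plus) (simp_all add: ennreal_mult)
    finally show "expm \<kappa> u \<le> ennreal C" .
  qed
qed

section \<open>Local well-posedness of mild solutions\<close>

text \<open>\<open>nl s = s - nonlin s\<close>: the mass term of the Klein--Gordon form is moved to the forcing.\<close>

definition nl :: "real \<Rightarrow> real" where "nl s = s - nonlin s"

lemma nl_DERIV: "(nl has_real_derivative 1 - (1 + 8 * pi * s\<^sup>2) * exp (4 * pi * s\<^sup>2)) (at s)"
  unfolding nl_def[abs_def] nonlin_def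
  by (auto intro!: derivative_eq_intros simp: algebra_simps power2_eq_square)

lemma nl_measurable [measurable]: "nl \<in> borel_measurable borel"
  using nl_DERIV DERIV_isCont continuous_at_imp_continuous_on borel_measurable_continuous_onI by blast

lemma nl_zero: "nl 0 = 0" by (simp add: nl_def nonlin_def)

text \<open>Mean value inequality: the derivative of \<open>nl\<close> is at most (1 + 8 pi s^2)
  exp(4 pi s^2) - 1 in modulus, and 1 + x \<le> exp x bounds this by exp(12 pi s^2) - 1. It vanishes
  at 0 because the linear part of the nonlinearity has been subtracted; without the -1 the bound
  would not be integrable over the plane.\<close>

lemma nl_diff_le:
  "\<bar>nl a - nl b\<bar> \<le> \<bar>a - b\<bar> * ((exp (12 * pi * a\<^sup>2) - 1) + (exp (12 * pi * b\<^sup>2) - 1))"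
proof -
  define P where "P = (exp (12 * pi * a\<^sup>2) - 1) + (exp (12 * pi * b\<^sup>2) - 1)"
  have "norm (nl a - nl b) \<le> P * norm (a - b)"
  proof (rule field_differentiable_bound[where S = "closed_segment b a" and f' = "\<lambda>s. 1 - (1 + 8 * pi * s\<^sup>2) * exp (4 * pi * s\<^sup>2)"])
    fix s assume s: "s \<in> closed_segment b a"
    show "(nl has_field_derivative 1 - (1 + 8 * pi * s\<^sup>2) * exp (4 * pi * s\<^sup>2)) (at s within closed_segment b a)"
      by (rule has_field_derivative_at_within[OF nl_DERIV])
    have "\<bar>s\<bar> \<le> \<bar>a\<bar> \<or> \<bar>s\<bar> \<le> \<bar>b\<bar>" using s by (auto simp: closed_segment_eq_real_ivl split: if_splits)
    then have "s\<^sup>2 \<le> a\<^sup>2 \<or> s\<^sup>2 \<le> b\<^sup>2" by (simp add: abs_le_square_iff)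
    then have "exp (12 * pi * s\<^sup>2) \<le> exp (12 * pi * a\<^sup>2) \<or> exp (12 * pi * s\<^sup>2) \<le> exp (12 * pi * b\<^sup>2)" by simp
    moreover have "exp (12 * pi * a\<^sup>2) \<ge> 1" "exp (12 * pi * b\<^sup>2) \<ge> 1" by simp_all
    ultimately have 1: "exp (12 * pi * s\<^sup>2) - 1 \<le> P" unfolding P_def by linarith
    have "1 \<le> (1 + 8 * pi * s\<^sup>2) * exp (4 * pi * s\<^sup>2)"
      using mult_mono[of 1 "1 + 8 * pi * s\<^sup>2" 1 "exp (4 * pi * s\<^sup>2)"] by simp
    moreover have "(1 + 8 * pi * s\<^sup>2) * exp (4 * pi * s\<^sup>2) \<le> exp (8 * pi * s\<^sup>2) * exp (4 * pi * s\<^sup>2)"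
      using exp_ge_add_one_self[of "8 * pi * s\<^sup>2"] by (intro mult_right_mono) simp_all
    moreover have "exp (8 * pi * s\<^sup>2) * exp (4 * pi * s\<^sup>2) = exp (12 * pi * s\<^sup>2)" by (simp add: exp_add[symmetric] algebra_simps)
    ultimately show "norm (1 - (1 + 8 * pi * s\<^sup>2) * exp (4 * pi * s\<^sup>2)) \<le> P" using 1 by simp
  qed auto
  then show ?thesis by (simp add: P_def mult.commute)
qed

text \<open>For X \<ge> 1 one has (X - 1)^2 \<le> X^2 - 1, so squaring doubles the exponent and
  keeps the subtracted 1.\<close>

lemma expm_L2:
  assumes "expm (2 * \<kappa>) u \<le> ennreal C" "\<kappa> \<ge> 0" "C \<ge> 0"
  shows "L2 (\<lambda>x. exp (\<kappa> * (fn u x)\<^sup>2) - 1)" "norm (toL2 (\<lambda>x. exp (\<kappa> * (fn u x)\<^sup>2) - 1)) \<le> sqrt C"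
proof -
  have "(\<integral>\<^sup>+x. ennreal ((exp (\<kappa> * (fn u x)\<^sup>2) - 1)\<^sup>2) \<partial>lborel) \<le> expm (2 * \<kappa>) u"
    unfolding expm_def
  proof (intro nn_integral_mono ennreal_leI)
    fix x
    define X where "X = exp (\<kappa> * (fn u x)\<^sup>2)"
    have X: "X \<ge> 1" using assms by (simp add: X_def)
    have "exp (2 * \<kappa> * (fn u x)\<^sup>2) = X * X" by (simp add: X_def exp_add[symmetric])
    moreover have "(X - 1)\<^sup>2 \<le> X * X - 1" using X by (simp add: power2_eq_square algebra_simps)
    ultimately show "(exp (\<kappa> * (fn u x)\<^sup>2) - 1)\<^sup>2 \<le> exp (2 * \<kappa> * (fn u x)\<^sup>2) - 1" by (simp add: X_def)
  qed
  then have le: "(\<integral>\<^sup>+x. ennreal ((exp (\<kappa> * (fn u x)\<^sup>2) - 1)\<^sup>2) \<partial>lborel) \<le> ennreal C" using assms(1) by (rule order_trans)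
  show L: "L2 (\<lambda>x. exp (\<kappa> * (fn u x)\<^sup>2) - 1)" by (rule L2I_nn_integral) (use le_less_trans[OF le ennreal_less_top] in simp_all)
  have "(norm (toL2 (\<lambda>x. exp (\<kappa> * (fn u x)\<^sup>2) - 1)))\<^sup>2 \<le> C"
    using le assms(3) unfolding nn_integral_square[OF L] by (subst (asm) ennreal_le_iff) simp_all
  then show "norm (toL2 (\<lambda>x. exp (\<kappa> * (fn u x)\<^sup>2) - 1)) \<le> sqrt C" by (rule real_le_rsqrt)
qed

text \<open>Squaring \<open>nl_diff_le\<close> gives (u - u')^2 times terms exp(24 pi u^2) - 1.
  Cauchy-Schwarz separates the factors: the first is in L2 by the fourth power bound, the second by
  the exponential bound at 48 pi. The constant is 8000 = 2 * 2000 * 2.\<close>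

lemma nl_diff_L2:
  assumes wp: "wp e1 (u - u') p" "wp e2 (u - u') q"
    and C: "expm (48 * pi) u \<le> ennreal C" "expm (48 * pi) u' \<le> ennreal C" "C \<ge> 0"
  shows "L2 (\<lambda>x. nl (fn u x) - nl (fn u' x))"
    "(norm (toL2 (\<lambda>x. nl (fn u x) - nl (fn u' x))))\<^sup>2 \<le> 8000 * sqrt C * (norm (u - u', p, q))\<^sup>2"
proof -
  define E where "E v x = exp (24 * pi * (fn v x)\<^sup>2) - 1" for v :: ll and x
  have EL: "L2 (E u)" "norm (toL2 (E u)) \<le> sqrt C" "L2 (E u')" "norm (toL2 (E u')) \<le> sqrt C"
    unfolding E_def[abs_def] using expm_L2[of "24 * pi" u C] expm_L2[of "24 * pi" u' C] C by simp_all
  define Q where "Q x = E u x + E u' x" for x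
  have Q: "L2 Q" "norm (toL2 Q) \<le> 2 * sqrt C"
    unfolding Q_def[abs_def] using L2_add[OF EL(1,3)] norm_triangle_ineq[of "toL2 (E u)" "toL2 (E u')"] EL(2,4)
    by (simp_all add: toL2_add[OF EL(1,3)])
  define d2 where "d2 x = (fn (u - u') x)\<^sup>2" for x
  have d2: "L2 d2" "norm (toL2 d2) \<le> 2000 * (norm (u - u', p, q))\<^sup>2"
    unfolding d2_def[abs_def] by (rule sobolev_L4[OF wp])+
  define D where "D x = nl (fn u x) - nl (fn u' x)" for x
  have [measurable]: "D \<in> borel_measurable borel" unfolding D_def[abs_def] by measurable
  have pw: "AE x in lborel. (D x)\<^sup>2 \<le> 2 * (d2 x * Q x)" using fn_diff[of u u']
  proof eventually_elim
    case (elim x)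
    define X Y where "X = exp (12 * pi * (fn u x)\<^sup>2)" and "Y = exp (12 * pi * (fn u' x)\<^sup>2)"
    have XY: "X \<ge> 1" "Y \<ge> 1" "E u x = X * X - 1" "E u' x = Y * Y - 1"
      by (simp_all add: X_def Y_def E_def exp_add[symmetric])
    have "\<bar>D x\<bar> \<le> \<bar>\<bar>fn u x - fn u' x\<bar> * ((X - 1) + (Y - 1))\<bar>"
      using order_trans[OF nl_diff_le abs_ge_self] unfolding D_def X_def Y_def .
    then have "(D x)\<^sup>2 \<le> (\<bar>fn u x - fn u' x\<bar> * ((X - 1) + (Y - 1)))\<^sup>2" by (simp only: abs_le_square_iff)
    also have "\<dots> = d2 x * ((X - 1) + (Y - 1))\<^sup>2" by (simp add: d2_def elim power_mult_distrib)
    also have "\<dots> \<le> d2 x * (2 * Q x)"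
    proof (rule mult_left_mono)
      have add: "s \<le> 2 * (c + d)" if "s \<le> 2 * a + 2 * b" "a \<le> c" "b \<le> d" for s a b c d :: real
      proof -
        have "2 * a + 2 * b \<le> 2 * c + 2 * d" by (rule add_mono) (use that in simp_all)
        from order_trans[OF that(1) this] show ?thesis by (simp only: distrib_left)
      qed
      have "((X - 1) + (Y - 1))\<^sup>2 \<le> 2 * (X - 1)\<^sup>2 + 2 * (Y - 1)\<^sup>2" by (rule square_sum_le)
      moreover have "(X - 1)\<^sup>2 \<le> X * X - 1" "(Y - 1)\<^sup>2 \<le> Y * Y - 1" using XY by (simp_all add: power2_eq_square algebra_simps)
      ultimately show "((X - 1) + (Y - 1))\<^sup>2 \<le> 2 * Q x" unfolding Q_def XY by (rule add)
    qed (simp add: d2_def)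
    finally show ?case by (simp add: mult.left_commute)
  qed
  have i: "integrable lborel (\<lambda>x. 2 * (d2 x * Q x))" using L2_integrable_mult[OF d2(1) Q(1)] by simp
  have iD: "integrable lborel (\<lambda>x. (D x)\<^sup>2)"
  proof (rule Bochner_Integration.integrable_bound[OF i])
    show "AE x in lborel. norm ((D x)\<^sup>2) \<le> norm (2 * (d2 x * Q x))"
      using pw by eventually_elim (simp add: order_trans[OF _ abs_ge_self])
  qed simp
  then have DL: "L2 D" by (simp add: L2_def)
  then show "L2 (\<lambda>x. nl (fn u x) - nl (fn u' x))" unfolding D_def[abs_def] .
  have "(norm (toL2 D))\<^sup>2 = (\<integral>x. (D x)\<^sup>2 \<partial>lborel)" by (rule norm_toL2_sq[OF DL])
  also have "\<dots> \<le> (\<integral>x. 2 * (d2 x * Q x) \<partial>lborel)" by (rule integral_mono_AE[OF iD i pw])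
  also have "\<dots> = 2 * inner (toL2 d2) (toL2 Q)" by (simp add: inner_toL2[OF d2(1) Q(1)])
  also have "\<dots> \<le> 2 * (norm (toL2 d2) * norm (toL2 Q))" using norm_cauchy_schwarz[of "toL2 d2" "toL2 Q"] by simp
  also have "\<dots> \<le> 2 * ((2000 * (norm (u - u', p, q))\<^sup>2) * (2 * sqrt C))"
    by (intro mult_left_mono mult_mono d2(2) Q(2)) simp_all
  finally show "(norm (toL2 (\<lambda>x. nl (fn u x) - nl (fn u' x))))\<^sup>2 \<le> 8000 * sqrt C * (norm (u - u', p, q))\<^sup>2"
    unfolding D_def[abs_def] by (simp add: algebra_simps)
qed

definition NL :: "st \<Rightarrow> ll" where "NL y = toL2 (\<lambda>x. nl (fn (fst (snd y)) x))"

lemma NL_locally_Lipschitz: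
  assumes y0: "y0 \<in> G"
  obtains r L where "r > 0" "L \<ge> 0"
    "\<And>x y. x \<in> G \<Longrightarrow> y \<in> G \<Longrightarrow> norm (x - y0) \<le> r \<Longrightarrow> norm (y - y0) \<le> r \<Longrightarrow> norm (NL x - NL y) \<le> L * norm (x - y)"
    "\<And>x. x \<in> G \<Longrightarrow> norm (x - y0) \<le> r \<Longrightarrow> L2 (\<lambda>z. nl (fn (fst (snd x)) z))"
proof -
  obtain v0 u0 p0 q0 where y: "y0 = (v0, u0, p0, q0)" by (cases y0) auto
  have wp0: "wp e1 u0 p0" "wp e2 u0 q0" using y0 unfolding y G_iff by blast+
  obtain r C where r: "r > 0" "C \<ge> 0" and bd: "\<And>u p q. wp e1 u p \<Longrightarrow> wp e2 u q \<Longrightarrow>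
      norm ((u, p, q) - (u0, p0, q0)) \<le> r \<Longrightarrow> expm (48 * pi) u \<le> ennreal C"
    by (rule trudinger_local[OF wp0, of "48 * pi"]) (simp, blast)
  \<comment> \<open>\<open>nl_diff_L2\<close> asks for exponential bounds and not for nearness to
    y0, so the comparison with the zero function shows that the forcing itself lies in L2.\<close>
  have z: "expm (48 * pi) 0 \<le> ennreal C"
  proof -
    have "expm (48 * pi) 0 = (\<integral>\<^sup>+x. 0 \<partial>(lborel :: (real^2) measure))" unfolding expm_def
    proof (rule nn_integral_cong_AE)
      have "AE x in lborel. fn (0 :: ll) x = 0" using fn_toL2[OF L2_zero] unfolding toL2_zero .
      then show "AE x in lborel. ennreal (exp (48 * pi * (fn (0 :: ll) x)\<^sup>2) - 1) = 0" by eventually_elim simp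
    qed
    then show ?thesis by simp
  qed
  have E: "expm (48 * pi) (fst (snd x)) \<le> ennreal C" if x: "x \<in> G" "norm (x - y0) \<le> r" for x
  proof -
    obtain v u p q where x': "x = (v, u, p, q)" by (cases x) auto
    have "norm ((u, p, q) - (u0, p0, q0)) \<le> norm (x - y0)" unfolding x' y using norm_snd_le by simp
    then show ?thesis using bd[of u p q] x unfolding x' G_iff by simp
  qed
  have Lnl: "L2 (\<lambda>z. nl (fn (fst (snd x)) z))" if x: "x \<in> G" "norm (x - y0) \<le> r" for x
  proof -
    obtain v u p q where x': "x = (v, u, p, q)" by (cases x) auto
    have wp: "wp e1 (u - 0) p" "wp e2 (u - 0) q" using x unfolding x' G_iff by simp_all
    have L: "L2 (\<lambda>z. nl (fn u z) - nl (fn 0 z))"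
      by (rule nl_diff_L2(1)[OF wp _ z r(2)]) (use E[OF x] in \<open>simp add: x'\<close>)
    have "AE z in lborel. fn (0 :: ll) z = 0" using fn_toL2[OF L2_zero] unfolding toL2_zero .
    then have "AE z in lborel. nl (fn u z) = nl (fn u z) - nl (fn 0 z)" by eventually_elim (simp add: nl_zero)
    then have "L2 (\<lambda>z. nl (fn u z))" by (rule L2_AE_cong[OF L, rotated]) simp
    then show ?thesis by (simp add: x')
  qed
  show thesis
  proof (rule that[OF r(1)])
    show "sqrt (8000 * sqrt C) \<ge> 0" using r by simp
    fix x y assume x: "x \<in> G" "norm (x - y0) \<le> r" and y: "y \<in> G" "norm (y - y0) \<le> r"
    obtain v u p q where x': "x = (v, u, p, q)" by (cases x) auto
    obtain v' u' p' q' where y': "y = (v', u', p', q')" by (cases y) auto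
    have wp: "wp e1 (u - u') (p - p')" "wp e2 (u - u') (q - q')" using G_diff[OF x(1) y(1)] unfolding x' y' by (simp_all add: G_iff)
    have L: "L2 (\<lambda>z. nl (fn u z))" "L2 (\<lambda>z. nl (fn u' z))" using Lnl[OF x] Lnl[OF y] by (simp_all add: x' y')
    have "(norm (NL x - NL y))\<^sup>2 \<le> 8000 * sqrt C * (norm (u - u', p - p', q - q'))\<^sup>2"
      using nl_diff_L2(2)[OF wp _ _ r(2)] E[OF x] E[OF y] by (simp add: NL_def x' y' toL2_diff[OF L])
    also have "\<dots> \<le> 8000 * sqrt C * (norm (x - y))\<^sup>2"
      unfolding x' y' using norm_snd_le r by (intro mult_left_mono power_mono) simp_all
    finally have "norm (NL x - NL y) \<le> sqrt (8000 * sqrt C * (norm (x - y))\<^sup>2)" by (rule real_le_rsqrt)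
    then show "norm (NL x - NL y) \<le> sqrt (8000 * sqrt C) * norm (x - y)" by (simp add: real_sqrt_mult)
  next
    fix x assume "x \<in> G" "norm (x - y0) \<le> r" then show "L2 (\<lambda>z. nl (fn (fst (snd x)) z))" by (rule Lnl)
  qed
qed

text \<open>At the first time at which h reaches r, all earlier values are at most r, so the
  hypothesis improves the bound there to a < r, a contradiction.\<close>

lemma continuity_bootstrap:
  fixes h :: "real \<Rightarrow> real"
  assumes c: "continuous_on {0..T} h" and h0: "h 0 \<le> a" and a: "a < r"
    and step: "\<And>t. t \<in> {0..T} \<Longrightarrow> (\<And>s. s \<in> {0..t} \<Longrightarrow> h s \<le> r) \<Longrightarrow> h t \<le> a"
    and t: "t \<in> {0..T}"
  shows "h t \<le> r"
proof (rule ccontr)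
  assume "\<not> h t \<le> r"
  then have ht: "r \<le> h t" by simp
  define A where "A = {0..t} \<inter> h -` {r}"
  have ct: "continuous_on {0..s} h" if "s \<le> t" for s using continuous_on_subset[OF c, of "{0..s}"] t that by auto
  have ivt: "\<exists>x\<in>A. x \<le> s" if s: "s \<in> {0..t}" "r \<le> h s" for s
  proof -
    obtain x where "0 \<le> x" "x \<le> s" "h x = r"
      using IVT'[of h 0 r s] h0 a s ct[of s] by auto
    then show ?thesis using s by (auto simp: A_def)
  qed
  have "compact A" unfolding A_def
    using continuous_closed_preimage[OF ct[OF order_refl], of "{r}"] by (simp add: compact_eq_bounded_closed bounded_Int)
  moreover have "A \<noteq> {}" using ivt[of t] ht t by auto
  ultimately obtain m where m: "m \<in> A" "\<And>x. x \<in> A \<Longrightarrow> m \<le> x" using compact_attains_inf[of A] by blast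
  have "h s \<le> r" if s: "s \<in> {0..m}" for s
  proof (rule ccontr)
    assume "\<not> h s \<le> r"
    moreover have "s \<in> {0..t}" using s m(1) by (auto simp: A_def)
    ultimately obtain x where "x \<in> A" "x \<le> s" using ivt[of s] by auto
    then have "s = m" using m(2)[of x] s by auto
    then show False using \<open>\<not> h s \<le> r\<close> m(1) by (simp add: A_def)
  qed
  then have "h m \<le> a" using step[of m] m(1) t by (auto simp: A_def)
  then show False using m(1) a by (simp add: A_def)
qed

section \<open>The fixed point problem\<close>

definition frc :: "ll \<Rightarrow> st" where "frc g = (g, 0, 0, 0)"

lemma norm_frc_diff: "norm (frc g - frc h) = norm (g - h)"
  by (simp add: frc_def norm_Pair)

lemma continuous_on_frc: "continuous_on X g \<Longrightarrow> continuous_on X (\<lambda>s. frc (g s))"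
  unfolding frc_def by (intro continuous_intros)

definition sol :: "real \<Rightarrow> st \<Rightarrow> (real \<Rightarrow> st) \<Rightarrow> bool" where
  "sol T x0 x \<longleftrightarrow> continuous_on {0..T} x \<and> (\<forall>t\<in>{0..T}. x t \<in> G) \<and>
    (\<forall>t\<in>{0..T}. x t = kg.mild x0 (\<lambda>s. frc (NL (x s))) t)"

lemma continuous_on_NL: "continuous_on G NL"
proof -
  have "(NL \<longlongrightarrow> NL y0) (at y0 within G)" if y0: "y0 \<in> G" for y0
  proof -
    obtain r L where r: "r > 0" "L \<ge> 0" and lip: "\<And>x y. x \<in> G \<Longrightarrow> y \<in> G \<Longrightarrow> norm (x - y0) \<le> r \<Longrightarrow>
        norm (y - y0) \<le> r \<Longrightarrow> norm (NL x - NL y) \<le> L * norm (x - y)"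
      by (rule NL_locally_Lipschitz[OF y0]) blast
    have "((\<lambda>x. NL x - NL y0) \<longlongrightarrow> 0) (at y0 within G)"
    proof (rule Lim_null_comparison)
      show "\<forall>\<^sub>F x in at y0 within G. norm (NL x - NL y0) \<le> L * norm (x - y0)"
        unfolding eventually_at
        by (intro exI[of _ r] conjI r ballI impI lip) (use y0 r in \<open>simp_all add: dist_norm\<close>)
      have "((\<lambda>x. L * norm (x - y0)) \<longlongrightarrow> L * norm (y0 - y0)) (at y0 within G)" by (intro tendsto_intros)
      then show "((\<lambda>x. L * norm (x - y0)) \<longlongrightarrow> 0) (at y0 within G)" by simp
    qed
    then show ?thesis by (simp add: LIM_zero_iff)
  qed
  then show ?thesis by (simp add: continuous_on_def)
qed

lemma continuous_on_NL_compose: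
  "continuous_on X x \<Longrightarrow> (\<And>t. t \<in> X \<Longrightarrow> x t \<in> G) \<Longrightarrow> continuous_on X (\<lambda>t. NL (x t))"
  by (rule continuous_on_compose2[OF continuous_on_NL]) auto

text \<open>T and \<delta> are chosen from y0 alone and serve all nearby data. The second claim
  speaks of arbitrary solutions, without assuming that they stay near y0, so with equal data it is
  uniqueness.\<close>

theorem local_wellposedness_mild:
  assumes y0: "y0 \<in> G"
  obtains T \<delta> where "T > 0" "\<delta> > 0"
    "\<And>x0. x0 \<in> G \<Longrightarrow> norm (x0 - y0) < \<delta> \<Longrightarrow> \<exists>x. sol T x0 x"
    "\<And>x0 z0 x z t. norm (x0 - y0) < \<delta> \<Longrightarrow> norm (z0 - y0) < \<delta> \<Longrightarrow> sol T x0 x \<Longrightarrow> sol T z0 z \<Longrightarrow>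
      t \<in> {0..T} \<Longrightarrow> norm (x t - z t) \<le> 2 * norm (x0 - z0)"
proof -
  obtain r L where r: "r > 0" and L: "L \<ge> 0" and lip: "\<And>x y. x \<in> G \<Longrightarrow> y \<in> G \<Longrightarrow> norm (x - y0) \<le> r \<Longrightarrow>
      norm (y - y0) \<le> r \<Longrightarrow> norm (NL x - NL y) \<le> L * norm (x - y)"
    by (rule NL_locally_Lipschitz[OF y0]) blast
  define M where "M = norm (NL y0) + L * r"
  have M: "M \<ge> 0" using L r by (simp add: M_def)
  have NLM: "norm (NL x) \<le> M" if "x \<in> G" "norm (x - y0) \<le> r" for x
  proof -
    have "norm (NL x - NL y0) \<le> L * norm (x - y0)" using lip[OF that(1) y0 that(2)] r by simp
    also have "\<dots> \<le> L * r" by (rule mult_left_mono[OF that(2) L])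
    finally show ?thesis using norm_triangle_ineq2[of "NL x" "NL y0"] by (simp add: M_def)
  qed
  have "isCont (\<lambda>t. kg.S t y0) 0" using kg.S_continuous_time by (simp add: continuous_on_eq_continuous_at)
  moreover have "r / 4 > 0" using r by simp
  ultimately obtain d where "d > 0" "\<forall>t. dist t 0 < d \<longrightarrow> dist (kg.S t y0) (kg.S 0 y0) < r / 4"
    unfolding continuous_at_eps_delta by blast
  then have d: "d > 0" "\<And>t. \<bar>t\<bar> < d \<Longrightarrow> norm (kg.S t y0 - y0) < r / 4"
    by (simp_all add: dist_norm kg.S_zero_time)
  \<comment> \<open>Three demands: T < d keeps the free evolution within r/4 of y0, T L \<le> 1/2
    gives the contraction, and T M \<le> r/4 bounds the effect of the forcing. With initial distance
    below r/4 this places solutions within 3r/4 of y0, strictly inside the ball as the bootstrap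
    requires. The added 1s cover L = 0 and M = 0.\<close>
  define T where "T = min (d / 2) (min (1 / (2 * (L + 1))) (r / (4 * (M + 1))))"
  have T: "T > 0" "T < d" using d r L M by (auto simp: T_def)
  have TL: "T * L \<le> 1 / 2"
  proof -
    have "T * L \<le> (1 / (2 * (L + 1))) * L" by (rule mult_right_mono[OF _ L]) (simp add: T_def)
    also have "\<dots> \<le> 1 / 2" using L by (simp add: field_simps)
    finally show ?thesis .
  qed
  have TM: "T * M \<le> r / 4"
  proof -
    have "T * M \<le> (r / (4 * (M + 1))) * M" by (rule mult_right_mono[OF _ M]) (simp add: T_def)
    also have "\<dots> \<le> r / 4" using M r by (simp add: field_simps)
    finally show ?thesis .
  qed
  define B where "B = {x \<in> G. norm (x - y0) \<le> r}"
  have near: "norm (kg.mild x0 (\<lambda>s. frc (f s)) t - y0) \<le> 3 / 4 * r"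
    if x0: "norm (x0 - y0) < r / 4" and f: "continuous_on {0..t} f" and t: "t \<in> {0..T}"
      and fM: "\<And>s. s \<in> {0..t} \<Longrightarrow> norm (f s) \<le> M" for x0 f t
  proof -
    have "norm (kg.mild x0 (\<lambda>s. frc (f s)) t - kg.mild y0 (\<lambda>s. frc 0) t) \<le> norm (x0 - y0) + t * M"
      by (rule kg.mild_diff_le[OF continuous_on_frc[OF f] continuous_on_const]) (use t fM in \<open>simp_all add: norm_frc_diff\<close>)
    moreover have "t * M \<le> T * M" using t M by (intro mult_right_mono) simp_all
    moreover have "kg.mild y0 (\<lambda>s. frc 0) t = kg.S t y0"
    proof -
      have "kg.S (- s) (frc 0) = 0" for s using kg.S_norm[of "- s" "frc 0"] by (simp add: frc_def norm_Pair)
      then show ?thesis by (simp add: kg.mild_def)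
    qed
    moreover have "norm (kg.S t y0 - y0) < r / 4" using d(2)[of t] t T by auto
    ultimately show ?thesis
      using norm_triangle_ineq[of "kg.mild x0 (\<lambda>s. frc (f s)) t - kg.S t y0" "kg.S t y0 - y0"] TM x0 by simp
  qed
  have contr: "norm (kg.mild x0 (\<lambda>s. frc (NL (x s))) t - kg.mild z0 (\<lambda>s. frc (NL (z s))) t) \<le> norm (x0 - z0) + D / 2"
    if x: "continuous_on {0..T} x" "\<And>s. s \<in> {0..T} \<Longrightarrow> x s \<in> B" and z: "continuous_on {0..T} z" "\<And>s. s \<in> {0..T} \<Longrightarrow> z s \<in> B"
      and D: "\<And>s. s \<in> {0..T} \<Longrightarrow> norm (x s - z s) \<le> D" and t: "t \<in> {0..T}" for x0 z0 x z t D
  proof -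
    have D0: "D \<ge> 0" using D[OF t] norm_ge_zero order_trans by blast
    have "norm (kg.mild x0 (\<lambda>s. frc (NL (x s))) t - kg.mild z0 (\<lambda>s. frc (NL (z s))) t) \<le> norm (x0 - z0) + t * (L * D)"
    proof (rule kg.mild_diff_le)
      show "continuous_on {0..T} (\<lambda>s. frc (NL (x s)))" "continuous_on {0..T} (\<lambda>s. frc (NL (z s)))"
        using x z by (auto simp: B_def intro!: continuous_on_frc continuous_on_NL_compose)
      fix s assume "s \<in> {0..t}"
      then have s: "s \<in> {0..T}" using t by auto
      have "norm (NL (x s) - NL (z s)) \<le> L * norm (x s - z s)" using x(2)[OF s] z(2)[OF s] by (intro lip) (auto simp: B_def)
      also have "\<dots> \<le> L * D" by (rule mult_left_mono[OF D[OF s] L])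
      finally show "norm (frc (NL (x s)) - frc (NL (z s))) \<le> L * D" by (simp add: norm_frc_diff)
    qed (rule t)
    also have "t * (L * D) \<le> T * (L * D)" using t L D0 by (intro mult_right_mono mult_nonneg_nonneg) simp_all
    also have "\<dots> \<le> 1 / 2 * D" using mult_right_mono[OF TL D0] by (simp add: mult.assoc)
    finally show ?thesis by simp
  qed
  \<comment> \<open>The ball is not part of the definition of \<open>sol\<close>; continuity in time
    confines every solution with nearby data to it.\<close>
  have stay: "x t \<in> B" if x0: "norm (x0 - y0) < r / 4" and x: "sol T x0 x" and t: "t \<in> {0..T}" for x0 x t
  proof -
    have xc: "continuous_on {0..T} x" and xG: "\<And>s. s \<in> {0..T} \<Longrightarrow> x s \<in> G"
      and xm: "\<And>s. s \<in> {0..T} \<Longrightarrow> x s = kg.mild x0 (\<lambda>s. frc (NL (x s))) s" using x by (auto simp: sol_def)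
    have "norm (x t - y0) \<le> r"
    proof (rule continuity_bootstrap[where T = T and h = "\<lambda>t. norm (x t - y0)" and a = "3 / 4 * r"])
      show "continuous_on {0..T} (\<lambda>t. norm (x t - y0))" by (intro continuous_intros xc)
      show "norm (x 0 - y0) \<le> 3 / 4 * r" using xm[of 0] T x0 r by (simp add: kg.mild_zero_time)
      fix t assume t: "t \<in> {0..T}" and le: "\<And>s. s \<in> {0..t} \<Longrightarrow> norm (x s - y0) \<le> r"
      have sub: "{0..t} \<subseteq> {0..T}" using t by auto
      show "norm (x t - y0) \<le> 3 / 4 * r" unfolding xm[OF t]
        by (rule near[OF x0 _ t]) (use sub xG le in \<open>auto intro!: NLM continuous_on_NL_compose continuous_on_subset[OF xc]\<close>)
    qed (use r t in simp_all)
    then show ?thesis using xG[OF t] by (simp add: B_def)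
  qed
  show thesis
  proof (rule that[OF T(1), of "r / 4"])
    show "r / 4 > 0" using r by simp
    fix x0 z0 x z t assume x0: "norm (x0 - y0) < r / 4" and z0: "norm (z0 - y0) < r / 4"
      and x: "sol T x0 x" and z: "sol T z0 z" and t: "t \<in> {0..T}"
    have c: "continuous_on {0..T} x" "continuous_on {0..T} z" using x z by (auto simp: sol_def)
    have "continuous_on {0..T} (\<lambda>t. norm (x t - z t))" by (intro continuous_intros c)
    \<comment> \<open>The largest difference D is attained. The contraction gives D \<le> |x0 - z0|
      + D/2 there, whence the factor 2.\<close>
    then obtain m where m: "m \<in> {0..T}" "\<And>s. s \<in> {0..T} \<Longrightarrow> norm (x s - z s) \<le> norm (x m - z m)"
      using continuous_attains_sup[of "{0..T}" "\<lambda>t. norm (x t - z t)"] T by auto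
    have eq: "x m = kg.mild x0 (\<lambda>s. frc (NL (x s))) m" "z m = kg.mild z0 (\<lambda>s. frc (NL (z s))) m"
      using x z m(1) unfolding sol_def by blast+
    have "norm (kg.mild x0 (\<lambda>s. frc (NL (x s))) m - kg.mild z0 (\<lambda>s. frc (NL (z s))) m) \<le> norm (x0 - z0) + norm (x m - z m) / 2"
      by (rule contr[OF c(1) stay[OF x0 x] c(2) stay[OF z0 z] m(2) m(1)])
    then have "norm (x m - z m) \<le> 2 * norm (x0 - z0)" unfolding eq[symmetric] by simp
    then show "norm (x t - z t) \<le> 2 * norm (x0 - z0)" using m(2)[OF t] by simp
  next
    fix x0 assume x0G: "x0 \<in> G" and x0: "norm (x0 - y0) < r / 4"
    define Y where "Y = rec_nat (kg.mild x0 (\<lambda>s. frc 0)) (\<lambda>n x. kg.mild x0 (\<lambda>s. frc (NL (x s))))"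
    have Y0: "Y 0 = kg.mild x0 (\<lambda>s. frc 0)" and YS: "Y (Suc n) = kg.mild x0 (\<lambda>s. frc (NL (Y n s)))" for n
      by (simp_all add: Y_def)
    have step: "continuous_on {0..T} (kg.mild x0 (\<lambda>s. frc (f s))) \<and> (\<forall>t\<in>{0..T}. kg.mild x0 (\<lambda>s. frc (f s)) t \<in> B)"
      if f: "continuous_on {0..T} f" "\<And>s. s \<in> {0..T} \<Longrightarrow> norm (f s) \<le> M" for f
    proof (intro conjI ballI)
      show "continuous_on {0..T} (kg.mild x0 (\<lambda>s. frc (f s)))" by (rule kg.mild_continuous[OF continuous_on_frc[OF f(1)]])
      fix t assume t: "t \<in> {0..T}"
      have "norm (kg.mild x0 (\<lambda>s. frc (f s)) t - y0) \<le> 3 / 4 * r"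
        by (rule near[OF x0 _ t]) (use t f continuous_on_subset[OF f(1), of "{0..t}"] in auto)
      moreover have "kg.mild x0 (\<lambda>s. frc (f s)) t \<in> G" using mild_G[OF x0G f(1) t] unfolding frc_def .
      ultimately show "kg.mild x0 (\<lambda>s. frc (f s)) t \<in> B" using r by (simp add: B_def)
    qed
    have NLstep: "continuous_on {0..T} (\<lambda>s. NL (x s))" "\<And>s. s \<in> {0..T} \<Longrightarrow> norm (NL (x s)) \<le> M"
      if "continuous_on {0..T} x" "\<And>s. s \<in> {0..T} \<Longrightarrow> x s \<in> B" for x
      using that by (auto simp: B_def intro!: continuous_on_NL_compose NLM)
    have Yc: "continuous_on {0..T} (Y n) \<and> (\<forall>t\<in>{0..T}. Y n t \<in> B)" for n
    proof (induction n)
      case 0 show ?case unfolding Y0 by (rule step) (use M in simp_all)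
    next
      case (Suc n) then show ?case unfolding YS by (intro step NLstep) blast+
    qed
    have YB: "Y n t \<in> B" if "t \<in> {0..T}" for n t using Yc that by blast
    \<comment> \<open>Picard iterates all lie in B, whose diameter is at most 2 r, and each
      application of the contraction halves the difference of two of them.\<close>
    have Ydiff: "t \<in> {0..T} \<Longrightarrow> norm (Y (n + k) t - Y n t) \<le> 2 * r * (1/2) ^ n" for n k t
    proof (induction n arbitrary: t)
      case 0
      have "norm (Y (0 + k) t - y0) \<le> r" "norm (Y 0 t - y0) \<le> r" using YB[OF 0] by (auto simp: B_def)
      then show ?case using norm_triangle_ineq4[of "Y (0 + k) t - y0" "Y 0 t - y0"] by simp
    next
      case (Suc n)
      have "norm (kg.mild x0 (\<lambda>s. frc (NL (Y (n + k) s))) t - kg.mild x0 (\<lambda>s. frc (NL (Y n s))) t) \<le> norm (x0 - x0) + (2 * r * (1/2) ^ n) / 2"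
        by (rule contr) (use Yc Suc in blast)+
      then show ?case by (simp add: YS)
    qed
    have lim0: "(\<lambda>n. 2 * r * (1/2) ^ n) \<longlonglongrightarrow> 0"
      using tendsto_mult[OF tendsto_const[of "2 * r"] LIMSEQ_power_zero[of "1/2 :: real"]] by simp
    have "uniformly_Cauchy_on {0..T} Y" unfolding uniformly_Cauchy_on_def
    proof (intro allI impI)
      fix e :: real assume e: "e > 0"
      obtain N where N: "\<And>n. n \<ge> N \<Longrightarrow> 2 * r * (1/2) ^ n < e / 2"
        using order_tendstoD(2)[OF lim0, of "e / 2"] e unfolding eventually_sequentially by auto
      show "\<exists>N. \<forall>t\<in>{0..T}. \<forall>m\<ge>N. \<forall>n\<ge>N. dist (Y m t) (Y n t) < e"
      proof (intro exI[of _ N] ballI allI impI)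
        fix t m n assume t: "t \<in> {0..T}" and mn: "m \<ge> N" "n \<ge> N"
        have "norm (Y m t - Y N t) < e / 2" "norm (Y n t - Y N t) < e / 2"
          using Ydiff[OF t, of N "m - N"] Ydiff[OF t, of N "n - N"] N[of N] mn by simp_all
        then show "dist (Y m t) (Y n t) < e"
          using norm_triangle_ineq4[of "Y m t - Y N t" "Y n t - Y N t"] by (simp add: dist_norm)
      qed
    qed
    then obtain y where y: "uniform_limit {0..T} Y y sequentially"
      using Cauchy_uniformly_convergent uniformly_convergent_on_def by blast
    have ylim: "(\<lambda>n. Y n t) \<longlonglongrightarrow> y t" if "t \<in> {0..T}" for t by (rule tendsto_uniform_limitI[OF y that])
    have yc: "continuous_on {0..T} y"
      by (rule uniform_limit_theorem[OF _ y]) (use Yc in simp_all)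
    have closedB: "closed B"
    proof -
      have "B = G \<inter> cball y0 r" by (auto simp: B_def dist_norm norm_minus_commute)
      then show ?thesis using closed_G by (simp add: closed_Int)
    qed
    have yB: "y t \<in> B" if t: "t \<in> {0..T}" for t
      by (rule Lim_in_closed_set[OF closedB _ _ ylim[OF t]]) (use YB[OF t] in simp_all)
    have Yy: "norm (Y n t - y t) \<le> 2 * r * (1/2) ^ n" if t: "t \<in> {0..T}" for n t
    proof -
      have "(\<lambda>k. norm (Y (k + n) t - Y n t)) \<longlonglongrightarrow> norm (y t - Y n t)"
        by (intro tendsto_intros LIMSEQ_ignore_initial_segment ylim t)
      then have "norm (y t - Y n t) \<le> 2 * r * (1/2) ^ n"
        by (rule LIMSEQ_le_const2) (use Ydiff[OF t, of n] in \<open>auto simp: add.commute\<close>)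
      then show ?thesis by (simp add: norm_minus_commute)
    qed
    have "y t = kg.mild x0 (\<lambda>s. frc (NL (y s))) t" if t: "t \<in> {0..T}" for t
    proof (rule LIMSEQ_unique)
      show "(\<lambda>n. Y (Suc n) t) \<longlonglongrightarrow> y t" by (rule LIMSEQ_Suc[OF ylim[OF t]])
      have "norm (Y (Suc n) t - kg.mild x0 (\<lambda>s. frc (NL (y s))) t) \<le> 2 * r * (1/2) ^ n" for n
      proof -
        have "norm (kg.mild x0 (\<lambda>s. frc (NL (Y n s))) t - kg.mild x0 (\<lambda>s. frc (NL (y s))) t) \<le> norm (x0 - x0) + (2 * r * (1/2) ^ n) / 2"
          by (rule contr[OF _ YB yc yB Yy t]) (use Yc in blast)
        also have "norm (x0 - x0) + (2 * r * (1/2) ^ n) / 2 \<le> 2 * r * (1/2) ^ n" using r by simp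
        finally show ?thesis unfolding YS .
      qed
      then have "(\<lambda>n. Y (Suc n) t - kg.mild x0 (\<lambda>s. frc (NL (y s))) t) \<longlonglongrightarrow> 0"
        by (intro Lim_null_comparison[OF always_eventually lim0]) simp
      then show "(\<lambda>n. Y (Suc n) t) \<longlonglongrightarrow> kg.mild x0 (\<lambda>s. frc (NL (y s))) t" by (simp add: LIM_zero_iff)
    qed
    then have "sol T x0 y" using yc yB by (auto simp: sol_def B_def)
    then show "\<exists>x. sol T x0 x" by blast
  qed
qed

section \<open>Distributional solutions are mild\<close>

lemma smooth_fun_real_DERIV: "smooth_fun \<theta> \<Longrightarrow> (\<theta> has_real_derivative pd 1 \<theta> t) (at t)" for \<theta> :: "real \<Rightarrow> real"
  using smooth_fun_DERIV[of \<theta> 1 0 t] by simp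

text \<open>For r < x < T - r the function y \<mapsto> \<rho>(x - y) has its support inside the open
  interval and is an admissible test function, so the mollification of \<gamma> has derivative 0 at
  x. It is therefore constant away from the ends, and letting r tend to 0 gives the claim for the
  continuous function \<gamma>.\<close>

lemma du_Bois_Reymond:
  fixes \<gamma> :: "real \<Rightarrow> real"
  assumes \<gamma>: "continuous_on {0..T} \<gamma>" and T: "T > 0"
    and weak: "\<And>\<theta>. test_fun {0<..<T} \<theta> \<Longrightarrow> ((\<lambda>t. pd 1 \<theta> t * \<gamma> t) has_integral 0) {0..T}"
    and t: "t \<in> {0..T}"
  shows "\<gamma> t = \<gamma> 0"
proof -
  define f where "f s = indicator {0..T} s * \<gamma> s" for s
  have f: "integrable lborel f"
    using borel_integrable_atLeastAtMost'[OF \<gamma>] by (simp add: set_integrable_def f_def[abs_def])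
  have zero: "conv (pd 1 \<rho>) f x = 0" if \<rho>: "mollifier r \<rho>" and x: "r < x" "x < T - r" for r \<rho> x
  proof -
    have t\<rho>: "test_fun UNIV \<rho>" and s: "\<And>x. \<rho> x \<noteq> 0 \<Longrightarrow> \<bar>x\<bar> \<le> r" using \<rho> by (auto simp: mollifier_def)
    have sm: "smooth_fun \<rho>" using t\<rho> by (simp add: test_fun_def)
    define \<theta> where "\<theta> y = \<rho> (x + (-1) *\<^sub>R y)" for y
    have "test_fun UNIV \<theta>" unfolding \<theta>_def[abs_def] by (rule test_fun_affine[OF t\<rho>]) simp
    moreover have "closure {y. \<theta> y \<noteq> 0} \<subseteq> {x - r..x + r}"
    proof (rule closure_minimal)
      show "{y. \<theta> y \<noteq> 0} \<subseteq> {x - r..x + r}"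
      proof
        fix y assume "y \<in> {y. \<theta> y \<noteq> 0}"
        then have "\<bar>x - y\<bar> \<le> r" using s[of "x - y"] by (simp add: \<theta>_def)
        then show "y \<in> {x - r..x + r}" by auto
      qed
    qed simp
    ultimately have \<theta>: "test_fun {0<..<T} \<theta>" using x by (auto simp: test_fun_def)
    have pd: "pd 1 \<theta> y = - pd 1 \<rho> (x - y)" for y
      unfolding \<theta>_def[abs_def] using pd_affine[OF sm, of 1 x "-1" y] by simp
    have c: "continuous_on {0..T} (\<lambda>y. pd 1 \<rho> (x - y) * \<gamma> y)"
      by (intro continuous_on_mult \<gamma> continuous_on_compose2[OF smooth_fun_continuous[OF smooth_fun_pd[OF sm]]] continuous_intros) simp_all
    have "conv (pd 1 \<rho>) f x = (LINT y:{0..T}|lborel. pd 1 \<rho> (x - y) * \<gamma> y)"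
      unfolding conv_def f_def set_lebesgue_integral_def by (simp add: mult.left_commute)
    also have "\<dots> = integral {0..T} (\<lambda>y. pd 1 \<rho> (x - y) * \<gamma> y)"
      by (rule set_borel_integral_eq_integral(2)[OF borel_integrable_atLeastAtMost'[OF c]])
    also have "\<dots> = 0"
      using integral_unique[OF has_integral_neg[OF weak[OF \<theta>]]] by (simp add: pd)
    finally show ?thesis .
  qed
  have const: "\<gamma> a = \<gamma> b" if ab: "a \<in> {0<..<T}" "b \<in> {0<..<T}" for a b
  proof -
    have close: "\<exists>d>0. \<forall>r \<rho>. r \<le> d \<longrightarrow> mollifier r \<rho> \<longrightarrow> \<bar>conv \<rho> f x - \<gamma> x\<bar> \<le> e" if x: "x \<in> {0<..<T}" and e: "e > 0" for x e
    proof -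
      obtain d where d: "d > 0" "\<And>y. y \<in> {0..T} \<Longrightarrow> dist y x < d \<Longrightarrow> dist (\<gamma> y) (\<gamma> x) < e"
        using \<gamma> x e unfolding continuous_on_iff by (meson greaterThanLessThan_subseteq_atLeastAtMost_iff order_refl subsetD)
      define d' where "d' = min (d / 2) (min x (T - x))"
      have d': "d' > 0" "d' < d" "d' \<le> x" "d' \<le> T - x" using d x by (auto simp: d'_def)
      have "\<bar>conv \<rho> f x - \<gamma> x\<bar> \<le> e" if r: "r \<le> d'" and \<rho>: "mollifier r \<rho>" for r \<rho>
      proof (rule conv_near[OF \<rho> f])
        fix y assume "norm (x - y) \<le> r"
        then have "\<bar>x - y\<bar> \<le> d'" using r by simp
        then have "y \<in> {0..T}" "dist y x < d" using d' by (auto simp: dist_real_def)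
        then show "\<bar>f y - \<gamma> x\<bar> \<le> e" using d(2)[of y] by (simp add: f_def dist_real_def)
      qed
      then show ?thesis using d'(1) by blast
    qed
    have "\<bar>\<gamma> a - \<gamma> b\<bar> \<le> e" if e: "e > 0" for e
    proof -
      have e2: "e / 2 > 0" using e by simp
      obtain d1 where d1: "d1 > 0" "\<And>r \<rho>. r \<le> d1 \<Longrightarrow> mollifier r \<rho> \<Longrightarrow> \<bar>conv \<rho> f a - \<gamma> a\<bar> \<le> e / 2" using close[OF ab(1) e2] by blast
      obtain d2 where d2: "d2 > 0" "\<And>r \<rho>. r \<le> d2 \<Longrightarrow> mollifier r \<rho> \<Longrightarrow> \<bar>conv \<rho> f b - \<gamma> b\<bar> \<le> e / 2" using close[OF ab(2) e2] by blast
      define m where "m = min (min a b) (min (T - a) (T - b))"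
      have m: "m > 0" "m \<le> a" "m \<le> b" "m \<le> T - a" "m \<le> T - b" using ab by (auto simp: m_def)
      define r where "r = min (min d1 d2) (m / 2)"
      have r: "r > 0" "r \<le> d1" "r \<le> d2" "r < m" using d1 d2 m(1) by (auto simp: r_def)
      have rab: "r < a" "r < b" "a < T - r" "b < T - r"
        using r(4) m by linarith+
      obtain \<rho> :: "real \<Rightarrow> real" where \<rho>: "mollifier r \<rho>" by (rule ex_mollifier[OF r(1)])
      have t\<rho>: "test_fun UNIV \<rho>" using \<rho> by (simp add: mollifier_def)
      have "conv \<rho> f a = conv \<rho> f b"
      proof -
        obtain c where "\<And>x. x \<in> {r<..<T - r} \<Longrightarrow> conv \<rho> f x = c"
        proof (rule exE[OF has_field_derivative_zero_constant[of "{r<..<T - r}" "conv \<rho> f"]])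
          fix x assume x: "x \<in> {r<..<T - r}"
          have "(conv \<rho> f has_real_derivative pd 1 (conv \<rho> f) x) (at x)" by (rule smooth_fun_real_DERIV[OF smooth_fun_conv[OF t\<rho> f]])
          then show "(conv \<rho> f has_real_derivative 0) (at x within {r<..<T - r})"
            using zero[OF \<rho>, of x] x by (simp add: pd_conv[OF t\<rho> f] has_field_derivative_at_within)
        qed auto
        then show ?thesis using rab by simp
      qed
      then show ?thesis using d1(2)[OF r(2) \<rho>] d2(2)[OF r(3) \<rho>] by (simp only: abs_le_iff) linarith
    qed
    from field_le_epsilon[of "\<bar>\<gamma> a - \<gamma> b\<bar>" 0] this show ?thesis by simp
  qed
  have cl: "closure {0<..<T} = {0..T}" using T by (rule closure_greaterThanLessThan)
  have T2: "T / 2 \<in> {0<..<T}" using T by simp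
  have "\<gamma> s = \<gamma> (T / 2)" if "s \<in> {0..T}" for s
    by (rule continuous_constant_on_closure[of "{0<..<T}" \<gamma>, unfolded cl, OF \<gamma> const[OF _ T2] that])
  from this[OF t] this[of 0] show ?thesis using T by simp
qed

lemma tendsto_of_norm_less:
  fixes x :: "nat \<Rightarrow> 'a::real_normed_vector"
  assumes "\<And>n. norm (x n - l) < 1 / real (Suc n)" shows "x \<longlonglongrightarrow> l"
proof -
  have "(\<lambda>n. x n - l) \<longlonglongrightarrow> 0"
    by (rule Lim_null_comparison[OF _ LIMSEQ_Suc[OF lim_1_over_n]]) (intro always_eventually allI less_imp_le assms)
  then show ?thesis by (simp add: LIM_zero_iff)
qed

lemma tensor_test:
  fixes \<theta> :: "real \<Rightarrow> real" and \<psi> :: "real^2 \<Rightarrow> real"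
  assumes \<theta>: "test_fun {0<..<T} \<theta>" and \<psi>: "test_fun UNIV \<psi>"
  defines "\<phi> \<equiv> \<lambda>z. \<theta> (fst z) * \<psi> (snd z)"
  shows "test_fun ({0<..<T} \<times> UNIV) \<phi>"
    "dtt \<phi> (t, x) - lap_x \<phi> (t, x) = pd 1 (pd 1 \<theta>) t * \<psi> x - \<theta> t * (pd e1 (pd e1 \<psi>) x + pd e2 (pd e2 \<psi>) x)"
proof -
  have sm: "smooth_fun \<theta>" "smooth_fun \<psi>" using \<theta> \<psi> by (simp_all add: test_fun_def)
  have sub: "closure {z. \<phi> z \<noteq> 0} \<subseteq> closure {t. \<theta> t \<noteq> 0} \<times> closure {x. \<psi> x \<noteq> 0}"
    unfolding closure_Times[symmetric] by (rule closure_mono) (auto simp: \<phi>_def)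
  have "compact (closure {t. \<theta> t \<noteq> 0} \<times> closure {x. \<psi> x \<noteq> 0})"
    using \<theta> \<psi> by (intro compact_Times) (simp_all add: test_fun_def)
  then have "compact (closure {z. \<phi> z \<noteq> 0})" using sub by (metis closed_closure compact_Int_closed inf.absorb2)
  moreover have "smooth_fun \<phi>" unfolding \<phi>_def by (rule smooth_fun_tensor[OF sm])
  moreover have "closure {z. \<phi> z \<noteq> 0} \<subseteq> {0<..<T} \<times> UNIV" using sub \<theta> by (auto simp: test_fun_def)
  ultimately show "test_fun ({0<..<T} \<times> UNIV) \<phi>" by (simp add: test_fun_def)
  have b: "(1::real) \<in> Basis" by simp
  note s = smooth_fun_pd[OF sm(1) b] smooth_fun_pd[OF sm(2) e1_Basis] smooth_fun_pd[OF sm(2) e2_Basis]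
  have "pd (1, 0) (pd (1, 0) \<phi>) (t, x) = pd 1 (pd 1 \<theta>) t * \<psi> x"
    unfolding \<phi>_def pd_tensor_fst[OF sm(1) b] pd_tensor_fst[OF s(1) b] by simp
  moreover have "pd (0, e1) (pd (0, e1) \<phi>) (t, x) = \<theta> t * pd e1 (pd e1 \<psi>) x"
    unfolding \<phi>_def pd_tensor_snd[OF sm(2) e1_Basis] pd_tensor_snd[OF s(2) e1_Basis] by simp
  moreover have "pd (0, e2) (pd (0, e2) \<phi>) (t, x) = \<theta> t * pd e2 (pd e2 \<psi>) x"
    unfolding \<phi>_def pd_tensor_snd[OF sm(2) e2_Basis] pd_tensor_snd[OF s(3) e2_Basis] by simp
  ultimately show "dtt \<phi> (t, x) - lap_x \<phi> (t, x) = pd 1 (pd 1 \<theta>) t * \<psi> x - \<theta> t * (pd e1 (pd e1 \<psi>) x + pd e2 (pd e2 \<psi>) x)"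
    using e1_neq_e2 by (simp add: dtt_def lap_x_def Basis_real2 distrib_left)
qed

text \<open>Testing the once integrated equation with the solution itself: the functional
  \<open>|w|\<^sup>2 + |\<integral> w|\<^sup>2 + |\<integral> \<nabla> w|\<^sup>2\<close> is constant, although \<open>w\<close> is too rough to test with \<open>\<partial>\<^sub>t w\<close>.\<close>

lemma weak_solution_zero:
  fixes d :: "real \<Rightarrow> st"
  assumes T: "T > 0" and dc: "continuous_on {0..T} d" and dG: "\<And>t. t \<in> {0..T} \<Longrightarrow> d t \<in> G" and d0: "d 0 = 0"
    and vel: "\<And>t. t \<in> {0..T} \<Longrightarrow> ((\<lambda>s. fst (snd (d s))) has_vector_derivative fst (d t)) (at t within {0..T})"
    and weak: "\<And>\<phi>. test_fun ({0<..<T} \<times> UNIV) \<phi> \<Longrightarrow> ((\<lambda>t. inner (fst (snd (d t))) (toL2 (\<lambda>x. \<phi> (t, x)))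
      + inner (fst (snd (d t))) (toL2 (\<lambda>x. dtt \<phi> (t, x) - lap_x \<phi> (t, x)))) has_integral 0) {0..T}"
    and t: "t \<in> {0..T}"
  shows "d t = 0"
proof -
  define z w p q where "z t = fst (d t)" and "w t = fst (snd (d t))" and "p t = fst (snd (snd (d t)))" and "q t = snd (snd (snd (d t)))" for t
  have c: "continuous_on {0..T} z" "continuous_on {0..T} w" "continuous_on {0..T} p" "continuous_on {0..T} q"
    unfolding z_def[abs_def] w_def[abs_def] p_def[abs_def] q_def[abs_def] by (intro continuous_intros dc)+
  have wp: "wp e1 (w t) (p t)" "wp e2 (w t) (q t)" if "t \<in> {0..T}" for t
    using dG[OF that] by (simp_all add: G_def w_def p_def q_def)
  have w': "(w has_vector_derivative z t) (at t within {0..T})" if "t \<in> {0..T}" for t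
    using vel[OF that] unfolding w_def[abs_def] z_def .
  have init: "z 0 = 0" "w 0 = 0" using d0 by (simp_all add: z_def w_def)
  define W P Q where "W t = integral {0..t} w" and "P t = integral {0..t} p" and "Q t = integral {0..t} q" for t
  have WPQ: "(W has_vector_derivative w t) (at t within {0..T})" "(P has_vector_derivative p t) (at t within {0..T})"
    "(Q has_vector_derivative q t) (at t within {0..T})" if "t \<in> {0..T}" for t
    unfolding W_def[abs_def] P_def[abs_def] Q_def[abs_def] by (intro integral_has_vector_derivative c that)+
  have WPQ0: "W 0 = 0" "P 0 = 0" "Q 0 = 0" by (simp_all add: W_def P_def Q_def)
  \<comment> \<open>The equation integrated once in time, w' + W - \<Delta> W = 0, tested with
    \<psi>. Products \<theta>(t) \<psi>(x) reduce the space-time equation to a scalar one, from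
    which the du Bois-Reymond lemma removes \<theta>.\<close>
  have id: "inner (z t) (toL2 \<psi>) + (inner (W t) (toL2 \<psi>) + inner (P t) (toL2 (pd e1 \<psi>)) + inner (Q t) (toL2 (pd e2 \<psi>))) = 0"
    if \<psi>: "test_fun UNIV \<psi>" and t: "t \<in> {0..T}" for \<psi> t
  proof -
    define a \<alpha> \<Gamma> c where "a t = inner (w t) (toL2 \<psi>)" and "\<alpha> t = inner (z t) (toL2 \<psi>)"
      and "\<Gamma> t = inner (W t) (toL2 \<psi>) + inner (P t) (toL2 (pd e1 \<psi>)) + inner (Q t) (toL2 (pd e2 \<psi>))"
      and "c t = inner (w t) (toL2 \<psi>) + inner (p t) (toL2 (pd e1 \<psi>)) + inner (q t) (toL2 (pd e2 \<psi>))" for t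
    note inl = bounded_linear.has_vector_derivative[OF bounded_linear_inner_left]
    have a': "(a has_vector_derivative \<alpha> t) (at t within {0..T})" if "t \<in> {0..T}" for t
      unfolding a_def[abs_def] \<alpha>_def by (rule inl[OF w'[OF that]])
    have \<Gamma>': "(\<Gamma> has_vector_derivative c t) (at t within {0..T})" if "t \<in> {0..T}" for t
      unfolding \<Gamma>_def[abs_def] c_def by (intro has_vector_derivative_add inl WPQ that)
    have \<Gamma>c: "continuous_on {0..T} \<Gamma>"
      unfolding continuous_on_eq_continuous_within by (intro ballI has_vector_derivative_continuous[OF \<Gamma>'])
    have \<alpha>c: "continuous_on {0..T} \<alpha>" unfolding \<alpha>_def[abs_def] by (intro continuous_intros c)
    have "\<alpha> t + \<Gamma> t = \<alpha> 0 + \<Gamma> 0"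
    proof (rule du_Bois_Reymond[of T "\<lambda>t. \<alpha> t + \<Gamma> t"])
      fix \<theta> :: "real \<Rightarrow> real" assume \<theta>: "test_fun {0<..<T} \<theta>"
      have b: "(1::real) \<in> Basis" by simp
      have sm: "smooth_fun \<theta>" "smooth_fun (pd 1 \<theta>)" using \<theta> smooth_fun_pd[OF _ b] by (simp_all add: test_fun_def)
      define \<theta>1 \<theta>2 where "\<theta>1 = pd 1 \<theta>" and "\<theta>2 = pd 1 (pd 1 \<theta>)"
      have \<theta>': "(\<theta> has_vector_derivative \<theta>1 t) (at t within {0..T})" "(\<theta>1 has_vector_derivative \<theta>2 t) (at t within {0..T})" for t
        unfolding \<theta>1_def \<theta>2_def
        by (rule has_vector_derivative_at_within[OF smooth_fun_real_DERIV[OF sm(1), unfolded has_real_derivative_iff_has_vector_derivative]]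
          has_vector_derivative_at_within[OF smooth_fun_real_DERIV[OF sm(2), unfolded has_real_derivative_iff_has_vector_derivative]])+
      have ends: "\<theta> s = 0" "\<theta>1 s = 0" if "s = 0 \<or> s = T" for s
      proof -
        have "s \<notin> closure {x. \<theta> x \<noteq> 0}" using \<theta> that unfolding test_fun_def by auto
        then show "\<theta> s = 0" "\<theta>1 s = 0" unfolding \<theta>1_def
          using closure_subset[of "{x. \<theta> x \<noteq> 0}"] pd_eq_0_outside[of s \<theta>] by blast+
      qed
      have eq: "inner (w t) (toL2 (\<lambda>x. \<theta> t * \<psi> x)) + inner (w t) (toL2 (\<lambda>x. \<theta>2 t * \<psi> x - \<theta> t * (pd e1 (pd e1 \<psi>) x + pd e2 (pd e2 \<psi>) x)))
          = \<theta>2 t * a t + \<theta> t * c t" if t: "t \<in> {0..T}" for t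
      proof -
        note t1 = test_fun_pd[OF \<psi> e1_Basis] and t2 = test_fun_pd[OF \<psi> e2_Basis]
        note L = test_fun_L2[OF \<psi>] test_fun_L2[OF test_fun_pd[OF t1 e1_Basis]] test_fun_L2[OF test_fun_pd[OF t2 e2_Basis]]
        have "toL2 (\<lambda>x. \<theta>2 t * \<psi> x - \<theta> t * (pd e1 (pd e1 \<psi>) x + pd e2 (pd e2 \<psi>) x))
            = \<theta>2 t *\<^sub>R toL2 \<psi> - \<theta> t *\<^sub>R (toL2 (pd e1 (pd e1 \<psi>)) + toL2 (pd e2 (pd e2 \<psi>)))"
          by (simp only: toL2_diff[OF L2_cmult[OF L(1)] L2_cmult[OF L2_add[OF L(2,3)]]] toL2_cmult[OF L(1)]
              toL2_cmult[OF L2_add[OF L(2,3)]] toL2_add[OF L(2,3)])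
        moreover have "inner (w t) (toL2 (pd e1 (pd e1 \<psi>))) = - inner (p t) (toL2 (pd e1 \<psi>))"
          "inner (w t) (toL2 (pd e2 (pd e2 \<psi>))) = - inner (q t) (toL2 (pd e2 \<psi>))"
          using wp[OF t] t1 t2 unfolding wp_def by blast+
        ultimately show ?thesis
          by (simp only: toL2_cmult[OF L(1)] inner_diff_right inner_add_right inner_scaleR_right a_def c_def) (simp add: algebra_simps)
      qed
      have "((\<lambda>t. \<theta>2 t * a t + \<theta> t * c t) has_integral 0) {0..T}"
      proof (rule has_integral_eq[OF _ weak[OF tensor_test(1)[OF \<theta> \<psi>]]])
        fix t assume t: "t \<in> {0..T}"
        show "inner (fst (snd (d t))) (toL2 (\<lambda>x. \<theta> (fst (t, x)) * \<psi> (snd (t, x))))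
          + inner (fst (snd (d t))) (toL2 (\<lambda>x. dtt (\<lambda>z. \<theta> (fst z) * \<psi> (snd z)) (t, x) - lap_x (\<lambda>z. \<theta> (fst z) * \<psi> (snd z)) (t, x)))
          = \<theta>2 t * a t + \<theta> t * c t"
          unfolding tensor_test(2)[OF \<theta> \<psi>] eq[OF t, symmetric] by (simp add: w_def \<theta>2_def)
      qed
      \<comment> \<open>Integration by parts in time: the boundary values of \<theta>' a + \<theta>
        \<Gamma> vanish. Its derivative contains the integrand \<theta>'' a + \<theta> c of the weak
        equation, and what remains is \<theta>' (\<alpha> + \<Gamma>).\<close>
      moreover have "((\<lambda>t. (\<theta>1 t * \<alpha> t + \<theta>2 t * a t) + (\<theta> t * c t + \<theta>1 t * \<Gamma> t)) has_integral
          (\<theta>1 T * a T + \<theta> T * \<Gamma> T) - (\<theta>1 0 * a 0 + \<theta> 0 * \<Gamma> 0)) {0..T}"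
        by (rule fundamental_theorem_of_calculus)
          (use T in \<open>auto intro!: has_vector_derivative_add has_vector_derivative_mult \<theta>' a' \<Gamma>'\<close>)
      ultimately have "((\<lambda>t. ((\<theta>1 t * \<alpha> t + \<theta>2 t * a t) + (\<theta> t * c t + \<theta>1 t * \<Gamma> t)) - (\<theta>2 t * a t + \<theta> t * c t)) has_integral 0 - 0) {0..T}"
        by (intro has_integral_diff) (simp_all add: ends)
      then show "((\<lambda>t. pd 1 \<theta> t * (\<alpha> t + \<Gamma> t)) has_integral 0) {0..T}"
        by (simp add: \<theta>1_def algebra_simps)
    qed (use T t in \<open>auto intro!: continuous_on_add \<alpha>c \<Gamma>c\<close>)
    then show ?thesis by (simp add: \<alpha>_def \<Gamma>_def init WPQ0)
  qed
  \<comment> \<open>Only \<psi> and its first derivatives occur in \<open>id\<close>, so the density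
    of test functions in H1 allows \<psi> = w t.\<close>
  have orth: "inner (z t) (w t) + (inner (W t) (w t) + inner (P t) (p t) + inner (Q t) (q t)) = 0" if t: "t \<in> {0..T}" for t
  proof -
    have "\<exists>\<psi>. test_fun UNIV \<psi> \<and> norm (toL2 \<psi> - w t) < 1 / real (Suc n) \<and> norm (toL2 (pd e1 \<psi>) - p t) < 1 / real (Suc n)
        \<and> norm (toL2 (pd e2 \<psi>) - q t) < 1 / real (Suc n)" for n
      by (rule test_fun_dense_plane[OF wp[OF t], of "1 / real (Suc n)"]) (simp, blast)
    then obtain \<psi> where \<psi>: "\<And>n. test_fun UNIV (\<psi> n)" "\<And>n. norm (toL2 (\<psi> n) - w t) < 1 / real (Suc n)"
      "\<And>n. norm (toL2 (pd e1 (\<psi> n)) - p t) < 1 / real (Suc n)" "\<And>n. norm (toL2 (pd e2 (\<psi> n)) - q t) < 1 / real (Suc n)" by metis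
    note lim = tendsto_of_norm_less[OF \<psi>(2)] tendsto_of_norm_less[OF \<psi>(3)] tendsto_of_norm_less[OF \<psi>(4)]
    have "(\<lambda>n. inner (z t) (toL2 (\<psi> n)) + (inner (W t) (toL2 (\<psi> n)) + inner (P t) (toL2 (pd e1 (\<psi> n))) + inner (Q t) (toL2 (pd e2 (\<psi> n)))))
        \<longlonglongrightarrow> inner (z t) (w t) + (inner (W t) (w t) + inner (P t) (p t) + inner (Q t) (q t))"
      by (intro tendsto_add tendsto_inner tendsto_const lim)
    then show ?thesis unfolding id[OF \<psi>(1) t] by (simp add: LIMSEQ_const_iff)
  qed
  have en: "inner (w t) (w t) + (inner (W t) (W t) + inner (P t) (P t) + inner (Q t) (Q t)) = 0" if t: "t \<in> {0..T}" for t
  proof -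
    have "((\<lambda>t. inner (w t) (w t) + (inner (W t) (W t) + inner (P t) (P t) + inner (Q t) (Q t))) has_real_derivative 0) (at t within {0..T})"
      if t: "t \<in> {0..T}" for t
    proof -
      have sq: "((\<lambda>t. inner (f t) (f t)) has_vector_derivative 2 * inner f' (f t)) (at t within {0..T})"
        if "(f has_vector_derivative f') (at t within {0..T})" for f and f' :: ll
        using bounded_bilinear.has_vector_derivative[OF bounded_bilinear_inner that that] by (simp add: inner_commute)
      have der: "((\<lambda>t. inner (w t) (w t) + (inner (W t) (W t) + inner (P t) (P t) + inner (Q t) (Q t))) has_vector_derivative
          2 * inner (z t) (w t) + (2 * inner (w t) (W t) + 2 * inner (p t) (P t) + 2 * inner (q t) (Q t))) (at t within {0..T})"
        by (intro has_vector_derivative_add sq w' WPQ t)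
      have "2 * inner (z t) (w t) + (2 * inner (w t) (W t) + 2 * inner (p t) (P t) + 2 * inner (q t) (Q t)) = 0"
        using orth[OF t] by (simp add: inner_commute)
      then show ?thesis using der unfolding has_real_derivative_iff_has_vector_derivative by simp
    qed
    from zero_derivative_const[OF this t] show ?thesis by (simp add: init WPQ0)
  qed
  have nn: "inner (w t) (w t) \<ge> 0" "inner (W t) (W t) \<ge> 0" "inner (P t) (P t) \<ge> 0" "inner (Q t) (Q t) \<ge> 0" by simp_all
  then have "inner (w t) (w t) = 0" "inner (W t) (W t) = 0" "inner (P t) (P t) = 0" "inner (Q t) (Q t) = 0"
    using en[OF t] by linarith+
  then have 0: "w t = 0" "W t = 0" "P t = 0" "Q t = 0" by simp_all
  have "z t = 0" by (rule l2_eqI) (use id[OF _ t] 0 in simp)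
  moreover have "p t = 0" using wp_unique[OF wp(1)[OF t], of 0] by (simp add: wp_zero 0(1))
  moreover have "q t = 0" using wp_unique[OF wp(2)[OF t], of 0] by (simp add: wp_zero 0(1))
  ultimately show ?thesis using 0(1) by (cases "d t") (simp add: z_def w_def p_def q_def zero_prod_def)
qed

section \<open>Functions and states\<close>

text \<open>Velocity first, in the order of the components of a state. Weak derivatives are unique
  as elements of L2, so the choice made in \<open>wgrad\<close> does not affect the value.\<close>

definition emb :: "(real^2 \<Rightarrow> real) \<Rightarrow> (real^2 \<Rightarrow> real) \<Rightarrow> st" where
  "emb v u = (toL2 v, toL2 u, toL2 (wgrad e1 u), toL2 (wgrad e2 u))"

lemma wgrad_wp:
  assumes "H1 u" "b \<in> Basis" shows "L2 (wgrad b u)" "wp b (toL2 u) (toL2 (wgrad b u))"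
proof -
  have "\<exists>g. L2 g \<and> weak_partial b u g" using assms by (simp add: H1_def)
  then have *: "L2 (wgrad b u) \<and> weak_partial b u (wgrad b u)" unfolding wgrad_def by (rule someI_ex)
  then show "L2 (wgrad b u)" by blast
  have "L2 u" using assms by (simp add: H1_def)
  with * assms show "wp b (toL2 u) (toL2 (wgrad b u))" using weak_partial_iff_wp by blast
qed

lemma H1_L2: "H1 u \<Longrightarrow> L2 u" by (simp add: H1_def)

lemma emb_G: "H1 u \<Longrightarrow> emb v u \<in> G"
  by (simp add: emb_def G_iff wgrad_wp e1_Basis e2_Basis)

lemma H1_I:
  assumes "L2 u" "wp e1 (toL2 u) p" "wp e2 (toL2 u) q" shows "H1 u"
proof -
  have "weak_partial e1 u (fn p)" "weak_partial e2 u (fn q)"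
    using assms weak_partial_iff_wp[OF assms(1) L2_fn e1_Basis] weak_partial_iff_wp[OF assms(1) L2_fn e2_Basis] by simp_all
  then show ?thesis unfolding H1_def using assms(1) L2_fn by (auto simp: Basis_real2)
qed

text \<open>A state in \<open>G\<close> is determined by its first two components, because weak
  derivatives are unique.\<close>

lemma emb_eqI:
  assumes "H1 u" "toL2 v = z" "toL2 u = w" "(z, w, p, q) \<in> G" shows "emb v u = (z, w, p, q)"
  using assms wp_unique[OF wgrad_wp(2)[OF assms(1) e1_Basis]] wp_unique[OF wgrad_wp(2)[OF assms(1) e2_Basis]]
  by (simp add: emb_def G_iff)

lemma H1_diff: fixes u w :: "real^2 \<Rightarrow> real" assumes "H1 u" "H1 w" shows "H1 (\<lambda>x. u x - w x)"
proof (rule H1_I)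
  show "L2 (\<lambda>x. u x - w x)" using assms by (intro L2_diff H1_L2)
  show "wp e1 (toL2 (\<lambda>x. u x - w x)) (toL2 (wgrad e1 u) - toL2 (wgrad e1 w))"
    "wp e2 (toL2 (\<lambda>x. u x - w x)) (toL2 (wgrad e2 u) - toL2 (wgrad e2 w))"
    using assms by (simp_all add: toL2_diff H1_L2 wp_diff wgrad_wp e1_Basis e2_Basis)
qed

lemma emb_diff:
  assumes "H1 u" "H1 w" "L2 v" "L2 z"
  shows "emb v u - emb z w = emb (\<lambda>x. v x - z x) (\<lambda>x. u x - w x)"
proof -
  have "emb (\<lambda>x. v x - z x) (\<lambda>x. u x - w x) = (toL2 v - toL2 z, toL2 u - toL2 w,
      toL2 (wgrad e1 u) - toL2 (wgrad e1 w), toL2 (wgrad e2 u) - toL2 (wgrad e2 w))"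
  proof (rule emb_eqI[OF H1_diff[OF assms(1,2)] toL2_diff[OF assms(3,4)] toL2_diff[OF H1_L2[OF assms(1)] H1_L2[OF assms(2)]]])
    show "(toL2 v - toL2 z, toL2 u - toL2 w, toL2 (wgrad e1 u) - toL2 (wgrad e1 w), toL2 (wgrad e2 u) - toL2 (wgrad e2 w)) \<in> G"
      using G_diff[OF emb_G[OF assms(1), of v] emb_G[OF assms(2), of z]] by (simp add: emb_def)
  qed
  then show ?thesis by (simp add: emb_def)
qed

lemma norm_emb:
  assumes "H1 u" "L2 v"
  shows "L2_norm v \<le> norm (emb v u)" "H1_norm u \<le> norm (emb v u)" "norm (emb v u) \<le> L2_norm v + H1_norm u"
proof -
  note L = wgrad_wp(1)[OF assms(1) e1_Basis] wgrad_wp(1)[OF assms(1) e2_Basis]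
  let ?w = "(toL2 u, toL2 (wgrad e1 u), toL2 (wgrad e2 u))"
  have H: "H1_norm u = norm ?w"
    using e1_neq_e2 by (simp add: H1_norm_def norm_Pair Basis_real2 norm_toL2 H1_L2 assms L)
  have V: "L2_norm v = norm (toL2 v)" by (simp add: norm_toL2 assms)
  show "L2_norm v \<le> norm (emb v u)" unfolding V emb_def by (rule norm_fst_le)
  show "H1_norm u \<le> norm (emb v u)" unfolding H emb_def by (rule norm_snd_le)
  show "norm (emb v u) \<le> L2_norm v + H1_norm u" unfolding H V emb_def by (rule norm_Pair_le)
qed

lemma NL_L2: assumes "y \<in> G" shows "L2 (\<lambda>x. nl (fn (fst (snd y)) x))"
  by (rule NL_locally_Lipschitz[OF assms]) (use assms in simp)

text \<open>\<open>nonlin\<close> is the identity minus \<open>nl\<close>, and both parts are in L2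
  on \<open>G\<close>, so the pairing is an inner product. The function u may differ from the chosen
  representative on a null set.\<close>

lemma nonlin_inner:
  assumes y: "y \<in> G" and u: "L2 u" "toL2 u = fst (snd y)" and \<phi>: "test_fun UNIV \<phi>"
  shows "integrable lborel (\<lambda>x. nonlin (u x) * \<phi> x)"
    "(\<integral>x. nonlin (u x) * \<phi> x \<partial>lborel) = inner (fst (snd y) - NL y) (toL2 \<phi>)"
proof -
  let ?U = "fn (fst (snd y))"
  have L: "L2 (\<lambda>x. ?U x - nl (?U x))" by (intro L2_diff L2_fn NL_L2 y)
  have ae: "AE x in lborel. (?U x - nl (?U x)) * \<phi> x = nonlin (u x) * \<phi> x"
    using fn_toL2[OF u(1)] unfolding u(2) by eventually_elim (simp add: nl_def)
  have m: "(\<lambda>x. (?U x - nl (?U x)) * \<phi> x) \<in> borel_measurable lborel" "(\<lambda>x. nonlin (u x) * \<phi> x) \<in> borel_measurable lborel"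
    using test_fun_measurable[OF \<phi>] L2_measurable[OF u(1)] by (simp_all add: nonlin_def)
  show "integrable lborel (\<lambda>x. nonlin (u x) * \<phi> x)"
    using integrable_cong_AE[OF m ae] L2_integrable_mult[OF L test_fun_L2[OF \<phi>]] by simp
  have "(\<integral>x. nonlin (u x) * \<phi> x \<partial>lborel) = (\<integral>x. (?U x - nl (?U x)) * \<phi> x \<partial>lborel)"
    by (rule integral_cong_AE[OF m ae, symmetric])
  also have "\<dots> = inner (fst (snd y) - NL y) (toL2 \<phi>)"
    unfolding inner_toL2[OF L test_fun_L2[OF \<phi>], symmetric] NL_def by (simp add: toL2_diff[OF L2_fn NL_L2[OF y]])
  finally show "(\<integral>x. nonlin (u x) * \<phi> x \<partial>lborel) = inner (fst (snd y) - NL y) (toL2 \<phi>)" .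
qed

lemma test_fun_box:
  fixes \<phi> :: "real \<times> (real^2) \<Rightarrow> real"
  assumes \<phi>: "test_fun UNIV \<phi>"
  shows "test_fun UNIV (\<lambda>x. dtt \<phi> (t, x) - lap_x \<phi> (t, x))"
    "continuous_on X (\<lambda>t. toL2 (\<lambda>x. dtt \<phi> (t, x) - lap_x \<phi> (t, x)))"
proof -
  have b: "(1, 0) \<in> (Basis :: (real \<times> (real^2)) set)" "(0, e1) \<in> (Basis :: (real \<times> (real^2)) set)" "(0, e2) \<in> (Basis :: (real \<times> (real^2)) set)"
    using e1_Basis e2_Basis by (simp_all add: Basis_prod_def)
  have t: "test_fun UNIV (pd b (pd b \<phi>))" if "b \<in> Basis" for b by (intro test_fun_pd \<phi> that)
  have eq: "dtt \<phi> z - lap_x \<phi> z = pd (1, 0) (pd (1, 0) \<phi>) z + (-1) * (pd (0, e1) (pd (0, e1) \<phi>) z + pd (0, e2) (pd (0, e2) \<phi>) z)" for z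
    using e1_neq_e2 by (simp add: dtt_def lap_x_def Basis_real2)
  have add: "test_fun UNIV (\<lambda>z. f z + g z)" if f: "test_fun UNIV f" and g: "test_fun UNIV g" for f g :: "real \<times> (real^2) \<Rightarrow> real"
  proof -
    obtain R R' where "\<And>x. f x \<noteq> 0 \<Longrightarrow> norm x \<le> R" "\<And>x. g x \<noteq> 0 \<Longrightarrow> norm x \<le> R'" using f g unfolding test_fun_UNIV_iff by metis
    then have "norm x \<le> max R R'" if "f x + g x \<noteq> 0" for x using that by (cases "f x = 0") (auto simp: le_max_iff_disj)
    then show ?thesis using f g smooth_fun_add unfolding test_fun_UNIV_iff by blast
  qed
  have "test_fun UNIV (\<lambda>z. dtt \<phi> z - lap_x \<phi> z)" unfolding eq by (intro add t test_fun_cmult b)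
  from test_fun_slice[OF this] continuous_on_slice[OF this]
  show "test_fun UNIV (\<lambda>x. dtt \<phi> (t, x) - lap_x \<phi> (t, x))"
    "continuous_on X (\<lambda>t. toL2 (\<lambda>x. dtt \<phi> (t, x) - lap_x \<phi> (t, x)))" .
qed

text \<open>On \<open>G\<close> embedding the representatives gives back the state, so the H1 and L2
  continuity clauses follow from continuity of y in norm, the derivative clause from
  \<open>mild_velocity\<close>, and the equation from \<open>mild_space_time\<close> with its sign
  reversed.\<close>

lemma sol_energy_solution:
  assumes T: "T > 0" and w: "H1 w0" "L2 w1" and y: "sol T (emb w1 w0) y"
  shows "energy_solution T (\<lambda>t. fn (fst (snd (y t)))) (\<lambda>t. fn (fst (y t))) w0 w1"
    "t \<in> {0..T} \<Longrightarrow> emb (fn (fst (y t))) (fn (fst (snd (y t)))) = y t" "t \<in> {0..T} \<Longrightarrow> H1 (fn (fst (snd (y t))))"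
proof -
  have yc: "continuous_on {0..T} y" and yG: "\<And>t. t \<in> {0..T} \<Longrightarrow> y t \<in> G"
    and ym: "\<And>t. t \<in> {0..T} \<Longrightarrow> y t = kg.mild (emb w1 w0) (\<lambda>s. (NL (y s), 0, 0, 0)) t" using y by (auto simp: sol_def frc_def)
  have fc: "continuous_on {0..T} (\<lambda>s. NL (y s))" by (rule continuous_on_NL_compose[OF yc yG])
  let ?u = "\<lambda>t. fn (fst (snd (y t)))" and ?v = "\<lambda>t. fn (fst (y t))"
  have H: "H1 (?u t)" if "t \<in> {0..T}" for t
    by (rule H1_I[OF L2_fn, where p = "fst (snd (snd (y t)))" and q = "snd (snd (snd (y t)))"]) (use yG[OF that] in \<open>simp_all add: G_def\<close>)
  then show "t \<in> {0..T} \<Longrightarrow> H1 (fn (fst (snd (y t))))" .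
  have E: "emb (?v t) (?u t) = y t" if "t \<in> {0..T}" for t
    using emb_eqI[OF H[OF that], of "?v t" "fst (y t)" "fst (snd (y t))" "fst (snd (snd (y t)))" "snd (snd (snd (y t)))"] yG[OF that] by simp
  then show "t \<in> {0..T} \<Longrightarrow> emb (fn (fst (y t))) (fn (fst (snd (y t)))) = y t" .
  have yt: "((\<lambda>s. norm (y s - y t)) \<longlongrightarrow> 0) (at t within {0..T})" if t: "t \<in> {0..T}" for t
  proof -
    have "(y \<longlongrightarrow> y t) (at t within {0..T})" using yc t by (simp add: continuous_on_def)
    then show ?thesis by (intro tendsto_norm_zero) (simp add: LIM_zero)
  qed
  have y0: "y 0 = emb w1 w0" using ym[of 0] T by (simp add: kg.mild_zero_time)
  show "energy_solution T ?u ?v w0 w1" unfolding energy_solution_def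
  proof (intro conjI ballI allI impI)
    fix t assume t: "t \<in> {0..T}"
    show "H1 (?u t)" by (rule H[OF t])
    show "L2 (?v t)" by (rule L2_fn)
    have ev: "\<forall>\<^sub>F s in at t within {0..T}. s \<in> {0..T}" by (simp add: eventually_at_filter)
    show "((\<lambda>s. H1_norm (\<lambda>x. ?u s x - ?u t x)) \<longlongrightarrow> 0) (at t within {0..T})"
    proof (rule Lim_null_comparison[OF _ yt[OF t]])
      show "\<forall>\<^sub>F s in at t within {0..T}. norm (H1_norm (\<lambda>x. ?u s x - ?u t x)) \<le> norm (y s - y t)"
        using ev
      proof eventually_elim
        case (elim s)
        have "H1_norm (\<lambda>x. ?u s x - ?u t x) \<le> norm (emb (\<lambda>x. ?v s x - ?v t x) (\<lambda>x. ?u s x - ?u t x))"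
          by (rule norm_emb(2)[OF H1_diff[OF H[OF elim] H[OF t]] L2_diff[OF L2_fn L2_fn]])
        also have "\<dots> = norm (y s - y t)"
          by (simp only: emb_diff[OF H[OF elim] H[OF t] L2_fn L2_fn, symmetric] E[OF elim] E[OF t])
        finally show ?case by (simp add: H1_norm_def sum_nonneg)
      qed
    qed
    show "((\<lambda>s. L2_norm (\<lambda>x. ?v s x - ?v t x)) \<longlongrightarrow> 0) (at t within {0..T})"
    proof (rule Lim_null_comparison[OF _ yt[OF t]])
      show "\<forall>\<^sub>F s in at t within {0..T}. norm (L2_norm (\<lambda>x. ?v s x - ?v t x)) \<le> norm (y s - y t)"
      proof (intro always_eventually allI)
        fix s
        have "L2_norm (\<lambda>x. ?v s x - ?v t x) = norm (fst (y s - y t))"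
          by (simp add: norm_toL2[symmetric] L2_diff L2_fn toL2_diff)
        also have "\<dots> \<le> norm (y s - y t)" by (cases "y s - y t") (simp add: norm_fst_le)
        finally show "norm (L2_norm (\<lambda>x. ?v s x - ?v t x)) \<le> norm (y s - y t)" by (simp add: L2_norm_def)
      qed
    qed
    show "((\<lambda>s. L2_norm (\<lambda>x. (?u s x - ?u t x) / (s - t) - ?v t x)) \<longlongrightarrow> 0) (at t within {0..T})"
    proof -
      have "((\<lambda>s. fst (snd (y s))) has_vector_derivative fst (y t)) (at t within {0..T})"
        by (rule has_vector_derivative_transform[OF t _ mild_velocity[OF fc t, of "emb w1 w0", folded ym[OF t]]]) (simp add: ym)
      then have "((\<lambda>s. (fst (snd (y s)) - fst (snd (y t))) /\<^sub>R (s - t) - fst (y t)) \<longlongrightarrow> 0) (at t within {0..T})"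
        unfolding has_vector_derivative_within_iff_quotient by (rule LIM_zero)
      moreover have "L2_norm (\<lambda>x. (?u s x - ?u t x) / (s - t) - ?v t x) = norm ((fst (snd (y s)) - fst (snd (y t))) /\<^sub>R (s - t) - fst (y t))" for s
      proof -
        have D: "L2 (\<lambda>x. inverse (s - t) * (?u s x - ?u t x) - ?v t x)" by (intro L2_diff L2_cmult L2_fn)
        have eq: "toL2 (\<lambda>x. inverse (s - t) * (?u s x - ?u t x) - ?v t x) = (fst (snd (y s)) - fst (snd (y t))) /\<^sub>R (s - t) - fst (y t)"
          by (simp only: toL2_diff[OF L2_cmult[OF L2_diff[OF L2_fn L2_fn]] L2_fn] toL2_cmult[OF L2_diff[OF L2_fn L2_fn]] toL2_diff[OF L2_fn L2_fn] toL2_fn)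
        show ?thesis using norm_toL2[OF D] unfolding eq by (simp add: divide_inverse mult.commute)
      qed
      ultimately show ?thesis by (simp add: tendsto_norm_zero)
    qed
  next
    show "AE x in lborel. ?u 0 x = w0 x" using fn_toL2[OF H1_L2[OF w(1)]] by (simp add: y0 emb_def)
    show "AE x in lborel. ?v 0 x = w1 x" using fn_toL2[OF w(2)] by (simp add: y0 emb_def)
  next
    fix \<phi> :: "real \<times> (real^2) \<Rightarrow> real" assume \<phi>: "test_fun ({0<..<T} \<times> UNIV) \<phi>"
    have \<phi>U: "test_fun UNIV \<phi>" by (rule test_fun_mono[OF \<phi>]) simp
    note W = test_fun_box[OF \<phi>U]
    have A: "(\<integral>x. ?u t x * (dtt \<phi> (t, x) - lap_x \<phi> (t, x)) \<partial>lborel) = inner (fst (snd (y t))) (toL2 (\<lambda>x. dtt \<phi> (t, x) - lap_x \<phi> (t, x)))" for t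
      by (rule inner_fn_test(1)[OF W(1), symmetric])
    have B: "integrable lborel (\<lambda>x. nonlin (?u t x) * \<phi> (t, x))"
      "(\<integral>x. nonlin (?u t x) * \<phi> (t, x) \<partial>lborel) = inner (fst (snd (y t)) - NL (y t)) (toL2 (\<lambda>x. \<phi> (t, x)))" if "t \<in> {0..T}" for t
      using nonlin_inner[OF yG[OF that] L2_fn toL2_fn test_fun_slice[OF \<phi>U]] by blast+
    show "integrable lborel (\<lambda>x. ?u t x * (dtt \<phi> (t, x) - lap_x \<phi> (t, x)))" for t by (rule inner_fn_test(2)[OF W(1)])
    show "integrable lborel (\<lambda>x. nonlin (?u t x) * \<phi> (t, x))" if "t \<in> {0..T}" for t by (rule B(1)[OF that])
    have cA: "continuous_on {0..T} (\<lambda>t. \<integral>x. ?u t x * (dtt \<phi> (t, x) - lap_x \<phi> (t, x)) \<partial>lborel)"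
      unfolding A by (intro continuous_intros W(2) yc)
    have cB: "continuous_on {0..T} (\<lambda>t. \<integral>x. nonlin (?u t x) * \<phi> (t, x) \<partial>lborel)"
    proof -
      have "continuous_on {0..T} (\<lambda>t. inner (fst (snd (y t)) - NL (y t)) (toL2 (\<lambda>x. \<phi> (t, x))))"
        by (intro continuous_intros continuous_on_slice \<phi>U yc fc)
      then show ?thesis by (rule continuous_on_eq) (simp add: B(2))
    qed
    show "set_integrable lborel {0..T} (\<lambda>t. \<integral>x. ?u t x * (dtt \<phi> (t, x) - lap_x \<phi> (t, x)) \<partial>lborel)"
      by (rule borel_integrable_atLeastAtMost'[OF cA])
    show "set_integrable lborel {0..T} (\<lambda>t. \<integral>x. nonlin (?u t x) * \<phi> (t, x) \<partial>lborel)"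
      by (rule borel_integrable_atLeastAtMost'[OF cB])
    have "((\<lambda>t. inner (NL (y t) - fst (snd (kg.mild (emb w1 w0) (\<lambda>s. (NL (y s), 0, 0, 0)) t))) (toL2 (\<lambda>x. \<phi> (t, x)))
        - inner (fst (snd (kg.mild (emb w1 w0) (\<lambda>s. (NL (y s), 0, 0, 0)) t))) (toL2 (\<lambda>x. dtt \<phi> (t, x) - lap_x \<phi> (t, x)))) has_integral 0) {0..T}"
      by (rule mild_space_time[OF emb_G[OF w(1)] fc \<phi>]) (use T in simp)
    then have "((\<lambda>t. inner (NL (y t) - fst (snd (y t))) (toL2 (\<lambda>x. \<phi> (t, x)))
        - inner (fst (snd (y t))) (toL2 (\<lambda>x. dtt \<phi> (t, x) - lap_x \<phi> (t, x)))) has_integral 0) {0..T}"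
      by (rule has_integral_eq[rotated]) (simp add: ym[symmetric])
    note neg = has_integral_neg[OF this]
    have "((\<lambda>t. (\<integral>x. ?u t x * (dtt \<phi> (t, x) - lap_x \<phi> (t, x)) \<partial>lborel) + (\<integral>x. nonlin (?u t x) * \<phi> (t, x) \<partial>lborel)) has_integral - 0) {0..T}"
      by (rule has_integral_eq[OF _ neg]) (simp add: A B(2) inner_diff_left)
    then show "(LINT t:{0..T}|lborel. (\<integral>x. ?u t x * (dtt \<phi> (t, x) - lap_x \<phi> (t, x)) \<partial>lborel) + (\<integral>x. nonlin (?u t x) * \<phi> (t, x) \<partial>lborel)) = 0"
      using set_borel_integral_eq_integral(2)[OF borel_integrable_atLeastAtMost'[OF continuous_on_add[OF cA cB]]] by (simp add: integral_unique)
  qed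
qed

text \<open>The forcing is frozen along the given solution: m is the mild solution of the linear
  problem with this forcing, so the comparison of y with m is linear.\<close>

lemma energy_solution_sol:
  assumes T: "T > 0" and w: "H1 w0" "L2 w1" and es: "energy_solution T u v w0 w1"
  shows "sol T (emb w1 w0) (\<lambda>t. emb (v t) (u t))"
proof -
  have H: "H1 (u t)" "L2 (v t)" if "t \<in> {0..T}" for t using es that unfolding energy_solution_def by blast+
  have lim: "((\<lambda>s. H1_norm (\<lambda>x. u s x - u t x)) \<longlongrightarrow> 0) (at t within {0..T})"
    "((\<lambda>s. L2_norm (\<lambda>x. (u s x - u t x) / (s - t) - v t x)) \<longlongrightarrow> 0) (at t within {0..T})"
    "((\<lambda>s. L2_norm (\<lambda>x. v s x - v t x)) \<longlongrightarrow> 0) (at t within {0..T})" if "t \<in> {0..T}" for t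
    using es that unfolding energy_solution_def by blast+
  have init: "AE x in lborel. u 0 x = w0 x" "AE x in lborel. v 0 x = w1 x" using es unfolding energy_solution_def by blast+
  define y where "y t = emb (v t) (u t)" for t
  have yG: "y t \<in> G" if "t \<in> {0..T}" for t unfolding y_def by (rule emb_G[OF H(1)[OF that]])
  have yu: "fst (snd (y t)) = toL2 (u t)" "fst (y t) = toL2 (v t)" for t by (simp_all add: y_def emb_def)
  have ev: "\<forall>\<^sub>F s in at t within {0..T}. s \<in> {0..T}" for t by (simp add: eventually_at_filter)
  have yc: "continuous_on {0..T} y" unfolding continuous_on_def
  proof
    fix t assume t: "t \<in> {0..T}"
    have "((\<lambda>s. y s - y t) \<longlongrightarrow> 0) (at t within {0..T})"
    proof (rule Lim_null_comparison)
      show "((\<lambda>s. L2_norm (\<lambda>x. v s x - v t x) + H1_norm (\<lambda>x. u s x - u t x)) \<longlongrightarrow> 0) (at t within {0..T})"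
        using tendsto_add[OF lim(3)[OF t] lim(1)[OF t]] by simp
      show "\<forall>\<^sub>F s in at t within {0..T}. norm (y s - y t) \<le> L2_norm (\<lambda>x. v s x - v t x) + H1_norm (\<lambda>x. u s x - u t x)"
        using ev
      proof eventually_elim
        case (elim s)
        show ?case unfolding y_def emb_diff[OF H(1)[OF elim] H(1)[OF t] H(2)[OF elim] H(2)[OF t]]
          by (rule norm_emb(3)[OF H1_diff[OF H(1)[OF elim] H(1)[OF t]] L2_diff[OF H(2)[OF elim] H(2)[OF t]]])
      qed
    qed
    then show "(y \<longlongrightarrow> y t) (at t within {0..T})" by (simp add: LIM_zero_iff)
  qed
  have y0: "y 0 = emb w1 w0"
  proof -
    have t0: "0 \<in> {0..T}" using T by simp
    have "toL2 (u 0) = toL2 w0" "toL2 (v 0) = toL2 w1"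
      using init H[OF t0] w by (simp_all add: toL2_eqI H1_L2)
    then show ?thesis unfolding y_def emb_def[of w1 w0]
      using emb_eqI[OF H(1)[OF t0], of "v 0" "toL2 w1" "toL2 w0"] emb_G[OF w(1), of w1] by (simp add: emb_def[of w1 w0])
  qed
  have vel: "((\<lambda>s. fst (snd (y s))) has_vector_derivative fst (y t)) (at t within {0..T})" if t: "t \<in> {0..T}" for t
  proof -
    have "((\<lambda>s. (toL2 (u s) - toL2 (u t)) /\<^sub>R (s - t) - toL2 (v t)) \<longlongrightarrow> 0) (at t within {0..T})"
    proof (rule Lim_null_comparison[OF _ lim(2)[OF t]])
      show "\<forall>\<^sub>F s in at t within {0..T}. norm ((toL2 (u s) - toL2 (u t)) /\<^sub>R (s - t) - toL2 (v t)) \<le> L2_norm (\<lambda>x. (u s x - u t x) / (s - t) - v t x)"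
        using ev
      proof eventually_elim
        case (elim s)
        note L = H1_L2[OF H(1)[OF elim]] H1_L2[OF H(1)[OF t]] H(2)[OF t]
        have D: "L2 (\<lambda>x. inverse (s - t) * (u s x - u t x) - v t x)" by (intro L2_diff L2_cmult L)
        have eq: "toL2 (\<lambda>x. inverse (s - t) * (u s x - u t x) - v t x) = (toL2 (u s) - toL2 (u t)) /\<^sub>R (s - t) - toL2 (v t)"
          by (simp only: toL2_diff[OF L2_cmult[OF L2_diff[OF L(1,2)]] L(3)] toL2_cmult[OF L2_diff[OF L(1,2)]] toL2_diff[OF L(1,2)])
        show ?case using norm_toL2[OF D] unfolding eq by (simp add: divide_inverse mult.commute)
      qed
    qed
    then show ?thesis unfolding yu has_vector_derivative_within_iff_quotient by (simp add: LIM_zero_iff)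
  qed
  have fc: "continuous_on {0..T} (\<lambda>s. NL (y s))" by (rule continuous_on_NL_compose[OF yc yG])
  define m where "m = kg.mild (emb w1 w0) (\<lambda>s. (NL (y s), 0, 0, 0))"
  have mc: "continuous_on {0..T} m" unfolding m_def by (intro kg.mild_continuous continuous_intros fc)
  have mG: "m t \<in> G" if "t \<in> {0..T}" for t unfolding m_def by (rule mild_G[OF emb_G[OF w(1)] fc that])
  have "y t - m t = 0" if t: "t \<in> {0..T}" for t
  proof (rule weak_solution_zero[OF T, of "\<lambda>t. y t - m t"])
    show "continuous_on {0..T} (\<lambda>t. y t - m t)" by (intro continuous_on_diff yc mc)
    show "y t - m t \<in> G" if "t \<in> {0..T}" for t by (rule G_diff[OF yG[OF that] mG[OF that]])
    show "y 0 - m 0 = 0" by (simp add: y0 m_def kg.mild_zero_time)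
    show "((\<lambda>s. fst (snd (y s - m s))) has_vector_derivative fst (y t - m t)) (at t within {0..T})" if t: "t \<in> {0..T}" for t
      using has_vector_derivative_diff[OF vel[OF t] mild_velocity[OF fc t, of "emb w1 w0"]] by (simp add: m_def)
    fix \<phi> :: "real \<times> (real^2) \<Rightarrow> real" assume \<phi>: "test_fun ({0<..<T} \<times> UNIV) \<phi>"
    have \<phi>U: "test_fun UNIV \<phi>" by (rule test_fun_mono[OF \<phi>]) simp
    note W = test_fun_box(1)[OF \<phi>U]
    let ?A = "\<lambda>t. \<integral>x. u t x * (dtt \<phi> (t, x) - lap_x \<phi> (t, x)) \<partial>lborel" and ?B = "\<lambda>t. \<integral>x. nonlin (u t x) * \<phi> (t, x) \<partial>lborel"
    have si: "set_integrable lborel {0..T} ?A" "set_integrable lborel {0..T} ?B" "(LINT t:{0..T}|lborel. ?A t + ?B t) = 0"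
      using es \<phi> unfolding energy_solution_def by blast+
    have "((\<lambda>t. ?A t + ?B t) has_integral 0) {0..T}"
      using set_borel_integral_eq_integral[OF set_integral_add(1)[OF si(1,2)]] si(3)
      by (simp add: has_integral_integral)
    moreover have "?A t + ?B t = inner (fst (snd (y t))) (toL2 (\<lambda>x. dtt \<phi> (t, x) - lap_x \<phi> (t, x)))
        + inner (fst (snd (y t)) - NL (y t)) (toL2 (\<lambda>x. \<phi> (t, x)))" if t: "t \<in> {0..T}" for t
      using nonlin_inner(2)[OF yG[OF t] H1_L2[OF H(1)[OF t]] yu(1)[symmetric] test_fun_slice[OF \<phi>U]]
        inner_toL2[OF H1_L2[OF H(1)[OF t]] test_fun_L2[OF W]] by (simp add: yu)
    ultimately have 1: "((\<lambda>t. inner (fst (snd (y t))) (toL2 (\<lambda>x. dtt \<phi> (t, x) - lap_x \<phi> (t, x)))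
        + inner (fst (snd (y t)) - NL (y t)) (toL2 (\<lambda>x. \<phi> (t, x)))) has_integral 0) {0..T}"
      by (rule has_integral_eq[rotated])
    have 2: "((\<lambda>t. inner (NL (y t) - fst (snd (m t))) (toL2 (\<lambda>x. \<phi> (t, x)))
        - inner (fst (snd (m t))) (toL2 (\<lambda>x. dtt \<phi> (t, x) - lap_x \<phi> (t, x)))) has_integral 0) {0..T}"
      unfolding m_def by (rule mild_space_time[OF emb_G[OF w(1)] fc \<phi>]) (use T in simp)
    \<comment> \<open>In the sum the common forcing \<open>NL (y t)\<close> cancels, which leaves
      the free Klein-Gordon equation for the difference.\<close>
    show "((\<lambda>t. inner (fst (snd (y t - m t))) (toL2 (\<lambda>x. \<phi> (t, x)))
        + inner (fst (snd (y t - m t))) (toL2 (\<lambda>x. dtt \<phi> (t, x) - lap_x \<phi> (t, x)))) has_integral 0) {0..T}"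
      using has_integral_add[OF 1 2] by (simp add: inner_diff_left algebra_simps)
  qed (rule t)
  then have "y t = m t" if "t \<in> {0..T}" for t using that by simp
  then show ?thesis using yc yG unfolding sol_def frc_def m_def y_def by blast
qed

theorem theorem2p2:
  fixes u0 u1 :: "real^2 \<Rightarrow> real"
  assumes "H1 u0" and "L2 u1"
  shows "\<exists>T>0. \<exists>u v. energy_solution T u v u0 u1 \<and>
     (\<forall>u' v'. energy_solution T u' v' u0 u1 \<longrightarrow>
        (\<forall>t\<in>{0..T}. AE x in lborel. u' t x = u t x)) \<and>
     (\<forall>\<epsilon>>0. \<exists>\<delta>>0. \<forall>w0 w1. H1 w0 \<and> L2 w1 \<and>
        H1_norm (\<lambda>x. w0 x - u0 x) + L2_norm (\<lambda>x. w1 x - u1 x) < \<delta> \<longrightarrow>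
          (\<exists>w w'. energy_solution T w w' w0 w1) \<and>
          (\<forall>w w'. energy_solution T w w' w0 w1 \<longrightarrow>
             (\<forall>t\<in>{0..T}. H1_norm (\<lambda>x. w t x - u t x) + L2_norm (\<lambda>x. w' t x - v t x) < \<epsilon>)))"
proof -
  define y0 where "y0 = emb u1 u0"
  have y0: "y0 \<in> G" unfolding y0_def by (rule emb_G[OF assms(1)])
  obtain T \<delta> where T: "T > 0" "\<delta> > 0" and ex: "\<And>x0. x0 \<in> G \<Longrightarrow> norm (x0 - y0) < \<delta> \<Longrightarrow> \<exists>x. sol T x0 x"
    and dep: "\<And>x0 z0 x z t. norm (x0 - y0) < \<delta> \<Longrightarrow> norm (z0 - y0) < \<delta> \<Longrightarrow> sol T x0 x \<Longrightarrow> sol T z0 z \<Longrightarrow>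
      t \<in> {0..T} \<Longrightarrow> norm (x t - z t) \<le> 2 * norm (x0 - z0)"
    by (rule local_wellposedness_mild[OF y0]) blast
  obtain y where y: "sol T y0 y" using ex[OF y0] T by auto
  define u v where "u t = fn (fst (snd (y t)))" and "v t = fn (fst (y t))" for t
  note es = sol_energy_solution[OF T(1) assms y[unfolded y0_def], folded u_def v_def]
  have vL: "L2 (v t)" for t by (simp add: v_def L2_fn)
  have es1: "energy_solution T u v u0 u1" using es(1) by (simp add: u_def[abs_def] v_def[abs_def])
  show ?thesis
  proof (rule exI[of _ T], intro conjI T(1), rule exI[of _ u], rule exI[of _ v], intro conjI es1 allI impI ballI)
    fix u' v' t assume es': "energy_solution T u' v' u0 u1" and t: "t \<in> {0..T}"
    have s': "sol T y0 (\<lambda>t. emb (v' t) (u' t))" unfolding y0_def by (rule energy_solution_sol[OF T(1) assms es'])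
    \<comment> \<open>Uniqueness is the dependence estimate for equal data.\<close>
    have "norm (emb (v' t) (u' t) - y t) \<le> 2 * norm (y0 - y0)" by (rule dep[OF _ _ s' y t]) (use T in simp_all)
    then have "emb (v' t) (u' t) = y t" by simp
    then have "fst (snd (y t)) = toL2 (u' t)" by (simp add: emb_def flip: \<open>emb (v' t) (u' t) = y t\<close>)
    moreover have "L2 (u' t)" using es' t unfolding energy_solution_def by (blast intro: H1_L2)
    ultimately have "AE x in lborel. u t x = u' t x" unfolding u_def using fn_toL2 by simp
    then show "AE x in lborel. u' t x = u t x" by eventually_elim simp
  next
    fix \<epsilon> :: real assume \<epsilon>: "\<epsilon> > 0"
    \<comment> \<open>The solutions differ by at most 2 \<eta> in the norm of states, which bounds
      each of the two norms in the claim, so their sum is at most 4 \<eta>, below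
      \<epsilon>.\<close>
    define \<eta> where "\<eta> = min \<delta> (\<epsilon> / 8)"
    have \<eta>: "\<eta> > 0" "\<eta> \<le> \<delta>" "4 * \<eta> < \<epsilon>" using T \<epsilon> by (auto simp: \<eta>_def)
    have main: "(\<exists>w w'. energy_solution T w w' w0 w1) \<and>
          (\<forall>w w'. energy_solution T w w' w0 w1 \<longrightarrow>
             (\<forall>t\<in>{0..T}. H1_norm (\<lambda>x. w t x - u t x) + L2_norm (\<lambda>x. w' t x - v t x) < \<epsilon>))"
      if w: "H1 w0" "L2 w1" and near: "H1_norm (\<lambda>x. w0 x - u0 x) + L2_norm (\<lambda>x. w1 x - u1 x) < \<eta>" for w0 w1
    proof -
      have n: "norm (emb w1 w0 - y0) < \<eta>"
        unfolding y0_def emb_diff[OF w(1) assms(1) w(2) assms(2)]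
        using norm_emb(3)[OF H1_diff[OF w(1) assms(1)] L2_diff[OF w(2) assms(2)]] near by simp
      then have n\<delta>: "norm (emb w1 w0 - y0) < \<delta>" using \<eta> by simp
      obtain z where "sol T (emb w1 w0) z" using ex[OF emb_G[OF w(1)] n\<delta>] by blast
      then have "\<exists>w w'. energy_solution T w w' w0 w1" using sol_energy_solution(1)[OF T(1) w] by blast
      moreover have "H1_norm (\<lambda>x. w t x - u t x) + L2_norm (\<lambda>x. w' t x - v t x) < \<epsilon>"
        if ew: "energy_solution T w w' w0 w1" and t: "t \<in> {0..T}" for w w' t
      proof -
        have wt: "H1 (w t)" "L2 (w' t)" using ew t unfolding energy_solution_def by blast+
        have ut: "H1 (u t)" "emb (v t) (u t) = y t" using es(2,3)[OF t] by simp_all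
        have "norm (emb (w' t) (w t) - y t) \<le> 2 * norm (emb w1 w0 - y0)"
          by (rule dep[OF n\<delta> _ energy_solution_sol[OF T(1) w ew] y t]) (use T in simp)
        then have "norm (emb (\<lambda>x. w' t x - v t x) (\<lambda>x. w t x - u t x)) \<le> 2 * \<eta>"
          using n by (simp add: emb_diff[OF wt(1) ut(1) wt(2) vL, symmetric] ut(2))
        then show ?thesis
          using norm_emb(1,2)[OF H1_diff[OF wt(1) ut(1)] L2_diff[OF wt(2) vL[of t]]] \<eta>(3) by linarith
      qed
      ultimately show ?thesis by blast
    qed
    show "\<exists>\<delta>>0. \<forall>w0 w1. H1 w0 \<and> L2 w1 \<and>
        H1_norm (\<lambda>x. w0 x - u0 x) + L2_norm (\<lambda>x. w1 x - u1 x) < \<delta> \<longrightarrow>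
          (\<exists>w w'. energy_solution T w w' w0 w1) \<and>
          (\<forall>w w'. energy_solution T w w' w0 w1 \<longrightarrow>
             (\<forall>t\<in>{0..T}. H1_norm (\<lambda>x. w t x - u t x) + L2_norm (\<lambda>x. w' t x - v t x) < \<epsilon>))"
      using main \<eta>(1) by (intro exI[of _ \<eta>] conjI allI impI) blast+
  qed
qed

end
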